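(* Let $\Omega=(-R,R)$, $s\ge0$, $1\le p\le\infty$, $u\in W^{s,p}(\Omega)$, $N_{\mathrm{loc}}\ge1$ an integer and $0\le\sigma\le\min(s,N_{\mathrm{loc}}-1)$. Consider partitions of unity $\{\phi_j\}_{j=1}^J\subset W^{m,\infty}(\Omega)$, $m=\lceil\sigma\rceil$, satisfying the partition-of-unity assumption in the context with fixed constants $M,C_\phi$, and quasi-uniform: $r:=\max_jr_j\lesssim\min_jr_j$ with a fixed constant. On every patch let $N_j=N_{\mathrm{loc}}$ and let $k_{j,1},\dots,k_{j,N_{\mathrm{loc}}}$ be i.i.d. with a law satisfying the sampling assumption in the context with parameters $\mu_j$ and $\varpi$, where $\mu_j=\nu r^t$ with $\nu>0$ and $t\ge\frac{s+1}{N_{\mathrm{loc}}+s-\sigma+1/p}-1$. Then, for all sufficiently small $r$, there are a function $u_\varepsilon\in G^0(\bar\Omega)$, with Gevrey constants $C_{u_\varepsilon,\bar\Omega_j}$ on $\bar\Omega_j$, and parameters $c_j>2$ such that $$u_{RF}=\sum_{j=1}^J\phi_jv_j,\qquad v_j(x)=\bigl(\mathcal R_{N_{\mathrm{loc}}}[\{k_{j,q}\}_{q=1}^{N_{\mathrm{loc}}},\mu_j,C_{u_\varepsilon,\bar\Omega_j},c_j]\,u_\varepsilon(\cdot+x_j)\bigr)(x-x_j),$$ satisfies $$\mathbb E\|u-u_{RF}\|_{W^{\sigma,p}(\Omega)}\lesssim r^{\frac{(N_{\mathrm{loc}}-\sigma-1+1/p)(s-\sigma)}{N_{\mathrm{loc}}+s-\sigma+1/p}}\,|\ln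 r|^{N_{\mathrm{loc}}-1}\,\|u\|_{W^{s,p}(\Omega)},$$ where the implied constant does not depend on $r$.
   Context: $W^{\sigma,p}$ is the standard (possibly fractional) Sobolev space; $1/p=0$ for $p=\infty$. Gevrey class $G^0(I)$, $I$ a compact interval: the set of $f\in C^\infty(I)$ for which there are $M_{f,I},C_{f,I}>0$ with $\max_I|f^{(n)}|\le M_{f,I}C_{f,I}^{\,n}$ for all $n\in\mathbb N=\{0,1,2,\dots\}$. Partition-of-unity assumption: $\Omega_j:=(\operatorname{supp}\phi_j)^\circ$ are open intervals in $\Omega$, $r_j:=\operatorname{diam}(\Omega_j)/2$, $x_j$ the center of $\Omega_j$; (1) $\sum_j\phi_j\equiv1$ on $\Omega$; (2) $\sup_{x\in\Omega}\operatorname{card}\{j:x\in\Omega_j\}\le M$; (3) $\|D^k\phi_j\|_{L^\infty(\Omega_j)}\le C_\phi r_j^{-k}$ for integers $0\le k\le m$, with $C_\phi$ independent of $j$. Sampling assumption with parameters $\mu,\varpi$: the law of $k_1$ is a Borel probability measure on $\mathbb R$, absolutely continuous with respect to Lebesgue measure, $\mu:=\sqrt{\mathbb E|k_1|^2}<\infty$, and, with $\pi$ the density of $|k_1|/\mu$, $\varpi:=\max\{1,\sup_{x>0}\max(1,x^3)\pi(x)\}<\infty$. The function $\mathcal Q$: for $k>0$, $w\ge0$, $c>2$, with $a=\max(k-1/2,0)$, $b=a+1$, put $\mathcal Q(k;w)=\varpi^{\frac{c}{c-1}}\max\bigl(\frac{1+w^2}{2(k^2-1)}+\frac{w^2}{2k^2},\frac{28(1+w^2)}{23k^2}\bigr)$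 if $k>4/3$, and $\mathcal Q(k;w)=2\varpi^{\frac{c}{c-1}}\max\bigl(\frac{w^2+a^2}{k+a},\frac{w^2+b^2}{k+b},\frac{w^2+1}{k+1}\bigr)$ if $k\le4/3$. The random operator $\mathcal R_N[\{k_i\},\mu,C,c]$ ($C\ge0$, $c>2$): let $E_i=\bigl\{\prod_{j\ne i}\frac{C^2+k_j^2}{|k_i^2-k_j^2|}<[e^c\mathcal Q(|k_i|/\mu;C/\mu)]^{N-1}\bigr\}$ and $E=\bigcap_{i=1}^NE_i$ (for $N=1$, $E$ is the sure event). Let $\mathbf V_N=((-k_j^2)^{i-1})_{1\le i,j\le N}$, $\mathbf K=\mathrm{diag}(k_1,\dots,k_N)$ (almost surely invertible), and for $v$ smooth near $0$ let $(\mathscr T_ev)_i=v^{(2i-2)}(0)$, $(\mathscr T_ov)_i=v^{(2i-1)}(0)$, $1\le i\le N$. Put $X=\mathbf V_N^{-1}\mathscr T_ev$, $Y=\mathbf K^{-1}\mathbf V_N^{-1}\mathscr T_ov$. Then $$(\mathcal R_N[\{k_i\},\mu,C,c]v)(x)=\mathbf 1_{E}\sum_{i=1}^N\bigl(X_i\cos(k_ix)+Y_i\sin(k_ix)\bigr).$$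
   Formalization: The formal statement also requires each φ_j to vanish almost everywhere on Ω outside Ω_j; this is automatic for m≥1, and for m=0 it excludes supports with an extra positive-measure, empty-interior part, for which the claim fails. *)

theory Defs
  imports "HOL-Probability.Probability" "Jordan_Normal_Form.Gauss_Jordan_Elimination"
begin

section \<open>Fractional Sobolev spaces on open subsets of the line\<close>

text \<open>Exponents range over \<open>p :: ennreal\<close> with \<open>1 \<le> p\<close>; then \<open>enn2real (1 / p)\<close> is the
  real number \<open>1/p\<close>, and it is \<open>0\<close> for \<open>p = \<infinity>\<close>.\<close>

definition Lp_norm :: "ennreal \<Rightarrow> 'a measure \<Rightarrow> ('a \<Rightarrow> real) \<Rightarrow> ennreal" where
  "Lp_norm p M f =
    (if f \<notin> borel_measurable M then \<infinity>
     else if p = \<infinity> then esssup M (\<lambda>x. ennreal \<bar>f x\<bar>)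
     else let I = (\<integral>\<^sup>+x. ennreal (\<bar>f x\<bar> powr enn2real p) \<partial>M)
          in if I = \<infinity> then \<infinity> else ennreal (enn2real I powr enn2real (1 / p)))"

definition test_function :: "real set \<Rightarrow> (real \<Rightarrow> real) \<Rightarrow> bool" where
  "test_function \<Omega> \<psi> \<longleftrightarrow>
    (\<forall>n x. (deriv ^^ n) \<psi> differentiable (at x)) \<and>
    (\<exists>K. compact K \<and> K \<subseteq> \<Omega> \<and> (\<forall>x. x \<notin> K \<longrightarrow> \<psi> x = 0))"

definition locally_integrable :: "real set \<Rightarrow> (real \<Rightarrow> real) \<Rightarrow> bool" where
  "locally_integrable \<Omega> u \<longleftrightarrow> (\<forall>K. compact K \<and> K \<subseteq> \<Omega> \<longrightarrow> integrable (lebesgue_on K) u)"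

definition has_weak_deriv :: "real set \<Rightarrow> nat \<Rightarrow> (real \<Rightarrow> real) \<Rightarrow> (real \<Rightarrow> real) \<Rightarrow> bool" where
  "has_weak_deriv \<Omega> n u w \<longleftrightarrow>
    locally_integrable \<Omega> u \<and> locally_integrable \<Omega> w \<and>
    (\<forall>\<psi>. test_function \<Omega> \<psi> \<longrightarrow>
      (\<integral>x. u x * (deriv ^^ n) \<psi> x \<partial>lebesgue_on \<Omega>) = (-1) ^ n * (\<integral>x. w x * \<psi> x \<partial>lebesgue_on \<Omega>))"

text \<open>For open \<open>\<Omega>\<close> the weak derivative is unique up to null sets; \<open>weak_deriv\<close> picks one version.\<close>

definition weak_deriv :: "real set \<Rightarrow> nat \<Rightarrow> (real \<Rightarrow> real) \<Rightarrow> real \<Rightarrow> real" where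
  "weak_deriv \<Omega> n u = (SOME w. has_weak_deriv \<Omega> n u w)"

text \<open>The \<open>p\<close>-th power of the following \<open>L\<^sup>p(\<Omega> \<times> \<Omega>)\<close> norm is the Gagliardo integral of
  \<open>\<bar>f x - f y\<bar>\<^sup>p / \<bar>x - y\<bar>\<^sup>1\<^sup>+\<^sup>\<theta>\<^sup>p\<close>; for \<open>p = \<infinity>\<close> it is the essential \<open>\<theta>\<close>-Hoelder seminorm.\<close>

definition slobodeckij_seminorm :: "real set \<Rightarrow> real \<Rightarrow> ennreal \<Rightarrow> (real \<Rightarrow> real) \<Rightarrow> ennreal" where
  "slobodeckij_seminorm \<Omega> \<theta> p f =
    Lp_norm p (lebesgue_on \<Omega> \<Otimes>\<^sub>M lebesgue_on \<Omega>)
      (\<lambda>(x, y). \<bar>f x - f y\<bar> / \<bar>x - y\<bar> powr (\<theta> + enn2real (1 / p)))"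

text \<open>The norm of \<open>W\<^sup>s\<^sup>,\<^sup>p(\<Omega>)\<close>, extended by \<open>\<infinity>\<close> to functions outside the space. The parts are
  added up, which gives a norm equivalent to their \<open>\<ell>\<^sup>p\<close> combination.\<close>

definition sobolev_norm :: "real set \<Rightarrow> real \<Rightarrow> ennreal \<Rightarrow> (real \<Rightarrow> real) \<Rightarrow> ennreal" where
  "sobolev_norm \<Omega> s p u =
    (let n = nat \<lfloor>s\<rfloor>; \<theta> = s - real n in
     if \<forall>i\<le>n. \<exists>w. has_weak_deriv \<Omega> i u w
     then (\<Sum>i\<le>n. Lp_norm p (lebesgue_on \<Omega>) (weak_deriv \<Omega> i u)) +
          (if \<theta> > 0 then slobodeckij_seminorm \<Omega> \<theta> p (weak_deriv \<Omega> n u) else 0)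
     else \<infinity>)"

definition sobolev_space :: "real set \<Rightarrow> real \<Rightarrow> ennreal \<Rightarrow> (real \<Rightarrow> real) set" where
  "sobolev_space \<Omega> s p = {u. sobolev_norm \<Omega> s p u < \<infinity>}"


section \<open>The Gevrey class of order zero\<close>

text \<open>Derivatives on a compact interval are one-sided at the end points; \<open>D n\<close> is the \<open>n\<close>-th one.\<close>

definition has_gevrey_constant :: "real set \<Rightarrow> (real \<Rightarrow> real) \<Rightarrow> real \<Rightarrow> bool" where
  "has_gevrey_constant I f C \<longleftrightarrow> C > 0 \<and>
    (\<exists>D :: nat \<Rightarrow> real \<Rightarrow> real. \<exists>B>0.
      (\<forall>x\<in>I. D 0 x = f x) \<and>
      (\<forall>n. \<forall>x\<in>I. (D n has_real_derivative D (Suc n) x) (at x within I)) \<and>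
      (\<forall>n. \<forall>x\<in>I. \<bar>D n x\<bar> \<le> B * C ^ n))"

definition gevrey0 :: "real set \<Rightarrow> (real \<Rightarrow> real) set" where
  "gevrey0 I = {f. \<exists>C. has_gevrey_constant I f C}"


section \<open>Partitions of unity\<close>

text \<open>The support of an (almost everywhere defined) function on \<open>\<Omega>\<close>.\<close>

definition ess_support :: "real set \<Rightarrow> (real \<Rightarrow> real) \<Rightarrow> real set" where
  "ess_support \<Omega> f = {x. \<forall>e>0. \<not> (AE y in lebesgue_on \<Omega>. y \<in> ball x e \<longrightarrow> f y = 0)}"

definition patch :: "real set \<Rightarrow> (real \<Rightarrow> real) \<Rightarrow> real set" where
  "patch \<Omega> f = interior (ess_support \<Omega> f)"

definition patch_radius :: "real set \<Rightarrow> (real \<Rightarrow> real) \<Rightarrow> real" where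
  "patch_radius \<Omega> f = diameter (patch \<Omega> f) / 2"

definition patch_center :: "real set \<Rightarrow> (real \<Rightarrow> real) \<Rightarrow> real" where
  "patch_center \<Omega> f = (Inf (patch \<Omega> f) + Sup (patch \<Omega> f)) / 2"

definition mesh_radius :: "real set \<Rightarrow> nat \<Rightarrow> (nat \<Rightarrow> real \<Rightarrow> real) \<Rightarrow> real" where
  "mesh_radius \<Omega> J \<phi> = Max ((\<lambda>j. patch_radius \<Omega> (\<phi> j)) ` {1..J})"

text \<open>The third clause makes explicit that \<open>\<phi> j\<close> lives on its patch. It is automatic if \<open>\<phi> j\<close> is
  continuous (\<open>m \<ge> 1\<close>); for \<open>m = 0\<close> it excludes supports that have, apart from the interval, a
  part of positive measure with empty interior.\<close>

definition partition_of_unity ::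
    "real set \<Rightarrow> nat \<Rightarrow> nat \<Rightarrow> real \<Rightarrow> nat \<Rightarrow> (nat \<Rightarrow> real \<Rightarrow> real) \<Rightarrow> bool" where
  "partition_of_unity \<Omega> m M C\<phi> J \<phi> \<longleftrightarrow>
    (\<forall>j\<in>{1..J}. \<phi> j \<in> sobolev_space \<Omega> (real m) \<infinity>) \<and>
    (\<forall>j\<in>{1..J}. \<exists>a b. a < b \<and> patch \<Omega> (\<phi> j) = {a<..<b} \<and> {a<..<b} \<subseteq> \<Omega>) \<and>
    (\<forall>j\<in>{1..J}. AE x in lebesgue_on \<Omega>. x \<notin> patch \<Omega> (\<phi> j) \<longrightarrow> \<phi> j x = 0) \<and>
    (AE x in lebesgue_on \<Omega>. (\<Sum>j=1..J. \<phi> j x) = 1) \<and>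
    (\<forall>x\<in>\<Omega>. card {j \<in> {1..J}. x \<in> patch \<Omega> (\<phi> j)} \<le> M) \<and>
    (\<forall>j\<in>{1..J}. \<forall>i\<le>m.
      Lp_norm \<infinity> (lebesgue_on (patch \<Omega> (\<phi> j))) (weak_deriv \<Omega> i (\<phi> j))
        \<le> ennreal (C\<phi> / patch_radius \<Omega> (\<phi> j) ^ i))"


section \<open>Random features\<close>

text \<open>The density of \<open>\<bar>k\<bar>/\<mu>\<close> is determined only up to null sets, so the supremum is that of some
  version \<open>\<pi>\<close> of it.\<close>

definition sampling_law :: "real measure \<Rightarrow> real \<Rightarrow> real \<Rightarrow> bool" where
  "sampling_law L \<mu> varpi \<longleftrightarrow>
    real_distribution L \<and> absolutely_continuous lborel L \<and>
    integrable L (\<lambda>k. k\<^sup>2) \<and> \<mu> = sqrt (\<integral>k. k\<^sup>2 \<partial>L) \<and>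
    (\<exists>\<pi> :: real \<Rightarrow> real. (\<forall>x. 0 \<le> \<pi> x) \<and>
      distributed L lborel (\<lambda>k. \<bar>k\<bar> / \<mu>) (\<lambda>x. ennreal (\<pi> x)) \<and>
      bdd_above ((\<lambda>x. max 1 (x ^ 3) * \<pi> x) ` {0<..}) \<and>
      varpi = max 1 (SUP x\<in>{0<..}. max 1 (x ^ 3) * \<pi> x))"

definition iid_with_law ::
    "'w measure \<Rightarrow> nat \<Rightarrow> (nat \<Rightarrow> 'w \<Rightarrow> real) \<Rightarrow> real measure \<Rightarrow> bool" where
  "iid_with_law P N k L \<longleftrightarrow>
    prob_space.indep_vars P (\<lambda>_. borel) k {..<N} \<and> (\<forall>q<N. distr P borel (k q) = L)"

definition \<Q> :: "real \<Rightarrow> real \<Rightarrow> real \<Rightarrow> real \<Rightarrow> real" where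
  "\<Q> varpi c k w =
    (let a = max (k - 1/2) 0; b = a + 1 in
     if k > 4/3 then
       varpi powr (c / (c - 1)) *
         max ((1 + w\<^sup>2) / (2 * (k\<^sup>2 - 1)) + w\<^sup>2 / (2 * k\<^sup>2)) (28 * (1 + w\<^sup>2) / (23 * k\<^sup>2))
     else
       2 * varpi powr (c / (c - 1)) *
         max ((w\<^sup>2 + a\<^sup>2) / (k + a)) (max ((w\<^sup>2 + b\<^sup>2) / (k + b)) ((w\<^sup>2 + 1) / (k + 1))))"

text \<open>The operator below is given for one realisation \<open>k 0, \<dots>, k (N - 1)\<close> of the features; all
  indices start at \<open>0\<close> instead of \<open>1\<close>.\<close>

definition rf_event :: "real \<Rightarrow> nat \<Rightarrow> (nat \<Rightarrow> real) \<Rightarrow> real \<Rightarrow> real \<Rightarrow> real \<Rightarrow> bool" where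
  "rf_event varpi N k \<mu> C c \<longleftrightarrow> N = 1 \<or>
    (\<forall>i<N. (\<Prod>j\<in>{..<N} - {i}. (C\<^sup>2 + (k j)\<^sup>2) / \<bar>(k i)\<^sup>2 - (k j)\<^sup>2\<bar>)
             < (exp c * \<Q> varpi c (\<bar>k i\<bar> / \<mu>) (C / \<mu>)) ^ (N - 1))"

text \<open>Almost surely the matrices inverted below are invertible; the value \<open>0\<close> for a singular
  matrix only matters on a null event.\<close>

definition inverse_matrix :: "real mat \<Rightarrow> real mat" where
  "inverse_matrix A = (case mat_inverse A of Some B \<Rightarrow> B | None \<Rightarrow> 0\<^sub>m (dim_row A) (dim_col A))"

definition vandermonde_mat :: "nat \<Rightarrow> (nat \<Rightarrow> real) \<Rightarrow> real mat" where
  "vandermonde_mat N k = Matrix.mat N N (\<lambda>(i, j). (- ((k j)\<^sup>2)) ^ i)"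

definition taylor_even :: "nat \<Rightarrow> (real \<Rightarrow> real) \<Rightarrow> real vec" where
  "taylor_even N v = Matrix.vec N (\<lambda>i. (deriv ^^ (2 * i)) v 0)"

definition taylor_odd :: "nat \<Rightarrow> (real \<Rightarrow> real) \<Rightarrow> real vec" where
  "taylor_odd N v = Matrix.vec N (\<lambda>i. (deriv ^^ (2 * i + 1)) v 0)"

definition rf_operator ::
    "real \<Rightarrow> nat \<Rightarrow> (nat \<Rightarrow> real) \<Rightarrow> real \<Rightarrow> real \<Rightarrow> real \<Rightarrow> (real \<Rightarrow> real) \<Rightarrow> real \<Rightarrow> real" where
  "rf_operator varpi N k \<mu> C c v x =
    (let X = inverse_matrix (vandermonde_mat N k) *\<^sub>v taylor_even N v;
         Y = inverse_matrix (mat_diag N k) *\<^sub>v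
               (inverse_matrix (vandermonde_mat N k) *\<^sub>v taylor_odd N v)
     in if rf_event varpi N k \<mu> C c
        then \<Sum>i<N. vec_index X i * cos (k i * x) + vec_index Y i * sin (k i * x)
        else 0)"

definition rf_approximation ::
    "real set \<Rightarrow> nat \<Rightarrow> (nat \<Rightarrow> real \<Rightarrow> real) \<Rightarrow> real \<Rightarrow> nat \<Rightarrow> (nat \<Rightarrow> nat \<Rightarrow> real) \<Rightarrow>
     (nat \<Rightarrow> real) \<Rightarrow> (nat \<Rightarrow> real) \<Rightarrow> (nat \<Rightarrow> real) \<Rightarrow> (real \<Rightarrow> real) \<Rightarrow> real \<Rightarrow> real" where
  "rf_approximation \<Omega> J \<phi> varpi N k \<mu> C c v x =
    (\<Sum>j=1..J. \<phi> j x *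
      rf_operator varpi N (k j) (\<mu> j) (C j) (c j) (\<lambda>y. v (y + patch_center \<Omega> (\<phi> j)))
        (x - patch_center \<Omega> (\<phi> j)))"

end

theory Submission
 imports Defs "HOL-Real_Asymp.Real_Asymp" "Jordan_Normal_Form.Determinant"
begin

text \<open>Smooth \<open>u\<close> on a scale \<open>r powr l\<close>: with \<open>A\<close> a mollification of the contracted function, \<open>u - (1 - A) ^ n u\<close> has the Jackson
error of order \<open>n\<close>, and a polynomial \<open>u\<^sub>\<epsilon>\<close> approximates it together with its derivatives; a polynomial admits every \<open>C > 0\<close> as
Gevrey constant. On a patch the random operator matches the Taylor coefficients of \<open>u\<^sub>\<epsilon>\<close> at the centre up to order \<open>2 N - 1\<close>,
with Lagrange coefficients controlled on the event \<open>E\<close>. Off \<open>E\<close> the operator vanishes; a fractional moment of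
\<open>(C\<^sup>2 + k\<^sub>j\<^sup>2) / \<bar>k\<^sub>i\<^sup>2 - k\<^sub>j\<^sup>2\<bar>\<close>, independence and Markov's inequality make this rare once \<open>c\<close> is of order \<open>\<bar>ln r\<bar>\<close>, which
produces the logarithm. The exponent \<open>l\<close> balances the smoothing error against the local one.\<close>

text \<open>Contraction has a price: smoothing commutes with differentiation only up to the factor
  \<open>1 - r\<close>. The iterated operator therefore belongs to a family
  \<open>T a f = f - a * moll f\<close>, and the derivative of \<open>T a f\<close> is
  \<open>T (a * (1 - r)) f'\<close>. After \<open>j\<close> derivatives \<open>1 - a\<close> is at
  most \<open>j * r\<close>, no worse than the smoothing error per derivative, so the Jackson order
  survives. The rate comes from a balance. \<open>C\<close> is of size \<open>r powr (- l)\<close>,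
  so with \<open>b = N * (1 - l)\<close> the Taylor remainder contributes
  \<open>(r * C) ^ (2 * N)\<close>, of size \<open>r powr (2 * b)\<close>. Conditioning on the event
  costs \<open>exp c ^ (N - 1)\<close>, and for \<open>N > 1\<close> the choice of \<open>c\<close>
  makes this \<open>r powr (- b)\<close>. The complement then has probability of order
  \<open>r powr b\<close> times the power of the logarithm, so both cases yield the same rate. The
  patch errors are added by the triangle inequality over a number of patches of order
  \<open>1 / r\<close>, which explains the \<open>-1\<close> in the exponent; its two
  \<open>1 / p\<close> stem from the length of a patch (numerator) and from pointwise bounds of
  derivatives by an \<open>L^p\<close> norm (denominator).\<close>

section \<open>Inequalities for \<open>L^p\<close> norms\<close>

lemma exponent_cases:
 fixes p :: ennreal
 assumes "1 \<le> p"
 obtains (inf) "p = \<infinity>" "enn2real (1 / p) = 0"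
 | (fin) P where "1 \<le> P" "p = ennreal P" "enn2real p = P" "enn2real (1 / p) = 1 / P" "p \<noteq> \<infinity>"
proof (cases p)
 case (real P)
 then have P: "1 \<le> P" using assms by (metis ennreal_1 ennreal_le_iff)
 have "1 / p = ennreal (1 / P)" using P real divide_ennreal[of 1 P] by simp
 then show ?thesis using P real fin by simp
next
 case top
 then show ?thesis using inf by simp
qed

text \<open>Nearly all later estimates have the form \<open>Lp_norm p M f <= ennreal a\<close>.
  Taking \<open>P\<close>-th powers turns them into bounds on an integral, so no root of an extended
  real has to be handled.\<close>

lemma Lp_norm_le_iff_fin:
 fixes P a :: real
 assumes "1 \<le> P" "f \<in> borel_measurable M" "0 \<le> a"
 shows "Lp_norm (ennreal P) M f \<le> ennreal a \<longleftrightarrow> (\<integral>\<^sup>+x. ennreal (\<bar>f x\<bar> powr P) \<partial>M) \<le> ennreal (a powr P)"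
proof -
 define I where "I = (\<integral>\<^sup>+x. ennreal (\<bar>f x\<bar> powr P) \<partial>M)"
 have p: "1 / ennreal P = ennreal (1 / P)" using assms divide_ennreal[of 1 P] by simp
 have L: "Lp_norm (ennreal P) M f = (if I = \<infinity> then \<infinity> else ennreal (enn2real I powr (1 / P)))"
  using assms unfolding Lp_norm_def I_def p by (simp add: Let_def)
 show ?thesis
 proof (cases "I = \<infinity>")
  case True
  then show ?thesis using L I_def by (simp add: top_unique)
 next
  case False
  then obtain i where i: "0 \<le> i" "I = ennreal i" by (cases I) auto
  have "i powr (1 / P) \<le> a \<longleftrightarrow> i \<le> a powr P"
  proof
   assume "i powr (1 / P) \<le> a"
   then have "(i powr (1 / P)) powr P \<le> a powr P" using assms by (intro powr_mono2) auto
   then show "i \<le> a powr P" using assms i by (simp add: powr_powr powr_one)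
  next
   assume "i \<le> a powr P"
   then have "i powr (1 / P) \<le> (a powr P) powr (1 / P)" using assms i by (intro powr_mono2) auto
   then show "i powr (1 / P) \<le> a" using assms i by (simp add: powr_powr powr_one)
  qed
  then show ?thesis using L i assms False unfolding I_def[symmetric] by simp
 qed
qed

lemma Lp_norm_le_iff_inf:
 assumes "f \<in> borel_measurable M" "0 \<le> a"
 shows "Lp_norm \<infinity> M f \<le> ennreal a \<longleftrightarrow> (AE x in M. \<bar>f x\<bar> \<le> a)"
proof -
 have m: "(\<lambda>x. ennreal \<bar>f x\<bar>) \<in> borel_measurable M" using assms by measurable
 have L: "Lp_norm \<infinity> M f = esssup M (\<lambda>x. ennreal \<bar>f x\<bar>)" using assms unfolding Lp_norm_def by simp
 show ?thesis
 proof
  assume "Lp_norm \<infinity> M f \<le> ennreal a"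
  then show "AE x in M. \<bar>f x\<bar> \<le> a" using esssup_AE[of "\<lambda>x. ennreal \<bar>f x\<bar>" M] L assms
   by (smt (verit, best) eventually_mono ennreal_le_iff order_trans)
 next
  assume "AE x in M. \<bar>f x\<bar> \<le> a"
  then have "AE x in M. ennreal \<bar>f x\<bar> \<le> ennreal a" by (auto elim!: eventually_mono intro: ennreal_leI)
  then show "Lp_norm \<infinity> M f \<le> ennreal a" unfolding L using m by (intro esssup_I)
 qed
qed

lemma Lp_norm_mono_AE:
 assumes "1 \<le> p" "f \<in> borel_measurable M" "AE x in M. \<bar>f x\<bar> \<le> \<bar>g x\<bar>"
 shows "Lp_norm p M f \<le> Lp_norm p M g"
proof (cases "g \<in> borel_measurable M \<and> Lp_norm p M g \<noteq> \<infinity>")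
 case True
 then obtain a where a: "0 \<le> a" "Lp_norm p M g = ennreal a" by (cases "Lp_norm p M g") auto
 have g: "g \<in> borel_measurable M" using True by simp
 from assms(1) have "Lp_norm p M f \<le> ennreal a"
 proof (cases p rule: exponent_cases)
  case inf
  have "AE x in M. \<bar>g x\<bar> \<le> a" using a g inf Lp_norm_le_iff_inf[OF g a(1)] by simp
  then show ?thesis unfolding inf Lp_norm_le_iff_inf[OF assms(2) a(1)] using assms(3) by eventually_elim simp
 next
  case (fin P)
  have "(\<integral>\<^sup>+x. ennreal (\<bar>f x\<bar> powr P) \<partial>M) \<le> (\<integral>\<^sup>+x. ennreal (\<bar>g x\<bar> powr P) \<partial>M)"
   using assms(3) fin by (intro nn_integral_mono_AE) (auto elim!: eventually_mono intro!: ennreal_leI powr_mono2)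
  also have "... \<le> ennreal (a powr P)" using a fin Lp_norm_le_iff_fin[OF fin(1) g a(1)] by simp
  finally show ?thesis unfolding fin(2) Lp_norm_le_iff_fin[OF fin(1) assms(2) a(1)] .
 qed
 then show ?thesis using a by simp
next
 \<comment> \<open>\<open>Lp_norm\<close> is infinite by definition for functions that are not
   measurable, so both ways of failing lead to the same trivial bound.\<close>
 case False
 then have "Lp_norm p M g = \<infinity>" by (auto simp: Lp_norm_def)
 then show ?thesis by simp
qed

lemma Lp_norm_cong_AE:
 assumes "1 \<le> p" "f \<in> borel_measurable M" "g \<in> borel_measurable M" "AE x in M. \<bar>f x\<bar> = \<bar>g x\<bar>"
 shows "Lp_norm p M f = Lp_norm p M g"
 using assms by (intro antisym Lp_norm_mono_AE) auto

lemma Lp_norm_zero: "1 \<le> p ==> Lp_norm p M (\<lambda>x. 0) = 0"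
proof -
 assume p: "1 \<le> p"
 then have "Lp_norm p M (\<lambda>x. 0) \<le> ennreal 0"
 proof (cases p rule: exponent_cases)
  case inf
  then show ?thesis using Lp_norm_le_iff_inf[of "\<lambda>x. 0" M 0] by auto
 next
  case (fin P)
  then show ?thesis using Lp_norm_le_iff_fin[of P "\<lambda>x. 0" M 0] by auto
 qed
 then show ?thesis by simp
qed

text \<open>The end point 0 is treated separately: there the inequality reduces to
  \<open>l powr P <= l\<close> for \<open>0 < l < 1\<close>.\<close>

lemma convex_on_powr_nonneg:
 fixes P :: real
 assumes "1 \<le> P"
 shows "convex_on {0..} (\<lambda>t. t powr P)"
proof (rule convex_onI)
 fix t x y :: real
 assume t: "0 < t" "t < 1" and xy: "x \<in> {0..}" "y \<in> {0..}"
 have z: "l powr P * z powr P \<le> l * z powr P" if "0 < l" "l < 1" for l z :: real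
  using that assms powr_mono'[of 1 P l] by (intro mult_right_mono) auto
 show "((1 - t) *\<^sub>R x + t *\<^sub>R y) powr P \<le> (1 - t) * x powr P + t * y powr P"
 proof (cases "x = 0 \<or> y = 0")
  case True
  then show ?thesis using t xy z[of t y] z[of "1 - t" x] assms by (auto simp: powr_mult)
 next
  case False
  then show ?thesis using convex_onD[OF powr_convex[OF assms], of t x y] t xy by auto
 qed
qed auto

text \<open>Minkowski's inequality: the two summands are normalised, and the power is convex.\<close>

lemma Lp_norm_triangle_real:
 assumes p: "1 \<le> p" and m: "f \<in> borel_measurable M" "g \<in> borel_measurable M"
  and a: "0 < a" "Lp_norm p M f \<le> ennreal a" and b: "0 < b" "Lp_norm p M g \<le> ennreal b"
 shows "Lp_norm p M (\<lambda>x. f x + g x) \<le> ennreal (a + b)"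
 using p
proof (cases p rule: exponent_cases)
 case inf
 have "AE x in M. \<bar>f x\<bar> \<le> a" "AE x in M. \<bar>g x\<bar> \<le> b"
  using a b m inf Lp_norm_le_iff_inf[of f M a] Lp_norm_le_iff_inf[of g M b] by (auto simp: less_imp_le)
 then have "AE x in M. \<bar>f x + g x\<bar> \<le> a + b" by eventually_elim linarith
 then show ?thesis using inf m a b Lp_norm_le_iff_inf[of "\<lambda>x. f x + g x" M "a + b"] by simp
next
 case (fin P)
 define l where "l = a / (a + b)"
 have l: "0 \<le> l" "l \<le> 1" "1 - l = b / (a + b)" using a b by (auto simp: l_def field_simps)
 have If: "(\<integral>\<^sup>+x. ennreal (\<bar>f x\<bar> powr P) \<partial>M) \<le> ennreal (a powr P)"
  using Lp_norm_le_iff_fin[OF fin(1) m(1)] a fin by simp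
 have Ig: "(\<integral>\<^sup>+x. ennreal (\<bar>g x\<bar> powr P) \<partial>M) \<le> ennreal (b powr P)"
  using Lp_norm_le_iff_fin[OF fin(1) m(2)] b fin by simp
 have cv: "convex_on {0..} (\<lambda>t. t powr P)" using fin(1) by (rule convex_on_powr_nonneg)
 have pw: "\<bar>f x + g x\<bar> powr P \<le> (a + b) powr P * (l / a powr P) * \<bar>f x\<bar> powr P
    + (a + b) powr P * ((1 - l) / b powr P) * \<bar>g x\<bar> powr P" for x
 proof -
  have "\<bar>f x + g x\<bar> powr P \<le> (\<bar>f x\<bar> + \<bar>g x\<bar>) powr P" using fin(1) by (intro powr_mono2) auto
  also have "\<bar>f x\<bar> + \<bar>g x\<bar> = (a + b) * (l * (\<bar>f x\<bar> / a) + (1 - l) * (\<bar>g x\<bar> / b))"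
  proof -
   have "(a + b) * l = a" "(a + b) * (1 - l) = b" using a b unfolding l(3) unfolding l_def by auto
   then show ?thesis using a b by (simp add: distrib_left mult.assoc[symmetric])
  qed
  also have "... powr P = (a + b) powr P * (l * (\<bar>f x\<bar> / a) + (1 - l) * (\<bar>g x\<bar> / b)) powr P" using a b l by (intro powr_mult)
  also have "... \<le> (a + b) powr P * (l * (\<bar>f x\<bar> / a) powr P + (1 - l) * (\<bar>g x\<bar> / b) powr P)"
   using convex_onD[OF cv, of "1 - l" "\<bar>f x\<bar> / a" "\<bar>g x\<bar> / b"] a b l(1,2) by (intro mult_left_mono) auto
  also have "... = (a + b) powr P * (l / a powr P) * \<bar>f x\<bar> powr P
    + (a + b) powr P * ((1 - l) / b powr P) * \<bar>g x\<bar> powr P" using a b by (simp add: powr_divide algebra_simps)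
  finally show ?thesis .
 qed
 define A where "A = (a + b) powr P * (l / a powr P)"
 define B where "B = (a + b) powr P * ((1 - l) / b powr P)"
 have AB: "0 \<le> A" "0 \<le> B" using l a b by (auto simp: A_def B_def)
 have "(\<integral>\<^sup>+x. ennreal (\<bar>f x + g x\<bar> powr P) \<partial>M)
   \<le> (\<integral>\<^sup>+x. ennreal A * ennreal (\<bar>f x\<bar> powr P) + ennreal B * ennreal (\<bar>g x\<bar> powr P) \<partial>M)"
  using pw[folded A_def B_def] AB
  by (intro nn_integral_mono) (simp add: ennreal_mult[symmetric] ennreal_plus[symmetric] ennreal_leI del: ennreal_plus)
 also have "... = ennreal A * (\<integral>\<^sup>+x. ennreal (\<bar>f x\<bar> powr P) \<partial>M) + ennreal B * (\<integral>\<^sup>+x. ennreal (\<bar>g x\<bar> powr P) \<partial>M)"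
  using m by (simp add: nn_integral_add nn_integral_cmult)
 also have "... \<le> ennreal A * ennreal (a powr P) + ennreal B * ennreal (b powr P)" using If Ig by (intro add_mono mult_left_mono) auto
 also have "... = ennreal (A * a powr P + B * b powr P)" using AB by (simp add: ennreal_mult[symmetric] ennreal_plus[symmetric] del: ennreal_plus)
 also have "A * a powr P + B * b powr P = (a + b) powr P" using a b by (simp add: A_def B_def distrib_left[symmetric])
 finally show ?thesis using fin m a b Lp_norm_le_iff_fin[of P "\<lambda>x. f x + g x" M "a + b"] by simp
qed

lemma Lp_norm_triangle:
 assumes p: "1 \<le> p" and m: "f \<in> borel_measurable M" "g \<in> borel_measurable M"
 shows "Lp_norm p M (\<lambda>x. f x + g x) \<le> Lp_norm p M f + Lp_norm p M g"
proof (cases "Lp_norm p M f = \<infinity> \<or> Lp_norm p M g = \<infinity>")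
 case False
 then obtain a b where ab: "0 \<le> a" "Lp_norm p M f = ennreal a" "0 \<le> b" "Lp_norm p M g = ennreal b"
  by (cases "Lp_norm p M f"; cases "Lp_norm p M g") auto
 have "Lp_norm p M (\<lambda>x. f x + g x) \<le> ennreal (a + b)"
 proof (rule ennreal_le_epsilon)
  \<comment> \<open>The normalisation divides by the bounds, so they have to be positive; each is
    enlarged by \<open>e / 2\<close>, and \<open>e\<close> tends to 0.\<close>
  fix e :: real assume e: "0 < e"
  have "Lp_norm p M (\<lambda>x. f x + g x) \<le> ennreal ((a + e / 2) + (b + e / 2))"
   using e ab by (intro Lp_norm_triangle_real[OF p m]) (auto intro!: ennreal_leI)
  also have "... = ennreal (a + b) + ennreal e" using e ab by (simp add: ennreal_plus[symmetric] del: ennreal_plus)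
  finally show "Lp_norm p M (\<lambda>x. f x + g x) \<le> ennreal (a + b) + ennreal e" .
 qed
 then show ?thesis using ab by simp
qed auto

lemma Lp_norm_cmult_le:
 assumes p: "1 \<le> p" and m: "f \<in> borel_measurable M"
 shows "Lp_norm p M (\<lambda>x. c * f x) \<le> ennreal \<bar>c\<bar> * Lp_norm p M f"
proof (cases "c = 0")
 case True
 then show ?thesis using Lp_norm_zero[OF p, of M] by simp
next
 case c: False
 show ?thesis
 proof (cases "Lp_norm p M f")
  case (real a)
  from p have "Lp_norm p M (\<lambda>x. c * f x) \<le> ennreal (\<bar>c\<bar> * a)"
  proof (cases p rule: exponent_cases)
   case inf
   have "AE x in M. \<bar>f x\<bar> \<le> a" using real m inf Lp_norm_le_iff_inf[of f M a] by simp
   then have "AE x in M. \<bar>c * f x\<bar> \<le> \<bar>c\<bar> * a" by (auto simp: abs_mult mult_left_mono elim!: eventually_mono)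
   then show ?thesis using Lp_norm_le_iff_inf[of "\<lambda>x. c * f x" M "\<bar>c\<bar> * a"] m real inf by simp
  next
   case (fin P)
   have "(\<integral>\<^sup>+x. ennreal (\<bar>c * f x\<bar> powr P) \<partial>M) = ennreal (\<bar>c\<bar> powr P) * (\<integral>\<^sup>+x. ennreal (\<bar>f x\<bar> powr P) \<partial>M)"
    using m by (subst nn_integral_cmult[symmetric]) (auto simp: abs_mult powr_mult ennreal_mult)
   also have "... \<le> ennreal (\<bar>c\<bar> powr P) * ennreal (a powr P)"
    using real m fin Lp_norm_le_iff_fin[of P f M a] by (intro mult_left_mono) auto
   also have "... = ennreal ((\<bar>c\<bar> * a) powr P)" using real by (simp add: powr_mult ennreal_mult)
   finally show ?thesis using Lp_norm_le_iff_fin[of P "\<lambda>x. c * f x" M "\<bar>c\<bar> * a"] m real fin by simp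
  qed
  then show ?thesis using real by (simp add: ennreal_mult)
 next
  case top
  then show ?thesis using c by (simp add: ennreal_mult_top)
 qed
qed

lemma Lp_norm_sum:
 assumes p: "1 \<le> p" and m: "\<And>i. i \<in> I ==> f i \<in> borel_measurable M" and I: "finite I"
 shows "Lp_norm p M (\<lambda>x. \<Sum>i\<in>I. f i x) \<le> (\<Sum>i\<in>I. Lp_norm p M (f i))"
 using I m
proof (induction I)
 case empty
 then show ?case using Lp_norm_zero[OF p, of M] by simp
next
 case (insert i I)
 have "Lp_norm p M (\<lambda>x. f i x + (\<Sum>i\<in>I. f i x)) \<le> Lp_norm p M (f i) + Lp_norm p M (\<lambda>x. \<Sum>i\<in>I. f i x)"
  using insert by (intro Lp_norm_triangle[OF p]) auto
 also have "... \<le> Lp_norm p M (f i) + (\<Sum>i\<in>I. Lp_norm p M (f i))" using insert by (intro add_left_mono) auto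
 finally show ?case using insert by simp
qed

text \<open>The factor for \<open>p = \<infinity>\<close> is written separately because
  \<open>v\<close> may be 0 and \<open>0 powr 0\<close> is 0.\<close>

lemma Lp_norm_le_bounded_on:
 assumes p: "1 \<le> p" and m: "f \<in> borel_measurable M" and S: "S \<in> sets M" "emeasure M S \<le> ennreal v"
  and a: "0 \<le> a" "0 \<le> v" and f: "AE x in M. \<bar>f x\<bar> \<le> a * indicator S x"
 shows "Lp_norm p M f \<le> ennreal (a * (if p = \<infinity> then 1 else v powr enn2real (1 / p)))"
 using p
proof (cases p rule: exponent_cases)
 case inf
 have "AE x in M. \<bar>f x\<bar> \<le> a" using f
  proof eventually_elim
   case (elim x)
   then show ?case using a by (cases "x \<in> S") auto
  qed
 then show ?thesis using Lp_norm_le_iff_inf[of f M a] m a inf by simp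
next
 case (fin P)
 have "(\<integral>\<^sup>+x. ennreal (\<bar>f x\<bar> powr P) \<partial>M) \<le> (\<integral>\<^sup>+x. ennreal (a powr P) * indicator S x \<partial>M)"
  using f
 proof (intro nn_integral_mono_AE, eventually_elim)
  case (elim x)
  then show ?case using a fin by (cases "x \<in> S") (auto intro!: ennreal_leI powr_mono2)
 qed
 also have "... = ennreal (a powr P) * emeasure M S" using S by (simp add: nn_integral_cmult_indicator)
 also have "... \<le> ennreal (a powr P) * ennreal v" using S by (intro mult_left_mono) auto
 also have "... = ennreal ((a * v powr (1 / P)) powr P)" using a fin by (simp add: powr_mult powr_powr powr_one ennreal_mult)
 finally show ?thesis using Lp_norm_le_iff_fin[of P f M "a * v powr (1 / P)"] m a fin by simp
qed

text \<open>This is Hoelder's inequality for the measure with density \<open>k\<close>. Young's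
  inequality gives a pointwise bound with a free scale \<open>l\<close>, and
  \<open>(b / a) powr (1 / P)\<close> is the scale that minimises the integrated right-hand
  side.\<close>

lemma nn_integral_weighted_power_mean:
 fixes k g :: "'a => real"
 assumes [measurable]: "k \<in> borel_measurable M" "g \<in> borel_measurable M"
  and nn: "\<And>x. 0 \<le> k x" "\<And>x. 0 \<le> g x" and P: "1 \<le> P" and a: "0 < a" and b: "0 \<le> b"
  and ka: "(\<integral>\<^sup>+x. ennreal (k x) \<partial>M) \<le> ennreal a"
  and kb: "(\<integral>\<^sup>+x. ennreal (k x * g x powr P) \<partial>M) \<le> ennreal b"
 shows "(\<integral>\<^sup>+x. ennreal (k x * g x) \<partial>M) \<le> ennreal (a powr (1 - 1 / P) * b powr (1 / P))"
proof (cases "b = 0")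
 \<comment> \<open>The optimal scale would degenerate to 0; instead the integrand vanishes almost
   everywhere.\<close>
 case True
 then have "(\<integral>\<^sup>+x. ennreal (k x * g x powr P) \<partial>M) = 0" using kb by simp
 then have "AE x in M. ennreal (k x * g x powr P) = 0" by (subst (asm) nn_integral_0_iff_AE) auto
 then have "AE x in M. ennreal (k x * g x) = 0"
 proof eventually_elim
  case (elim x)
  then have "k x * g x powr P = 0" using nn(1)[of x] by (intro antisym) (auto simp: ennreal_eq_0_iff)
  then show ?case by auto
 qed
 then have "(\<integral>\<^sup>+x. ennreal (k x * g x) \<partial>M) = (\<integral>\<^sup>+x. 0 \<partial>M)" by (intro nn_integral_cong_AE) auto
 then show ?thesis by simp
next
 case False
 then have b: "0 < b" using b by simp
 define l where "l = (b / a) powr (1 / P)"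
 have l: "0 < l" using a b by (simp add: l_def)
 have lP: "l powr P = b / a" using a b P by (simp add: l_def powr_powr)
 have young: "t \<le> l powr (1 - P) / P * t powr P + (1 - 1 / P) * l" if "0 \<le> t" for t
 proof (cases "t = 0")
  case True
  then show ?thesis using P l by simp
 next
  case False
  then have t: "0 < t" using that by simp
  have "(l powr (1 - P) * t powr P) powr (1 / P) * l powr (1 - 1 / P)
    \<le> 1 / P * (l powr (1 - P) * t powr P) + (1 - 1 / P) * l" using P l t by (intro Youngs_inequality_0) auto
  also have "(l powr (1 - P) * t powr P) powr (1 / P) = l powr ((1 - P) / P) * t" using l t P by (simp add: powr_mult powr_powr)
  also have "l powr ((1 - P) / P) * t * l powr (1 - 1 / P) = t * l powr ((1 - P) / P + (1 - 1 / P))" by (simp add: powr_add)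
  also have "(1 - P) / P + (1 - 1 / P) = 0" using P by (simp add: field_simps)
  finally show ?thesis using l by simp
 qed
 define c where "c = l powr (1 - P) / P"
 have c: "0 \<le> c" using P by (simp add: c_def)
 have "(\<integral>\<^sup>+x. ennreal (k x * g x) \<partial>M)
   \<le> (\<integral>\<^sup>+x. ennreal c * ennreal (k x * g x powr P) + ennreal ((1 - 1 / P) * l) * ennreal (k x) \<partial>M)"
 proof (intro nn_integral_mono)
  fix x
  have "k x * g x \<le> k x * (c * g x powr P + (1 - 1 / P) * l)" using young[of "g x"] nn[of x] by (intro mult_left_mono) (auto simp: c_def)
  also have "... = c * (k x * g x powr P) + ((1 - 1 / P) * l) * k x" by (simp add: algebra_simps)
  finally show "ennreal (k x * g x) \<le> ennreal c * ennreal (k x * g x powr P) + ennreal ((1 - 1 / P) * l) * ennreal (k x)"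
   using c l P nn[of x] by (simp add: ennreal_mult[symmetric] ennreal_plus[symmetric] ennreal_leI del: ennreal_plus)
 qed
 also have "... = ennreal c * (\<integral>\<^sup>+x. ennreal (k x * g x powr P) \<partial>M) + ennreal ((1 - 1 / P) * l) * (\<integral>\<^sup>+x. ennreal (k x) \<partial>M)"
  by (simp add: nn_integral_add nn_integral_cmult)
 also have "... \<le> ennreal c * ennreal b + ennreal ((1 - 1 / P) * l) * ennreal a" using ka kb by (intro add_mono mult_left_mono) auto
 also have "... = ennreal (c * b + (1 - 1 / P) * l * a)"
  using c b a l P by (simp add: ennreal_mult[symmetric] ennreal_plus[symmetric] del: ennreal_plus)
 also have "c * b + (1 - 1 / P) * l * a = l * a"
 proof -
  have "c * b = l * (b / l powr P) / P" unfolding c_def using l by (simp add: powr_diff)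
  also have "b / l powr P = a" unfolding lP using a b by simp
  finally show ?thesis by (simp add: algebra_simps)
 qed
 also have "l * a = a powr (1 - 1 / P) * b powr (1 / P)" using a b by (simp add: l_def powr_divide powr_diff)
 finally show ?thesis .
qed

text \<open>Every \<open>x\<close> sees only a section of \<open>K\<close> of measure at most
  \<open>a\<close>. Hoelder's inequality on this section bounds the \<open>P\<close>-th power of
  \<open>F x\<close> by \<open>a powr (P - 1)\<close> times an integral over the section, and
  Fubini's theorem finishes. \<open>g\<close> may depend on both variables, so that averages of a
  function and averages of its differences are both covered.\<close>

lemma Lp_norm_kernel_le:
 fixes g :: "'a \<times> 'a => real" and F :: "'a => real"
 assumes "sigma_finite_measure M" and p: "1 \<le> p"
  and F: "F \<in> borel_measurable M" and g[measurable]: "g \<in> borel_measurable (M \<Otimes>\<^sub>M M)"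
  and K[measurable]: "K \<in> sets (M \<Otimes>\<^sub>M M)"
  and a: "0 < a" "\<And>x. x \<in> space M ==> emeasure M (Pair x -` K) \<le> ennreal a"
  and FK: "AE x in M. ennreal \<bar>F x\<bar> \<le> (\<integral>\<^sup>+y. ennreal (indicator K (x, y) * \<bar>g (x, y)\<bar>) \<partial>M)"
  and b: "0 \<le> b" "Lp_norm p (M \<Otimes>\<^sub>M M) (\<lambda>z. indicator K z * g z) \<le> ennreal b"
 shows "Lp_norm p M F \<le> ennreal (a powr (1 - enn2real (1 / p)) * b)"
proof -
 interpret S: sigma_finite_measure M by fact
 interpret pair_sigma_finite M M by unfold_locales
 define h where "h z = indicator K z * g z" for z
 have h[measurable]: "h \<in> borel_measurable (M \<Otimes>\<^sub>M M)" unfolding h_def by measurable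
 have hg: "indicator K (x, y) * \<bar>g (x, y)\<bar> = indicator K (x, y) * \<bar>h (x, y)\<bar>" for x y by (auto simp: h_def indicator_def)
 have mx: "(\<lambda>y. indicator K (x, y) :: real) \<in> borel_measurable M"
  "(\<lambda>y. h (x, y)) \<in> borel_measurable M" if "x \<in> space M" for x using that by measurable
 have kx: "(\<integral>\<^sup>+y. ennreal (indicator K (x, y)) \<partial>M) \<le> ennreal a" if "x \<in> space M" for x
 proof -
  have "(\<integral>\<^sup>+y. ennreal (indicator K (x, y)) \<partial>M) = (\<integral>\<^sup>+y. indicator (Pair x -` K) y \<partial>M)"
   by (intro nn_integral_cong) (auto simp: indicator_def)
  also have "... = emeasure M (Pair x -` K)" using that K by (intro nn_integral_indicator) (auto intro: sets_Pair1)
  finally show ?thesis using a(2)[OF that] by simp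
 qed
 have bb: "Lp_norm p (M \<Otimes>\<^sub>M M) h \<le> ennreal b" using b(2) by (simp add: h_def[abs_def])
 from p show ?thesis
 proof (cases p rule: exponent_cases)
  case inf
  have "AE z in M \<Otimes>\<^sub>M M. \<bar>h z\<bar> \<le> b" using bb inf Lp_norm_le_iff_inf[OF h b(1)] by simp
  then have "AE x in M. AE y in M. \<bar>h (x, y)\<bar> \<le> b" by (rule AE_pair)
  with FK have "AE x in M. \<bar>F x\<bar> \<le> a * b" using AE_space
  proof eventually_elim
   case (elim x)
   have "ennreal \<bar>F x\<bar> \<le> (\<integral>\<^sup>+y. ennreal (indicator K (x, y)) * ennreal b \<partial>M)"
    unfolding hg using elim(1)[unfolded hg]
   proof (rule order_trans)
    show "(\<integral>\<^sup>+y. ennreal (indicator K (x, y) * \<bar>h (x, y)\<bar>) \<partial>M) \<le> (\<integral>\<^sup>+y. ennreal (indicator K (x, y)) * ennreal b \<partial>M)"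
     using elim(2) by (intro nn_integral_mono_AE) (auto elim!: eventually_mono simp: indicator_def intro!: ennreal_leI)
   qed
   also have "... = (\<integral>\<^sup>+y. ennreal (indicator K (x, y)) \<partial>M) * ennreal b"
    using mx[OF elim(3)] by (intro nn_integral_multc) auto
   also have "... \<le> ennreal a * ennreal b" using kx[OF elim(3)] by (intro mult_right_mono) auto
   also have "... = ennreal (a * b)" using a b by (simp add: ennreal_mult)
   finally show ?case using a b by (subst (asm) ennreal_le_iff) auto
  qed
  then show ?thesis using Lp_norm_le_iff_inf[OF F, of "a * b"] a b inf by simp
 next
  case (fin P)
  define G where "G x = (\<integral>\<^sup>+y. ennreal (\<bar>h (x, y)\<bar> powr P) \<partial>M)" for x
  have Gm[measurable]: "G \<in> borel_measurable M" unfolding G_def by measurable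
  have GI: "(\<integral>\<^sup>+x. G x \<partial>M) \<le> ennreal (b powr P)"
  proof -
   have "(\<integral>\<^sup>+x. G x \<partial>M) = (\<integral>\<^sup>+z. ennreal (\<bar>h z\<bar> powr P) \<partial>(M \<Otimes>\<^sub>M M))"
    unfolding G_def by (rule S.nn_integral_fst[of "\<lambda>z. ennreal (\<bar>h z\<bar> powr P)" M]) measurable
   also have "... \<le> ennreal (b powr P)" using bb fin Lp_norm_le_iff_fin[OF fin(1) h b(1)] by simp
   finally show ?thesis .
  qed
  then have "(\<integral>\<^sup>+x. G x \<partial>M) \<noteq> \<infinity>" by (auto simp: top_unique)
  then have fin_G: "AE x in M. G x \<noteq> \<infinity>" by (intro nn_integral_PInf_AE) auto
  have "AE x in M. ennreal (\<bar>F x\<bar> powr P) \<le> ennreal (a powr (P - 1)) * G x" using FK fin_G AE_space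
  proof eventually_elim
   case (elim x)
   then obtain r where r: "0 \<le> r" "G x = ennreal r" by (cases "G x") auto
   have "ennreal \<bar>F x\<bar> \<le> ennreal (a powr (1 - 1 / P) * r powr (1 / P))"
   proof (rule order_trans[OF elim(1)[unfolded hg]])
    show "(\<integral>\<^sup>+y. ennreal (indicator K (x, y) * \<bar>h (x, y)\<bar>) \<partial>M) \<le> ennreal (a powr (1 - 1 / P) * r powr (1 / P))"
    proof (rule nn_integral_weighted_power_mean[OF _ _ _ _ fin(1) a(1) r(1) kx[OF elim(3)]])
     have "(\<integral>\<^sup>+y. ennreal (indicator K (x, y) * \<bar>h (x, y)\<bar> powr P) \<partial>M) \<le> G x"
      unfolding G_def by (intro nn_integral_mono) (auto simp: indicator_def)
     then show "(\<integral>\<^sup>+y. ennreal (indicator K (x, y) * \<bar>h (x, y)\<bar> powr P) \<partial>M) \<le> ennreal r" using r by simp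
    qed (use mx[OF elim(3)] in auto)
   qed
   then have "\<bar>F x\<bar> \<le> a powr (1 - 1 / P) * r powr (1 / P)" by (subst (asm) ennreal_le_iff) auto
   then have "\<bar>F x\<bar> powr P \<le> (a powr (1 - 1 / P) * r powr (1 / P)) powr P" using fin by (intro powr_mono2) auto
   also have "... = a powr (P - 1) * r" using fin r by (simp add: powr_mult powr_powr left_diff_distrib)
   finally show ?case using r by (simp add: ennreal_mult[symmetric] ennreal_leI)
  qed
  then have "(\<integral>\<^sup>+x. ennreal (\<bar>F x\<bar> powr P) \<partial>M) \<le> (\<integral>\<^sup>+x. ennreal (a powr (P - 1)) * G x \<partial>M)"
   by (rule nn_integral_mono_AE)
  also have "... = ennreal (a powr (P - 1)) * (\<integral>\<^sup>+x. G x \<partial>M)" by (rule nn_integral_cmult) simp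
  also have "... \<le> ennreal (a powr (P - 1)) * ennreal (b powr P)" using GI by (intro mult_left_mono) auto
  also have "... = ennreal ((a powr (1 - 1 / P) * b) powr P)" using fin a b by (simp add: powr_mult powr_powr left_diff_distrib ennreal_mult)
  finally show ?thesis using Lp_norm_le_iff_fin[OF fin(1) F, of "a powr (1 - 1 / P) * b"] fin a b by simp
 qed
qed

text \<open>\<open>f (fst z)\<close> is constant in the second variable, so the inner integral sees
  the weight alone. The weight will be a truncated power of the distance, or the indicator of a
  strip along the diagonal.\<close>

lemma Lp_norm_pair_weight_le:
 fixes W :: "'a \<times> 'a => real"
 assumes "sigma_finite_measure M" and p: "1 \<le> p"
  and f: "f \<in> borel_measurable M" and W[measurable]: "W \<in> borel_measurable (M \<Otimes>\<^sub>M M)"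
  and w: "0 \<le> w" "p = \<infinity> ==> AE z in M \<Otimes>\<^sub>M M. \<bar>W z\<bar> \<le> w"
   "\<And>P x. p = ennreal P ==> 1 \<le> P ==> x \<in> space M ==> (\<integral>\<^sup>+y. ennreal (\<bar>W (x, y)\<bar> powr P) \<partial>M) \<le> ennreal (w powr P)"
  and b: "0 \<le> b" "Lp_norm p M f \<le> ennreal b"
 shows "Lp_norm p (M \<Otimes>\<^sub>M M) (\<lambda>z. W z * f (fst z)) \<le> ennreal (w * b)"
proof -
 interpret S: sigma_finite_measure M by fact
 interpret pair_sigma_finite M M by unfold_locales
 note f[measurable]
 have m: "(\<lambda>z. W z * f (fst z)) \<in> borel_measurable (M \<Otimes>\<^sub>M M)" by measurable
 from p show ?thesis
 proof (cases p rule: exponent_cases)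
  case inf
  have "AE x in M. \<bar>f x\<bar> \<le> b" using b inf Lp_norm_le_iff_inf[OF f b(1)] by simp
  then have "AE x in M. AE y in M. \<bar>f (fst (x, y))\<bar> \<le> b" by eventually_elim auto
  then have "AE z in M \<Otimes>\<^sub>M M. \<bar>f (fst z)\<bar> \<le> b" by (intro AE_pair_measure) auto
  with w(2)[OF inf(1)] have "AE z in M \<Otimes>\<^sub>M M. \<bar>W z * f (fst z)\<bar> \<le> w * b"
  proof eventually_elim
   case (elim z)
   then show ?case using w(1) by (simp add: abs_mult mult_mono)
  qed
  then show ?thesis using Lp_norm_le_iff_inf[OF m, of "w * b"] inf w b by simp
 next
  case (fin P)
  have "(\<integral>\<^sup>+z. ennreal (\<bar>W z * f (fst z)\<bar> powr P) \<partial>(M \<Otimes>\<^sub>M M))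
    = (\<integral>\<^sup>+x. \<integral>\<^sup>+y. ennreal (\<bar>W (x, y) * f (fst (x, y))\<bar> powr P) \<partial>M \<partial>M)"
   by (rule S.nn_integral_fst[of "\<lambda>z. ennreal (\<bar>W z * f (fst z)\<bar> powr P)" M, symmetric]) measurable
  also have "... = (\<integral>\<^sup>+x. ennreal (\<bar>f x\<bar> powr P) * (\<integral>\<^sup>+y. ennreal (\<bar>W (x, y)\<bar> powr P) \<partial>M) \<partial>M)"
   by (intro nn_integral_cong, subst nn_integral_cmult[symmetric])
    (auto simp: abs_mult powr_mult ennreal_mult[symmetric] mult.commute)
  also have "... \<le> (\<integral>\<^sup>+x. ennreal (\<bar>f x\<bar> powr P) * ennreal (w powr P) \<partial>M)"
   using w(3)[OF fin(2,1)] by (intro nn_integral_mono mult_left_mono) auto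
  also have "... = (\<integral>\<^sup>+x. ennreal (\<bar>f x\<bar> powr P) \<partial>M) * ennreal (w powr P)" by (rule nn_integral_multc) simp
  also have "... \<le> ennreal (b powr P) * ennreal (w powr P)" using b fin Lp_norm_le_iff_fin[OF fin(1) f b(1)] by (intro mult_right_mono) auto
  also have "... = ennreal ((w * b) powr P)" using w b by (simp add: powr_mult ennreal_mult mult.commute)
  finally show ?thesis using Lp_norm_le_iff_fin[OF fin(1) m, of "w * b"] fin w b by simp
 qed
qed

lemma Lp_norm_swap:
 assumes "sigma_finite_measure M" and p: "1 \<le> p" and f: "f \<in> borel_measurable (M \<Otimes>\<^sub>M M)"
 shows "Lp_norm p (M \<Otimes>\<^sub>M M) (\<lambda>(x, y). f (y, x)) = Lp_norm p (M \<Otimes>\<^sub>M M) f"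
proof -
 interpret S: sigma_finite_measure M by fact
 interpret pair_sigma_finite M M by unfold_locales
 note f[measurable]
 let ?N = "M \<Otimes>\<^sub>M M" and ?f = "\<lambda>(x, y). f (y, x)"
 have D: "?N = distr ?N ?N (\<lambda>(x, y). (y, x))" by (rule distr_pair_swap)
 have m: "?f \<in> borel_measurable ?N" by measurable
 have le: "Lp_norm p ?N (\<lambda>(x, y). g (y, x)) \<le> ennreal a"
  if g[measurable]: "g \<in> borel_measurable ?N" and a: "0 \<le> a" "Lp_norm p ?N g \<le> ennreal a" for g :: "'a \<times> 'a => real" and a
 proof -
  have gm: "(\<lambda>(x, y). g (y, x)) \<in> borel_measurable ?N" by measurable
  from p show ?thesis
  proof (cases p rule: exponent_cases)
   case inf
   have "AE z in ?N. \<bar>g z\<bar> \<le> a" using a inf Lp_norm_le_iff_inf[OF g a(1)] by simp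
   then have "AE z in ?N. \<bar>g ((\<lambda>(x, y). (y, x)) z)\<bar> \<le> a" by (subst (asm) D, subst (asm) AE_distr_iff) auto
   then show ?thesis using Lp_norm_le_iff_inf[OF gm a(1)] inf by (simp add: case_prod_beta)
  next
   case (fin P)
   have "(\<integral>\<^sup>+z. ennreal (\<bar>(\<lambda>(x, y). g (y, x)) z\<bar> powr P) \<partial>?N) = (\<integral>\<^sup>+z. ennreal (\<bar>g z\<bar> powr P) \<partial>distr ?N ?N (\<lambda>(x, y). (y, x)))"
    by (subst nn_integral_distr) (auto intro!: nn_integral_cong simp: case_prod_beta)
   also have "... = (\<integral>\<^sup>+z. ennreal (\<bar>g z\<bar> powr P) \<partial>?N)" by (simp only: D[symmetric])
   also have "... \<le> ennreal (a powr P)" using a fin Lp_norm_le_iff_fin[OF fin(1) g a(1)] by simp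
   finally show ?thesis using Lp_norm_le_iff_fin[OF fin(1) gm a(1)] fin by simp
  qed
 qed
 have le': "Lp_norm p ?N (\<lambda>(x, y). g (y, x)) \<le> Lp_norm p ?N g" if "g \<in> borel_measurable ?N" for g :: "'a \<times> 'a => real"
  by (cases "Lp_norm p ?N g") (use le[OF that] in auto)
 show ?thesis using le'[OF f] le'[OF m] by (intro antisym) (auto simp: case_prod_beta)
qed

section \<open>Lebesgue measure on subsets of the line and integrals of power kernels\<close>

lemma measurable_ident_lebesgue_on [measurable]: "(\<lambda>x::real. x) \<in> borel_measurable (lebesgue_on S)"
 using id_borel_measurable_lebesgue_on[of S] by (simp add: id_def)

lemma measurable_fst_lebesgue_on [measurable]:
 "fst \<in> borel_measurable (lebesgue_on (S :: real set) \<Otimes>\<^sub>M N)"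
 using measurable_compose[OF measurable_fst measurable_ident_lebesgue_on] by simp

lemma measurable_snd_lebesgue_on [measurable]:
 "snd \<in> borel_measurable (N \<Otimes>\<^sub>M lebesgue_on (S :: real set))"
 using measurable_compose[OF measurable_snd measurable_ident_lebesgue_on] by simp

lemma sigma_finite_lebesgue_on: "S \<in> lmeasurable ==> sigma_finite_measure (lebesgue_on S)"
 using finite_measure_lebesgue_on finite_measure_def by blast

lemma nn_integral_lebesgue_on_le:
 assumes "S \<in> sets lebesgue"
 shows "(\<integral>\<^sup>+x. f x \<partial>lebesgue_on S) \<le> (\<integral>\<^sup>+x. f x \<partial>lborel)"
proof -
 have "(\<integral>\<^sup>+x. f x \<partial>lebesgue_on S) = (\<integral>\<^sup>+x. f x * indicator S x \<partial>lebesgue)"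
  using assms by (intro nn_integral_restrict_space) auto
 also have "... \<le> (\<integral>\<^sup>+x. f x \<partial>lebesgue)" by (intro nn_integral_mono) (auto simp: indicator_def)
 finally show ?thesis by (simp add: nn_integral_completion)
qed

lemma emeasure_lebesgue_on_le:
 assumes "S \<in> sets lebesgue" "A \<in> sets lebesgue"
 shows "emeasure (lebesgue_on S) (A \<inter> S) \<le> emeasure lebesgue A"
 using assms by (subst emeasure_restrict_space) (auto simp del: emeasure_completion intro!: emeasure_mono)

text \<open>A translation moves \<open>x\<close> to the origin and a reflection folds the two
  half-lines onto each other, hence the factor 2.\<close>

lemma nn_integral_abs_diff_le:
 fixes g :: "real => real"
 assumes [measurable]: "g \<in> borel_measurable borel" and S: "S \<in> sets lebesgue"
  and I: "(\<integral>\<^sup>+y. ennreal (g y) * indicator {0..} y \<partial>lborel) \<le> ennreal I" "0 \<le> I"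
 shows "(\<integral>\<^sup>+y. ennreal (g \<bar>x - y\<bar>) \<partial>lebesgue_on S) \<le> ennreal (2 * I)"
proof -
 have "(\<integral>\<^sup>+y. ennreal (g \<bar>x - y\<bar>) \<partial>lebesgue_on S) \<le> (\<integral>\<^sup>+y. ennreal (g \<bar>x - y\<bar>) \<partial>lborel)"
  by (rule nn_integral_lebesgue_on_le[OF S])
 also have "... = (\<integral>\<^sup>+y. ennreal (g \<bar>y\<bar>) \<partial>lborel)" by (subst nn_integral_real_affine[where c = 1 and t = x]) auto
 also have "... \<le> (\<integral>\<^sup>+y. ennreal (g y) * indicator {0..} y + ennreal (g (0 + (-1) * y)) * indicator {0..} (0 + (-1) * y) \<partial>lborel)"
  by (intro nn_integral_mono) (auto simp: indicator_def)
 also have "... = (\<integral>\<^sup>+y. ennreal (g y) * indicator {0..} y \<partial>lborel)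
   + (\<integral>\<^sup>+y. ennreal (g (0 + (-1) * y)) * indicator {0..} (0 + (-1) * y) \<partial>lborel)" by (intro nn_integral_add) auto
 also have "(\<integral>\<^sup>+y. ennreal (g (0 + (-1) * y)) * indicator {0..} (0 + (-1) * y) \<partial>lborel)
   = (\<integral>\<^sup>+y. ennreal (g y) * indicator {0..} y \<partial>lborel)" by (subst (2) nn_integral_real_affine[where c = "-1" and t = 0]) auto
 also have "(\<integral>\<^sup>+y. ennreal (g y) * indicator {0..} y \<partial>lborel) + (\<integral>\<^sup>+y. ennreal (g y) * indicator {0..} y \<partial>lborel)
   \<le> ennreal I + ennreal I" using I by (intro add_mono)
 also have "... = ennreal (2 * I)" using I by (simp add: ennreal_plus[symmetric] del: ennreal_plus)
 finally show ?thesis .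
qed

lemma nn_integral_powr_near:
 fixes a h x :: real
 assumes "-1 < a" "0 < h" "S \<in> sets lebesgue"
 shows "(\<integral>\<^sup>+y. ennreal (indicator {..h} \<bar>x - y\<bar> * \<bar>x - y\<bar> powr a) \<partial>lebesgue_on S) \<le> ennreal (2 * (h powr (a + 1) / (a + 1)))"
proof (rule nn_integral_abs_diff_le[of "\<lambda>t. indicator {..h} t * t powr a"])
 have "(\<integral>\<^sup>+y. ennreal (indicator {..h} y * y powr a) * indicator {0..} y \<partial>lborel)
   = (\<integral>\<^sup>+y. ennreal (y powr a) * indicator {0..h} y \<partial>lborel)" by (intro nn_integral_cong) (auto simp: indicator_def)
 also have "... = ennreal (h powr (a + 1) / (a + 1))" using assms by (intro nn_integral_has_integral_lebesgue' has_integral_powr_from_0) auto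
 finally show "(\<integral>\<^sup>+y. ennreal (indicator {..h} y * y powr a) * indicator {0..} y \<partial>lborel) \<le> ennreal (h powr (a + 1) / (a + 1))"
  by simp
qed (use assms in auto)

lemma nn_integral_powr_far:
 fixes e h x :: real
 assumes "e < -1" "0 < h" "S \<in> sets lebesgue"
 shows "(\<integral>\<^sup>+y. ennreal (indicator {h<..} \<bar>x - y\<bar> * \<bar>x - y\<bar> powr e) \<partial>lebesgue_on S) \<le> ennreal (2 * (- (h powr (e + 1)) / (e + 1)))"
proof (rule nn_integral_abs_diff_le[of "\<lambda>t. indicator {h<..} t * t powr e"])
 have "(\<integral>\<^sup>+y. ennreal (indicator {h<..} y * y powr e) * indicator {0..} y \<partial>lborel)
   \<le> (\<integral>\<^sup>+y. ennreal (y powr e) * indicator {h..} y \<partial>lborel)"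
  using assms by (intro nn_integral_mono) (auto simp: indicator_def)
 also have "... = ennreal (- (h powr (e + 1)) / (e + 1))" using assms by (intro nn_integral_has_integral_lebesgue' has_integral_powr_to_inf) auto
 finally show "(\<integral>\<^sup>+y. ennreal (indicator {h<..} y * y powr e) * indicator {0..} y \<partial>lborel) \<le> ennreal (- (h powr (e + 1)) / (e + 1))" .
qed (use assms in \<open>auto simp: divide_nonneg_neg\<close>)

section \<open>The Slobodeckij seminorm near the diagonal and away from it\<close>

text \<open>Away from the diagonal no cancellation in \<open>f x - f y\<close> is exploited. The two
  terms are estimated separately, since the kernel with exponent \<open>- t * P - 1\<close> is
  integrable at distances larger than \<open>h\<close>, with an integral of order
  \<open>h powr (- t * P)\<close>.\<close>

lemma slobodeckij_far:
 fixes p :: ennreal and t :: real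
 assumes p: "1 \<le> p" and t: "0 < t"
 obtains K where "0 < K"
  "\<And>(S :: real set) f b h. S \<in> lmeasurable ==> f \<in> borel_measurable (lebesgue_on S) ==> 0 \<le> b ==> 0 < h ==>
   Lp_norm p (lebesgue_on S) f \<le> ennreal b ==>
   Lp_norm p (lebesgue_on S \<Otimes>\<^sub>M lebesgue_on S)
    (\<lambda>(x, y). indicator {h<..} \<bar>x - y\<bar> * (\<bar>f x - f y\<bar> / \<bar>x - y\<bar> powr (t + enn2real (1 / p))))
   \<le> ennreal (K * h powr (- t) * b)"
proof -
 \<comment> \<open>The \<open>P\<close>-th root of \<open>2 / (t * P)\<close>, the constant that
   results from integrating the kernel over two half-lines.\<close>
 define \<kappa> where "\<kappa> = (if p = \<infinity> then 1 else (2 / (t * enn2real p)) powr (1 / enn2real p))"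
 have \<kappa>: "0 < \<kappa>" unfolding \<kappa>_def using p t by (cases p rule: exponent_cases) auto
 show ?thesis
 proof (rule that[of "2 * \<kappa>"], goal_cases)
  case (2 S f b h)
  note S = 2(1) and f[measurable] = 2(2) and b = 2(3) and h = 2(4) and fb = 2(5)
  let ?M = "lebesgue_on S"
  define e where "e = t + enn2real (1 / p)"
  define W where "W z = indicator {h<..} \<bar>fst z - snd z\<bar> * \<bar>fst z - snd z\<bar> powr (- e)" for z :: "real \<times> real"
  have Wm[measurable]: "W \<in> borel_measurable (?M \<Otimes>\<^sub>M ?M)" unfolding W_def by measurable
  have e: "t \<le> e" unfolding e_def by simp
  have A: "Lp_norm p (?M \<Otimes>\<^sub>M ?M) (\<lambda>z. W z * f (fst z)) \<le> ennreal ((\<kappa> * h powr (-t)) * b)"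
  proof (rule Lp_norm_pair_weight_le[OF sigma_finite_lebesgue_on[OF S] p f Wm _ _ _ b fb])
   show "0 \<le> \<kappa> * h powr (-t)" using \<kappa> by simp
  next
   assume inf: "p = \<infinity>"
   then have e': "e = t" by (simp add: e_def)
   show "AE z in ?M \<Otimes>\<^sub>M ?M. \<bar>W z\<bar> \<le> \<kappa> * h powr (-t)"
   proof (rule AE_I2)
    fix z :: "real \<times> real"
    show "\<bar>W z\<bar> \<le> \<kappa> * h powr (-t)"
     using inf h t unfolding W_def e' \<kappa>_def by (auto simp: indicator_def intro!: powr_mono2')
   qed
  next
   fix P x
   assume P: "p = ennreal P" "1 \<le> P"
   have pP: "enn2real p = P" "p \<noteq> \<infinity>" using P by auto
   have ip: "enn2real (1 / p) = 1 / P" using pP by (cases rule: exponent_cases[OF p]) auto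
   have eP: "- e * P = - (t * P) - 1" using P(2) by (simp add: e_def ip algebra_simps)
   have tP: "0 < t * P" using P(2) t by simp
   have "(\<integral>\<^sup>+y. ennreal (\<bar>W (x, y)\<bar> powr P) \<partial>?M)
     = (\<integral>\<^sup>+y. ennreal (indicator {h<..} \<bar>x - y\<bar> * \<bar>x - y\<bar> powr (- e * P)) \<partial>?M)"
    unfolding W_def using h by (intro nn_integral_cong) (auto simp: indicator_def powr_powr)
   also have "... \<le> ennreal (2 * (- (h powr (- e * P + 1)) / (- e * P + 1)))"
    using tP h S unfolding eP by (intro nn_integral_powr_far) (auto simp: fmeasurableD)
   also have "- e * P + 1 = - (t * P)" unfolding eP by simp
   also have "2 * (- (h powr (- (t * P))) / (- (t * P))) = (\<kappa> * h powr (-t)) powr P"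
   proof -
    have "\<kappa> powr P = 2 / (t * P)" using P(2) tP pP by (simp add: \<kappa>_def powr_powr)
    moreover have "(h powr (-t)) powr P = h powr (- (t * P))" by (simp add: powr_powr)
    ultimately show ?thesis using \<kappa> by (simp add: powr_mult)
   qed
   finally show "(\<integral>\<^sup>+y. ennreal (\<bar>W (x, y)\<bar> powr P) \<partial>?M) \<le> ennreal ((\<kappa> * h powr (-t)) powr P)" .
  qed
  have B: "Lp_norm p (?M \<Otimes>\<^sub>M ?M) (\<lambda>z. W z * f (snd z)) \<le> ennreal ((\<kappa> * h powr (-t)) * b)"
  proof -
   have "(\<lambda>z. W z * f (snd z)) = (\<lambda>(x, y). (\<lambda>z. W z * f (fst z)) (y, x))" by (auto simp: fun_eq_iff W_def abs_minus_commute)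
   then have "Lp_norm p (?M \<Otimes>\<^sub>M ?M) (\<lambda>z. W z * f (snd z)) = Lp_norm p (?M \<Otimes>\<^sub>M ?M) (\<lambda>z. W z * f (fst z))"
    using Lp_norm_swap[OF sigma_finite_lebesgue_on[OF S] p, of "\<lambda>z. W z * f (fst z)"] by simp
   then show ?thesis using A by simp
  qed
  have "Lp_norm p (?M \<Otimes>\<^sub>M ?M) (\<lambda>(x, y). indicator {h<..} \<bar>x - y\<bar> * (\<bar>f x - f y\<bar> / \<bar>x - y\<bar> powr (t + enn2real (1 / p))))
    = Lp_norm p (?M \<Otimes>\<^sub>M ?M) (\<lambda>z. W z * f (fst z) + (- 1) * (W z * f (snd z)))"
  proof (rule Lp_norm_cong_AE[OF p])
   show "AE z in ?M \<Otimes>\<^sub>M ?M. \<bar>case z of (x, y) => indicator {h<..} \<bar>x - y\<bar> * (\<bar>f x - f y\<bar> / \<bar>x - y\<bar> powr (t + enn2real (1 / p)))\<bar>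
    = \<bar>W z * f (fst z) + (- 1) * (W z * f (snd z))\<bar>"
   proof (rule AE_I2)
    fix z :: "real \<times> real"
    have "W z * f (fst z) + (- 1) * (W z * f (snd z)) = W z * (f (fst z) - f (snd z))" by (simp add: right_diff_distrib)
    moreover have "W z = indicator {h<..} \<bar>fst z - snd z\<bar> / \<bar>fst z - snd z\<bar> powr e" "0 \<le> W z"
     by (auto simp: W_def powr_minus divide_inverse)
    ultimately show "\<bar>case z of (x, y) => indicator {h<..} \<bar>x - y\<bar> * (\<bar>f x - f y\<bar> / \<bar>x - y\<bar> powr (t + enn2real (1 / p)))\<bar>
     = \<bar>W z * f (fst z) + (- 1) * (W z * f (snd z))\<bar>" unfolding e_def[symmetric] by (simp add: case_prod_unfold abs_mult)
   qed
  qed measurable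
  also have "... \<le> Lp_norm p (?M \<Otimes>\<^sub>M ?M) (\<lambda>z. W z * f (fst z)) + Lp_norm p (?M \<Otimes>\<^sub>M ?M) (\<lambda>z. (- 1) * (W z * f (snd z)))"
   by (rule Lp_norm_triangle[OF p]) measurable
  also have "... \<le> ennreal ((\<kappa> * h powr (-t)) * b) + ennreal ((\<kappa> * h powr (-t)) * b)"
  proof (rule add_mono[OF A])
   have "Lp_norm p (?M \<Otimes>\<^sub>M ?M) (\<lambda>z. (- 1) * (W z * f (snd z))) \<le> ennreal \<bar>-1\<bar> * Lp_norm p (?M \<Otimes>\<^sub>M ?M) (\<lambda>z. W z * f (snd z))"
    by (rule Lp_norm_cmult_le[OF p]) measurable
   then show "Lp_norm p (?M \<Otimes>\<^sub>M ?M) (\<lambda>z. (- 1) * (W z * f (snd z))) \<le> ennreal ((\<kappa> * h powr (-t)) * b)"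
    using B by simp
  qed
  also have "... = ennreal (2 * \<kappa> * h powr (- t) * b)" using \<kappa> b by (simp add: ennreal_plus[symmetric] del: ennreal_plus)
  finally show ?case .
 qed (use \<kappa> in auto)
qed

definition slobodeckij_near :: "real set => real => ennreal => real => (real => real) => ennreal" where
 "slobodeckij_near S t p h f = Lp_norm p (lebesgue_on S \<Otimes>\<^sub>M lebesgue_on S)
  (\<lambda>(x, y). indicator {..h} \<bar>x - y\<bar> * (\<bar>f x - f y\<bar> / \<bar>x - y\<bar> powr (t + enn2real (1 / p))))"

text \<open>Hoelder's inequality applied to the increment leaves the integral of the
  \<open>P\<close>-th power of \<open>f'\<close> between \<open>x\<close> and \<open>y\<close>,
  times the power \<open>q\<close> of the distance. For a fixed \<open>t\<close> between the two
  points, both \<open>\<bar>t - x\<bar>\<close> and \<open>\<bar>t - y\<bar>\<close> are smaller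
  than \<open>\<bar>x - y\<bar>\<close>, so a negative exponent can be shared equally among them.
  The double integral over \<open>x\<close> and \<open>y\<close> then splits into two single ones.
  The relation between \<open>f\<close> and \<open>f'\<close> is stated as an inequality for almost
  all pairs, which is what a weak derivative provides.\<close>

lemma slobodeckij_near_bound:
 fixes p :: ennreal and s :: real
 assumes p: "1 \<le> p" and s: "0 < s" "s < 1"
 obtains K where "0 < K"
  "\<And>(S :: real set) f f' b h. S \<in> lmeasurable ==> f \<in> borel_measurable (lebesgue_on S) ==> f' \<in> borel_measurable (lebesgue_on S) ==>
   AE z in lebesgue_on S \<Otimes>\<^sub>M lebesgue_on S. ennreal \<bar>f (fst z) - f (snd z)\<bar> \<le>
     (\<integral>\<^sup>+t. ennreal (indicator {min (fst z) (snd z)<..<max (fst z) (snd z)} t * \<bar>f' t\<bar>) \<partial>lebesgue_on S) ==>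
   0 \<le> b ==> 0 < h ==> Lp_norm p (lebesgue_on S) f' \<le> ennreal b ==>
   slobodeckij_near S s p h f \<le> ennreal (K * h powr (1 - s) * b)"
proof -
 define P where "P = enn2real p"
 \<comment> \<open>Hoelder's inequality contributes \<open>P - 1\<close>, and the kernel subtracts
   \<open>(s + 1 / P) * P\<close>.\<close>
 define q where "q = P * (1 - s) - 2"
 \<comment> \<open>A positive \<open>q\<close> is absorbed by powers of \<open>h\<close>; only the
   nonpositive part \<open>q0\<close> is shared by the two points, and \<open>q > -2\<close> makes
   \<open>q0 / 2\<close> an integrable exponent.\<close>
 define q0 where "q0 = min q 0"
 define \<kappa> where "\<kappa> = (if p = \<infinity> then 1 else (4 / (q0 / 2 + 1)\<^sup>2) powr (1 / P))"
 have Pq: "1 \<le> P" "-1 < q0 / 2" if "p \<noteq> \<infinity>"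
 proof -
  show P: "1 \<le> P" using p that by (cases p rule: exponent_cases) (auto simp: P_def)
  have "0 < P * (1 - s)" using P s by simp
  then show "-1 < q0 / 2" by (auto simp: q0_def q_def min_def)
 qed
 have \<kappa>: "0 < \<kappa>" unfolding \<kappa>_def using Pq by auto
 show ?thesis
 proof (rule that[of \<kappa>], goal_cases)
  case (2 S f f' b h)
  note S = 2(1) and f[measurable] = 2(2) and f'[measurable] = 2(3) and ff = 2(4) and b = 2(5) and h = 2(6) and fb = 2(7)
  let ?M = "lebesgue_on S"
  interpret S: sigma_finite_measure ?M by (rule sigma_finite_lebesgue_on[OF S])
  interpret pair_sigma_finite ?M ?M by unfold_locales
  define I :: "real => real => real => real" where "I x y t = indicator {min x y<..<max x y} t" for x y t
  have len: "(\<integral>\<^sup>+t. ennreal (I x y t) \<partial>?M) \<le> ennreal \<bar>x - y\<bar>" for x y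
  proof -
   have "(\<integral>\<^sup>+t. ennreal (I x y t) \<partial>?M) \<le> (\<integral>\<^sup>+t. ennreal (I x y t) \<partial>lborel)"
    using S by (intro nn_integral_lebesgue_on_le) auto
   also have "... = (\<integral>\<^sup>+t. indicator {min x y<..<max x y} t \<partial>lborel)"
    unfolding I_def by (intro nn_integral_cong) (auto simp: indicator_def)
   also have "... = ennreal \<bar>x - y\<bar>" by (simp add: min_def max_def abs_if)
   finally show ?thesis .
  qed
  define Fn where "Fn z = indicator {..h} \<bar>fst z - snd z\<bar> * (\<bar>f (fst z) - f (snd z)\<bar> / \<bar>fst z - snd z\<bar> powr (s + enn2real (1 / p)))" for z
  have Fm[measurable]: "Fn \<in> borel_measurable (?M \<Otimes>\<^sub>M ?M)" unfolding Fn_def by measurable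
  have goal: "Lp_norm p (?M \<Otimes>\<^sub>M ?M) Fn \<le> ennreal (\<kappa> * h powr (1 - s) * b)" using p
  proof (cases p rule: exponent_cases)
   case inf
   have bd: "AE t in ?M. \<bar>f' t\<bar> \<le> b" using fb inf Lp_norm_le_iff_inf[OF f' b] by simp
   from ff have "AE z in ?M \<Otimes>\<^sub>M ?M. \<bar>Fn z\<bar> \<le> \<kappa> * h powr (1 - s) * b"
   proof eventually_elim
    case (elim z)
    define d where "d = \<bar>fst z - snd z\<bar>"
    have "ennreal \<bar>f (fst z) - f (snd z)\<bar> \<le> (\<integral>\<^sup>+t. ennreal (I (fst z) (snd z) t) * ennreal b \<partial>?M)" using elim
    proof (rule order_trans)
     show "(\<integral>\<^sup>+t. ennreal (indicator {min (fst z) (snd z)<..<max (fst z) (snd z)} t * \<bar>f' t\<bar>) \<partial>?M)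
       \<le> (\<integral>\<^sup>+t. ennreal (I (fst z) (snd z) t) * ennreal b \<partial>?M)"
      using bd by (intro nn_integral_mono_AE) (auto elim!: eventually_mono simp: I_def indicator_def intro!: ennreal_leI)
    qed
    also have "... = (\<integral>\<^sup>+t. ennreal (I (fst z) (snd z) t) \<partial>?M) * ennreal b" by (rule nn_integral_multc) (simp add: I_def)
    also have "... \<le> ennreal d * ennreal b" unfolding d_def by (intro mult_right_mono len) auto
    also have "... = ennreal (d * b)" using b by (simp add: ennreal_mult d_def)
    finally have *: "\<bar>f (fst z) - f (snd z)\<bar> \<le> d * b" using b by (simp add: d_def)
    show ?case
    proof (cases "0 < d \<and> d \<le> h")
     case True
     have "\<bar>Fn z\<bar> = \<bar>f (fst z) - f (snd z)\<bar> / d powr s" using True inf by (simp add: Fn_def d_def[symmetric])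
     also have "... \<le> d * b / d powr s" using * by (intro divide_right_mono) auto
     also have "... = d powr (1 - s) * b" using True by (simp add: powr_diff)
     also have "... \<le> h powr (1 - s) * b" using True s b by (intro mult_right_mono powr_mono2) auto
     finally show ?thesis using inf by (simp add: \<kappa>_def)
    next
     case False
     then have "Fn z = 0" using * by (auto simp: Fn_def d_def[symmetric] indicator_def) (auto simp: d_def)
     then show ?thesis using \<kappa> b by simp
    qed
   qed
   then show ?thesis using Lp_norm_le_iff_inf[OF Fm, of "\<kappa> * h powr (1 - s) * b"] \<kappa> b inf by simp
  next
   case (fin P')
   have P: "P' = P" "1 \<le> P" using fin by (auto simp: P_def)
   define w where "w x t = indicator {..h} \<bar>t - x\<bar> * \<bar>t - x\<bar> powr (q0 / 2)" for x t :: real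
   have w0: "0 \<le> w x t" for x t by (simp add: w_def)
   have wI: "(\<integral>\<^sup>+x. ennreal (w x t) \<partial>?M) \<le> ennreal (2 * (h powr (q0 / 2 + 1) / (q0 / 2 + 1)))" for t
    unfolding w_def using Pq fin h S by (intro nn_integral_powr_near) auto
   have pw: "\<bar>x - y\<bar> powr q * indicator {..h} \<bar>x - y\<bar> * I x y t \<le> h powr (q - q0) * (w x t * w y t)" for x y t
   proof (cases "\<bar>x - y\<bar> \<le> h \<and> I x y t \<noteq> 0")
    case True
    then have t: "0 < \<bar>t - x\<bar>" "\<bar>t - x\<bar> < \<bar>x - y\<bar>" "0 < \<bar>t - y\<bar>" "\<bar>t - y\<bar> < \<bar>x - y\<bar>" "I x y t = 1"
     by (auto simp: I_def min_def max_def indicator_def split: if_splits)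
    have "\<bar>x - y\<bar> powr q = \<bar>x - y\<bar> powr (q - q0) * (\<bar>x - y\<bar> powr (q0 / 2) * \<bar>x - y\<bar> powr (q0 / 2))"
     by (simp add: powr_add[symmetric])
    also have "... \<le> h powr (q - q0) * (\<bar>t - x\<bar> powr (q0 / 2) * \<bar>t - y\<bar> powr (q0 / 2))"
     using True t by (intro mult_mono powr_mono2 powr_mono2') (auto simp: q0_def)
    also have "\<bar>t - x\<bar> powr (q0 / 2) * \<bar>t - y\<bar> powr (q0 / 2) = w x t * w y t" using True t by (auto simp: w_def indicator_def)
    finally show ?thesis using True t by simp
   next
    case False
    then show ?thesis using w0 by (auto simp: indicator_def)
   qed
   have "AE z in ?M \<Otimes>\<^sub>M ?M. ennreal (\<bar>Fn z\<bar> powr P)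
     \<le> (\<integral>\<^sup>+t. ennreal (\<bar>fst z - snd z\<bar> powr q * indicator {..h} \<bar>fst z - snd z\<bar> * I (fst z) (snd z) t * \<bar>f' t\<bar> powr P) \<partial>?M)"
    using ff
   proof eventually_elim
    case (elim z)
    define x y where "x = fst z" and "y = snd z"
    define d where "d = \<bar>x - y\<bar>"
    define G where "G = (\<integral>\<^sup>+t. ennreal (I x y t * \<bar>f' t\<bar> powr P) \<partial>?M)"
    have [measurable]: "I x y \<in> borel_measurable ?M" unfolding I_def by measurable
    have Geq: "(\<integral>\<^sup>+t. ennreal (d powr q * indicator {..h} d * I x y t * \<bar>f' t\<bar> powr P) \<partial>?M)
      = ennreal (d powr q * indicator {..h} d) * G"
     unfolding G_def by (subst nn_integral_cmult[symmetric]) (auto simp: I_def ennreal_mult'[symmetric] mult.assoc intro!: nn_integral_cong)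
    show ?case
    proof (cases "0 < d \<and> d \<le> h \<and> G \<noteq> \<infinity>")
     case True
     then obtain r where r: "0 \<le> r" "G = ennreal r" by (cases G) auto
     have "ennreal \<bar>f x - f y\<bar> \<le> ennreal (d powr (1 - 1 / P) * r powr (1 / P))"
     proof (rule order_trans[OF elim[folded x_def y_def]])
      show "(\<integral>\<^sup>+t. ennreal (indicator {min x y<..<max x y} t * \<bar>f' t\<bar>) \<partial>?M) \<le> ennreal (d powr (1 - 1 / P) * r powr (1 / P))"
       using nn_integral_weighted_power_mean[of "I x y" ?M "\<lambda>t. \<bar>f' t\<bar>" P d r] len[of x y] r True P by (simp add: I_def d_def G_def)
     qed
     then have "\<bar>f x - f y\<bar> \<le> d powr (1 - 1 / P) * r powr (1 / P)" by (subst (asm) ennreal_le_iff) auto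
     then have "\<bar>f x - f y\<bar> powr P \<le> (d powr (1 - 1 / P) * r powr (1 / P)) powr P" using P by (intro powr_mono2) auto
     also have "... = d powr (P - 1) * r" using P r by (simp add: powr_mult powr_powr left_diff_distrib)
     finally have *: "\<bar>f x - f y\<bar> powr P \<le> d powr (P - 1) * r" .
     have "\<bar>Fn z\<bar> powr P = \<bar>f x - f y\<bar> powr P / d powr ((s + 1 / P) * P)"
      using True fin P by (simp add: Fn_def x_def[symmetric] y_def[symmetric] d_def[symmetric] powr_divide powr_powr)
     also have "... \<le> d powr (P - 1) * r / d powr ((s + 1 / P) * P)" using * by (intro divide_right_mono) auto
     also have "... = d powr (P - 1 - (s + 1 / P) * P) * r" by (simp add: powr_diff)
     also have "P - 1 - (s + 1 / P) * P = q" using P by (simp add: q_def algebra_simps)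
     finally have "ennreal (\<bar>Fn z\<bar> powr P) \<le> ennreal (d powr q * indicator {..h} d) * G"
      using r True by (simp add: ennreal_mult[symmetric] ennreal_leI)
     then show ?thesis using Geq by (simp add: x_def y_def d_def)
    next
     case False
     then consider "d = 0" | "h < d" | "0 < d" "d \<le> h" "G = \<infinity>" by (force simp: d_def)
     then show ?thesis
     proof cases
      case 1
      then have "Fn z = 0" by (auto simp: Fn_def d_def x_def y_def)
      then show ?thesis by simp
     next
      case 2
      then have "Fn z = 0" by (auto simp: Fn_def d_def x_def y_def)
      then show ?thesis by simp
     next
      case 3
      then show ?thesis using Geq by (simp add: x_def y_def d_def ennreal_mult_top)
     qed
    qed
   qed
   then have "(\<integral>\<^sup>+z. ennreal (\<bar>Fn z\<bar> powr P) \<partial>(?M \<Otimes>\<^sub>M ?M))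
     \<le> (\<integral>\<^sup>+z. \<integral>\<^sup>+t. ennreal (\<bar>fst z - snd z\<bar> powr q * indicator {..h} \<bar>fst z - snd z\<bar> * I (fst z) (snd z) t * \<bar>f' t\<bar> powr P) \<partial>?M \<partial>(?M \<Otimes>\<^sub>M ?M))"
    by (rule nn_integral_mono_AE)
   also have "... \<le> (\<integral>\<^sup>+z. \<integral>\<^sup>+t. ennreal (h powr (q - q0) * \<bar>f' t\<bar> powr P) * (ennreal (w (fst z) t) * ennreal (w (snd z) t)) \<partial>?M \<partial>(?M \<Otimes>\<^sub>M ?M))"
   proof (intro nn_integral_mono)
    fix z t
    have "\<bar>fst z - snd z\<bar> powr q * indicator {..h} \<bar>fst z - snd z\<bar> * I (fst z) (snd z) t * \<bar>f' t\<bar> powr P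
      \<le> h powr (q - q0) * (w (fst z) t * w (snd z) t) * \<bar>f' t\<bar> powr P" by (intro mult_right_mono pw) auto
    then show "ennreal (\<bar>fst z - snd z\<bar> powr q * indicator {..h} \<bar>fst z - snd z\<bar> * I (fst z) (snd z) t * \<bar>f' t\<bar> powr P)
     \<le> ennreal (h powr (q - q0) * \<bar>f' t\<bar> powr P) * (ennreal (w (fst z) t) * ennreal (w (snd z) t))"
     using w0 by (simp add: ennreal_mult[symmetric] ennreal_leI mult_ac)
   qed
   also have "... = (\<integral>\<^sup>+x. \<integral>\<^sup>+y. \<integral>\<^sup>+t. ennreal (h powr (q - q0) * \<bar>f' t\<bar> powr P) * (ennreal (w x t) * ennreal (w y t)) \<partial>?M \<partial>?M \<partial>?M)"
    unfolding w_def by (subst S.nn_integral_fst[symmetric]) simp_all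
   also have "... = (\<integral>\<^sup>+x. \<integral>\<^sup>+t. \<integral>\<^sup>+y. ennreal (h powr (q - q0) * \<bar>f' t\<bar> powr P) * (ennreal (w x t) * ennreal (w y t)) \<partial>?M \<partial>?M \<partial>?M)"
    unfolding w_def by (intro nn_integral_cong Fubini') measurable
   also have "... = (\<integral>\<^sup>+t. \<integral>\<^sup>+x. \<integral>\<^sup>+y. ennreal (h powr (q - q0) * \<bar>f' t\<bar> powr P) * (ennreal (w x t) * ennreal (w y t)) \<partial>?M \<partial>?M \<partial>?M)"
    unfolding w_def by (intro Fubini') measurable
   \<comment> \<open>With \<open>t\<close> outermost, the integrals over \<open>x\<close> and over
     \<open>y\<close> factorise.\<close>
   also have "... = (\<integral>\<^sup>+t. ennreal (h powr (q - q0) * \<bar>f' t\<bar> powr P) * ((\<integral>\<^sup>+x. ennreal (w x t) \<partial>?M) * (\<integral>\<^sup>+y. ennreal (w y t) \<partial>?M)) \<partial>?M)"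
    by (simp add: nn_integral_cmult nn_integral_multc w_def)
   also have "... \<le> (\<integral>\<^sup>+t. ennreal (h powr (q - q0) * \<bar>f' t\<bar> powr P) * (ennreal (2 * (h powr (q0 / 2 + 1) / (q0 / 2 + 1))) * ennreal (2 * (h powr (q0 / 2 + 1) / (q0 / 2 + 1)))) \<partial>?M)"
    by (intro nn_integral_mono mult_left_mono mult_mono wI) auto
   also have "... = (\<integral>\<^sup>+t. ennreal (\<bar>f' t\<bar> powr P) * ennreal ((\<kappa> * h powr (1 - s)) powr P) \<partial>?M)"
   proof (intro nn_integral_cong)
    fix t
    have "h powr (q - q0) * ((2 * (h powr (q0 / 2 + 1) / (q0 / 2 + 1))) * (2 * (h powr (q0 / 2 + 1) / (q0 / 2 + 1))))
      = 4 / (q0 / 2 + 1)\<^sup>2 * (h powr (q - q0) * h powr (q0 / 2 + 1) * h powr (q0 / 2 + 1))" by (simp add: power2_eq_square)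
    also have "h powr (q - q0) * h powr (q0 / 2 + 1) * h powr (q0 / 2 + 1) = h powr (P * (1 - s))" by (simp add: powr_add[symmetric] q_def)
    also have "4 / (q0 / 2 + 1)\<^sup>2 * h powr (P * (1 - s)) = (\<kappa> * h powr (1 - s)) powr P"
     using fin P by (simp add: \<kappa>_def powr_mult powr_powr mult.commute)
    finally have *: "h powr (q - q0) * ((2 * (h powr (q0 / 2 + 1) / (q0 / 2 + 1))) * (2 * (h powr (q0 / 2 + 1) / (q0 / 2 + 1)))) = (\<kappa> * h powr (1 - s)) powr P" .
    have nn: "0 \<le> 2 * (h powr (q0 / 2 + 1) / (q0 / 2 + 1))" using Pq(2) fin by simp
    show "ennreal (h powr (q - q0) * \<bar>f' t\<bar> powr P) * (ennreal (2 * (h powr (q0 / 2 + 1) / (q0 / 2 + 1))) * ennreal (2 * (h powr (q0 / 2 + 1) / (q0 / 2 + 1))))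
     = ennreal (\<bar>f' t\<bar> powr P) * ennreal ((\<kappa> * h powr (1 - s)) powr P)"
     unfolding *[symmetric] using nn by (simp only: ennreal_mult[symmetric] powr_ge_zero mult_nonneg_nonneg) (simp add: mult_ac)
   qed
   also have "... = (\<integral>\<^sup>+t. ennreal (\<bar>f' t\<bar> powr P) \<partial>?M) * ennreal ((\<kappa> * h powr (1 - s)) powr P)"
    by (rule nn_integral_multc) simp
   also have "... \<le> ennreal (b powr P) * ennreal ((\<kappa> * h powr (1 - s)) powr P)"
    using fb fin P Lp_norm_le_iff_fin[OF P(2) f' b] by (intro mult_right_mono) auto
   also have "... = ennreal ((\<kappa> * h powr (1 - s) * b) powr P)" using b \<kappa> by (simp add: powr_mult ennreal_mult mult.commute)
   finally show ?thesis using Lp_norm_le_iff_fin[OF P(2) Fm, of "\<kappa> * h powr (1 - s) * b"] fin P \<kappa> b by simp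
  qed
  then show ?case by (simp add: slobodeckij_near_def Fn_def[abs_def] case_prod_unfold)
 qed (use \<kappa> in auto)
qed

lemma slobodeckij_near_triangle:
 assumes p: "1 \<le> p" and [measurable]: "f \<in> borel_measurable (lebesgue_on S)" "g \<in> borel_measurable (lebesgue_on S)"
 shows "slobodeckij_near S t p h (\<lambda>x. f x + g x) \<le> slobodeckij_near S t p h f + slobodeckij_near S t p h g"
proof -
 let ?M = "lebesgue_on S \<Otimes>\<^sub>M lebesgue_on S"
 define G where "G u = (\<lambda>z. indicator {..h} \<bar>fst z - snd z\<bar> * (\<bar>u (fst z) - u (snd z)\<bar> / \<bar>fst z - snd z\<bar> powr (t + enn2real (1 / p))))"
  for u :: "real => real"
 have m: "G u \<in> borel_measurable ?M" if [measurable]: "u \<in> borel_measurable (lebesgue_on S)" for u unfolding G_def by measurable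
 have "Lp_norm p ?M (G (\<lambda>x. f x + g x)) \<le> Lp_norm p ?M (\<lambda>z. G f z + G g z)"
 proof (rule Lp_norm_mono_AE[OF p m], measurable, rule AE_I2)
  fix z :: "real \<times> real"
  have "G (\<lambda>x. f x + g x) z \<le> G f z + G g z" unfolding G_def distrib_left[symmetric] add_divide_distrib[symmetric]
   by (intro mult_left_mono divide_right_mono) auto
  moreover have "0 \<le> G u z" for u by (simp add: G_def)
  ultimately show "\<bar>G (\<lambda>x. f x + g x) z\<bar> \<le> \<bar>G f z + G g z\<bar>" by (simp add: abs_of_nonneg)
 qed
 also have "... \<le> Lp_norm p ?M (G f) + Lp_norm p ?M (G g)" by (intro Lp_norm_triangle[OF p] m) measurable
 finally show ?thesis by (simp add: slobodeckij_near_def G_def case_prod_unfold)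
qed

text \<open>Lowering the smoothness index leaves a positive power of the distance, which is at most
  \<open>h\<close> in the near part.\<close>

lemma slobodeckij_near_le:
 assumes p: "1 \<le> p" and m[measurable]: "f \<in> borel_measurable (lebesgue_on S)"
  and t: "t \<le> t'" and h: "0 < h"
 shows "slobodeckij_near S t p h f \<le> ennreal (h powr (t' - t)) * slobodeckij_seminorm S t' p f"
proof -
 let ?M = "lebesgue_on S \<Otimes>\<^sub>M lebesgue_on S"
 define G where "G t = (\<lambda>z. \<bar>f (fst z) - f (snd z)\<bar> / \<bar>fst z - snd z\<bar> powr (t + enn2real (1 / p)))" for t
 have gm[measurable]: "G t \<in> borel_measurable ?M" for t unfolding G_def by measurable
 have "slobodeckij_near S t p h f = Lp_norm p ?M (\<lambda>z. indicator {..h} \<bar>fst z - snd z\<bar> * G t z)"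
  by (simp add: slobodeckij_near_def G_def case_prod_unfold)
 also have "... \<le> Lp_norm p ?M (\<lambda>z. h powr (t' - t) * G t' z)"
 proof (rule Lp_norm_mono_AE[OF p], measurable, rule AE_I2)
  fix z :: "real \<times> real"
  define d where "d = \<bar>fst z - snd z\<bar>"
  have nn: "0 \<le> G t z" for t by (simp add: G_def)
  have "indicator {..h} d * G t z \<le> h powr (t' - t) * G t' z"
  proof (cases "0 < d \<and> d \<le> h")
   case True
   have "1 / d powr (t + enn2real (1 / p)) = d powr (t' - t) / d powr (t' + enn2real (1 / p))"
    using True by (simp add: powr_diff powr_add divide_simps)
   also have "... \<le> h powr (t' - t) / d powr (t' + enn2real (1 / p))" using True t by (intro divide_right_mono powr_mono2) auto
   finally have "\<bar>f (fst z) - f (snd z)\<bar> * (1 / d powr (t + enn2real (1 / p)))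
     \<le> \<bar>f (fst z) - f (snd z)\<bar> * (h powr (t' - t) / d powr (t' + enn2real (1 / p)))" by (intro mult_left_mono) auto
   then show ?thesis using True by (simp add: G_def d_def[symmetric] mult_ac)
  next
   case False
   then have "indicator {..h} d * G t z = 0" by (auto simp: G_def d_def)
   then show ?thesis using nn[of t'] by (metis mult_nonneg_nonneg powr_ge_zero)
  qed
  then show "\<bar>indicator {..h} \<bar>fst z - snd z\<bar> * G t z\<bar> \<le> \<bar>h powr (t' - t) * G t' z\<bar>"
   using nn by (simp add: d_def abs_mult)
 qed
 also have "... \<le> ennreal \<bar>h powr (t' - t)\<bar> * Lp_norm p ?M (G t')" by (rule Lp_norm_cmult_le[OF p gm])
 finally show ?thesis by (simp add: slobodeckij_seminorm_def G_def case_prod_unfold)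
qed

lemma slobodeckij_seminorm_le_near:
 fixes p :: ennreal and t :: real
 assumes p: "1 \<le> p" and t: "0 < t"
 obtains K where "0 < K"
  "\<And>(S :: real set) f b h. S \<in> lmeasurable ==> f \<in> borel_measurable (lebesgue_on S) ==> 0 \<le> b ==> 0 < h ==>
   Lp_norm p (lebesgue_on S) f \<le> ennreal b ==>
   slobodeckij_seminorm S t p f \<le> slobodeckij_near S t p h f + ennreal (K * h powr (- t) * b)"
proof (rule slobodeckij_far[OF p t], goal_cases)
 case K: (1 K)
 show ?case
 proof (rule that[OF K(2)], goal_cases)
  case a: (1 S f b h)
  note a(2)[measurable]
  let ?M = "lebesgue_on S \<Otimes>\<^sub>M lebesgue_on S"
  define G where "G = (\<lambda>z. \<bar>f (fst z) - f (snd z)\<bar> / \<bar>fst z - snd z\<bar> powr (t + enn2real (1 / p)))"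
  have gm[measurable]: "G \<in> borel_measurable ?M" unfolding G_def by measurable
  have "slobodeckij_seminorm S t p f = Lp_norm p ?M G" by (simp add: slobodeckij_seminorm_def G_def case_prod_unfold)
  also have "G = (\<lambda>z. indicator {..h} \<bar>fst z - snd z\<bar> * G z + indicator {h<..} \<bar>fst z - snd z\<bar> * G z)"
   by (auto simp: fun_eq_iff indicator_def)
  also have "Lp_norm p ?M ... \<le> Lp_norm p ?M (\<lambda>z. indicator {..h} \<bar>fst z - snd z\<bar> * G z) + Lp_norm p ?M (\<lambda>z. indicator {h<..} \<bar>fst z - snd z\<bar> * G z)"
   by (rule Lp_norm_triangle[OF p]) measurable
  also have "... \<le> slobodeckij_near S t p h f + ennreal (K * h powr (- t) * b)"
   using K(3)[OF a] by (intro add_mono) (auto simp: slobodeckij_near_def G_def case_prod_unfold)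
  finally show ?case .
 qed
qed

lemma slobodeckij_seminorm_triangle:
 assumes p: "1 \<le> p" and [measurable]: "f \<in> borel_measurable (lebesgue_on S)" "g \<in> borel_measurable (lebesgue_on S)"
 shows "slobodeckij_seminorm S t p (\<lambda>x. f x + g x) \<le> slobodeckij_seminorm S t p f + slobodeckij_seminorm S t p g"
proof -
 let ?M = "lebesgue_on S \<Otimes>\<^sub>M lebesgue_on S"
 define G where "G u = (\<lambda>z. \<bar>u (fst z) - u (snd z)\<bar> / \<bar>fst z - snd z\<bar> powr (t + enn2real (1 / p)))"
  for u :: "real => real"
 have m: "G u \<in> borel_measurable ?M" if [measurable]: "u \<in> borel_measurable (lebesgue_on S)" for u unfolding G_def by measurable
 have "Lp_norm p ?M (G (\<lambda>x. f x + g x)) \<le> Lp_norm p ?M (\<lambda>z. G f z + G g z)"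
 proof (rule Lp_norm_mono_AE[OF p m], measurable, rule AE_I2)
  fix z :: "real \<times> real"
  have "G (\<lambda>x. f x + g x) z \<le> G f z + G g z" unfolding G_def add_divide_distrib[symmetric] by (intro divide_right_mono) auto
  moreover have "0 \<le> G u z" for u by (simp add: G_def)
  ultimately show "\<bar>G (\<lambda>x. f x + g x) z\<bar> \<le> \<bar>G f z + G g z\<bar>" by (simp add: abs_of_nonneg)
 qed
 also have "... \<le> Lp_norm p ?M (G f) + Lp_norm p ?M (G g)" by (intro Lp_norm_triangle[OF p] m) measurable
 finally show ?thesis by (simp add: slobodeckij_seminorm_def G_def case_prod_unfold)
qed

lemma slobodeckij_seminorm_cong_AE:
 assumes S: "S \<in> lmeasurable" and p: "1 \<le> p" and [measurable]: "f \<in> borel_measurable (lebesgue_on S)" "g \<in> borel_measurable (lebesgue_on S)"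
  and fg: "AE x in lebesgue_on S. f x = g x"
 shows "slobodeckij_seminorm S t p f = slobodeckij_seminorm S t p g"
proof -
 interpret S: sigma_finite_measure "lebesgue_on S" by (rule sigma_finite_lebesgue_on[OF S])
 interpret pair_sigma_finite "lebesgue_on S" "lebesgue_on S" by unfold_locales
 have "AE x in lebesgue_on S. AE y in lebesgue_on S. f (fst (x, y)) = g (fst (x, y)) \<and> f (snd (x, y)) = g (snd (x, y))" using fg
 proof eventually_elim
  case (elim x)
  show ?case using fg by eventually_elim (simp add: elim)
 qed
 then have "AE z in lebesgue_on S \<Otimes>\<^sub>M lebesgue_on S. f (fst z) = g (fst z) \<and> f (snd z) = g (snd z)" by (intro AE_pair_measure) auto
 then have "AE z in lebesgue_on S \<Otimes>\<^sub>M lebesgue_on S.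
   \<bar>\<bar>f (fst z) - f (snd z)\<bar> / \<bar>fst z - snd z\<bar> powr (t + enn2real (1 / p))\<bar>
   = \<bar>\<bar>g (fst z) - g (snd z)\<bar> / \<bar>fst z - snd z\<bar> powr (t + enn2real (1 / p))\<bar>" by eventually_elim simp
 then show ?thesis unfolding slobodeckij_seminorm_def case_prod_unfold by (rule Lp_norm_cong_AE[OF p, rotated 2]) measurable
qed

section \<open>Smooth functions\<close>

text \<open>The derivative is quantified existentially instead of being written as
  \<open>deriv\<close>: closure under sums, products and affine substitutions is then an induction
  with the explicit derivative as witness. \<open>smooth_iff\<close> returns to iterated
  \<open>deriv\<close>, the form used by \<open>test_function\<close>.\<close>

primrec kdiff :: "nat => (real => real) => bool" where
 "kdiff 0 f = True"
| "kdiff (Suc n) f = (\<exists>f'. (\<forall>x. (f has_real_derivative f' x) (at x)) \<and> kdiff n f')"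

definition smooth :: "(real => real) => bool" where
 "smooth f \<longleftrightarrow> (\<forall>n. kdiff n f)"

lemma kdiff_Suc_deriv:
 "kdiff (Suc n) f \<longleftrightarrow> (\<forall>x. (f has_real_derivative deriv f x) (at x)) \<and> kdiff n (deriv f)"
proof
 assume "kdiff (Suc n) f"
 then obtain f' where f': "\<And>x. (f has_real_derivative f' x) (at x)" "kdiff n f'" by auto
 then have "deriv f = f'" by (auto intro!: ext DERIV_imp_deriv)
 then show "(\<forall>x. (f has_real_derivative deriv f x) (at x)) \<and> kdiff n (deriv f)" using f' by auto
qed auto

lemma kdiff_SucD: "kdiff (Suc n) f ==> kdiff n f" by (induction n arbitrary: f) auto

lemma smooth_deriv: "smooth f ==> smooth (deriv f)" unfolding smooth_def using kdiff_Suc_deriv by blast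

lemma smooth_DERIV: "smooth f ==> (f has_real_derivative deriv f x) (at x)" unfolding smooth_def using kdiff_Suc_deriv by blast

lemma smooth_higher_deriv: "smooth f ==> smooth ((deriv ^^ n) f)" by (induction n) (auto intro: smooth_deriv)

lemma smooth_higher_DERIV: "smooth f ==> ((deriv ^^ n) f has_real_derivative (deriv ^^ Suc n) f x) (at x)"
 using smooth_DERIV[OF smooth_higher_deriv] by simp

lemma smooth_iff: "smooth f \<longleftrightarrow> (\<forall>n x. (deriv ^^ n) f differentiable (at x))"
proof
 assume "smooth f"
 then show "\<forall>n x. (deriv ^^ n) f differentiable (at x)" using smooth_higher_DERIV real_differentiable_def by blast
next
 have "kdiff n f" if "\<forall>n x. (deriv ^^ n) f differentiable (at x)" for n f using that
 proof (induction n arbitrary: f)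
  case (Suc n)
  have "f differentiable (at x)" for x using Suc.prems[rule_format, of 0] by simp
  then have "(f has_real_derivative deriv f x) (at x)" for x by (simp add: DERIV_deriv_iff_real_differentiable)
  moreover have "kdiff n (deriv f)"
  proof (rule Suc.IH, intro allI)
   fix m x
   show "(deriv ^^ m) (deriv f) differentiable (at x)" using Suc.prems[rule_format, of "Suc m" x] by (simp only: funpow_Suc_right o_apply)
  qed
  ultimately show ?case by auto
 qed simp
 then show "\<forall>n x. (deriv ^^ n) f differentiable (at x) ==> smooth f" by (simp add: smooth_def)
qed

lemma smooth_continuous_on: "smooth f ==> continuous_on S f"
 by (rule DERIV_continuous_on[of _ _ "deriv f"]) (rule has_field_derivative_at_within[OF smooth_DERIV])

lemma smooth_measurable: "smooth f ==> f \<in> borel_measurable borel" by (rule borel_measurable_continuous_onI) (rule smooth_continuous_on)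

lemma kdiff_const: "kdiff n (\<lambda>x. c)" by (induction n arbitrary: c) (auto intro!: exI[of _ "\<lambda>x. 0"])

lemma kdiff_add: "kdiff n f ==> kdiff n g ==> kdiff n (\<lambda>x. f x + g x)"
proof (induction n arbitrary: f g)
 case (Suc n)
 then obtain f' g' where d: "\<And>x. (f has_real_derivative f' x) (at x)" "\<And>x. (g has_real_derivative g' x) (at x)"
  and k: "kdiff n f'" "kdiff n g'" by auto
 have "((\<lambda>x. f x + g x) has_real_derivative f' x + g' x) (at x)" for x by (intro DERIV_add d)
 then show ?case using Suc.IH[OF k] by (auto intro!: exI[of _ "\<lambda>x. f' x + g' x"])
qed simp

lemma kdiff_mult: "kdiff n f ==> kdiff n g ==> kdiff n (\<lambda>x. f x * g x)"
proof (induction n arbitrary: f g)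
 case (Suc n)
 then obtain f' g' where d: "\<And>x. (f has_real_derivative f' x) (at x)" "\<And>x. (g has_real_derivative g' x) (at x)"
  and k: "kdiff n f'" "kdiff n g'" by auto
 have fg: "kdiff n f" "kdiff n g" using Suc.prems kdiff_SucD by auto
 have "((\<lambda>x. f x * g x) has_real_derivative f' x * g x + g' x * f x) (at x)" for x by (intro DERIV_mult d)
 moreover have "kdiff n (\<lambda>x. f' x * g x + g' x * f x)" by (intro kdiff_add Suc.IH k fg)
 ultimately show ?case unfolding kdiff.simps by (intro exI[of _ "\<lambda>x. f' x * g x + g' x * f x"]) simp
qed simp

lemma kdiff_affine: "kdiff n f ==> kdiff n (\<lambda>x. f (c * x + d))"
proof (induction n arbitrary: f)
 case (Suc n)
 then obtain f' where d: "\<And>x. (f has_real_derivative f' x) (at x)" and k: "kdiff n f'" by auto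
 have "((\<lambda>x. f (c * x + d)) has_real_derivative f' (c * x + d) * c) (at x)" for x
  by (rule DERIV_chain2[OF d]) (auto intro!: derivative_eq_intros)
 moreover have "kdiff n (\<lambda>x. f' (c * x + d) * c)" by (rule kdiff_mult[OF Suc.IH[OF k] kdiff_const])
 ultimately show ?case by (auto intro!: exI[of _ "\<lambda>x. f' (c * x + d) * c"])
qed simp

lemma smooth_const [simp]: "smooth (\<lambda>x. c)" by (simp add: smooth_def kdiff_const)
lemma smooth_add: "smooth f ==> smooth g ==> smooth (\<lambda>x. f x + g x)" by (simp add: smooth_def kdiff_add)
lemma smooth_mult: "smooth f ==> smooth g ==> smooth (\<lambda>x. f x * g x)" by (simp add: smooth_def kdiff_mult)
lemma smooth_affine: "smooth f ==> smooth (\<lambda>x. f (c * x + d))" by (simp add: smooth_def kdiff_affine)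

lemma smooth_cmult: "smooth f ==> smooth (\<lambda>x. c * f x)" by (rule smooth_mult) auto

lemma smooth_diff: "smooth f ==> smooth g ==> smooth (\<lambda>x. f x - g x)"
 using smooth_add[of f "\<lambda>x. (- 1) * g x"] smooth_cmult[of g "-1"] by simp

lemma smooth_sum: "(\<And>i. i \<in> I ==> smooth (f i)) ==> smooth (\<lambda>x. \<Sum>i\<in>I. f i x)"
proof (induction I rule: infinite_finite_induct)
 case (insert i I)
 then have "smooth (\<lambda>x. f i x + (\<Sum>i\<in>I. f i x))" by (intro smooth_add) auto
 then show ?case using insert by simp
qed auto

text \<open>Higher derivatives of concrete functions are found by naming the whole sequence in
  advance; a single differentiation step then remains to be checked.\<close>

lemma smooth_of_derivative_sequence:
 assumes "\<And>n x. (D n has_real_derivative D (Suc n) x) (at x)"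
 shows "smooth (D 0)" "(deriv ^^ n) (D 0) = D n"
proof -
 have "kdiff m (D n)" for m n
 proof (induction m arbitrary: n)
  case (Suc m)
  then show ?case using assms by auto
 qed simp
 then show "smooth (D 0)" by (simp add: smooth_def)
 show "(deriv ^^ n) (D 0) = D n"
 proof (induction n)
  case (Suc n)
  then show ?case using assms by (auto intro!: ext DERIV_imp_deriv)
 qed simp
qed

lemma smooth_higher_deriv_unique:
 assumes "\<And>n x. (D n has_real_derivative D (Suc n) x) (at x)" "D 0 = f"
 shows "smooth f" "(deriv ^^ n) f = D n"
 using smooth_of_derivative_sequence[of D, OF assms(1)] assms(2) by auto

section \<open>Bump functions from the flat exponential\<close>

definition flat_exp :: "real => real" where
 "flat_exp t = (if t > 0 then exp (- 1 / t) else 0)"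

lemma poly_exp_decay: "((\<lambda>x. poly q x * exp (- x)) \<longlongrightarrow> (0::real)) at_top"
proof (induction q)
 case (pCons a q)
 have "((\<lambda>x. a * exp (- x) + (poly q x * x) * exp (- x)) \<longlongrightarrow> a * 0 + 0) at_top" if
  "((\<lambda>x. (poly q x * x) * exp (- x)) \<longlongrightarrow> 0) at_top" using that by (intro tendsto_intros) real_asymp+
 moreover have "((\<lambda>x. (poly q x * x) * exp (- x)) \<longlongrightarrow> (0::real)) at_top"
 proof -
  have "((\<lambda>x::real. x ^ n * exp (- x)) \<longlongrightarrow> 0) at_top" for n by real_asymp
  then have "((\<lambda>x. \<Sum>i\<le>degree q. coeff q i * (x ^ Suc i * exp (- x))) \<longlongrightarrow> (\<Sum>i\<le>degree q. coeff q i * 0)) at_top"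
   by (intro tendsto_intros)
  moreover have "(\<lambda>x. \<Sum>i\<le>degree q. coeff q i * (x ^ Suc i * exp (- x))) = (\<lambda>x. (poly q x * x) * exp (- x))"
   by (simp add: fun_eq_iff poly_altdef sum_distrib_right sum_distrib_left mult_ac)
  ultimately show ?thesis by simp
 qed
 ultimately show ?case by (simp add: algebra_simps)
qed simp

text \<open>Polynomials in \<open>1 / t\<close> times the flat exponential form a class closed under
  differentiation: \<open>q\<close> turns into \<open>X^2 * (q - pderiv q)\<close>. At 0 the
  exponential beats every power, so the difference quotient tends to 0 from the right as
  well.\<close>

lemma kdiff_flat_exp_poly:
 "kdiff n (\<lambda>t. if t > 0 then poly q (1 / t) * exp (- 1 / t) else 0)"
proof (induction n arbitrary: q)
 case (Suc n)
 define g where "g q t = (if t > 0 then poly q (1 / t) * exp (- 1 / t) else 0)" for q and t :: real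
 define q' where "q' = [:0, 0, 1:] * (q - pderiv q)"
 have pos: "(g q has_real_derivative g q' t) (at t)" if "t > 0" for t
 proof -
  have "((\<lambda>t. poly q (1 / t) * exp (- 1 / t)) has_real_derivative poly q' (1 / t) * exp (- 1 / t)) (at t)"
   using that unfolding q'_def by (auto intro!: derivative_eq_intros DERIV_chain2[OF poly_DERIV] simp: field_simps power2_eq_square)
  moreover have "eventually (\<lambda>s. g q s = poly q (1 / s) * exp (- 1 / s)) (nhds t)"
   using that eventually_nhds_in_open[of "{0<..}" t] by (auto simp: g_def elim!: eventually_mono)
  ultimately show ?thesis using that by (subst DERIV_cong_ev[OF refl _ refl]) (auto simp: g_def)
 qed
 have neg: "(g q has_real_derivative g q' t) (at t)" if "t < 0" for t
 proof -
  have "eventually (\<lambda>s. g q s = 0) (nhds t)" using that eventually_nhds_in_open[of "{..<0}" t] by (auto simp: g_def elim!: eventually_mono)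
  moreover have "((\<lambda>s. 0) has_real_derivative g q' t) (at t)" using that by (simp add: g_def)
  ultimately show ?thesis by (subst DERIV_cong_ev[OF refl _ refl])
 qed
 have zero: "(g q has_real_derivative g q' 0) (at 0)"
 proof -
  have r: "((\<lambda>t. g q t / t) \<longlongrightarrow> 0) (at_right 0)"
  proof -
   \<comment> \<open>The extra factor \<open>x\<close> contributed by \<open>pCons 0\<close> is the
     division by \<open>t\<close> in the difference quotient.\<close>
   have "((\<lambda>x. poly (pCons 0 q) x * exp (- x)) \<longlongrightarrow> 0) at_top" by (rule poly_exp_decay)
   then have "((\<lambda>x. poly (pCons 0 q) (inverse x) * exp (- inverse x)) \<longlongrightarrow> (0::real)) (at_right 0)"
    by (rule filterlim_compose) (rule filterlim_inverse_at_top_right)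
   moreover have "eventually (\<lambda>t. poly (pCons 0 q) (inverse t) * exp (- inverse t) = g q t / t) (at_right 0)"
    using eventually_at_right_less[of 0] by eventually_elim (auto simp: g_def divide_inverse)
   ultimately show ?thesis by (rule Lim_transform_eventually)
  qed
  have l: "((\<lambda>t. g q t / t) \<longlongrightarrow> 0) (at_left 0)"
  proof (rule tendsto_eventually)
   have "eventually (\<lambda>t::real. t < 0) (at_left 0)" by (simp add: eventually_at_filter)
   then show "eventually (\<lambda>t. g q t / t = 0) (at_left 0)" by eventually_elim (simp add: g_def)
  qed
  have "((\<lambda>t. g q t / t) \<longlongrightarrow> 0) (at 0)" using l r by (rule filterlim_split_at)
  then show ?thesis by (simp add: has_field_derivative_iff g_def)
 qed
 have "(g q has_real_derivative g q' t) (at t)" for t using pos neg zero by (cases t "0::real" rule: linorder_cases) auto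
 then have "\<forall>t. (g q has_real_derivative g q' t) (at t)" by blast
 moreover have "kdiff n (g q')" using Suc.IH[of q'] by (simp add: g_def[abs_def])
 ultimately have "kdiff (Suc n) (g q)" unfolding kdiff.simps by (intro exI[of _ "g q'"]) simp
 then show ?case by (simp only: g_def[abs_def])
qed simp

lemma smooth_flat_exp: "smooth flat_exp"
proof -
 have "flat_exp = (\<lambda>t. if t > 0 then poly 1 (1 / t) * exp (- 1 / t) else 0)" by (auto simp: flat_exp_def)
 then show ?thesis unfolding smooth_def using kdiff_flat_exp_poly[of _ 1] by metis
qed

lemma flat_exp_bounds: "0 \<le> flat_exp t" "flat_exp t \<le> 1" by (auto simp: flat_exp_def)

section \<open>Test functions\<close>

lemma test_functionI: "smooth f ==> compact K ==> K \<subseteq> X ==> (\<And>x. x \<notin> K ==> f x = 0) ==> test_function X f"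
 unfolding test_function_def smooth_iff[symmetric] by blast

lemma test_functionD:
 "test_function X f ==> smooth f \<and> (\<exists>K. compact K \<and> K \<subseteq> X \<and> (\<forall>x. x \<notin> K --> f x = 0))"
 unfolding test_function_def smooth_iff[symmetric] by blast

lemma test_function_deriv:
 assumes "test_function X f"
 shows "test_function X (deriv f)"
proof -
 obtain K where K: "smooth f" "compact K" "K \<subseteq> X" "\<forall>x. x \<notin> K --> f x = 0" using test_functionD[OF assms] by blast
 show ?thesis
 proof (rule test_functionI[OF smooth_deriv[OF K(1)] K(2,3)])
  fix x assume x: "x \<notin> K"
  have "eventually (\<lambda>s. s \<in> - K) (nhds x)" using x K(2) by (intro eventually_nhds_in_open) (auto simp: compact_imp_closed)
  then have "eventually (\<lambda>s. f s = 0) (nhds x)" by eventually_elim (use K(4) in simp)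
  then have "(f has_real_derivative 0) (at x)" by (subst DERIV_cong_ev[OF refl _ refl]) auto
  then show "deriv f x = 0" by (rule DERIV_imp_deriv)
 qed
qed

lemma test_function_higher_deriv: "test_function X f ==> test_function X ((deriv ^^ n) f)" by (induction n) (auto intro: test_function_deriv)

lemma test_function_mult: "smooth g ==> test_function X f ==> test_function X (\<lambda>x. g x * f x)"
 using test_functionD[of X f] by (auto intro!: test_functionI[of "\<lambda>x. g x * f x"] smooth_mult)

lemma test_function_subset: "test_function X f ==> X \<subseteq> X' ==> test_function X' f" unfolding test_function_def by (metis subset_trans)

lemma test_function_smooth: "test_function X f ==> smooth f" using test_functionD by blast

lemma test_function_zero_outside: "test_function X f ==> x \<notin> X ==> f x = 0" using test_functionD[of X f] by blast

text \<open>The parameter \<open>n\<close> steepens the flanks and leaves the support alone. Letting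
  it grow approximates the indicator of the open interval, so bumps can test integrals over
  intervals.\<close>

definition bump :: "real => real => nat => real => real" where
 "bump a b n x = flat_exp (real n * (x - a)) * flat_exp (real n * (b - x))"

lemma bump_bounds: "0 \<le> bump a b n x" "bump a b n x \<le> 1" unfolding bump_def by (auto intro!: mult_nonneg_nonneg mult_le_one flat_exp_bounds)

lemma bump_outside: "x \<notin> {a<..<b} ==> bump a b n x = 0" by (auto simp: bump_def flat_exp_def zero_less_mult_iff not_less)

lemma smooth_bump: "smooth (bump a b n)"
proof -
 have "smooth (\<lambda>x. flat_exp (real n * x + - real n * a) * flat_exp (- real n * x + real n * b))"
  by (intro smooth_mult smooth_affine smooth_flat_exp)
 moreover have "(\<lambda>x. flat_exp (real n * x + - real n * a) * flat_exp (- real n * x + real n * b)) = bump a b n"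
  by (simp add: fun_eq_iff bump_def algebra_simps)
 ultimately show ?thesis by simp
qed

lemma test_function_bump: "{a..b} \<subseteq> X ==> test_function X (bump a b n)"
 by (rule test_functionI[OF smooth_bump, of "{a..b}"]) (auto intro!: bump_outside)

lemma bump_pos: "0 < n ==> a < x ==> x < b ==> 0 < bump a b n x" by (auto simp: bump_def flat_exp_def)

lemma bump_tendsto: "(\<lambda>n. bump a b n x) \<longlonglongrightarrow> indicator {a<..<b} x"
proof (cases "x \<in> {a<..<b}")
 case True
 then have x: "a < x" "x < b" by auto
 have *: "(\<lambda>n. flat_exp (real n * d)) \<longlonglongrightarrow> 1" if "0 < d" for d
 proof -
  have "(\<lambda>n. exp (- 1 / (real n * d))) \<longlonglongrightarrow> 1" using that by real_asymp
  moreover have "eventually (\<lambda>n. exp (- 1 / (real n * d)) = flat_exp (real n * d)) sequentially"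
   using eventually_gt_at_top[of 0] by eventually_elim (use that in \<open>auto simp: flat_exp_def\<close>)
  ultimately show ?thesis by (rule Lim_transform_eventually)
 qed
 have "(\<lambda>n. bump a b n x) \<longlonglongrightarrow> 1 * 1" unfolding bump_def using x by (intro tendsto_mult *) auto
 then show ?thesis using True by simp
next
 case False
 then show ?thesis using bump_outside[OF False] by simp
qed

section \<open>Weak derivatives on an interval\<close>

text \<open>The positive and the negative part of \<open>g\<close> are densities of two measures
  that agree on all half-lines. The measures are therefore equal, and densities are unique almost
  everywhere.\<close>

lemma AE_zero_of_integral_lborel:
 fixes g :: "real => real"
 assumes g: "integrable lborel g" and z: "\<And>x. (\<integral>t. g t * indicator {x<..} t \<partial>lborel) = 0"
 shows "AE t in lborel. g t = 0"
proof -
 have gm[measurable]: "g \<in> borel_measurable borel" using g by auto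
 let ?p = "\<lambda>t. ennreal (g t)" and ?n = "\<lambda>t. ennreal (- g t)"
 have int: "integrable lborel (\<lambda>t. g t * indicator {x<..} t)" for x
  by (rule Bochner_Integration.integrable_bound[OF g]) (auto simp: indicator_def)
 have fin: "(\<integral>\<^sup>+t. ?p t * indicator {x<..} t \<partial>lborel) < \<infinity>" "(\<integral>\<^sup>+t. ?n t * indicator {x<..} t \<partial>lborel) < \<infinity>" for x
 proof -
  have "(\<integral>\<^sup>+t. ennreal (norm (g t)) \<partial>lborel) < \<infinity>" using g by (simp add: integrable_iff_bounded)
  moreover have "(\<integral>\<^sup>+t. ?p t * indicator {x<..} t \<partial>lborel) \<le> (\<integral>\<^sup>+t. ennreal (norm (g t)) \<partial>lborel)"
   "(\<integral>\<^sup>+t. ?n t * indicator {x<..} t \<partial>lborel) \<le> (\<integral>\<^sup>+t. ennreal (norm (g t)) \<partial>lborel)"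
   by (intro nn_integral_mono; auto simp: indicator_def intro!: ennreal_leI)+
  ultimately show "(\<integral>\<^sup>+t. ?p t * indicator {x<..} t \<partial>lborel) < \<infinity>" "(\<integral>\<^sup>+t. ?n t * indicator {x<..} t \<partial>lborel) < \<infinity>"
   using order_le_less_trans by blast+
 qed
 have eq: "(\<integral>\<^sup>+t. ?p t * indicator {x<..} t \<partial>lborel) = (\<integral>\<^sup>+t. ?n t * indicator {x<..} t \<partial>lborel)" for x
 proof -
  have p': "(\<integral>\<^sup>+t. ?p t * indicator {x<..} t \<partial>lborel) = (\<integral>\<^sup>+t. ennreal (g t * indicator {x<..} t) \<partial>lborel)"
   by (intro nn_integral_cong) (auto simp: indicator_def)
  have n': "(\<integral>\<^sup>+t. ?n t * indicator {x<..} t \<partial>lborel) = (\<integral>\<^sup>+t. ennreal (- (g t * indicator {x<..} t)) \<partial>lborel)"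
   by (intro nn_integral_cong) (auto simp: indicator_def)
  have "0 = enn2real (\<integral>\<^sup>+t. ?p t * indicator {x<..} t \<partial>lborel) - enn2real (\<integral>\<^sup>+t. ?n t * indicator {x<..} t \<partial>lborel)"
   using real_lebesgue_integral_def[OF int[of x]] z[of x] unfolding p' n' by simp
  then show ?thesis using fin[of x] by (metis eq_iff_diff_eq_0 ennreal_enn2real infinity_ennreal_def)
 qed
 have "density lborel ?p = density lborel ?n" by (rule measure_eqI_lessThan) (use fin eq in \<open>auto simp: emeasure_density\<close>)
 then have "AE t in lborel. ?p t = ?n t" by (intro sigma_finite_measure.density_unique[OF sigma_finite_lborel]) auto
 then show ?thesis
 proof eventually_elim
  case (elim t)
  then show ?case by (cases "0 \<le> g t") (auto simp: ennreal_neg ennreal_eq_0_iff)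
 qed
qed

lemma AE_zero_of_integral_lebesgue:
 fixes g :: "real => real"
 assumes g: "integrable lebesgue g" and z: "\<And>x. (\<integral>t. g t * indicator {x<..} t \<partial>lebesgue) = 0"
 shows "AE t in lebesgue. g t = 0"
proof -
 have "g \<in> borel_measurable lebesgue" using g by auto
 \<comment> \<open>A Borel version of \<open>g\<close> carries the question over from the completed
   measure to \<open>lborel\<close>.\<close>
 from completion_ex_borel_measurable_real[OF this] obtain g' where
  g'm: "g' \<in> borel_measurable lborel" and AE: "AE t in lborel. g t = g' t" by blast
 have gl: "g' \<in> borel_measurable lebesgue" using g'm by (rule measurable_completion)
 have AE': "AE t in lebesgue. g t = g' t" using AE by (rule AE_completion)
 have "integrable lebesgue g'" using g gl AE' by (subst integrable_cong_AE[of g' lebesgue g]) auto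
 then have "integrable lborel g'" using integrable_completion[OF g'm] by simp
 moreover have "(\<integral>t. g' t * indicator {x<..} t \<partial>lborel) = 0" for x
 proof -
  have "(\<integral>t. g' t * indicator {x<..} t \<partial>lborel) = (\<integral>t. g' t * indicator {x<..} t \<partial>lebesgue)"
   using g'm by (intro integral_completion[symmetric] borel_measurable_times) auto
  also have "... = (\<integral>t. g t * indicator {x<..} t \<partial>lebesgue)"
  proof (rule integral_cong_AE)
   have "(indicator {x<..} :: real => real) \<in> borel_measurable lebesgue" by (intro borel_measurable_indicator) auto
   then show "(\<lambda>t. g' t * indicator {x<..} t) \<in> borel_measurable lebesgue" "(\<lambda>t. g t * indicator {x<..} t) \<in> borel_measurable lebesgue"
    using gl \<open>g \<in> borel_measurable lebesgue\<close> by (auto intro!: borel_measurable_times)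
   show "AE t in lebesgue. g' t * indicator {x<..} t = g t * indicator {x<..} t" using AE' by eventually_elim simp
  qed
  finally show ?thesis using z by simp
 qed
 ultimately have "AE t in lborel. g' t = 0" by (rule AE_zero_of_integral_lborel)
 then have "AE t in lebesgue. g' t = 0" by (rule AE_completion)
 with AE' show ?thesis by eventually_elim simp
qed

lemma integrable_lebesgue_on_iff:
 fixes f :: "real => real"
 assumes "S \<in> sets lebesgue"
 shows "integrable (lebesgue_on S) f \<longleftrightarrow> integrable lebesgue (\<lambda>x. indicator S x * f x)"
 using integrable_restrict_space[of S lebesgue f] assms by simp

lemma integral_lebesgue_on:
 fixes f :: "real => real"
 assumes "S \<in> sets lebesgue"
 shows "(\<integral>x. f x \<partial>lebesgue_on S) = (\<integral>x. indicator S x * f x \<partial>lebesgue)"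
 using integral_restrict_space[of S lebesgue f] assms by simp

lemma measurable_lebesgue_on_iff:
 fixes f :: "real => real"
 assumes "S \<in> sets lebesgue"
 shows "f \<in> borel_measurable (lebesgue_on S) \<longleftrightarrow> (\<lambda>x. indicator S x * f x) \<in> borel_measurable lebesgue"
 using borel_measurable_restrict_space_iff[of S lebesgue f] assms by simp

lemma AE_lebesgue_on_iff:
 assumes "S \<in> sets lebesgue"
 shows "(AE x in lebesgue_on S. P x) \<longleftrightarrow> (AE x in lebesgue. x \<in> S --> P x)"
 using assms by (subst AE_restrict_space_iff) auto

lemma borel_measurable_lebesgue_on:
 fixes f :: "real => real"
 shows "f \<in> borel_measurable borel ==> f \<in> borel_measurable (lebesgue_on S)"
 by (rule measurable_compose[OF measurable_ident_lebesgue_on])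

lemma smooth_measurable_lebesgue_on [simp]: "smooth f ==> f \<in> borel_measurable (lebesgue_on S)"
 by (rule borel_measurable_lebesgue_on[OF smooth_measurable])

lemma eventually_inverse_Suc_less: "0 < d ==> eventually (\<lambda>n. 1 / real (Suc n) < d) sequentially"
 by (rule order_tendstoD(2)[OF LIMSEQ_Suc[OF lim_1_over_n]])

text \<open>Local integrability speaks of compact subsets only. The intervals \<open>K n\<close>
  exhaust the open interval, and measurability passes to the pointwise limit.\<close>

lemma locally_integrable_measurable:
 assumes u: "locally_integrable {a<..<b} u"
 shows "u \<in> borel_measurable (lebesgue_on {a<..<b})"
proof -
 define K where "K n = {a + 1 / real (Suc n)..b - 1 / real (Suc n)}" for n
 have Ks: "compact (K n) \<and> K n \<subseteq> {a<..<b}" for n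
 proof -
  have "0 < 1 / real (Suc n)" by simp
  then show ?thesis unfolding K_def by (intro conjI subsetI) (simp, unfold atLeastAtMost_iff greaterThanLessThan_iff, linarith)
 qed
 have m: "(\<lambda>x. indicator (K n) x * u x) \<in> borel_measurable lebesgue" for n using u Ks[of n] unfolding locally_integrable_def
  by (subst measurable_lebesgue_on_iff[symmetric]) (auto simp: K_def)
 have "(\<lambda>n. indicator (K n) x * u x) \<longlonglongrightarrow> indicator {a<..<b} x * u x" for x
 proof (cases "x \<in> {a<..<b}")
  case True
  then have "eventually (\<lambda>n. 1 / real (Suc n) < x - a) sequentially" "eventually (\<lambda>n. 1 / real (Suc n) < b - x) sequentially"
   by (auto simp del: of_nat_Suc intro!: eventually_inverse_Suc_less)
  then have "eventually (\<lambda>n. indicator (K n) x * u x = u x) sequentially" by eventually_elim (auto simp: K_def indicator_def)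
  then show ?thesis using True by (auto intro: tendsto_eventually)
 next
  case False
  then have "x \<notin> K n" for n using Ks[of n] by auto
  then show ?thesis using False by simp
 qed
 then have "(\<lambda>x. indicator {a<..<b} x * u x) \<in> borel_measurable lebesgue" by (rule borel_measurable_LIMSEQ_real[OF _ m])
 then show ?thesis by (subst measurable_lebesgue_on_iff) auto
qed

lemma integrable_locally_integrable:
 assumes "integrable (lebesgue_on X) u" "X \<in> sets lebesgue"
 shows "locally_integrable X u"
 unfolding locally_integrable_def
proof (intro allI impI)
 fix K assume K: "compact K \<and> K \<subseteq> X"
 then have Km: "K \<in> sets lebesgue" by (simp add: compact_imp_closed borel_closed lmeasurable_compact fmeasurableD)
 have "integrable lebesgue (\<lambda>x. indicator X x * u x)" by (rule iffD1[OF integrable_lebesgue_on_iff[OF assms(2)] assms(1)])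
 then have "integrable lebesgue (\<lambda>x. indicator K x * (indicator X x * u x))"
  using integrable_mult_indicator[OF Km, of "\<lambda>x. indicator X x * u x"] by simp
 moreover have "(\<lambda>x. indicator K x * (indicator X x * u x)) = (\<lambda>x. indicator K x * u x)"
  using K by (auto simp: indicator_def fun_eq_iff)
 ultimately show "integrable (lebesgue_on K) u" using integrable_lebesgue_on_iff[OF Km] by simp
qed

lemma test_function_bounded:
 assumes "test_function X f"
 obtains B where "0 \<le> B" "\<And>x. \<bar>f x\<bar> \<le> B"
proof -
 from test_functionD[OF assms] obtain K where K: "smooth f" "compact K" "\<forall>x. x \<notin> K --> f x = 0" by blast
 have "compact (f ` K)" using K by (intro compact_continuous_image smooth_continuous_on) auto
 then have "bounded (f ` K)" by (rule compact_imp_bounded)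
 then obtain B where B: "\<And>x. x \<in> K ==> \<bar>f x\<bar> \<le> B" unfolding bounded_iff by auto
 show ?thesis by (rule that[of "max 0 B"]) (use B K in \<open>auto simp: le_max_iff_disj\<close>)
qed

lemma integrable_times_test_function:
 assumes u: "locally_integrable X u" and t: "test_function X f" and X: "X \<in> sets lebesgue"
 shows "integrable (lebesgue_on X) (\<lambda>x. u x * f x)"
proof -
 from test_functionD[OF t] obtain K where K: "smooth f" "compact K" "K \<subseteq> X" "\<forall>x. x \<notin> K --> f x = 0" by blast
 have Km: "K \<in> sets lebesgue" using K by (simp add: lmeasurable_compact fmeasurableD)
 obtain B where B: "0 \<le> B" "\<And>x. \<bar>f x\<bar> \<le> B" using test_function_bounded[OF t] by blast
 have uK: "integrable (lebesgue_on K) u" using u K unfolding locally_integrable_def by blast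
 have m: "u \<in> borel_measurable (lebesgue_on K)" "f \<in> borel_measurable (lebesgue_on K)" using uK K by auto
 have "integrable (lebesgue_on K) (\<lambda>x. B * u x)" using uK by simp
 then have "integrable (lebesgue_on K) (\<lambda>x. u x * f x)"
 proof (rule Bochner_Integration.integrable_bound)
  show "(\<lambda>x. u x * f x) \<in> borel_measurable (lebesgue_on K)" using m by measurable
  show "AE x in lebesgue_on K. norm (u x * f x) \<le> norm (B * u x)"
   using B by (intro AE_I2) (auto simp: abs_mult mult.commute intro!: mult_right_mono)
 qed
 then have "integrable lebesgue (\<lambda>x. indicator K x * (u x * f x))" by (rule iffD1[OF integrable_lebesgue_on_iff[OF Km]])
 moreover have "(\<lambda>x. indicator K x * (u x * f x)) = (\<lambda>x. indicator X x * (u x * f x))"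
  using K by (auto simp: indicator_def fun_eq_iff)
 ultimately show ?thesis using integrable_lebesgue_on_iff[OF X] by simp
qed

text \<open>Bumps that converge to an indicator show that \<open>g\<close> has integral 0 over every
  interval compactly contained in the domain. This forces \<open>g = 0\<close> almost everywhere on
  each of them, and countably many exhaust the domain.\<close>

lemma fundamental_lemma:
 assumes g: "locally_integrable {h<..<u} g"
  and z: "\<And>f. test_function {h<..<u} f ==> (\<integral>x. g x * f x \<partial>lebesgue_on {h<..<u}) = 0"
 shows "AE x in lebesgue_on {h<..<u}. g x = 0"
proof -
 have int0: "(\<integral>x. indicator {a<..<b} x * g x \<partial>lebesgue) = 0" if ab: "h < a" "b < u" for a b
 proof -
  have K: "compact {a..b}" "{a..b} \<subseteq> {h<..<u}" using ab by auto
  have gi: "integrable lebesgue (\<lambda>x. indicator {a..b} x * g x)"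
   using g K unfolding locally_integrable_def by (subst integrable_lebesgue_on_iff[symmetric]) auto
  have bm: "bump a b n \<in> borel_measurable lebesgue" for n
  proof -
   have "bump a b n \<in> borel_measurable lborel" using smooth_measurable[OF smooth_bump] by simp
   then show ?thesis by (rule measurable_completion)
  qed
  have eq: "indicator {a..b} x * g x * bump a b n x = indicator {h<..<u} x * (g x * bump a b n x)" for n x
   using ab bump_outside[of x a b n] by (cases "x \<in> {a<..<b}") (auto simp: indicator_def)
  have "(\<lambda>n. \<integral>x. indicator {a..b} x * g x * bump a b n x \<partial>lebesgue) \<longlonglongrightarrow> (\<integral>x. indicator {a..b} x * g x * indicator {a<..<b} x \<partial>lebesgue)"
  proof (rule integral_dominated_convergence)
   show "integrable lebesgue (\<lambda>x. norm (indicator {a..b} x * g x))" using gi by (rule integrable_norm)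
   show "AE x in lebesgue. (\<lambda>n. indicator {a..b} x * g x * bump a b n x) \<longlonglongrightarrow> indicator {a..b} x * g x * indicator {a<..<b} x"
    by (intro AE_I2 tendsto_mult tendsto_const bump_tendsto)
   show "AE x in lebesgue. norm (indicator {a..b} x * g x * bump a b n x) \<le> norm (indicator {a..b} x * g x)" for n
    using bump_bounds[of a b n] by (intro AE_I2) (auto simp: abs_mult mult_left_le)
   show "(\<lambda>x. indicator {a..b} x * g x * bump a b n x) \<in> borel_measurable lebesgue" for n
    by (rule borel_measurable_times[OF borel_measurable_integrable[OF gi] bm])
   have "(indicator {a<..<b} :: real => real) \<in> borel_measurable lebesgue" by (intro borel_measurable_indicator) auto
   then show "(\<lambda>x. indicator {a..b} x * g x * indicator {a<..<b} x) \<in> borel_measurable lebesgue"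
    by (rule borel_measurable_times[OF borel_measurable_integrable[OF gi]])
  qed
  moreover have "(\<integral>x. indicator {a..b} x * g x * bump a b n x \<partial>lebesgue) = 0" for n
   unfolding eq using z[OF test_function_bump[OF K(2), of n]] by (subst (asm) integral_lebesgue_on) auto
  ultimately have "(\<integral>x. indicator {a..b} x * g x * indicator {a<..<b} x \<partial>lebesgue) = 0" by (simp add: LIMSEQ_const_iff)
  moreover have "indicator {a..b} x * g x * indicator {a<..<b} x = indicator {a<..<b} x * g x" for x by (auto simp: indicator_def)
  ultimately show ?thesis by simp
 qed
 have z': "AE x in lebesgue. x \<in> {a<..<b} --> g x = 0" if ab: "h < a" "b < u" for a b
 proof -
  have "AE x in lebesgue. indicator {a<..<b} x * g x = 0"
  proof (rule AE_zero_of_integral_lebesgue)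
   have "compact {a..b}" "{a..b} \<subseteq> {h<..<u}" using ab by auto
   then have "integrable lebesgue (\<lambda>x. indicator {a..b} x * g x)"
    using g unfolding locally_integrable_def by (subst integrable_lebesgue_on_iff[symmetric]) auto
   then have "integrable lebesgue (\<lambda>x. indicator {a<..<b} x *\<^sub>R (indicator {a..b} x * g x))" by (intro integrable_mult_indicator) auto
   moreover have "(\<lambda>x. indicator {a<..<b} x *\<^sub>R (indicator {a..b} x * g x)) = (\<lambda>x. indicator {a<..<b} x * g x)"
    by (auto simp: indicator_def)
   ultimately show "integrable lebesgue (\<lambda>x. indicator {a<..<b} x * g x)" by (simp only:)
   fix y
   have e: "(\<lambda>x. indicator {a<..<b} x * g x * indicator {y<..} x) = (\<lambda>x. indicator {max a y<..<b} x * g x)"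
    by (auto simp: indicator_def)
   then show "(\<integral>x. indicator {a<..<b} x * g x * indicator {y<..} x \<partial>lebesgue) = 0" unfolding e using ab by (intro int0) auto
  qed
  then show ?thesis by eventually_elim auto
 qed
 have "AE x in lebesgue. \<forall>n. x \<in> {h + 1 / real (Suc n)<..<u - 1 / real (Suc n)} --> g x = 0"
  unfolding AE_all_countable by (intro allI z') auto
 then have "AE x in lebesgue. x \<in> {h<..<u} --> g x = 0"
 proof eventually_elim
  case (elim x)
  note zero = this
  show ?case
  proof
   assume x: "x \<in> {h<..<u}"
   then have "eventually (\<lambda>n. 1 / real (Suc n) < x - h) sequentially" "eventually (\<lambda>n. 1 / real (Suc n) < u - x) sequentially"
    by (auto simp del: of_nat_Suc intro!: eventually_inverse_Suc_less)
   then have "eventually (\<lambda>n. g x = 0) sequentially"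
   proof eventually_elim
    case (elim n)
    then have "x \<in> {h + 1 / real (Suc n)<..<u - 1 / real (Suc n)}" unfolding greaterThanLessThan_iff by linarith
    then show ?case using zero by blast
   qed
   then show "g x = 0" by simp
  qed
 qed
 then show ?thesis by (subst AE_lebesgue_on_iff) auto
qed

lemma interval_lebesgue_sets [simp]: "{a<..<b} \<in> sets lebesgue" for a b :: real by simp

lemma locally_integrable_diff:
 assumes "locally_integrable X f" "locally_integrable X g"
 shows "locally_integrable X (\<lambda>x. f x - g x)"
 using assms unfolding locally_integrable_def by auto

lemma locally_integrable_add:
 assumes "locally_integrable X f" "locally_integrable X g"
 shows "locally_integrable X (\<lambda>x. f x + g x)"
 using assms unfolding locally_integrable_def by auto

lemma locally_integrable_continuous_mult:
 assumes f: "locally_integrable X f" and g: "continuous_on UNIV g"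
 shows "locally_integrable X (\<lambda>x. f x * g x)"
 unfolding locally_integrable_def
proof (intro allI impI)
 fix K assume K: "compact K \<and> K \<subseteq> X"
 have fK: "integrable (lebesgue_on K) f" using f K unfolding locally_integrable_def by blast
 have "compact (g ` K)" using K g by (intro compact_continuous_image) (auto intro: continuous_on_subset)
 then have "bounded (g ` K)" by (rule compact_imp_bounded)
 then obtain B where B: "\<And>x. x \<in> K ==> \<bar>g x\<bar> \<le> B" unfolding bounded_iff by auto
 have gm: "g \<in> borel_measurable (lebesgue_on K)" using borel_measurable_lebesgue_on[OF borel_measurable_continuous_onI[OF g]] .
 have "integrable (lebesgue_on K) (\<lambda>x. B * f x)" using fK by simp
 then show "integrable (lebesgue_on K) (\<lambda>x. f x * g x)"
 proof (rule Bochner_Integration.integrable_bound)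
  show "(\<lambda>x. f x * g x) \<in> borel_measurable (lebesgue_on K)" by (rule borel_measurable_times[OF borel_measurable_integrable[OF fK] gm])
  have "norm (f x * g x) \<le> norm (B * f x)" if "x \<in> K" for x
  proof -
   have "\<bar>f x\<bar> * \<bar>g x\<bar> \<le> \<bar>f x\<bar> * \<bar>B\<bar>" using B[OF that] by (intro mult_left_mono) auto
   then show ?thesis by (simp add: abs_mult mult.commute)
  qed
  then show "AE x in lebesgue_on K. norm (f x * g x) \<le> norm (B * f x)" by (intro AE_I2) auto
 qed
qed

lemma locally_integrable_cmult:
 "locally_integrable X f ==> locally_integrable X (\<lambda>x. c * f x)" unfolding locally_integrable_def by auto

lemma locally_integrable_const: "locally_integrable X (\<lambda>x. c)" unfolding locally_integrable_def
proof (intro allI impI)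
 fix K :: "real set" assume "compact K \<and> K \<subseteq> X"
 then have "finite_measure (lebesgue_on K)" by (intro finite_measure_lebesgue_on lmeasurable_compact) auto
 then show "integrable (lebesgue_on K) (\<lambda>x. c)" by (rule finite_measure.integrable_const)
qed

lemma locally_integrable_continuous:
 assumes "continuous_on UNIV g" shows "locally_integrable X g"
 using locally_integrable_continuous_mult[OF locally_integrable_const[of X 1] assms] by simp

lemma locally_integrable_cong_AE:
 assumes f: "locally_integrable {a<..<b} f" and g: "g \<in> borel_measurable (lebesgue_on {a<..<b})"
  and fg: "AE x in lebesgue_on {a<..<b}. f x = g x"
 shows "locally_integrable {a<..<b} g"
 unfolding locally_integrable_def
proof (intro allI impI)
 fix K assume K: "compact K \<and> K \<subseteq> {a<..<b}"
 then have Km: "K \<in> sets lebesgue" by (simp add: lmeasurable_compact fmeasurableD)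
 have fK: "integrable lebesgue (\<lambda>x. indicator K x * f x)"
  using f K integrable_lebesgue_on_iff[OF Km, of f] unfolding locally_integrable_def by simp
 have "(\<lambda>x. indicator {a<..<b} x * g x) \<in> borel_measurable lebesgue" using g measurable_lebesgue_on_iff[of "{a<..<b}" g] by simp
 then have "(\<lambda>x. indicator K x * (indicator {a<..<b} x * g x)) \<in> borel_measurable lebesgue"
  by (rule borel_measurable_times[OF borel_measurable_indicator[OF Km]])
 moreover have "(\<lambda>x. indicator K x * (indicator {a<..<b} x * g x)) = (\<lambda>x. indicator K x * g x)"
  using K by (auto simp: indicator_def fun_eq_iff)
 ultimately have gK: "(\<lambda>x. indicator K x * g x) \<in> borel_measurable lebesgue" by simp
 have "AE x in lebesgue. x \<in> {a<..<b} --> f x = g x" using fg by (subst (asm) AE_lebesgue_on_iff) auto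
 then have "AE x in lebesgue. indicator K x * f x = indicator K x * g x" by eventually_elim (use K in \<open>auto simp: indicator_def\<close>)
 then have "integrable lebesgue (\<lambda>x. indicator K x * g x)" using fK gK integrable_cong_AE[OF borel_measurable_integrable[OF fK] gK] by simp
 then show "integrable (lebesgue_on K) g" using integrable_lebesgue_on_iff[OF Km, of g] by simp
qed

lemma has_weak_deriv_unique:
 assumes "has_weak_deriv {a<..<b} n u v" "has_weak_deriv {a<..<b} n u w"
 shows "AE x in lebesgue_on {a<..<b}. v x = w x"
proof -
 let ?X = "{a<..<b}"
 have l: "locally_integrable ?X v" "locally_integrable ?X w" using assms unfolding has_weak_deriv_def by auto
 have "AE x in lebesgue_on ?X. v x - w x = 0"
 proof (rule fundamental_lemma[OF locally_integrable_diff[OF l]])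
  fix f assume t: "test_function ?X f"
  have "(\<integral>x. v x * f x \<partial>lebesgue_on ?X) = (\<integral>x. w x * f x \<partial>lebesgue_on ?X)"
  proof -
   have "(-1) ^ n * (\<integral>x. v x * f x \<partial>lebesgue_on ?X) = (-1) ^ n * (\<integral>x. w x * f x \<partial>lebesgue_on ?X)"
   proof -
    have "(\<integral>x. u x * (deriv ^^ n) f x \<partial>lebesgue_on ?X) = (-1) ^ n * (\<integral>x. v x * f x \<partial>lebesgue_on ?X)"
     "(\<integral>x. u x * (deriv ^^ n) f x \<partial>lebesgue_on ?X) = (-1) ^ n * (\<integral>x. w x * f x \<partial>lebesgue_on ?X)"
     using assms t unfolding has_weak_deriv_def by blast+
    then show ?thesis by (rule trans[OF sym])
   qed
   then show ?thesis by simp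
  qed
  then show "(\<integral>x. (v x - w x) * f x \<partial>lebesgue_on ?X) = 0" unfolding left_diff_distrib
   by (subst Bochner_Integration.integral_diff) (auto intro!: integrable_times_test_function[OF _ t] l)
 qed
 then show ?thesis by eventually_elim simp
qed

lemma has_weak_deriv_cong_AE:
 assumes uw: "has_weak_deriv {a<..<b} n u w"
  and m: "u' \<in> borel_measurable (lebesgue_on {a<..<b})" "w' \<in> borel_measurable (lebesgue_on {a<..<b})"
  and ae: "AE x in lebesgue_on {a<..<b}. u x = u' x" "AE x in lebesgue_on {a<..<b}. w x = w' x"
 shows "has_weak_deriv {a<..<b} n u' w'"
 unfolding has_weak_deriv_def
proof (intro conjI allI impI)
 let ?X = "{a<..<b}"
 have l: "locally_integrable ?X u" "locally_integrable ?X w" using uw unfolding has_weak_deriv_def by auto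
 show "locally_integrable ?X u'" "locally_integrable ?X w'" by (rule locally_integrable_cong_AE; fact)+
 fix g assume t: "test_function ?X g"
 have eq: "(\<integral>x. f' x * \<phi> x \<partial>lebesgue_on ?X) = (\<integral>x. f x * \<phi> x \<partial>lebesgue_on ?X)"
  if "test_function ?X \<phi>" "AE x in lebesgue_on ?X. f x = f' x" "f \<in> borel_measurable (lebesgue_on ?X)" "f' \<in> borel_measurable (lebesgue_on ?X)"
  for f f' \<phi> :: "real => real"
 proof (rule integral_cong_AE)
  have "\<phi> \<in> borel_measurable (lebesgue_on ?X)" using test_function_smooth[OF that(1)] by simp
  then show "(\<lambda>x. f' x * \<phi> x) \<in> borel_measurable (lebesgue_on ?X)" "(\<lambda>x. f x * \<phi> x) \<in> borel_measurable (lebesgue_on ?X)"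
   using that by (auto intro!: borel_measurable_times)
  show "AE x in lebesgue_on ?X. f' x * \<phi> x = f x * \<phi> x" using that(2) by eventually_elim simp
 qed
 show "(\<integral>x. u' x * (deriv ^^ n) g x \<partial>lebesgue_on ?X) = (-1) ^ n * (\<integral>x. w' x * g x \<partial>lebesgue_on ?X)"
  using uw t eq[OF test_function_higher_deriv[OF t] ae(1) locally_integrable_measurable[OF l(1)] m(1)]
   eq[OF t ae(2) locally_integrable_measurable[OF l(2)] m(2)] unfolding has_weak_deriv_def by simp
qed

lemma has_weak_deriv_0: "locally_integrable X u ==> has_weak_deriv X 0 u u" unfolding has_weak_deriv_def by simp

lemma has_weak_deriv_compose:
 assumes "has_weak_deriv X n u w" "has_weak_deriv X 1 w z"
 shows "has_weak_deriv X (Suc n) u z"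
 unfolding has_weak_deriv_def
proof (intro conjI allI impI)
 show "locally_integrable X u" "locally_integrable X z" using assms unfolding has_weak_deriv_def by auto
 fix f assume t: "test_function X f"
 have "(\<integral>x. u x * (deriv ^^ n) (deriv f) x \<partial>lebesgue_on X) = (-1) ^ n * (\<integral>x. w x * deriv f x \<partial>lebesgue_on X)"
  using assms(1) test_function_deriv[OF t] unfolding has_weak_deriv_def by blast
 also have "(\<integral>x. w x * deriv f x \<partial>lebesgue_on X) = - (\<integral>x. z x * f x \<partial>lebesgue_on X)"
  using assms(2) t unfolding has_weak_deriv_def by auto
 finally show "(\<integral>x. u x * (deriv ^^ Suc n) f x \<partial>lebesgue_on X) = (-1) ^ Suc n * (\<integral>x. z x * f x \<partial>lebesgue_on X)"
  by (simp only: funpow_Suc_right o_apply) simp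
qed

text \<open>Every order of weak derivative is defined from \<open>u\<close> itself. Testing with
  \<open>deriv f\<close> converts two consecutive orders into a derivative of first order, the form
  in which the smoothing operators are differentiated later.\<close>

lemma has_weak_deriv_step:
 assumes "has_weak_deriv X n u w" "has_weak_deriv X (Suc n) u z"
 shows "has_weak_deriv X 1 w z"
 unfolding has_weak_deriv_def
proof (intro conjI allI impI)
 show "locally_integrable X w" "locally_integrable X z" using assms unfolding has_weak_deriv_def by auto
 fix f assume t: "test_function X f"
 have "(\<integral>x. u x * (deriv ^^ n) (deriv f) x \<partial>lebesgue_on X) = (-1) ^ n * (\<integral>x. w x * deriv f x \<partial>lebesgue_on X)"
  using assms(1) test_function_deriv[OF t] unfolding has_weak_deriv_def by blast
 moreover have "(\<integral>x. u x * (deriv ^^ Suc n) f x \<partial>lebesgue_on X) = (-1) ^ Suc n * (\<integral>x. z x * f x \<partial>lebesgue_on X)"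
  using assms(2) t unfolding has_weak_deriv_def by blast
 ultimately have "(-1) ^ n * (\<integral>x. w x * deriv f x \<partial>lebesgue_on X) = (-1) ^ n * (- (\<integral>x. z x * f x \<partial>lebesgue_on X))"
  by (simp only: funpow_Suc_right o_apply) simp
 then have "(\<integral>x. w x * deriv f x \<partial>lebesgue_on X) = - (\<integral>x. z x * f x \<partial>lebesgue_on X)"
  by (subst (asm) mult_cancel_left) simp
 then show "(\<integral>x. w x * (deriv ^^ 1) f x \<partial>lebesgue_on X) = (-1) ^ 1 * (\<integral>x. z x * f x \<partial>lebesgue_on X)" by simp
qed

lemma has_weak_deriv_add:
 assumes X: "X \<in> sets lebesgue" and "has_weak_deriv X n u w" "has_weak_deriv X n u' w'"
 shows "has_weak_deriv X n (\<lambda>x. u x + u' x) (\<lambda>x. w x + w' x)"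
 unfolding has_weak_deriv_def
proof (intro conjI allI impI)
 have l: "locally_integrable X u" "locally_integrable X u'" "locally_integrable X w" "locally_integrable X w'"
  using assms unfolding has_weak_deriv_def by auto
 show "locally_integrable X (\<lambda>x. u x + u' x)" "locally_integrable X (\<lambda>x. w x + w' x)" by (intro locally_integrable_add l)+
 fix f assume t: "test_function X f"
 then have "(\<integral>x. u x * (deriv ^^ n) f x \<partial>lebesgue_on X) = (-1) ^ n * (\<integral>x. w x * f x \<partial>lebesgue_on X)"
  "(\<integral>x. u' x * (deriv ^^ n) f x \<partial>lebesgue_on X) = (-1) ^ n * (\<integral>x. w' x * f x \<partial>lebesgue_on X)"
  using assms unfolding has_weak_deriv_def by blast+
 then show "(\<integral>x. (u x + u' x) * (deriv ^^ n) f x \<partial>lebesgue_on X) = (-1) ^ n * (\<integral>x. (w x + w' x) * f x \<partial>lebesgue_on X)"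
  using l integrable_times_test_function[OF _ t X] integrable_times_test_function[OF _ test_function_higher_deriv[OF t] X]
  by (simp add: distrib_right distrib_left)
qed

lemma has_weak_deriv_cmult:
 assumes "has_weak_deriv X n u w"
 shows "has_weak_deriv X n (\<lambda>x. c * u x) (\<lambda>x. c * w x)"
 using assms unfolding has_weak_deriv_def by (auto simp: mult.assoc intro: locally_integrable_cmult)

lemma has_weak_deriv_zero: "has_weak_deriv X n (\<lambda>x. 0) (\<lambda>x. 0)" unfolding has_weak_deriv_def by (auto intro: locally_integrable_const)

lemma has_weak_deriv_diff:
 assumes "X \<in> sets lebesgue" "has_weak_deriv X n u w" "has_weak_deriv X n u' w'"
 shows "has_weak_deriv X n (\<lambda>x. u x - u' x) (\<lambda>x. w x - w' x)"
 using has_weak_deriv_add[OF assms(1,2) has_weak_deriv_cmult[OF assms(3), of "-1"]] by simp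

lemma has_weak_deriv_sum:
 assumes "X \<in> sets lebesgue" "\<And>i. i \<in> I ==> has_weak_deriv X n (u i) (w i)"
 shows "has_weak_deriv X n (\<lambda>x. \<Sum>i\<in>I. u i x) (\<lambda>x. \<Sum>i\<in>I. w i x)"
 using assms(2)
proof (induction I rule: infinite_finite_induct)
 case (insert i I)
 then have "has_weak_deriv X n (\<lambda>x. u i x + (\<Sum>i\<in>I. u i x)) (\<lambda>x. w i x + (\<Sum>i\<in>I. w i x))"
  by (intro has_weak_deriv_add assms(1)) auto
 then show ?case using insert by simp
qed (auto intro: has_weak_deriv_zero)

lemma has_weak_deriv_mult_smooth:
 assumes X: "X \<in> sets lebesgue" and u: "has_weak_deriv X 1 u w" and g: "smooth g"
 shows "has_weak_deriv X 1 (\<lambda>x. u x * g x) (\<lambda>x. w x * g x + u x * deriv g x)"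
 unfolding has_weak_deriv_def
proof (intro conjI allI impI)
 have l: "locally_integrable X u" "locally_integrable X w" using u unfolding has_weak_deriv_def by auto
 note gc = smooth_continuous_on[OF g] smooth_continuous_on[OF smooth_deriv[OF g]]
 show "locally_integrable X (\<lambda>x. u x * g x)" "locally_integrable X (\<lambda>x. w x * g x + u x * deriv g x)"
  by (intro locally_integrable_add locally_integrable_continuous_mult l gc)+
 fix f assume t: "test_function X f"
 have gt: "test_function X (\<lambda>x. g x * f x)" and g't: "test_function X (\<lambda>x. deriv g x * f x)"
  and gt': "test_function X (\<lambda>x. g x * deriv f x)"
  using t g test_function_deriv[OF t] smooth_deriv[OF g] by (auto intro: test_function_mult)
 have d: "deriv (\<lambda>x. g x * f x) x = deriv g x * f x + g x * deriv f x" for x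
  using DERIV_mult[OF smooth_DERIV[OF g, of x] smooth_DERIV[OF test_function_smooth[OF t], of x]]
  by (intro DERIV_imp_deriv) (simp add: mult.commute add.commute)
 have "(\<integral>x. u x * (deriv g x * f x + g x * deriv f x) \<partial>lebesgue_on X) = - (\<integral>x. w x * (g x * f x) \<partial>lebesgue_on X)"
  using u gt unfolding has_weak_deriv_def by (auto simp: d)
 moreover have "(\<integral>x. u x * (deriv g x * f x + g x * deriv f x) \<partial>lebesgue_on X)
   = (\<integral>x. u x * (deriv g x * f x) \<partial>lebesgue_on X) + (\<integral>x. u x * (g x * deriv f x) \<partial>lebesgue_on X)"
  unfolding distrib_left by (intro Bochner_Integration.integral_add integrable_times_test_function l g't gt' X)
 moreover have "(\<integral>x. (w x * g x + u x * deriv g x) * f x \<partial>lebesgue_on X)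
   = (\<integral>x. w x * (g x * f x) \<partial>lebesgue_on X) + (\<integral>x. u x * (deriv g x * f x) \<partial>lebesgue_on X)"
  unfolding distrib_right mult.assoc by (intro Bochner_Integration.integral_add integrable_times_test_function l g't gt X)
 ultimately show "(\<integral>x. u x * g x * (deriv ^^ 1) f x \<partial>lebesgue_on X) = (-1) ^ 1 * (\<integral>x. (w x * g x + u x * deriv g x) * f x \<partial>lebesgue_on X)"
  by (simp add: mult.assoc)
qed

lemma integral_deriv_test_function:
 assumes t: "test_function {a<..<b} f" and y: "a \<le> y" "y < b"
 shows "(\<integral>x. indicator {y<..} x * deriv f x \<partial>lebesgue_on {a<..<b}) = - f y"
proof -
 have s: "smooth f" using t by (rule test_function_smooth)
 have c: "continuous_on {y..b} (deriv f)" by (rule smooth_continuous_on[OF smooth_deriv[OF s]])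
 have "(\<integral>x. indicator {y<..} x * deriv f x \<partial>lebesgue_on {a<..<b}) = (\<integral>x. indicator {a<..<b} x * (indicator {y<..} x * deriv f x) \<partial>lebesgue)"
  by (rule integral_lebesgue_on) auto
 also have "... = (\<integral>x. indicator {y<..<b} x * deriv f x \<partial>lebesgue)"
  using y by (intro Bochner_Integration.integral_cong) (auto simp: indicator_def)
 also have "... = (\<integral>x. indicator {y<..<b} x * deriv f x \<partial>lborel)" using smooth_measurable[OF smooth_deriv[OF s]]
  by (intro integral_completion borel_measurable_times borel_measurable_indicator) auto
 also have "... = (\<integral>x. deriv f x * indicator {y..b} x \<partial>lborel)"
 proof (rule integral_cong_AE)
  have "AE x in lborel. x \<noteq> y" "AE x in lborel. x \<noteq> b" by (rule AE_lborel_singleton)+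
  then show "AE x in lborel. indicator {y<..<b} x * deriv f x = deriv f x * indicator {y..b} x" by eventually_elim (auto simp: indicator_def)
 qed (use smooth_measurable[OF smooth_deriv[OF s]] in \<open>auto intro!: borel_measurable_times borel_measurable_indicator\<close>)
 also have "... = f b - f y" using y smooth_DERIV[OF s] smooth_continuous_on[OF smooth_deriv[OF s], of UNIV]
  by (intro integral_FTC_Icc_real) (auto simp: continuous_on_eq_continuous_at intro: has_field_derivative_at_within)
 also have "f b = 0" by (rule test_function_zero_outside[OF t]) simp
 finally show ?thesis by simp
qed

lemma has_weak_deriv_smooth:
 assumes g: "smooth g"
 shows "has_weak_deriv {a<..<b} n g ((deriv ^^ n) g)"
proof (induction n)
 case 0
 show ?case using has_weak_deriv_0[OF locally_integrable_continuous[OF smooth_continuous_on[OF g]]] by simp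
next
 case (Suc n)
 \<comment> \<open>The constant 1 has weak derivative 0; the product rule for 1 times a smooth
   function then gives the derivative of the latter.\<close>
 have one: "has_weak_deriv {a<..<b} 1 (\<lambda>x. 1) (\<lambda>x. 0)" unfolding has_weak_deriv_def
 proof (intro conjI allI impI locally_integrable_const)
  fix f assume t: "test_function {a<..<b} f"
  show "(\<integral>x. 1 * (deriv ^^ 1) f x \<partial>lebesgue_on {a<..<b}) = (-1) ^ 1 * (\<integral>x. 0 * f x \<partial>lebesgue_on {a<..<b})"
  proof (cases "a < b")
   case True
   have "(\<integral>x. deriv f x \<partial>lebesgue_on {a<..<b}) = (\<integral>x. indicator {a<..} x * deriv f x \<partial>lebesgue_on {a<..<b})"
    by (intro Bochner_Integration.integral_cong) auto
   also have "... = - f a" using True by (intro integral_deriv_test_function[OF t]) auto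
   also have "f a = 0" by (rule test_function_zero_outside[OF t]) simp
   finally show ?thesis by simp
  next
   case False
   have "deriv f x = 0" for x using False by (intro test_function_zero_outside[OF test_function_deriv[OF t]]) auto
   then show ?thesis by simp
  qed
 qed
 show ?case using has_weak_deriv_compose[OF Suc, of "(deriv ^^ Suc n) g"]
   has_weak_deriv_mult_smooth[OF _ one smooth_higher_deriv[OF g, of n]] by simp
qed

lemma smooth_antiderivative:
 assumes s: "smooth v" and z: "\<And>x. x \<le> a ==> v x = 0"
 shows "\<And>x. ((\<lambda>x. integral {a..x} v) has_real_derivative v x) (at x)"
  and "smooth (\<lambda>x. integral {a..x} v)"
proof -
 \<comment> \<open>Starting the integral one unit to the left makes every \<open>x >= a\<close> an
   interior point, so that the derivative is two-sided.\<close>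
 have eq: "integral {a..x} v = integral {a - 1..x} v" for x
 proof (cases "a \<le> x")
  case True
  have "integral {a - 1..a} v + integral {a..x} v = integral {a - 1..x} v"
   using True by (intro Henstock_Kurzweil_Integration.integral_combine integrable_continuous_interval smooth_continuous_on[OF s]) auto
  moreover have "integral {a - 1..a} v = integral {a - 1..a} (\<lambda>x. 0)" using z by (intro integral_cong) auto
  ultimately show ?thesis by simp
 next
  case False
  then have "integral {a - 1..x} v = integral {a - 1..x} (\<lambda>x. 0)" using z by (intro integral_cong) auto
  then show ?thesis using False by simp
 qed
 show d: "((\<lambda>x. integral {a..x} v) has_real_derivative v x) (at x)" for x
 proof (cases "x < a")
  case True
  then have "eventually (\<lambda>t. t \<in> {..<a}) (nhds x)" by (intro eventually_nhds_in_open) auto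
  then have ev: "eventually (\<lambda>t. integral {a..t} v = 0) (nhds x)" by eventually_elim simp
  have "((\<lambda>t. 0) has_real_derivative v x) (at x)" using True z[of x] by simp
  then show ?thesis using DERIV_cong_ev[OF refl ev refl] by simp
 next
  case False
  have "((\<lambda>x. integral {a - 1..x} v) has_real_derivative v x) (at x within {a - 1..x + 1})"
   using False by (intro integral_has_real_derivative smooth_continuous_on[OF s]) auto
  then have "((\<lambda>x. integral {a - 1..x} v) has_real_derivative v x) (at x)" using False by (subst (asm) at_within_interior) auto
  then show ?thesis by (simp add: eq)
 qed
 have "kdiff n (\<lambda>x. integral {a..x} v)" for n
 proof (cases n)
  case (Suc m)
  then show ?thesis using d s unfolding smooth_def by auto
 qed simp
 then show "smooth (\<lambda>x. integral {a..x} v)" by (simp add: smooth_def)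
qed

lemma integral_lebesgue_on_eq_hk:
 assumes s: "smooth v" and z: "\<And>x. x \<notin> {a<..<b} ==> v x = 0"
 shows "(\<integral>x. v x \<partial>lebesgue_on {a<..<b}) = integral {a..b} v"
proof -
 have "(\<integral>x. v x \<partial>lebesgue_on {a<..<b}) = (\<integral>x. indicator {a<..<b} x * v x \<partial>lebesgue)"
  by (rule integral_lebesgue_on) simp
 also have "... = (\<integral>x. indicator {a..b} x * v x \<partial>lebesgue)"
  using z by (intro Bochner_Integration.integral_cong) (auto simp: indicator_def)
 also have "... = (\<integral>x. v x \<partial>lebesgue_on {a..b})" by (rule integral_lebesgue_on[symmetric]) simp
 also have "... = integral {a..b} v" by (intro lebesgue_integral_eq_integral continuous_imp_integrable_real smooth_continuous_on[OF s]) auto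
 finally show ?thesis .
qed

text \<open>A test function with integral 0 is the derivative of a test function. Subtracting a
  multiple of the fixed bump \<open>q\<close>, whose integral \<open>I\<close> is not 0, brings any
  test function into this form; \<open>c\<close> is the mean of \<open>h\<close> with weight
  \<open>q / I\<close>.\<close>

lemma du_bois_reymond:
 assumes ab: "l < v" and h: "locally_integrable {l<..<v} h"
  and z: "\<And>f. test_function {l<..<v} f ==> (\<integral>x. h x * deriv f x \<partial>lebesgue_on {l<..<v}) = 0"
 obtains c where "AE x in lebesgue_on {l<..<v}. h x = c"
proof -
 let ?X = "{l<..<v}"
 define a b where "a = (2 * l + v) / 3" and "b = (l + 2 * v) / 3"
 have ab': "l < a" "a < b" "b < v" using ab by (auto simp: a_def b_def field_simps)
 define q where "q = bump a b 1"
 have tq: "test_function ?X q" unfolding q_def using ab' by (intro test_function_bump) auto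
 have sq: "smooth q" using tq by (rule test_function_smooth)
 define I where "I = integral {l..v} q"
 have "I \<noteq> 0"
 proof
  assume "I = 0"
  moreover have "q integrable_on {l..v}" by (intro integrable_continuous_interval smooth_continuous_on sq)
  ultimately have "(q has_integral 0) (cbox l v)" unfolding I_def by (metis integrable_integral cbox_interval)
  moreover have "(a + b) / 2 \<in> cbox l v" using ab' by auto
  ultimately have "q ((a + b) / 2) = 0" using ab bump_bounds smooth_continuous_on[OF sq]
   by (intro has_integral_0_cbox_imp_0[of l v q]) (auto simp: q_def)
  moreover have "0 < q ((a + b) / 2)" unfolding q_def using ab' by (intro bump_pos) auto
  ultimately show False by simp
 qed
 define c where "c = (\<integral>x. h x * q x \<partial>lebesgue_on ?X) / I"
 have "AE x in lebesgue_on ?X. h x - c = 0"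
 proof (rule fundamental_lemma[OF locally_integrable_diff[OF h locally_integrable_const]])
  fix y assume t: "test_function ?X y"
  have s: "smooth y" using t by (rule test_function_smooth)
  define m where "m = integral {l..v} y / I"
  define n where "n x = y x - m * q x" for x
  have sn: "smooth n" unfolding n_def by (intro smooth_diff smooth_cmult s sq)
  from test_functionD[OF t] test_functionD[OF tq] obtain K L where
   K: "compact K" "K \<subseteq> ?X" "\<forall>x. x \<notin> K --> y x = 0" and L: "compact L" "L \<subseteq> ?X" "\<forall>x. x \<notin> L --> q x = 0" by blast
  define KL where "KL = insert a (K \<union> L)"
  have KL: "compact KL" "KL \<subseteq> ?X" "KL \<noteq> {}" "\<And>x. x \<notin> KL ==> n x = 0"
   using K L ab' by (auto simp: KL_def n_def intro!: compact_insert compact_Un)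
  obtain a' where a': "a' \<in> KL" "\<And>x. x \<in> KL ==> a' \<le> x" using compact_attains_inf[OF KL(1,3)] by blast
  obtain b' where b': "b' \<in> KL" "\<And>x. x \<in> KL ==> x \<le> b'" using compact_attains_sup[OF KL(1,3)] by blast
  have zn: "n x = 0" if "x \<notin> {a'..b'}" for x using a'(2) b'(2) KL(4) that by (meson atLeastAtMost_iff)
  have ab'': "l < a'" "b' < v" "a' \<le> b'" using a' b' KL(2) by auto
  have int_n: "integral {l..v} n = 0"
  proof -
   have "integral {l..v} n = integral {l..v} y - integral {l..v} (\<lambda>x. m * q x)"
    unfolding n_def by (intro Henstock_Kurzweil_Integration.integral_diff integrable_continuous_interval smooth_continuous_on s smooth_cmult sq)
   also have "integral {l..v} (\<lambda>x. m * q x) = m * I" by (simp add: I_def)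
   finally show ?thesis using \<open>I \<noteq> 0\<close> by (simp add: m_def)
  qed
  define f where "f x = integral {l..x} n" for x
  have f: "(f has_real_derivative n x) (at x)" "smooth f" for x unfolding f_def using ab'' by (intro smooth_antiderivative sn zn; auto)+
  have "test_function ?X f"
  proof (rule test_functionI[OF f(2), of "{a'..b'}"])
   fix x assume "x \<notin> {a'..b'}"
   then consider "x < a'" | "b' < x" by fastforce
   then show "f x = 0"
   proof cases
    case 1
    then have "f x = integral {l..x} (\<lambda>x. 0)" unfolding f_def by (intro integral_cong zn) auto
    then show ?thesis by simp
   next
    \<comment> \<open>To the right of the support the primitive is constant and equals the total
      integral of \<open>n\<close>, which is 0.\<close>
    case 2
    define B where "B = max x v"
    have comb: "integral {l..u} n + integral {u..B} n = integral {l..B} n" if "b' < u" "u \<le> B" for u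
     using ab'' that by (intro Henstock_Kurzweil_Integration.integral_combine integrable_continuous_interval smooth_continuous_on[OF sn]) auto
    have z0: "integral {u..B} n = 0" if "b' < u" for u
    proof -
     have "integral {u..B} n = integral {u..B} (\<lambda>x. 0)" using that by (intro integral_cong zn) auto
     then show ?thesis by simp
    qed
    show ?thesis using comb[of x] comb[of v] z0[of x] z0[of v] int_n 2 ab'' by (simp add: f_def B_def)
   qed
  qed (use ab'' in auto)
  then have "(\<integral>x. h x * deriv f x \<partial>lebesgue_on ?X) = 0" by (rule z)
  moreover have "deriv f = n" using f(1) by (auto intro!: ext DERIV_imp_deriv)
  ultimately have "(\<integral>x. h x * y x - m * (h x * q x) \<partial>lebesgue_on ?X) = 0" by (simp add: n_def algebra_simps)
  moreover have i: "integrable (lebesgue_on ?X) (\<lambda>x. h x * y x)" "integrable (lebesgue_on ?X) (\<lambda>x. h x * q x)"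
   "integrable (lebesgue_on ?X) (\<lambda>x. c * y x)"
   by (intro integrable_times_test_function h t tq locally_integrable_const interval_lebesgue_sets)+
  ultimately have e: "(\<integral>x. h x * y x \<partial>lebesgue_on ?X) = m * (\<integral>x. h x * q x \<partial>lebesgue_on ?X)" by simp
  have "(\<integral>x. (h x - c) * y x \<partial>lebesgue_on ?X) = (\<integral>x. h x * y x \<partial>lebesgue_on ?X) - (\<integral>x. c * y x \<partial>lebesgue_on ?X)"
   unfolding left_diff_distrib by (rule Bochner_Integration.integral_diff[OF i(1,3)])
  also have "(\<integral>x. c * y x \<partial>lebesgue_on ?X) = c * integral {l..v} y"
   using integral_lebesgue_on_eq_hk[OF s test_function_zero_outside[OF t]] by simp
  also have "c * integral {l..v} y = m * (\<integral>x. h x * q x \<partial>lebesgue_on ?X)" by (simp add: c_def m_def)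
  finally show "(\<integral>x. (h x - c) * y x \<partial>lebesgue_on ?X) = 0" using e by simp
 qed
 then have "AE x in lebesgue_on ?X. h x = c" by eventually_elim simp
 then show ?thesis by (rule that)
qed

lemma finite_measure_interval: "finite_measure (lebesgue_on {a<..<b})" for a b :: real
 by (intro finite_measure_lebesgue_on bounded_set_imp_lmeasurable) auto

text \<open>A primitive of the weak derivative differs from the function by a constant.\<close>

lemma weak_deriv_increment:
 assumes ab: "a < b" and w: "has_weak_deriv {a<..<b} 1 f f'" and i: "integrable (lebesgue_on {a<..<b}) f'"
 shows "AE x in lebesgue_on {a<..<b}. AE y in lebesgue_on {a<..<b}.
  ennreal \<bar>f x - f y\<bar> \<le> (\<integral>\<^sup>+t. ennreal (indicator {min x y<..<max x y} t * \<bar>f' t\<bar>) \<partial>lebesgue_on {a<..<b})"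
proof -
 let ?X = "{a<..<b}" and ?M = "lebesgue_on {a<..<b}"
 interpret finite_measure ?M by (rule finite_measure_interval)
 interpret pair_sigma_finite ?M ?M by unfold_locales
 have lf: "locally_integrable ?X f" "locally_integrable ?X f'" using w unfolding has_weak_deriv_def by auto
 have f'm[measurable]: "f' \<in> borel_measurable ?M" using i by auto
 define F where "F x = (\<integral>t. indicator {..<x} t * f' t \<partial>?M)" for x
 have it: "integrable ?M (\<lambda>t. indicator {..<x} t * f' t)" for x
  by (rule Bochner_Integration.integrable_bound[OF i]) (auto simp: indicator_def)
 have Fb: "\<bar>F x\<bar> \<le> (\<integral>t. \<bar>f' t\<bar> \<partial>?M)" for x
 proof -
  have "\<bar>F x\<bar> \<le> (\<integral>t. \<bar>indicator {..<x} t * f' t\<bar> \<partial>?M)" unfolding F_def by (rule integral_abs_bound)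
  also have "... \<le> (\<integral>t. \<bar>f' t\<bar> \<partial>?M)" using it i by (intro integral_mono) (auto simp: indicator_def)
  finally show ?thesis .
 qed
 have Fm[measurable]: "F \<in> borel_measurable ?M"
 proof -
  have "(\<lambda>(x, t). indicator {..<x} t * f' t) = (\<lambda>z. (if snd z < fst z then 1 else 0) * f' (snd z))"
   by (auto simp: indicator_def fun_eq_iff)
  then have "(\<lambda>(x, t). indicator {..<x} t * f' t) \<in> borel_measurable (?M \<Otimes>\<^sub>M ?M)" by simp
  then show ?thesis unfolding F_def by (rule sigma_finite_measure.borel_measurable_lebesgue_integral[OF sigma_finite_lebesgue_on[OF bounded_set_imp_lmeasurable], rotated 2]) auto
 qed
 have Fi: "integrable ?M F"
  by (rule Bochner_Integration.integrable_bound[OF integrable_const[of "\<integral>t. \<bar>f' t\<bar> \<partial>?M"]]) (use Fb in \<open>auto intro!: AE_I2 order_trans[OF Fb]\<close>)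
 obtain c where c: "AE x in ?M. f x - F x = c"
 proof (rule du_bois_reymond[OF ab])
  show "locally_integrable ?X (\<lambda>x. f x - F x)" by (intro locally_integrable_diff lf integrable_locally_integrable Fi) auto
  fix g assume t: "test_function ?X g"
  have t': "test_function ?X (deriv g)" using t by (rule test_function_deriv)
  obtain B where B: "0 \<le> B" "\<And>x. \<bar>deriv g x\<bar> \<le> B" using test_function_bounded[OF t'] by blast
  have dm[measurable]: "deriv g \<in> borel_measurable ?M" using test_function_smooth[OF t'] by simp
  define G where "G x t = indicator {..<x} t * f' t * deriv g x" for x t
  have Geq: "case_prod G = (\<lambda>z. (if snd z < fst z then 1 else 0) * f' (snd z) * deriv g (fst z))"
   by (auto simp: G_def indicator_def fun_eq_iff)
  have Gm: "case_prod G \<in> borel_measurable (?M \<Otimes>\<^sub>M ?M)" unfolding Geq by measurable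
  have Gi: "integrable (?M \<Otimes>\<^sub>M ?M) (case_prod G)"
  proof (rule Bochner_Integration.integrable_bound[OF _ Gm])
   show "integrable (?M \<Otimes>\<^sub>M ?M) (\<lambda>z. B * f' (snd z))"
   proof -
    have "integrable (?M \<Otimes>\<^sub>M ?M) (\<lambda>(x, y). B * f' y)"
    proof (rule Fubini_integrable)
     show "integrable ?M (\<lambda>x. \<integral>y. norm (case (x, y) of (x, y) => B * f' y) \<partial>?M)" by simp
    qed (use i in auto)
    then show ?thesis by (simp add: case_prod_unfold)
   qed
   show "AE z in ?M \<Otimes>\<^sub>M ?M. norm (case_prod G z) \<le> norm (B * f' (snd z))"
    using B by (intro AE_I2) (auto simp: G_def indicator_def abs_mult mult.commute[of "\<bar>f' _\<bar>"] intro!: mult_right_mono)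
  qed
  have "(\<integral>x. F x * deriv g x \<partial>?M) = (\<integral>x. (\<integral>t. G x t \<partial>?M) \<partial>?M)" by (simp add: F_def G_def)
  \<comment> \<open>Fubini's theorem leaves the integral of \<open>deriv g\<close> over the points
    to the right of \<open>t\<close> as inner integral, which is \<open>- g t\<close>.\<close>
  also have "... = (\<integral>t. (\<integral>x. G x t \<partial>?M) \<partial>?M)" by (rule Fubini_integral[OF Gi, symmetric])
  also have "... = (\<integral>t. f' t * (- g t) \<partial>?M)"
  proof (rule Bochner_Integration.integral_cong[OF refl])
   fix s assume "s \<in> space ?M"
   then have s: "a \<le> s" "s < b" by auto
   have "(\<integral>x. G x s \<partial>?M) = (\<integral>x. f' s * (indicator {s<..} x * deriv g x) \<partial>?M)"
    by (intro Bochner_Integration.integral_cong) (auto simp: G_def indicator_def)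
   also have "... = f' s * (- g s)" using integral_deriv_test_function[OF t s] by simp
   finally show "(\<integral>x. G x s \<partial>?M) = f' s * (- g s)" .
  qed
  also have "... = - (\<integral>t. f' t * g t \<partial>?M)" by simp
  finally have "(\<integral>x. F x * deriv g x \<partial>?M) = - (\<integral>t. f' t * g t \<partial>?M)" .
  moreover have "(\<integral>x. f x * deriv g x \<partial>?M) = - (\<integral>t. f' t * g t \<partial>?M)"
   using w t unfolding has_weak_deriv_def by auto
  moreover have "integrable ?M (\<lambda>x. f x * deriv g x)" "integrable ?M (\<lambda>x. F x * deriv g x)"
   by (intro integrable_times_test_function t' lf integrable_locally_integrable[OF Fi] interval_lebesgue_sets)+
  ultimately show "(\<integral>x. (f x - F x) * deriv g x \<partial>?M) = 0" by (simp add: left_diff_distrib)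
 qed
 have FF: "ennreal \<bar>F x - F y\<bar> \<le> (\<integral>\<^sup>+t. ennreal (indicator {min x y<..<max x y} t * \<bar>f' t\<bar>) \<partial>?M)" for x y
 proof -
  have "F x - F y = (\<integral>t. indicator {..<x} t * f' t - indicator {..<y} t * f' t \<partial>?M)"
   unfolding F_def by (rule Bochner_Integration.integral_diff[OF it it, symmetric])
  then have "ennreal \<bar>F x - F y\<bar> \<le> (\<integral>\<^sup>+t. ennreal (norm (indicator {..<x} t * f' t - indicator {..<y} t * f' t)) \<partial>?M)"
   using integral_norm_bound_ennreal[OF Bochner_Integration.integrable_diff[OF it[of x] it[of y]]] by simp
  also have "... \<le> (\<integral>\<^sup>+t. ennreal (indicator {min x y<..<max x y} t * \<bar>f' t\<bar>) \<partial>?M)"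
  proof (rule nn_integral_mono_AE)
   \<comment> \<open>The difference of the two half-line indicators is that of an interval
     containing its left end point, whereas the claim has the open interval.\<close>
   have "AE t in lebesgue. t \<noteq> min x y" by (rule AE_completion[OF AE_lborel_singleton])
   then have "AE t in ?M. t \<noteq> min x y" by (subst AE_lebesgue_on_iff) auto
   then show "AE t in ?M. ennreal (norm (indicator {..<x} t * f' t - indicator {..<y} t * f' t)) \<le> ennreal (indicator {min x y<..<max x y} t * \<bar>f' t\<bar>)"
    by eventually_elim (auto simp: indicator_def min_def max_def split: if_splits)
  qed
  finally show ?thesis .
 qed
 from c show ?thesis
 proof eventually_elim
  case (elim x)
  note x = this
  from c show ?case
  proof eventually_elim
   case (elim y)
   have "f x - f y = F x - F y" using x elim by simp
   then show ?case using FF[of x y] by simp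
  qed
 qed
qed

section \<open>Sobolev norms on an interval\<close>

lemma nn_integral_indicator_Lp_le:
 assumes p: "1 \<le> p" and f: "f \<in> borel_measurable M" and S: "S \<in> sets M" "emeasure M S \<le> ennreal v" "0 < v"
  and b: "0 \<le> b" "Lp_norm p M f \<le> ennreal b"
 shows "(\<integral>\<^sup>+x. ennreal (indicator S x * \<bar>f x\<bar>) \<partial>M) \<le> ennreal (v powr (1 - enn2real (1 / p)) * b)"
 using p
proof (cases p rule: exponent_cases)
 case inf
 have "AE x in M. \<bar>f x\<bar> \<le> b" using Lp_norm_le_iff_inf[OF f b(1)] b(2) inf by simp
 then have "(\<integral>\<^sup>+x. ennreal (indicator S x * \<bar>f x\<bar>) \<partial>M) \<le> (\<integral>\<^sup>+x. ennreal b * indicator S x \<partial>M)"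
  by (intro nn_integral_mono_AE) (auto elim!: eventually_mono simp: indicator_def intro!: ennreal_leI)
 also have "... = ennreal b * emeasure M S" using S by (intro nn_integral_cmult_indicator)
 also have "... \<le> ennreal b * ennreal v" using S by (intro mult_left_mono) auto
 finally show ?thesis using inf S b by (simp add: ennreal_mult mult.commute)
next
 case (fin P)
 have "(\<integral>\<^sup>+x. ennreal (indicator S x * \<bar>f x\<bar>) \<partial>M) \<le> ennreal (v powr (1 - 1 / P) * (b powr P) powr (1 / P))"
 proof (rule nn_integral_weighted_power_mean[OF _ _ _ _ fin(1) S(3)])
  have "(\<integral>\<^sup>+x. ennreal (indicator S x) \<partial>M) = emeasure M S" using S by (simp only: ennreal_indicator nn_integral_indicator)
  then show "(\<integral>\<^sup>+x. ennreal (indicator S x) \<partial>M) \<le> ennreal v" using S by simp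
  have "(\<integral>\<^sup>+x. ennreal (indicator S x * \<bar>f x\<bar> powr P) \<partial>M) \<le> (\<integral>\<^sup>+x. ennreal (\<bar>f x\<bar> powr P) \<partial>M)"
   by (intro nn_integral_mono) (auto simp: indicator_def)
  also have "... \<le> ennreal (b powr P)" using Lp_norm_le_iff_fin[OF fin(1) f b(1)] b(2) fin by simp
  finally show "(\<integral>\<^sup>+x. ennreal (indicator S x * \<bar>f x\<bar> powr P) \<partial>M) \<le> ennreal (b powr P)" .
 qed (use S f in auto)
 then show ?thesis using fin b by (simp add: powr_powr)
qed

lemma Lp_integrable:
 assumes p: "1 \<le> p" and S: "S \<in> lmeasurable" and f: "Lp_norm p (lebesgue_on S) f < \<infinity>"
 shows "integrable (lebesgue_on S) f"
proof -
 have m: "f \<in> borel_measurable (lebesgue_on S)" using f by (auto simp: Lp_norm_def split: if_splits)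
 obtain b where b: "0 \<le> b" "Lp_norm p (lebesgue_on S) f = ennreal b" using f by (cases "Lp_norm p (lebesgue_on S) f") auto
 interpret finite_measure "lebesgue_on S" by (rule finite_measure_lebesgue_on[OF S])
 \<comment> \<open>The summand 1 keeps the bound positive even if \<open>S\<close> is a null
   set.\<close>
 have "emeasure (lebesgue_on S) S \<le> ennreal (measure (lebesgue_on S) S + 1)" by (simp add: emeasure_eq_measure ennreal_leI)
 then have "(\<integral>\<^sup>+x. ennreal (indicator S x * \<bar>f x\<bar>) \<partial>lebesgue_on S) \<le> ennreal ((measure (lebesgue_on S) S + 1) powr (1 - enn2real (1 / p)) * b)"
  using S b by (intro nn_integral_indicator_Lp_le[OF p m])
   (auto simp: sets_restrict_space_iff fmeasurableD add_nonneg_pos)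
 moreover have "(\<integral>\<^sup>+x. ennreal (indicator S x * \<bar>f x\<bar>) \<partial>lebesgue_on S) = (\<integral>\<^sup>+x. ennreal (norm (f x)) \<partial>lebesgue_on S)"
  by (intro nn_integral_cong) auto
 ultimately have "(\<integral>\<^sup>+x. ennreal (norm (f x)) \<partial>lebesgue_on S) < \<infinity>"
  by (metis ennreal_less_top infinity_ennreal_def order_le_less_trans)
 then show ?thesis using m by (simp add: integrable_iff_bounded)
qed

lemma interval_lmeasurable [simp]: "{a<..<b} \<in> lmeasurable" for a b :: real by (intro bounded_set_imp_lmeasurable) auto

lemma has_weak_deriv_measurable:
 "has_weak_deriv {a<..<b} n u w ==> w \<in> borel_measurable (lebesgue_on {a<..<b})"
 "has_weak_deriv {a<..<b} n u w ==> u \<in> borel_measurable (lebesgue_on {a<..<b})"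
 unfolding has_weak_deriv_def using locally_integrable_measurable by auto

lemma has_weak_deriv_weak_deriv:
 "has_weak_deriv X n u w ==> has_weak_deriv X n u (weak_deriv X n u)" unfolding weak_deriv_def by (rule someI[of "has_weak_deriv X n u"])

text \<open>\<open>weak_deriv\<close> is an unspecified choice. Any family of weak derivatives
  agrees with it almost everywhere and may be used to compute the norm; this is how the norms of
  explicit functions become accessible.\<close>

lemma sobolev_norm_eq:
 assumes p: "1 \<le> p" and d: "\<And>i. i \<le> nat \<lfloor>s\<rfloor> ==> has_weak_deriv {a<..<b} i f (d i)"
 shows "sobolev_norm {a<..<b} s p f = (\<Sum>i\<le>nat \<lfloor>s\<rfloor>. Lp_norm p (lebesgue_on {a<..<b}) (d i)) +
  (if s - real (nat \<lfloor>s\<rfloor>) > 0 then slobodeckij_seminorm {a<..<b} (s - real (nat \<lfloor>s\<rfloor>)) p (d (nat \<lfloor>s\<rfloor>)) else 0)"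
proof -
 let ?X = "{a<..<b}"
 have w: "has_weak_deriv ?X i f (weak_deriv ?X i f)" if "i \<le> nat \<lfloor>s\<rfloor>" for i using has_weak_deriv_weak_deriv[OF d[OF that]] .
 have ae: "AE x in lebesgue_on ?X. weak_deriv ?X i f x = d i x" if "i \<le> nat \<lfloor>s\<rfloor>" for i
  using has_weak_deriv_unique[OF w[OF that] d[OF that]] .
 have "Lp_norm p (lebesgue_on ?X) (weak_deriv ?X i f) = Lp_norm p (lebesgue_on ?X) (d i)" if "i \<le> nat \<lfloor>s\<rfloor>" for i
  by (rule Lp_norm_cong_AE[OF p has_weak_deriv_measurable(1)[OF w[OF that]] has_weak_deriv_measurable(1)[OF d[OF that]]])
   (use ae[OF that] in eventually_elim, simp)
 then have "(\<Sum>i\<le>nat \<lfloor>s\<rfloor>. Lp_norm p (lebesgue_on ?X) (weak_deriv ?X i f)) = (\<Sum>i\<le>nat \<lfloor>s\<rfloor>. Lp_norm p (lebesgue_on ?X) (d i))"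
  by (intro sum.cong) auto
 moreover have "slobodeckij_seminorm ?X t p (weak_deriv ?X (nat \<lfloor>s\<rfloor>) f) = slobodeckij_seminorm ?X t p (d (nat \<lfloor>s\<rfloor>))" for t
  by (rule slobodeckij_seminorm_cong_AE[OF _ p has_weak_deriv_measurable(1)[OF w[OF order_refl]]
     has_weak_deriv_measurable(1)[OF d[OF order_refl]] ae[OF order_refl]]) simp
 moreover have "\<forall>i\<le>nat \<lfloor>s\<rfloor>. \<exists>w. has_weak_deriv ?X i f w" using d by blast
 ultimately show ?thesis unfolding sobolev_norm_def Let_def by (subst if_P) (assumption, simp only:)
qed

lemma sobolev_norm_finite_weak_deriv:
 assumes "sobolev_norm X s p f < \<infinity>" "i \<le> nat \<lfloor>s\<rfloor>"
 shows "has_weak_deriv X i f (weak_deriv X i f)"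
proof -
 have "\<exists>w. has_weak_deriv X i f w" using assms unfolding sobolev_norm_def Let_def by (auto split: if_splits)
 then show ?thesis using has_weak_deriv_weak_deriv by blast
qed

lemma sobolev_norm_triangle:
 assumes p: "1 \<le> p"
 shows "sobolev_norm {h<..<u} s p (\<lambda>x. f x + g x) \<le> sobolev_norm {h<..<u} s p f + sobolev_norm {h<..<u} s p g"
proof (cases "sobolev_norm {h<..<u} s p f < \<infinity> \<and> sobolev_norm {h<..<u} s p g < \<infinity>")
 case True
 let ?X = "{h<..<u}" and ?n = "nat \<lfloor>s\<rfloor>"
 have f: "has_weak_deriv ?X i f (weak_deriv ?X i f)" and g: "has_weak_deriv ?X i g (weak_deriv ?X i g)" if "i \<le> ?n" for i
  using True that by (auto intro: sobolev_norm_finite_weak_deriv)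
 note m = has_weak_deriv_measurable(1)[OF f] has_weak_deriv_measurable(1)[OF g]
 have fg: "has_weak_deriv ?X i (\<lambda>x. f x + g x) (\<lambda>x. weak_deriv ?X i f x + weak_deriv ?X i g x)" if "i \<le> ?n" for i
  using f[OF that] g[OF that] by (intro has_weak_deriv_add) auto
 have L: "(\<Sum>i\<le>?n. Lp_norm p (lebesgue_on ?X) (\<lambda>x. weak_deriv ?X i f x + weak_deriv ?X i g x))
   \<le> (\<Sum>i\<le>?n. Lp_norm p (lebesgue_on ?X) (weak_deriv ?X i f)) + (\<Sum>i\<le>?n. Lp_norm p (lebesgue_on ?X) (weak_deriv ?X i g))"
  unfolding sum.distrib[symmetric] by (intro sum_mono Lp_norm_triangle[OF p] m) auto
 have S: "slobodeckij_seminorm ?X t p (\<lambda>x. weak_deriv ?X ?n f x + weak_deriv ?X ?n g x)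
   \<le> slobodeckij_seminorm ?X t p (weak_deriv ?X ?n f) + slobodeckij_seminorm ?X t p (weak_deriv ?X ?n g)" for t
  by (intro slobodeckij_seminorm_triangle[OF p] m) auto
 define T where "T d = (\<Sum>i\<le>?n. Lp_norm p (lebesgue_on ?X) (d i)) +
  (if s - real ?n > 0 then slobodeckij_seminorm ?X (s - real ?n) p (d ?n) else 0)" for d
 have E: "sobolev_norm ?X s p (\<lambda>x. f x + g x) = T (\<lambda>i x. weak_deriv ?X i f x + weak_deriv ?X i g x)"
  "sobolev_norm ?X s p f = T (\<lambda>i. weak_deriv ?X i f)" "sobolev_norm ?X s p g = T (\<lambda>i. weak_deriv ?X i g)"
  unfolding T_def by (intro sobolev_norm_eq[OF p] fg f g; assumption)+
 have gen: "a + (if P then a' else 0) \<le> (b + (if P then b' else 0)) + (c + (if P then c' else 0))"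
  if "a \<le> b + c" "a' \<le> b' + c'" for a a' b b' c c' :: ennreal and P using add_mono[OF that] that(1) by (simp add: add_ac)
 show ?thesis unfolding E T_def by (rule gen[OF L S])
next
 case False
 then show ?thesis by (auto simp: not_less top_unique)
qed

lemma sobolev_norm_zero: "1 \<le> p ==> sobolev_norm {a<..<b} s p (\<lambda>x. 0) = 0" by (subst sobolev_norm_eq[where d = "\<lambda>i x. 0"])
  (auto intro: has_weak_deriv_zero simp: Lp_norm_zero slobodeckij_seminorm_def case_prod_unfold)

lemma sobolev_norm_sum:
 assumes p: "1 \<le> p"
 shows "sobolev_norm {a<..<b} s p (\<lambda>x. \<Sum>i\<in>I. f i x) \<le> (\<Sum>i\<in>I. sobolev_norm {a<..<b} s p (f i))"
proof (induction I rule: infinite_finite_induct)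
 case (insert i I)
 have "sobolev_norm {a<..<b} s p (\<lambda>x. f i x + (\<Sum>i\<in>I. f i x))
  \<le> sobolev_norm {a<..<b} s p (f i) + sobolev_norm {a<..<b} s p (\<lambda>x. \<Sum>i\<in>I. f i x)" by (rule sobolev_norm_triangle[OF p])
 also have "... \<le> sobolev_norm {a<..<b} s p (f i) + (\<Sum>i\<in>I. sobolev_norm {a<..<b} s p (f i))" by (intro add_left_mono insert)
 finally show ?case using insert by simp
qed (auto simp: sobolev_norm_zero[OF p])

lemma weak_deriv_increment_pair:
 assumes ab: "a < b" and w: "has_weak_deriv {a<..<b} 1 f f'" and i: "integrable (lebesgue_on {a<..<b}) f'"
 shows "AE z in lebesgue_on {a<..<b} \<Otimes>\<^sub>M lebesgue_on {a<..<b}. ennreal \<bar>f (fst z) - f (snd z)\<bar> \<le>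
     (\<integral>\<^sup>+t. ennreal (indicator {min (fst z) (snd z)<..<max (fst z) (snd z)} t * \<bar>f' t\<bar>) \<partial>lebesgue_on {a<..<b})"
proof -
 let ?M = "lebesgue_on {a<..<b}"
 interpret finite_measure ?M by (rule finite_measure_interval)
 interpret pair_sigma_finite ?M ?M by unfold_locales
 note [measurable] = has_weak_deriv_measurable[OF w]
 have eq: "indicator {min x y<..<max x y} t = (if min x y < t \<and> t < max x y then 1 else 0 :: real)" for x y t :: real
  by (auto simp: indicator_def)
 have "(\<lambda>z. \<integral>\<^sup>+t. ennreal (indicator {min (fst z) (snd z)<..<max (fst z) (snd z)} t * \<bar>f' t\<bar>) \<partial>?M) \<in> borel_measurable (?M \<Otimes>\<^sub>M ?M)"
  unfolding eq by (rule sigma_finite_measure.borel_measurable_nn_integral[OF sigma_finite_lebesgue_on]) simp_all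
 then show ?thesis using weak_deriv_increment[OF assms] by (intro AE_pair_measure) auto
qed

text \<open>Interpolation between integer orders at the scale \<open>H\<close>. The seminorm is
  split at distance \<open>H\<close>: the far part uses the derivative of order \<open>n\<close>,
  the near part that of order \<open>n + 1\<close>, and both come out proportional to
  \<open>H powr (- s)\<close>. The constant is the same for all intervals.\<close>

lemma sobolev_norm_le_of_derivs:
 fixes s :: real and p :: ennreal
 assumes p: "1 \<le> p" and s: "0 \<le> s"
 obtains K where "0 < K"
  "\<And>h u f d B H. h < u ==> 0 < H ==> 0 \<le> B ==> (\<And>i. i \<le> nat \<lceil>s\<rceil> ==> has_weak_deriv {h<..<u} i f (d i)) ==>
   (\<And>i. i \<le> nat \<lceil>s\<rceil> ==> Lp_norm p (lebesgue_on {h<..<u}) (d i) \<le> ennreal (B * H powr (- real i))) ==>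
   H \<le> 1 ==> sobolev_norm {h<..<u} s p f \<le> ennreal (K * B * H powr (- s))"
proof -
 define n where "n = nat \<lfloor>s\<rfloor>"
 define v where "v = s - real n"
 have n: "real n = of_int \<lfloor>s\<rfloor>" using s by (simp add: n_def)
 then have v: "0 \<le> v" "v < 1" unfolding v_def n by linarith+
 have nm: "n \<le> nat \<lceil>s\<rceil>" unfolding n_def by (intro nat_mono) linarith
 have nm': "Suc n \<le> nat \<lceil>s\<rceil>" if "0 < v"
 proof -
  have "int n < \<lceil>s\<rceil>" using that unfolding v_def by linarith
  then show ?thesis by linarith
 qed
 \<comment> \<open>For integer \<open>s\<close> there is no seminorm; \<open>1 / 2\<close> is then a
   placeholder inside the range that the two splitting lemmas require.\<close>
 define t where "t = (if 0 < v then v else 1 / 2)"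
 have t: "0 < t" "t < 1" using v by (auto simp: t_def)
 show ?thesis
 proof (rule slobodeckij_seminorm_le_near[OF p t(1)], rule slobodeckij_near_bound[OF p t], goal_cases)
 case (1 K1 K2)
 note K1 = 1(1,2) and K2 = 1(3,4)
 show ?case
 proof (rule that[of "real (Suc n) + (K1 + K2)"], goal_cases)
  case a: (2 h u f d B H)
  let ?X = "{h<..<u}"
  have dn: "has_weak_deriv ?X i f (d i)" if "i \<le> nat \<lfloor>s\<rfloor>" for i using a(4)[of i] that nm by (simp add: n_def)
  have 2: "(if v > 0 then slobodeckij_seminorm ?X v p (d n) else 0) \<le> ennreal ((K1 + K2) * B * H powr (- s))"
  proof (cases "0 < v")
   case True
   then have tt: "t = v" by (simp add: t_def)
   have d: "has_weak_deriv ?X n f (d n)" "has_weak_deriv ?X (Suc n) f (d (Suc n))" using a nm nm' True by auto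
   have w: "has_weak_deriv ?X 1 (d n) (d (Suc n))" using d by (rule has_weak_deriv_step)
   have b: "Lp_norm p (lebesgue_on ?X) (d n) \<le> ennreal (B * H powr (- real n))"
    "Lp_norm p (lebesgue_on ?X) (d (Suc n)) \<le> ennreal (B * H powr (- real (Suc n)))" using a(5)[OF nm] a(5)[OF nm'[OF True]] by blast+
   have i: "integrable (lebesgue_on ?X) (d (Suc n))" using b(2) by (intro Lp_integrable[OF p]) (auto intro: order_le_less_trans)
   have "slobodeckij_seminorm ?X v p (d n) \<le> slobodeckij_near ?X v p H (d n) + ennreal (K1 * H powr (- v) * (B * H powr (- real n)))"
    using a by (intro K1(2)[unfolded tt, OF _ has_weak_deriv_measurable(1)[OF d(1)]] b) auto
   also have "slobodeckij_near ?X v p H (d n) \<le> ennreal (K2 * H powr (1 - v) * (B * H powr (- real (Suc n))))"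
    using a by (intro K2(2)[unfolded tt, OF _ has_weak_deriv_measurable(1)[OF d(1)] has_weak_deriv_measurable(1)[OF d(2)] weak_deriv_increment_pair[OF a(1) w i]] b) auto
   finally have "slobodeckij_seminorm ?X v p (d n)
     \<le> ennreal (K2 * H powr (1 - v) * (B * H powr (- real (Suc n)))) + ennreal (K1 * H powr (- v) * (B * H powr (- real n)))"
    by (simp add: add_right_mono)
   also have "... = ennreal (K2 * H powr (1 - v) * (B * H powr (- real (Suc n))) + K1 * H powr (- v) * (B * H powr (- real n)))"
    using K1(1) K2(1) a by (intro ennreal_plus[symmetric]) auto
   also have "K2 * H powr (1 - v) * (B * H powr (- real (Suc n))) + K1 * H powr (- v) * (B * H powr (- real n)) = (K1 + K2) * B * H powr (- s)"
   proof -
    have "H powr (1 - v) * H powr (- real (Suc n)) = H powr (- s)" "H powr (- v) * H powr (- real n) = H powr (- s)"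
     by (simp_all add: powr_add[symmetric] v_def)
    then show ?thesis by (simp add: algebra_simps)
   qed
   finally show ?thesis using True by simp
  qed simp
  have "(\<Sum>i\<le>n. Lp_norm p (lebesgue_on ?X) (d i)) \<le> (\<Sum>i\<le>n. ennreal (B * H powr (- s)))"
  proof (intro sum_mono)
   fix i assume i: "i \<in> {..n}"
   then have "Lp_norm p (lebesgue_on ?X) (d i) \<le> ennreal (B * H powr (- real i))" using a(5)[of i] nm by simp
   also have "... \<le> ennreal (B * H powr (- s))" using i a v by (intro ennreal_leI mult_left_mono powr_mono') (auto simp: v_def)
   finally show "Lp_norm p (lebesgue_on ?X) (d i) \<le> ennreal (B * H powr (- s))" .
  qed
  also have "... = ennreal (real (Suc n) * (B * H powr (- s)))" by (subst sum_ennreal) (use a in auto)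
  finally have 1: "(\<Sum>i\<le>n. Lp_norm p (lebesgue_on ?X) (d i)) \<le> ennreal (real (Suc n) * (B * H powr (- s)))" .
  have E: "sobolev_norm ?X s p f = (\<Sum>i\<le>nat \<lfloor>s\<rfloor>. Lp_norm p (lebesgue_on ?X) (d i)) +
    (if s - real (nat \<lfloor>s\<rfloor>) > 0 then slobodeckij_seminorm ?X (s - real (nat \<lfloor>s\<rfloor>)) p (d (nat \<lfloor>s\<rfloor>)) else 0)"
   by (rule sobolev_norm_eq[OF p dn])
  have "sobolev_norm ?X s p f \<le> ennreal (real (Suc n) * (B * H powr (- s))) + ennreal ((K1 + K2) * B * H powr (- s))"
   unfolding E n_def[symmetric] v_def[symmetric] by (rule add_mono[OF 1 2])
  also have "... = ennreal ((real (Suc n) + (K1 + K2)) * B * H powr (- s))"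
   using K1(1) K2(1) a by (subst ennreal_plus[symmetric]) (auto simp: algebra_simps)
  finally show ?case .
 qed (use K1(1) K2(1) in auto)
 qed
qed

section \<open>Mollification that stays inside the interval\<close>

definition mollifier :: "real => real" where
 "mollifier t = inverse (integral {-1..1} (bump (-1) 1 1)) * bump (-1) 1 1 t"

lemma integral_bump_pos: "0 < integral {-1..1} (bump (-1) 1 1)"
proof -
 have c: "continuous_on {-1..1} (bump (-1) 1 1)" by (rule smooth_continuous_on[OF smooth_bump])
 have nn: "0 \<le> integral {-1..1} (bump (-1) 1 1)"
  by (intro Henstock_Kurzweil_Integration.integral_nonneg integrable_continuous_interval c bump_bounds)
 moreover have "integral {-1..1} (bump (-1) 1 1) \<noteq> 0"
 proof
  assume z: "integral {-1..1} (bump (-1) 1 1) = 0"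
  have "bump (-1) 1 1 integrable_on {-1..1}" by (rule integrable_continuous_interval[OF c])
  then have "(bump (-1) 1 1 has_integral 0) (cbox (-1) 1)" using z by (metis integrable_integral cbox_interval)
  then have "bump (-1) 1 1 0 = 0" using bump_bounds c by (intro has_integral_0_cbox_imp_0[of "-1" 1 "bump (-1) 1 1"]) auto
  then show False using bump_pos[of 1 "-1" 0 1] by simp
 qed
 ultimately show ?thesis by simp
qed

lemma smooth_mollifier: "smooth mollifier" using smooth_cmult[OF smooth_bump] by (simp add: mollifier_def[abs_def])

lemma mollifier_outside: "t \<notin> {-1<..<1} ==> mollifier t = 0" by (simp add: mollifier_def bump_outside)

lemma integral_mollifier: "integral {-1..1} mollifier = 1" using integral_bump_pos by (simp add: mollifier_def[abs_def])

lemma test_function_mollifier: "test_function UNIV mollifier"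
 by (rule test_functionI[OF smooth_mollifier, of "{-1..1}"]) (auto intro!: mollifier_outside)

lemma mollifier_higher_deriv_outside:
 assumes "\<bar>t\<bar> > 1" shows "(deriv ^^ q) mollifier t = 0"
proof -
 have "test_function {-(1 + \<bar>t\<bar>) / 2..(1 + \<bar>t\<bar>) / 2} mollifier"
  using assms by (intro test_functionI[OF smooth_mollifier, of "{-1..1}"]) (auto intro!: mollifier_outside)
 then show ?thesis by (rule test_function_zero_outside[OF test_function_higher_deriv]) (use assms in auto)
qed

text \<open>One bound per order of derivative, fixed once, makes the constants below uniform in the
  scale \<open>r\<close>.\<close>

definition moll_bd :: "nat => real" where
 "moll_bd q = (SOME B. 0 \<le> B \<and> (\<forall>t. \<bar>(deriv ^^ q) mollifier t\<bar> \<le> B))"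

lemma moll_bd: "0 \<le> moll_bd q" "\<bar>(deriv ^^ q) mollifier t\<bar> \<le> moll_bd q"
proof -
 obtain B where "0 \<le> B \<and> (\<forall>t. \<bar>(deriv ^^ q) mollifier t\<bar> \<le> B)"
  using test_function_bounded[OF test_function_higher_deriv[OF test_function_mollifier, of q]] by metis
 then have "0 \<le> moll_bd q \<and> (\<forall>t. \<bar>(deriv ^^ q) mollifier t\<bar> \<le> moll_bd q)" unfolding moll_bd_def by (rule someI)
 then show "0 \<le> moll_bd q" "\<bar>(deriv ^^ q) mollifier t\<bar> \<le> moll_bd q" by auto
qed

lemma quadratic_bound_imp_DERIV:
 assumes "\<And>h. \<bar>F (x + h) - F x - h * D\<bar> \<le> K * h^2"
 shows "(F has_real_derivative D) (at x)"
 unfolding DERIV_def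
proof (rule LIM_zero_cancel, rule Lim_null_comparison)
 show "eventually (\<lambda>h. norm ((F (x + h) - F x) / h - D) \<le> \<bar>K\<bar> * \<bar>h\<bar>) (at 0)" unfolding eventually_at_filter
 proof (intro always_eventually allI impI)
  fix h :: real assume h: "h \<noteq> 0"
  have "\<bar>(F (x + h) - F x) / h - D\<bar> = \<bar>F (x + h) - F x - h * D\<bar> / \<bar>h\<bar>"
   using h by (simp add: abs_divide[symmetric] diff_divide_distrib)
  also have "... \<le> (\<bar>K\<bar> * h^2) / \<bar>h\<bar>" using order_trans[OF assms[of h] mult_right_mono[OF abs_ge_self[of K], of "h^2"]]
   by (intro divide_right_mono) auto
  also have "... = \<bar>K\<bar> * \<bar>h\<bar>" using h by (cases "h > 0") (auto simp: power2_eq_square divide_simps)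
  finally show "norm ((F (x + h) - F x) / h - D) \<le> \<bar>K\<bar> * \<bar>h\<bar>" by simp
 qed
 show "((\<lambda>h. \<bar>K\<bar> * \<bar>h\<bar>) \<longlongrightarrow> 0) (at 0)" by (auto intro!: tendsto_eq_intros)
qed

text \<open>The remainder is quadratic in \<open>h\<close> uniformly in \<open>t\<close>.
  Integrating it against a function therefore differentiates under the integral sign by
  \<open>quadratic_bound_imp_DERIV\<close>.\<close>

lemma mollifier_taylor:
 "\<bar>(deriv ^^ q) mollifier (t + h) - (deriv ^^ q) mollifier t - h * (deriv ^^ Suc q) mollifier t\<bar> \<le> moll_bd (Suc (Suc q)) * h^2"
proof -
 let ?f = "\<lambda>q. (deriv ^^ q) mollifier"
 have lip: "\<bar>?f q u - ?f q v\<bar> \<le> moll_bd (Suc q) * \<bar>u - v\<bar>" for u v q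
 proof -
  have "norm (?f q u - ?f q v) \<le> moll_bd (Suc q) * norm (u - v)" by (rule field_differentiable_bound[of UNIV "?f q" "?f (Suc q)"])
    (use smooth_higher_DERIV[OF smooth_mollifier, of q] moll_bd(2)[of "Suc q"] in auto)
  then show ?thesis by simp
 qed
 define g where "g s = ?f q (t + s) - s * ?f (Suc q) t" for s
 have dg: "(g has_real_derivative ?f (Suc q) (t + s) - ?f (Suc q) t) (at s)" for s
 proof -
  have "((\<lambda>s. ?f q (t + s)) has_real_derivative ?f (Suc q) (t + s) * 1) (at s)"
   by (rule DERIV_chain2[OF smooth_higher_DERIV[OF smooth_mollifier]]) (auto intro!: derivative_eq_intros)
  then show ?thesis unfolding g_def by (auto intro!: derivative_eq_intros)
 qed
 have "norm (g h - g 0) \<le> (moll_bd (Suc (Suc q)) * \<bar>h\<bar>) * norm (h - 0)"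
 proof (rule field_differentiable_bound[of "closed_segment 0 h" g])
  fix s assume s: "s \<in> closed_segment 0 h"
  then show "(g has_real_derivative ?f (Suc q) (t + s) - ?f (Suc q) t) (at s within closed_segment 0 h)"
   using dg by (blast intro: has_field_derivative_at_within)
  have "\<bar>s\<bar> \<le> \<bar>h\<bar>" using s by (auto simp: closed_segment_eq_real_ivl split: if_splits)
  then show "norm (?f (Suc q) (t + s) - ?f (Suc q) t) \<le> moll_bd (Suc (Suc q)) * \<bar>h\<bar>"
   using lip[of "Suc q" "t + s" t] moll_bd(1)[of "Suc (Suc q)"] by (auto intro: order_trans mult_left_mono)
 qed auto
 then show ?thesis by (simp add: g_def power2_eq_square abs_mult[symmetric] algebra_simps)
qed

text \<open>One parameter controls the contraction and the smoothing: shrinking the interval by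
  \<open>1 - r\<close> leaves a margin \<open>r * R\<close> on either side, and this margin is the
  half-width of the kernel.\<close>

locale inner_mollification =
 fixes R r :: real
 assumes R_pos: "0 < R" and d_pos: "0 < r" and d_le: "r < 1"
begin

abbreviation X :: "real set" where "X \<equiv> {-R<..<R}"
abbreviation M :: "real measure" where "M \<equiv> lebesgue_on {-R<..<R}"
abbreviation H :: real where "H \<equiv> r * R"
abbreviation U :: "real => real => real" where "U y x \<equiv> (y - (1 - r) * x) / H"

definition ker :: "nat => (real => real) => real => real" where
 "ker q f x = (\<integral>y. f y * (deriv ^^ q) mollifier (U y x) \<partial>M)"

text \<open>The contraction \<open>x \<mapsto> (1 - r) * x\<close> keeps the support of the kernel inside the interval, so no extension operator is needed.\<close>

definition moll :: "(real => real) => real => real" where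
 "moll f x = ker 0 f x / H"

lemma e_pos: "0 < H" using R_pos d_pos by simp

lemma kernel_measurable [measurable]:
 "(\<lambda>y. (deriv ^^ q) mollifier ((y - b) / H)) \<in> borel_measurable M"
 by (rule borel_measurable_lebesgue_on) (use smooth_measurable[OF smooth_higher_deriv[OF smooth_mollifier, of q]] in measurable)

lemma kernel_integrable:
 assumes f: "integrable M f"
 shows "integrable M (\<lambda>y. f y * (deriv ^^ q) mollifier ((y - b) / H))"
proof (rule Bochner_Integration.integrable_bound)
 show "integrable M (\<lambda>y. moll_bd q * f y)" using f by simp
 show "(\<lambda>y. f y * (deriv ^^ q) mollifier ((y - b) / H)) \<in> borel_measurable M" using f by measurable
 show "AE y in M. norm (f y * (deriv ^^ q) mollifier ((y - b) / H)) \<le> norm (moll_bd q * f y)"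
  using moll_bd[of q] by (intro AE_I2) (auto simp: abs_mult mult.commute[of "\<bar>f _\<bar>"] intro!: mult_right_mono)
qed

lemma ker_DERIV:
 assumes f: "integrable M f"
 shows "(ker q f has_real_derivative (- (1 - r) / H) * ker (Suc q) f x) (at x)"
proof (rule quadratic_bound_imp_DERIV)
 fix h
 define k where "k = - (1 - r) / H"
 let ?f = "\<lambda>q. (deriv ^^ q) mollifier" and ?t = "\<lambda>y x. U y x"
 have t: "?t y (x + h) = ?t y x + k * h" for y unfolding k_def by (simp add: diff_divide_distrib add_divide_distrib algebra_simps)
 have eq: "ker q f (x + h) - ker q f x - h * (k * ker (Suc q) f x)
   = (\<integral>y. f y * (?f q (?t y (x + h)) - ?f q (?t y x) - (k * h) * ?f (Suc q) (?t y x)) \<partial>M)"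
 proof -
  have "(\<integral>y. f y * (?f q (?t y (x + h)) - ?f q (?t y x) - (k * h) * ?f (Suc q) (?t y x)) \<partial>M)
   = (\<integral>y. (f y * ?f q (?t y (x + h)) - f y * ?f q (?t y x)) - (k * h) * (f y * ?f (Suc q) (?t y x)) \<partial>M)"
   by (intro Bochner_Integration.integral_cong) (auto simp: algebra_simps)
  also have "... = ker q f (x + h) - ker q f x - (k * h) * ker (Suc q) f x"
  proof -
   note i = kernel_integrable[OF f]
   have "(\<integral>y. (f y * ?f q (?t y (x + h)) - f y * ?f q (?t y x)) - (k * h) * (f y * ?f (Suc q) (?t y x)) \<partial>M)
    = (\<integral>y. f y * ?f q (?t y (x + h)) - f y * ?f q (?t y x) \<partial>M) - (\<integral>y. (k * h) * (f y * ?f (Suc q) (?t y x)) \<partial>M)"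
    by (intro Bochner_Integration.integral_diff Bochner_Integration.integrable_diff integrable_mult_right i)
   also have "(\<integral>y. f y * ?f q (?t y (x + h)) - f y * ?f q (?t y x) \<partial>M) = ker q f (x + h) - ker q f x"
    unfolding ker_def by (intro Bochner_Integration.integral_diff i)
   also have "(\<integral>y. (k * h) * (f y * ?f (Suc q) (?t y x)) \<partial>M) = (k * h) * ker (Suc q) f x"
    unfolding ker_def by (rule integral_mult_right_zero)
   finally show ?thesis .
  qed
  finally show ?thesis by (simp add: mult_ac)
 qed
 have "\<bar>ker q f (x + h) - ker q f x - h * (k * ker (Suc q) f x)\<bar>
   \<le> (\<integral>y. \<bar>f y * (?f q (?t y (x + h)) - ?f q (?t y x) - (k * h) * ?f (Suc q) (?t y x))\<bar> \<partial>M)"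
  unfolding eq by (rule integral_abs_bound)
 also have "... \<le> (\<integral>y. \<bar>f y\<bar> * (moll_bd (Suc (Suc q)) * (k * h)\<^sup>2) \<partial>M)"
 proof (rule integral_mono)
  have "integrable M (\<lambda>y. (f y * ?f q (?t y (x + h)) - f y * ?f q (?t y x)) - (k * h) * (f y * ?f (Suc q) (?t y x)))"
   by (intro Bochner_Integration.integrable_diff integrable_mult_right kernel_integrable[OF f])
  then have "integrable M (\<lambda>y. f y * (?f q (?t y (x + h)) - ?f q (?t y x) - (k * h) * ?f (Suc q) (?t y x)))" by (simp add: algebra_simps)
  then show "integrable M (\<lambda>y. \<bar>f y * (?f q (?t y (x + h)) - ?f q (?t y x) - (k * h) * ?f (Suc q) (?t y x))\<bar>)"
   by (rule integrable_abs)
  show "integrable M (\<lambda>y. \<bar>f y\<bar> * (moll_bd (Suc (Suc q)) * (k * h)\<^sup>2))" using f by simp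
  fix y
  show "\<bar>f y * (?f q (?t y (x + h)) - ?f q (?t y x) - (k * h) * ?f (Suc q) (?t y x))\<bar>
    \<le> \<bar>f y\<bar> * (moll_bd (Suc (Suc q)) * (k * h)\<^sup>2)" unfolding abs_mult t by (rule mult_left_mono[OF mollifier_taylor]) simp
 qed
 also have "... = (\<integral>y. \<bar>f y\<bar> \<partial>M) * moll_bd (Suc (Suc q)) * k^2 * h^2" by (simp add: power_mult_distrib)
 finally show "\<bar>ker q f (x + h) - ker q f x - h * (- (1 - r) / H * ker (Suc q) f x)\<bar>
   \<le> (\<integral>y. \<bar>f y\<bar> \<partial>M) * moll_bd (Suc (Suc q)) * k^2 * h^2" by (simp add: k_def)
qed

lemma moll_derivs:
 assumes f: "integrable M f"
 shows "smooth (moll f)" "(deriv ^^ q) (moll f) x = (- (1 - r) / H) ^ q * ker q f x / H"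
proof -
 define D where "D q x = (- (1 - r) / H) ^ q * ker q f x / H" for q x
 have d: "(D q has_real_derivative D (Suc q) x) (at x)" for q x
  unfolding D_def by (rule DERIV_cong[OF DERIV_cdivide[OF DERIV_cmult[OF ker_DERIV[OF f]]]]) simp
 have D0: "D 0 = moll f" by (simp add: D_def moll_def fun_eq_iff)
 show "smooth (moll f)" by (rule smooth_higher_deriv_unique(1)[OF d D0])
 show "(deriv ^^ q) (moll f) x = (- (1 - r) / H) ^ q * ker q f x / H" using smooth_higher_deriv_unique(2)[OF d D0, of q] by (simp add: D_def)
qed

lemma moll_measurable: "integrable M f ==> moll f \<in> borel_measurable M" using moll_derivs(1) by simp

text \<open>Hoelder's inequality on the interval of length \<open>2 * H\<close> that carries the
  kernel. This passage from an \<open>L^p\<close> norm to a pointwise bound is the origin of the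
  exponent \<open>- 1 / p\<close> in the derivative bounds of the smoothed function.\<close>

lemma ker_sup_bound:
 assumes p: "1 \<le> p" and f: "f \<in> borel_measurable M" "0 \<le> b" "Lp_norm p M f \<le> ennreal b"
 shows "\<bar>ker q f x\<bar> \<le> moll_bd q * ((2 * H) powr (1 - enn2real (1 / p)) * b)"
proof -
 have i: "integrable M f" using f by (intro Lp_integrable[OF p]) (auto intro: order_le_less_trans)
 define I where "I = {(1 - r) * x - H..(1 - r) * x + H}"
 have z: "(deriv ^^ q) mollifier (U y x) = 0" if "y \<notin> I" for y
 proof -
  have "H < \<bar>y - (1 - r) * x\<bar>" using that by (auto simp: I_def)
  then show ?thesis using e_pos by (intro mollifier_higher_deriv_outside) (simp add: abs_divide)
 qed
 have IS: "I \<inter> X \<in> sets M" by (auto simp: sets_restrict_space_iff I_def)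
 have "ennreal \<bar>ker q f x\<bar> \<le> (\<integral>\<^sup>+y. ennreal (norm (f y * (deriv ^^ q) mollifier (U y x))) \<partial>M)"
  unfolding ker_def using integral_norm_bound_ennreal[OF kernel_integrable[OF i]] by simp
 also have "... \<le> (\<integral>\<^sup>+y. ennreal (moll_bd q) * ennreal (indicator (I \<inter> X) y * \<bar>f y\<bar>) \<partial>M)"
 proof (intro nn_integral_mono)
  fix y assume y: "y \<in> space M"
  show "ennreal (norm (f y * (deriv ^^ q) mollifier (U y x))) \<le> ennreal (moll_bd q) * ennreal (indicator (I \<inter> X) y * \<bar>f y\<bar>)"
  proof (cases "y \<in> I")
   case True
   then show ?thesis using y moll_bd[of q]
    by (simp add: ennreal_mult[symmetric] abs_mult mult.commute[of "\<bar>f _\<bar>"] ennreal_leI mult_right_mono)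
  next
   case False
   then show ?thesis by (simp add: z)
  qed
 qed
 also have "... = ennreal (moll_bd q) * (\<integral>\<^sup>+y. ennreal (indicator (I \<inter> X) y * \<bar>f y\<bar>) \<partial>M)"
  using f IS by (intro nn_integral_cmult measurable_compose[OF _ measurable_ennreal] borel_measurable_times borel_measurable_abs borel_measurable_indicator) auto
 also have "... \<le> ennreal (moll_bd q) * ennreal ((2 * H) powr (1 - enn2real (1 / p)) * b)"
 proof (intro mult_left_mono nn_integral_indicator_Lp_le[OF p f(1) IS _ _ f(2,3)])
  have "emeasure M (I \<inter> X) \<le> emeasure lebesgue I" by (intro emeasure_lebesgue_on_le) (auto simp: I_def)
  also have "... = ennreal (2 * H)" using e_pos by (simp add: I_def mult.commute)
  finally show "emeasure M (I \<inter> X) \<le> ennreal (2 * H)" .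
 qed (use e_pos in auto)
 also have "... = ennreal (moll_bd q * ((2 * H) powr (1 - enn2real (1 / p)) * b))" using moll_bd[of q] f by (simp add: ennreal_mult)
 finally show ?thesis using moll_bd[of q] f by (subst (asm) ennreal_le_iff) auto
qed

text \<open>The displacement has two sources, the width of the kernel and the contraction, and each
  of them contributes at most \<open>H\<close>.\<close>

lemma kernel_support:
 assumes x: "x \<in> X" and y: "(deriv ^^ q) mollifier (U y x) \<noteq> 0"
 shows "\<bar>x - y\<bar> \<le> 2 * H"
proof -
 have "\<bar>(y - (1 - r) * x) / H\<bar> \<le> 1" using y mollifier_higher_deriv_outside not_less by blast
 then have "\<bar>y - (1 - r) * x\<bar> \<le> H" using e_pos by (simp add: abs_divide)
 moreover have "\<bar>r * x\<bar> \<le> H" using x d_pos by (auto simp: abs_mult intro!: mult_left_mono)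
 moreover have "y - x = (y - (1 - r) * x) - r * x" by (simp add: algebra_simps)
 ultimately show ?thesis by linarith
qed

definition near_diag :: "(real \<times> real) set" where
 "near_diag = {z \<in> X \<times> X. \<bar>fst z - snd z\<bar> \<le> 2 * H}"

abbreviation nearI :: "(real => real) => real => ennreal" where
 "nearI f x \<equiv> \<integral>\<^sup>+y. ennreal (indicator near_diag (x, y) * \<bar>f y\<bar>) \<partial>M"

lemma near_diag_sets [measurable]: "near_diag \<in> sets (M \<Otimes>\<^sub>M M)"
proof -
 have "near_diag = {z \<in> space (M \<Otimes>\<^sub>M M). \<bar>fst z - snd z\<bar> \<le> 2 * H}" by (simp add: near_diag_def space_pair_measure)
 then show ?thesis by simp
qed

lemma near_diag_section:
 assumes "x \<in> X" shows "emeasure M (Pair x -` near_diag) \<le> ennreal (4 * H)"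
proof -
 have "Pair x -` near_diag = {x - 2 * H..x + 2 * H} \<inter> X" using assms by (auto simp: near_diag_def)
 then have "emeasure M (Pair x -` near_diag) \<le> emeasure lebesgue {x - 2 * H..x + 2 * H}"
  using emeasure_lebesgue_on_le[of X "{x - 2 * H..x + 2 * H}"] by simp
 also have "... = ennreal (4 * H)" using e_pos by (simp add: mult.commute)
 finally show ?thesis .
qed

lemma Lp_kernel_bound:
 assumes p: "1 \<le> p" and F: "F \<in> borel_measurable M" and g[measurable]: "g \<in> borel_measurable (M \<Otimes>\<^sub>M M)"
  and c: "0 \<le> c" and FK: "AE x in M. ennreal \<bar>F x\<bar> \<le> ennreal c * (\<integral>\<^sup>+y. ennreal (indicator near_diag (x, y) * \<bar>g (x, y)\<bar>) \<partial>M)"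
  and b: "0 \<le> b" "Lp_norm p (M \<Otimes>\<^sub>M M) (\<lambda>z. indicator near_diag z * g z) \<le> ennreal b"
 shows "Lp_norm p M F \<le> ennreal (c * ((4 * H) powr (1 - enn2real (1 / p)) * b))"
proof (cases "c = 0")
 case True
 have "AE x in M. F x = 0" using FK by eventually_elim (use True in simp)
 then have "Lp_norm p M F = Lp_norm p M (\<lambda>x. 0)" by (intro Lp_norm_cong_AE[OF p F]) auto
 then show ?thesis using Lp_norm_zero[OF p, of M] by simp
next
 case False
 then have c: "0 < c" using c by simp
 have "Lp_norm p M (\<lambda>x. F x / c) \<le> ennreal ((4 * H) powr (1 - enn2real (1 / p)) * b)"
 proof (rule Lp_norm_kernel_le[OF sigma_finite_lebesgue_on p _ g near_diag_sets _ near_diag_section _ b])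
  show "AE x in M. ennreal \<bar>F x / c\<bar> \<le> (\<integral>\<^sup>+y. ennreal (indicator near_diag (x, y) * \<bar>g (x, y)\<bar>) \<partial>M)"
   using FK
  proof eventually_elim
   case (elim x)
   have "ennreal \<bar>F x / c\<bar> = ennreal (1 / c) * ennreal \<bar>F x\<bar>" using c by (simp add: ennreal_mult[symmetric] abs_divide)
   also have "... \<le> ennreal (1 / c) * (ennreal c * (\<integral>\<^sup>+y. ennreal (indicator near_diag (x, y) * \<bar>g (x, y)\<bar>) \<partial>M))"
    by (intro mult_left_mono elim) auto
   also have "... = (\<integral>\<^sup>+y. ennreal (indicator near_diag (x, y) * \<bar>g (x, y)\<bar>) \<partial>M)"
    using c by (simp add: mult.assoc[symmetric] ennreal_mult[symmetric])
   finally show ?case .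
  qed
 qed (use F e_pos in auto)
 then have "ennreal \<bar>c\<bar> * Lp_norm p M (\<lambda>x. F x / c) \<le> ennreal c * ennreal ((4 * H) powr (1 - enn2real (1 / p)) * b)"
  using c by (intro mult_mono) auto
 moreover have "Lp_norm p M (\<lambda>x. c * (F x / c)) \<le> ennreal \<bar>c\<bar> * Lp_norm p M (\<lambda>x. F x / c)"
  using F by (intro Lp_norm_cmult_le[OF p]) auto
 ultimately show ?thesis using c b by (simp add: ennreal_mult)
qed

lemma Lp_near_diag_snd:
 assumes p: "1 \<le> p" and f[measurable]: "f \<in> borel_measurable M" and b: "0 \<le> b" "Lp_norm p M f \<le> ennreal b"
 shows "Lp_norm p (M \<Otimes>\<^sub>M M) (\<lambda>z. indicator near_diag z * f (snd z)) \<le> ennreal ((4 * H) powr enn2real (1 / p) * b)"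
proof -
 have "Lp_norm p (M \<Otimes>\<^sub>M M) (\<lambda>z. indicator near_diag z * f (fst z)) \<le> ennreal ((4 * H) powr enn2real (1 / p) * b)"
 proof (rule Lp_norm_pair_weight_le[OF sigma_finite_lebesgue_on p f _ _ _ _ b])
  show "AE z in M \<Otimes>\<^sub>M M. \<bar>indicator near_diag z\<bar> \<le> (4 * H) powr enn2real (1 / p)" if "p = \<infinity>"
   using that R_pos d_pos by (auto simp: indicator_def)
  fix P x assume P: "p = ennreal P" "1 \<le> P" "x \<in> space M"
  have ip: "enn2real (1 / p) = 1 / P" using P by (cases rule: exponent_cases[OF p]) auto
  have "(\<integral>\<^sup>+y. ennreal (\<bar>indicator near_diag (x, y)\<bar> powr P) \<partial>M) = (\<integral>\<^sup>+y. indicator (Pair x -` near_diag) y \<partial>M)"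
   by (intro nn_integral_cong) (auto simp: indicator_def)
  also have "... = emeasure M (Pair x -` near_diag)" by (intro nn_integral_indicator sets_Pair1[OF near_diag_sets])
  also have "... \<le> ennreal (4 * H)" using P by (intro near_diag_section) auto
  also have "4 * H = ((4 * H) powr enn2real (1 / p)) powr P" using P e_pos unfolding ip by (simp add: powr_powr)
  finally show "(\<integral>\<^sup>+y. ennreal (\<bar>indicator near_diag (x, y)\<bar> powr P) \<partial>M) \<le> ennreal (((4 * H) powr enn2real (1 / p)) powr P)" .
 qed auto
 moreover have "(\<lambda>z. indicator near_diag z * f (snd z)) = (\<lambda>(x, y). (\<lambda>z. indicator near_diag z * f (fst z)) (y, x))"
  by (auto simp: near_diag_def indicator_def fun_eq_iff)
 moreover have "Lp_norm p (M \<Otimes>\<^sub>M M) (\<lambda>(x, y). (\<lambda>z. indicator near_diag z * f (fst z)) (y, x)) = Lp_norm p (M \<Otimes>\<^sub>M M) (\<lambda>z. indicator near_diag z * f (fst z))"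
  by (intro Lp_norm_swap[OF sigma_finite_lebesgue_on p]) auto
 ultimately show ?thesis by simp
qed

text \<open>The strip has sections of length at most \<open>4 * H\<close> in both variables.
  Hoelder's inequality and the weight estimate contribute complementary powers of this length, and
  their product does not depend on \<open>p\<close>.\<close>

lemma Lp_average:
 assumes p: "1 \<le> p" and F: "F \<in> borel_measurable M" and f[measurable]: "f \<in> borel_measurable M"
  and c: "0 \<le> c" and FK: "AE x in M. ennreal \<bar>F x\<bar> \<le> ennreal c * (nearI f x)"
  and b: "0 \<le> b" "Lp_norm p M f \<le> ennreal b"
 shows "Lp_norm p M F \<le> ennreal (c * (4 * H) * b)"
proof -
 have "Lp_norm p M F \<le> ennreal (c * ((4 * H) powr (1 - enn2real (1 / p)) * ((4 * H) powr enn2real (1 / p) * b)))"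
  by (rule Lp_kernel_bound[OF p F _ c, of "\<lambda>z. f (snd z)"]) (use FK b Lp_near_diag_snd[OF p f b] in auto)
 also have "c * ((4 * H) powr (1 - enn2real (1 / p)) * ((4 * H) powr enn2real (1 / p) * b)) = c * (4 * H) * b"
  using e_pos by (simp add: mult.assoc[symmetric] powr_add[symmetric]) (simp add: mult.assoc powr_add[symmetric])
 finally show ?thesis .
qed

lemma ker_le:
 assumes f: "integrable M f" and x: "x \<in> X"
 shows "ennreal \<bar>\<integral>y. f y * (deriv ^^ q) mollifier (U y x) \<partial>M\<bar>
  \<le> ennreal (moll_bd q) * (nearI f x)"
proof -
 have fm[measurable]: "f \<in> borel_measurable M" using f by auto
 have im: "(\<lambda>y. indicator near_diag (x, y) :: real) \<in> borel_measurable M" 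
  by (rule measurable_compose[OF measurable_Pair1' borel_measurable_indicator[OF near_diag_sets]]) (use x in simp)
 have "ennreal \<bar>\<integral>y. f y * (deriv ^^ q) mollifier (U y x) \<partial>M\<bar>
   \<le> (\<integral>\<^sup>+y. ennreal (norm (f y * (deriv ^^ q) mollifier (U y x))) \<partial>M)"
  using integral_norm_bound_ennreal[OF kernel_integrable[OF f]] by simp
 also have "... \<le> (\<integral>\<^sup>+y. ennreal (moll_bd q) * ennreal (indicator near_diag (x, y) * \<bar>f y\<bar>) \<partial>M)"
 proof (intro nn_integral_mono)
  fix y assume y: "y \<in> space M"
  show "ennreal (norm (f y * (deriv ^^ q) mollifier (U y x))) \<le> ennreal (moll_bd q) * ennreal (indicator near_diag (x, y) * \<bar>f y\<bar>)"
  proof (cases "(deriv ^^ q) mollifier (U y x) = 0")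
   case False
   then have "(x, y) \<in> near_diag" using kernel_support[OF x False] x y by (simp add: near_diag_def)
   then show ?thesis using moll_bd[of q]
    by (simp add: ennreal_mult[symmetric] abs_mult mult.commute[of "\<bar>f _\<bar>"] ennreal_leI mult_right_mono)
  qed simp
 qed
 also have "... = ennreal (moll_bd q) * (nearI f x)"
  using im by (intro nn_integral_cmult measurable_compose[OF _ measurable_ennreal] borel_measurable_times borel_measurable_abs fm)
 finally show ?thesis .
qed

text \<open>For fixed \<open>x\<close> the kernel can be inserted as a test function into the
  definition of the weak derivative. The contraction is what keeps its support, the interval of
  radius \<open>H\<close> about \<open>(1 - r) * x\<close>, inside the open interval
  \<open>X\<close>.\<close>

lemma test_function_kernel:
 assumes x: "x \<in> X"
 shows "test_function X (\<lambda>y. mollifier (U y x))"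
  and "deriv (\<lambda>y. mollifier (U y x)) = (\<lambda>y. deriv mollifier (U y x) / H)"
proof -
 have aff: "(\<lambda>y. mollifier (U y x)) = (\<lambda>y. mollifier ((1 / H) * y + - ((1 - r) * x / H)))" by (simp add: diff_divide_distrib)
 have s: "smooth (\<lambda>y. mollifier (U y x))" unfolding aff by (rule smooth_affine[OF smooth_mollifier])
 show "test_function X (\<lambda>y. mollifier (U y x))"
 proof (rule test_functionI[OF s, of "{(1 - r) * x - H..(1 - r) * x + H}"])
  show "{(1 - r) * x - H..(1 - r) * x + H} \<subseteq> X"
  proof -
   have d: "0 < 1 - r" using d_le by simp
   have "(1 - r) * x < (1 - r) * R" "(1 - r) * (- R) < (1 - r) * x" using x by (intro mult_strict_left_mono d; simp)+
   then show ?thesis by (auto simp: algebra_simps)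
  qed
  fix y assume "y \<notin> {(1 - r) * x - H..(1 - r) * x + H}"
  then have "H < \<bar>y - (1 - r) * x\<bar>" by auto
  then have "(y - (1 - r) * x) / H \<notin> {-1<..<1}" using e_pos by (auto simp: abs_if field_simps split: if_splits)
  then show "mollifier (U y x) = 0" by (rule mollifier_outside)
 qed simp
 show "deriv (\<lambda>y. mollifier (U y x)) = (\<lambda>y. deriv mollifier (U y x) / H)"
 proof (intro ext DERIV_imp_deriv)
  fix y
  have "((\<lambda>y. mollifier (U y x)) has_real_derivative deriv mollifier (U y x) * (1 / H)) (at y)"
   using e_pos by (intro DERIV_chain2[OF smooth_DERIV[OF smooth_mollifier]]) (auto intro!: derivative_eq_intros)
  then show "((\<lambda>y. mollifier (U y x)) has_real_derivative deriv mollifier (U y x) / H) (at y)" by simp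
 qed
qed

text \<open>These two moments permit the subtraction of the constant \<open>f x\<close> under the
  integral, both in the smoothing error and in the derivative of the smoothed function.\<close>

lemma integral_kernel:
 assumes x: "x \<in> X"
 shows "(\<integral>y. mollifier (U y x) \<partial>M) = H"
  and "(\<integral>y. deriv mollifier (U y x) \<partial>M) = 0"
proof -
 let ?k = "\<lambda>y. mollifier (U y x)"
 note t = test_function_kernel(1)[OF x]
 have s: "smooth ?k" using t by (rule test_function_smooth)
 have "(\<integral>y. ?k y \<partial>M) = (\<integral>y. indicator X y * ?k y \<partial>lebesgue)" by (rule integral_lebesgue_on) simp
 also have "... = (\<integral>y. ?k y \<partial>lebesgue)"
  using test_function_zero_outside[OF t] by (intro Bochner_Integration.integral_cong) (auto simp: indicator_def)
 also have "... = (\<integral>y. ?k y \<partial>lborel)" using smooth_measurable[OF s] by (intro integral_completion) auto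
 also have "... = \<bar>H\<bar> *\<^sub>R (\<integral>t. ?k ((1 - r) * x + H * t) \<partial>lborel)"
  using R_pos d_pos by (intro lborel_integral_real_affine) simp
 also have "(\<lambda>t. ?k ((1 - r) * x + H * t)) = mollifier" using R_pos d_pos by auto
 also have "(\<integral>t. mollifier t \<partial>lborel) = (\<integral>t. mollifier t \<partial>lebesgue)"
  using smooth_measurable[OF smooth_mollifier] by (intro integral_completion[symmetric]) auto
 also have "... = (\<integral>t. indicator {-1<..<1} t * mollifier t \<partial>lebesgue)"
  using mollifier_outside by (intro Bochner_Integration.integral_cong) (auto simp: indicator_def)
 also have "... = (\<integral>t. mollifier t \<partial>lebesgue_on {-1<..<1})" by (rule integral_lebesgue_on[symmetric]) simp
 also have "... = 1" using integral_lebesgue_on_eq_hk[OF smooth_mollifier mollifier_outside] integral_mollifier by simp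
 finally show "(\<integral>y. ?k y \<partial>M) = H" using e_pos by simp
 have "(\<integral>y. deriv ?k y \<partial>M) = (\<integral>y. indicator {-R<..} y * deriv ?k y \<partial>M)"
  by (intro Bochner_Integration.integral_cong) auto
 also have "... = - ?k (- R)" using R_pos by (intro integral_deriv_test_function[OF t]) auto
 also have "?k (- R) = 0" by (rule test_function_zero_outside[OF t]) simp
 finally have "(\<integral>y. deriv mollifier (U y x) / H \<partial>M) = 0" unfolding test_function_kernel(2)[OF x] by simp
 then show "(\<integral>y. deriv mollifier (U y x) \<partial>M) = 0" using R_pos d_pos by simp
qed

lemma finite_measure_\<mu>: "finite_measure M" by (rule finite_measure_interval)

lemma integrable_const_\<mu> [simp]: "integrable M (\<lambda>x. c :: real)" by (rule finite_measure.integrable_const[OF finite_measure_\<mu>])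

lemma moll_minus_id:
 assumes f: "integrable M f" and x: "x \<in> X"
 shows "moll f x - f x = (\<integral>y. (f y - f x) * (deriv ^^ 0) mollifier (U y x) \<partial>M) / H"
  and "deriv (moll f) x = (- (1 - r) / H) * (\<integral>y. (f y - f x) * (deriv ^^ 1) mollifier (U y x) \<partial>M) / H"
proof -
 have eq: "(\<integral>y. (f y - f x) * (deriv ^^ q) mollifier (U y x) \<partial>M)
   = ker q f x - f x * (\<integral>y. (deriv ^^ q) mollifier (U y x) \<partial>M)" for q
 proof -
  have "(\<integral>y. (f y - f x) * (deriv ^^ q) mollifier (U y x) \<partial>M)
    = ker q f x - (\<integral>y. f x * (deriv ^^ q) mollifier (U y x) \<partial>M)" unfolding ker_def left_diff_distrib
   by (intro Bochner_Integration.integral_diff kernel_integrable f) auto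
  then show ?thesis by simp
 qed
 have k0: "(\<integral>y. (deriv ^^ 0) mollifier (U y x) \<partial>M) = H" using integral_kernel(1)[OF x] by simp
 show "moll f x - f x = (\<integral>y. (f y - f x) * (deriv ^^ 0) mollifier (U y x) \<partial>M) / H"
  unfolding eq k0 moll_def using R_pos d_pos by (simp add: diff_divide_distrib)
 show "deriv (moll f) x = (- (1 - r) / H) * (\<integral>y. (f y - f x) * (deriv ^^ 1) mollifier (U y x) \<partial>M) / H"
  unfolding eq using integral_kernel(2)[OF x] moll_derivs(2)[OF f, of 1 x] by simp
qed

lemma moll_bound:
 assumes p: "1 \<le> p" and f: "f \<in> borel_measurable M" and b: "0 \<le> b" "Lp_norm p M f \<le> ennreal b"
 shows "Lp_norm p M (moll f) \<le> ennreal (4 * moll_bd 0 * b)"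
proof -
 have i: "integrable M f" using b by (intro Lp_integrable[OF p]) (auto intro: order_le_less_trans)
 have "Lp_norm p M (moll f) \<le> ennreal (moll_bd 0 / H * (4 * H) * b)"
 proof (rule Lp_average[OF p moll_measurable[OF i] f _ _ b])
  show "0 \<le> moll_bd 0 / H" using moll_bd(1) e_pos by simp
  show "AE x in M. ennreal \<bar>moll f x\<bar> \<le> ennreal (moll_bd 0 / H) * (nearI f x)"
  proof (rule AE_I2)
   fix x assume "x \<in> space M"
   then have x: "x \<in> X" by simp
   have "ennreal \<bar>moll f x\<bar> = ennreal (1 / H) * ennreal \<bar>ker 0 f x\<bar>"
    using e_pos by (simp add: moll_def ennreal_mult[symmetric] abs_divide)
   also have "... \<le> ennreal (1 / H) * (ennreal (moll_bd 0) * (nearI f x))"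
    using ker_le[OF i x, of 0] by (intro mult_left_mono) (auto simp: ker_def)
   also have "... = ennreal (moll_bd 0 / H) * (nearI f x)" using e_pos moll_bd(1)[of 0] by (simp add: mult.assoc[symmetric] ennreal_mult[symmetric])
   finally show "ennreal \<bar>moll f x\<bar> \<le> ennreal (moll_bd 0 / H) * (nearI f x)" .
  qed
 qed
 also have "moll_bd 0 / H * (4 * H) * b = 4 * moll_bd 0 * b" using R_pos d_pos by simp
 finally show ?thesis .
qed

text \<open>The smoothing error (\<open>q = 0\<close>) and the derivative of the smoothed function
  (\<open>q = 1\<close>) are both integrals of \<open>f y - f x\<close> against a kernel, so one
  estimate serves for both. For the first bound, the distance is at most \<open>2 * H\<close> on the
  strip, which lets the Gagliardo quotient be inserted. For the second, the increment is bounded by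
  the integral of \<open>f'\<close> over the section of the strip at \<open>x\<close>; the increment
  bound and the averaging contribute one power of \<open>H\<close> each.\<close>

lemma difference_bound:
 assumes p: "1 \<le> p" and f: "integrable M f" and F: "F \<in> borel_measurable M"
  and c: "0 \<le> c" and Fx: "\<And>x. x \<in> X ==> \<bar>F x\<bar> \<le> c * \<bar>\<integral>y. (f y - f x) * (deriv ^^ q) mollifier (U y x) \<partial>M\<bar>"
  and b: "0 \<le> b"
 shows "slobodeckij_seminorm X s p f \<le> ennreal b ==> 0 \<le> s ==>
   Lp_norm p M F \<le> ennreal (4 * (c * moll_bd q) * (2 * H) powr (1 + s) * b)"
  and "has_weak_deriv X 1 f f' ==> Lp_norm p M f' \<le> ennreal b ==>
   Lp_norm p M F \<le> ennreal (16 * (c * moll_bd q) * H^2 * b)"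
proof -
 have fm[measurable]: "f \<in> borel_measurable M" using f by auto
 have FK: "ennreal \<bar>F x\<bar> \<le> ennreal (c * moll_bd q) * (\<integral>\<^sup>+y. ennreal (indicator near_diag (x, y) * \<bar>f y - f x\<bar>) \<partial>M)"
  if x: "x \<in> X" for x
 proof -
  have "ennreal \<bar>F x\<bar> \<le> ennreal c * ennreal \<bar>\<integral>y. (f y - f x) * (deriv ^^ q) mollifier (U y x) \<partial>M\<bar>"
   using Fx[OF x] c by (simp add: ennreal_mult[symmetric] ennreal_leI)
  also have "... \<le> ennreal c * (ennreal (moll_bd q) * (\<integral>\<^sup>+y. ennreal (indicator near_diag (x, y) * \<bar>f y - f x\<bar>) \<partial>M))"
   by (intro mult_left_mono ker_le[OF Bochner_Integration.integrable_diff[OF f integrable_const_\<mu>] x]) auto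
  finally show ?thesis using c moll_bd(1)[of q] by (simp add: mult.assoc[symmetric] ennreal_mult)
 qed
 have cm: "0 \<le> c * moll_bd q" using c moll_bd(1) by simp
 show "Lp_norm p M F \<le> ennreal (4 * (c * moll_bd q) * (2 * H) powr (1 + s) * b)"
  if S: "slobodeckij_seminorm X s p f \<le> ennreal b" and s: "0 \<le> s"
 proof -
  define h where "h = 2 * H"
  define ip where "ip = enn2real (1 / p)"
  have ip: "0 \<le> ip" "ip \<le> 1" unfolding ip_def using p by (cases p rule: exponent_cases; simp)+
  have h: "0 < h" using e_pos by (simp add: h_def)
  define G where "G z = \<bar>f (fst z) - f (snd z)\<bar> / \<bar>fst z - snd z\<bar> powr (s + ip)" for z
  have gm[measurable]: "G \<in> borel_measurable (M \<Otimes>\<^sub>M M)" unfolding G_def by measurable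
  have "Lp_norm p (M \<Otimes>\<^sub>M M) (\<lambda>z. indicator near_diag z * (f (snd z) - f (fst z))) \<le> Lp_norm p (M \<Otimes>\<^sub>M M) (\<lambda>z. h powr (s + ip) * G z)"
  proof (rule Lp_norm_mono_AE[OF p])
   show "AE z in M \<Otimes>\<^sub>M M. \<bar>indicator near_diag z * (f (snd z) - f (fst z))\<bar> \<le> \<bar>h powr (s + ip) * G z\<bar>"
   proof (rule AE_I2)
    fix z :: "real \<times> real"
    define d where "d = \<bar>fst z - snd z\<bar>"
    have "\<bar>f (fst z) - f (snd z)\<bar> \<le> h powr (s + ip) * (\<bar>f (fst z) - f (snd z)\<bar> / d powr (s + ip))" if "d \<le> h" "d > 0"
    proof -
     have "1 \<le> h powr (s + ip) / d powr (s + ip)" using that s ip by (simp add: divide_simps powr_mono2)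
     from mult_left_mono[OF this, of "\<bar>f (fst z) - f (snd z)\<bar>"] show ?thesis by (simp add: mult_ac)
    qed
    moreover have "\<bar>f (fst z) - f (snd z)\<bar> = 0" if "\<not> d > 0" using that by (simp add: d_def)
    ultimately have "indicator near_diag z * \<bar>f (fst z) - f (snd z)\<bar> \<le> h powr (s + ip) * (\<bar>f (fst z) - f (snd z)\<bar> / d powr (s + ip))"
     by (cases "z \<in> near_diag"; cases "d > 0") (auto simp: near_diag_def d_def h_def)
    then show "\<bar>indicator near_diag z * (f (snd z) - f (fst z))\<bar> \<le> \<bar>h powr (s + ip) * G z\<bar>"
     by (simp add: abs_mult G_def d_def abs_minus_commute)
   qed
  qed measurable
  also have "... \<le> ennreal \<bar>h powr (s + ip)\<bar> * Lp_norm p (M \<Otimes>\<^sub>M M) G" by (rule Lp_norm_cmult_le[OF p gm])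
  also have "Lp_norm p (M \<Otimes>\<^sub>M M) G \<le> ennreal b"
   using S by (simp add: slobodeckij_seminorm_def G_def[abs_def] case_prod_unfold ip_def)
  finally have "Lp_norm p (M \<Otimes>\<^sub>M M) (\<lambda>z. indicator near_diag z * (f (snd z) - f (fst z))) \<le> ennreal (h powr (s + ip) * b)"
   using b by (simp add: ennreal_mult mult_left_mono)
  then have "Lp_norm p M F \<le> ennreal (c * moll_bd q * ((4 * H) powr (1 - enn2real (1 / p)) * (h powr (s + ip) * b)))"
   using b FK by (intro Lp_kernel_bound[OF p F _ cm, of "\<lambda>z. f (snd z) - f (fst z)"]) (auto intro!: AE_I2)
  also have "... \<le> ennreal (4 * (c * moll_bd q) * (2 * H) powr (1 + s) * b)"
  proof (rule ennreal_leI)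
   have 4: "4 * H = 2 * h" by (simp add: h_def)
   have "(4 * H) powr (1 - enn2real (1 / p)) * h powr (s + ip) = 2 powr (1 - ip) * (h powr (1 - ip) * h powr (s + ip))"
    unfolding 4 ip_def[symmetric] using h by (simp add: powr_mult)
   also have "h powr (1 - ip) * h powr (s + ip) = h powr (1 + s)" by (simp add: powr_add[symmetric])
   also have "2 powr (1 - ip) * h powr (1 + s) \<le> 4 * h powr (1 + s)"
   proof (rule mult_right_mono)
    have "2 powr (1 - ip) \<le> 2 powr (1 :: real)" using ip by (intro powr_mono) auto
    then show "2 powr (1 - ip) \<le> 4" by simp
   qed simp
   finally have "(4 * H) powr (1 - enn2real (1 / p)) * h powr (s + ip) \<le> 4 * h powr (1 + s)" .
   from mult_left_mono[OF this mult_nonneg_nonneg[OF cm b]]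
   show "c * moll_bd q * ((4 * H) powr (1 - enn2real (1 / p)) * (h powr (s + ip) * b)) \<le> 4 * (c * moll_bd q) * (2 * H) powr (1 + s) * b"
    by (simp add: h_def mult_ac)
  qed
  finally show ?thesis .
 qed
 show "Lp_norm p M F \<le> ennreal (16 * (c * moll_bd q) * H^2 * b)"
  if w: "has_weak_deriv X 1 f f'" and Lf: "Lp_norm p M f' \<le> ennreal b"
 proof -
  have RR: "- R < R" using R_pos by simp
  have f'm: "f' \<in> borel_measurable M" using w by (rule has_weak_deriv_measurable)
  have f'i: "integrable M f'" using Lf by (intro Lp_integrable[OF p]) (auto intro: order_le_less_trans)
  have "AE x in M. ennreal \<bar>F x\<bar> \<le> ennreal (c * moll_bd q * (4 * H)) * (nearI f' x)" using weak_deriv_increment[OF RR w f'i] AE_space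
  proof eventually_elim
   case (elim x)
   then have x: "x \<in> X" by simp
   have "(\<integral>\<^sup>+y. ennreal (indicator near_diag (x, y) * \<bar>f y - f x\<bar>) \<partial>M)
    \<le> (\<integral>\<^sup>+y. indicator (Pair x -` near_diag) y * (nearI f' x) \<partial>M)" using elim(1)
   proof (intro nn_integral_mono_AE, eventually_elim)
    case (elim y)
    show ?case
    proof (cases "(x, y) \<in> near_diag")
     case True
     have "ennreal \<bar>f x - f y\<bar> \<le> (nearI f' x)" using elim(2)
     proof (rule order_trans, intro nn_integral_mono)
      \<comment> \<open>A point between \<open>x\<close> and \<open>y\<close> is no farther from
        \<open>x\<close> than \<open>y\<close> is, so it lies in the same strip.\<close>
      fix t assume "t \<in> space M"
      then show "ennreal (indicator {min x y<..<max x y} t * \<bar>f' t\<bar>) \<le> ennreal (indicator near_diag (x, t) * \<bar>f' t\<bar>)"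
       using True x by (intro ennreal_leI mult_right_mono) (auto simp: near_diag_def indicator_def min_def max_def split: if_splits)
     qed
     then show ?thesis using True by (simp add: abs_minus_commute)
    qed simp
   qed
   also have "... = emeasure M (Pair x -` near_diag) * (nearI f' x)"
    by (subst nn_integral_multc) (auto intro!: borel_measurable_indicator sets_Pair1[OF near_diag_sets] nn_integral_indicator)
   also have "... \<le> ennreal (4 * H) * (nearI f' x)" by (intro mult_right_mono near_diag_section[OF x]) simp
   finally have *: "(\<integral>\<^sup>+y. ennreal (indicator near_diag (x, y) * \<bar>f y - f x\<bar>) \<partial>M) \<le> ennreal (4 * H) * (nearI f' x)" .
   have "ennreal \<bar>F x\<bar> \<le> ennreal (c * moll_bd q) * (ennreal (4 * H) * (nearI f' x))"
    using FK[OF x] by (rule order_trans) (intro mult_left_mono *, simp)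
   moreover have "ennreal (c * moll_bd q * (4 * H)) = ennreal (c * moll_bd q) * ennreal (4 * H)" using cm e_pos by (intro ennreal_mult) auto
   ultimately show ?case by (simp only: mult.assoc)
  qed
  then have "Lp_norm p M F \<le> ennreal (c * moll_bd q * (4 * H) * (4 * H) * b)" using cm e_pos by (intro Lp_average[OF p F f'm _ _ b Lf]) auto
  also have "c * moll_bd q * (4 * H) * (4 * H) * b = 16 * (c * moll_bd q) * H^2 * b" by (simp add: power2_eq_square)
  finally show ?thesis .
 qed
qed

lemma moll_error_slobodeckij:
 assumes p: "1 \<le> p" and f: "integrable M f" and t: "0 \<le> t" and b: "0 \<le> b" "slobodeckij_seminorm X t p f \<le> ennreal b"
 shows "Lp_norm p M (\<lambda>x. f x - moll f x) \<le> ennreal (8 * moll_bd 0 * (2 * H) powr t * b)"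
  and "Lp_norm p M (deriv (moll f)) \<le> ennreal (8 * moll_bd 1 * (2 * H) powr t / H * b)"
proof -
 have mm: "moll f \<in> borel_measurable M" "deriv (moll f) \<in> borel_measurable M"
  using moll_derivs(1)[OF f] smooth_deriv[OF moll_derivs(1)[OF f]] by auto
 have hp: "(2 * H) powr (1 + t) = 2 * H * (2 * H) powr t" using e_pos by (simp add: powr_add)
 have "Lp_norm p M (\<lambda>x. f x - moll f x) \<le> ennreal (4 * ((1 / H) * moll_bd 0) * (2 * H) powr (1 + t) * b)"
 proof (rule difference_bound(1)[OF p f _ _ _ b t])
  fix x assume x: "x \<in> X"
  show "\<bar>f x - moll f x\<bar> \<le> 1 / H * \<bar>\<integral>y. (f y - f x) * (deriv ^^ 0) mollifier (U y x) \<partial>M\<bar>"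
   using moll_minus_id(1)[OF f x] e_pos by (subst abs_minus_commute) (simp add: abs_divide)
 qed (use mm f e_pos in auto)
 also have "4 * ((1 / H) * moll_bd 0) * (2 * H) powr (1 + t) * b = 8 * moll_bd 0 * (2 * H) powr t * b" unfolding hp using R_pos d_pos by simp
 finally show "Lp_norm p M (\<lambda>x. f x - moll f x) \<le> ennreal (8 * moll_bd 0 * (2 * H) powr t * b)" .
 have "Lp_norm p M (deriv (moll f)) \<le> ennreal (4 * ((1 / H^2) * moll_bd 1) * (2 * H) powr (1 + t) * b)"
 proof (rule difference_bound(1)[OF p f _ _ _ b t])
  fix x assume x: "x \<in> X"
  define I where "I = (\<integral>y. (f y - f x) * (deriv ^^ 1) mollifier (U y x) \<partial>M)"
  have "\<bar>deriv (moll f) x\<bar> = (1 - r) * (1 / H^2 * \<bar>I\<bar>)"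
   unfolding moll_minus_id(2)[OF f x] I_def[symmetric] using e_pos d_le R_pos d_pos by (simp add: abs_mult abs_divide power2_eq_square)
  also have "... \<le> 1 * (1 / H^2 * \<bar>I\<bar>)" using d_pos by (intro mult_right_mono) auto
  finally show "\<bar>deriv (moll f) x\<bar> \<le> 1 / H^2 * \<bar>I\<bar>" by simp
 qed (use mm in auto)
 also have "4 * ((1 / H^2) * moll_bd 1) * (2 * H) powr (1 + t) * b = 8 * moll_bd 1 * (2 * H) powr t / H * b"
  unfolding hp using R_pos d_pos by (simp add: power2_eq_square)
 finally show "Lp_norm p M (deriv (moll f)) \<le> ennreal (8 * moll_bd 1 * (2 * H) powr t / H * b)" .
qed

lemma moll_error_deriv:
 assumes p: "1 \<le> p" and f: "integrable M f" and w: "has_weak_deriv X 1 f f'" and b: "0 \<le> b" "Lp_norm p M f' \<le> ennreal b"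
 shows "Lp_norm p M (\<lambda>x. f x - moll f x) \<le> ennreal (16 * moll_bd 0 * H * b)"
proof -
 have mm: "moll f \<in> borel_measurable M" using moll_derivs(1)[OF f] by auto
 have "Lp_norm p M (\<lambda>x. f x - moll f x) \<le> ennreal (16 * ((1 / H) * moll_bd 0) * H^2 * b)"
 proof (rule difference_bound(2)[OF p f _ _ _ b(1) w b(2)])
  fix x assume x: "x \<in> X"
  show "\<bar>f x - moll f x\<bar> \<le> 1 / H * \<bar>\<integral>y. (f y - f x) * (deriv ^^ 0) mollifier (U y x) \<partial>M\<bar>"
   using moll_minus_id(1)[OF f x] e_pos by (subst abs_minus_commute) (simp add: abs_divide)
 qed (use mm f e_pos in auto)
 also have "16 * ((1 / H) * moll_bd 0) * H^2 * b = 16 * moll_bd 0 * H * b" using R_pos d_pos by (simp add: power2_eq_square)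
 finally show ?thesis .
qed

text \<open>The derivative in \<open>x\<close> falls on the kernel and is turned into a derivative
  in \<open>y\<close>, which the weak derivative of \<open>f\<close> absorbs. The inner derivative
  of the contraction remains as the factor \<open>1 - r\<close>.\<close>

lemma moll_weak_deriv:
 assumes f: "integrable M f" "integrable M f'" and w: "has_weak_deriv X 1 f f'"
 shows "has_weak_deriv X 1 (moll f) (\<lambda>x. (1 - r) * moll f' x)"
proof (rule has_weak_deriv_cong_AE[OF has_weak_deriv_smooth[OF moll_derivs(1)[OF f(1)]]])
 show "AE x in M. (deriv ^^ 1) (moll f) x = (1 - r) * moll f' x"
 proof (rule AE_I2)
  fix x assume "x \<in> space M"
  then have x: "x \<in> X" by simp
  have "(\<integral>y. f y * deriv (\<lambda>y. mollifier (U y x)) y \<partial>M) = - (\<integral>y. f' y * mollifier (U y x) \<partial>M)"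
   using w test_function_kernel(1)[OF x] unfolding has_weak_deriv_def by auto
  then have "ker 1 f x / H = - ker 0 f' x" unfolding test_function_kernel(2)[OF x] by (simp add: ker_def)
  moreover have "(deriv ^^ 1) (moll f) x = - (1 - r) / H * (ker 1 f x / H)" using moll_derivs(2)[OF f(1), of 1 x] by simp
  ultimately have "(deriv ^^ 1) (moll f) x = - (1 - r) / H * - ker 0 f' x" by (simp only:)
  then show "(deriv ^^ 1) (moll f) x = (1 - r) * moll f' x"
   by (simp only: minus_divide_left[symmetric] minus_mult_minus moll_def times_divide_eq_left times_divide_eq_right)
 qed
qed (use moll_measurable[OF f(1)] moll_measurable[OF f(2)] in auto)

end

section \<open>A Jackson estimate\<close>

context inner_mollification
begin

text \<open>The case \<open>a = 1\<close> is the operator that is iterated; the values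
  \<open>(1 - r) ^ j\<close> arise when an iterate is differentiated \<open>j\<close> times.\<close>

definition T :: "real => (real => real) => real => real" where
 "T a f x = f x - a * moll f x"

lemma smooth_integrable: "smooth g ==> integrable M g"
proof -
 assume g: "smooth g"
 have "integrable (lebesgue_on {-R..R}) g" by (intro continuous_imp_integrable_real smooth_continuous_on[OF g])
 then have "integrable lebesgue (\<lambda>x. indicator {-R..R} x * g x)" by (subst (asm) integrable_lebesgue_on_iff) auto
 then have "integrable lebesgue (\<lambda>x. indicator X x *\<^sub>R (indicator {-R..R} x * g x))" by (intro integrable_mult_indicator) auto
 moreover have "(\<lambda>x. indicator X x *\<^sub>R (indicator {-R..R} x * g x)) = (\<lambda>x. indicator X x * g x)" by (auto simp: indicator_def)
 ultimately show ?thesis by (subst integrable_lebesgue_on_iff) simp_all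
qed

lemma moll_integrable: "integrable M f ==> integrable M (moll f)" by (rule smooth_integrable[OF moll_derivs(1)])

lemma T_integrable: "integrable M f ==> integrable M (T a f)"
 unfolding T_def by (intro Bochner_Integration.integrable_diff integrable_mult_right moll_integrable)

lemma T_pow_integrable: "integrable M f ==> integrable M ((T a ^^ k) f)" by (induction k) (auto intro: T_integrable)

lemma moll_T:
 assumes f: "integrable M f" shows "moll (T a f) = T a (moll f)"
proof
 fix x
 have "ker 0 (T a f) x = (\<integral>y. f y * (deriv ^^ 0) mollifier (U y x) - a * (moll f y * (deriv ^^ 0) mollifier (U y x)) \<partial>M)"
  unfolding ker_def T_def by (intro Bochner_Integration.integral_cong) (auto simp: algebra_simps)
 also have "... = ker 0 f x - (\<integral>y. a * (moll f y * (deriv ^^ 0) mollifier (U y x)) \<partial>M)" unfolding ker_def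
  by (intro Bochner_Integration.integral_diff integrable_mult_right kernel_integrable moll_integrable f)
 also have "(\<integral>y. a * (moll f y * (deriv ^^ 0) mollifier (U y x)) \<partial>M) = a * ker 0 (moll f) x"
  unfolding ker_def by (rule integral_mult_right_zero)
 finally show "moll (T a f) x = T a (moll f) x" unfolding T_def moll_def[of _ x] by (simp add: moll_def[of _ x] diff_divide_distrib)
qed

lemma moll_T_pow: "integrable M f ==> moll ((T a ^^ k) f) = (T a ^^ k) (moll f)" by (induction k) (auto simp: moll_T T_pow_integrable)

lemma T_weak_deriv:
 assumes "integrable M f" "integrable M f'" "has_weak_deriv X 1 f f'"
 shows "has_weak_deriv X 1 (T a f) (T (a * (1 - r)) f')"
 using has_weak_deriv_diff[OF _ assms(3) has_weak_deriv_cmult[OF moll_weak_deriv[OF assms], of a]] by (simp add: T_def[abs_def] mult.assoc)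

lemma T_pow_weak_deriv:
 assumes "integrable M f" "integrable M f'" "has_weak_deriv X 1 f f'"
 shows "has_weak_deriv X 1 ((T a ^^ k) f) ((T (a * (1 - r)) ^^ k) f')"
proof (induction k)
 case (Suc k)
 show ?case unfolding funpow.simps o_apply by (intro T_weak_deriv T_pow_integrable assms Suc)
qed (use assms in simp)

text \<open>The difference between \<open>f\<close> and its iterate is a finite sum of mollified
  functions and hence smooth. For \<open>a = 1\<close> it is the smooth approximation
  \<open>V\<close> used below.\<close>

lemma T_telescope: "(T a ^^ k) f x = f x - a * (\<Sum>l<k. moll ((T a ^^ l) f) x)" by (induction k) (auto simp: T_def algebra_simps)

lemma Lp_norm_add_le:
 assumes p: "1 \<le> p" and "f \<in> borel_measurable M" "g \<in> borel_measurable M" "0 \<le> b" "0 \<le> c"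
  and "Lp_norm p M f \<le> ennreal b" "Lp_norm p M g \<le> ennreal c"
 shows "Lp_norm p M (\<lambda>x. f x + g x) \<le> ennreal (b + c)"
 using Lp_norm_triangle[OF p assms(2,3)] add_mono[OF assms(6,7)] assms(4,5) by (simp add: order_trans)

lemma Lp_norm_cmult_le':
 assumes p: "1 \<le> p" and "f \<in> borel_measurable M" "0 \<le> b" "Lp_norm p M f \<le> ennreal b" "\<bar>c\<bar> \<le> c'"
 shows "Lp_norm p M (\<lambda>x. c * f x) \<le> ennreal (c' * b)"
proof -
 have "Lp_norm p M (\<lambda>x. c * f x) \<le> ennreal \<bar>c\<bar> * Lp_norm p M f" by (rule Lp_norm_cmult_le[OF p assms(2)])
 also have "... \<le> ennreal c' * ennreal b" using assms by (intro mult_mono ennreal_leI) auto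
 finally show ?thesis using assms by (simp add: ennreal_mult)
qed

lemma Lp_imp_integrable: "1 \<le> p ==> Lp_norm p M f \<le> ennreal b ==> integrable M f" by (rule Lp_integrable) (auto intro: order_le_less_trans)

lemma T_bound:
 assumes p: "1 \<le> p" and a: "0 \<le> a" "a \<le> 1" and b: "0 \<le> b" "Lp_norm p M f \<le> ennreal b"
 shows "Lp_norm p M (T a f) \<le> ennreal ((1 + 4 * moll_bd 0) * b)"
proof -
 have f: "integrable M f" using Lp_imp_integrable[OF p b(2)] .
 have fm: "f \<in> borel_measurable M" using f by auto
 have mm: "moll f \<in> borel_measurable M" by (rule moll_measurable[OF f])
 have B: "0 \<le> 4 * moll_bd 0 * b" using moll_bd(1) b by simp
 have "Lp_norm p M (\<lambda>x. f x + (- a) * moll f x) \<le> ennreal (b + 1 * (4 * moll_bd 0 * b))"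
  using a b by (intro Lp_norm_add_le[OF p] Lp_norm_cmult_le'[OF p mm _ moll_bound[OF p fm b]] fm) (use mm B in auto)
 then show ?thesis by (simp add: T_def[abs_def] algebra_simps)
qed

text \<open>\<open>T a f\<close> is \<open>(1 - a) * f\<close> plus \<open>a\<close> times the
  smoothing error, so the deviation of \<open>a\<close> from 1 enters only as an additional term of
  size \<open>e * b\<close>.\<close>

lemma T_split_bound:
 assumes p: "1 \<le> p" and a: "0 \<le> a" "a \<le> 1" "1 - a \<le> e" and b: "0 \<le> b" "Lp_norm p M f \<le> ennreal b"
  and c: "0 \<le> c" "Lp_norm p M (\<lambda>x. f x - moll f x) \<le> ennreal c"
 shows "Lp_norm p M (T a f) \<le> ennreal (e * b + c)"
proof -
 have f: "integrable M f" using Lp_imp_integrable[OF p b(2)] .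
 have fm[measurable]: "f \<in> borel_measurable M" using f by auto
 have mm[measurable]: "moll f \<in> borel_measurable M" by (rule moll_measurable[OF f])
 have "Lp_norm p M (\<lambda>x. (1 - a) * f x + a * (f x - moll f x)) \<le> ennreal (e * b + 1 * c)"
  using a b c by (intro Lp_norm_add_le[OF p] Lp_norm_cmult_le'[OF p fm] Lp_norm_cmult_le'[OF p _ _ c(2)]) auto
 moreover have "(\<lambda>x. (1 - a) * f x + a * (f x - moll f x)) = T a f" by (auto simp: T_def algebra_simps)
 ultimately show ?thesis by simp
qed

lemma dilation_power_bounds: "0 \<le> (1 - r) ^ j" "(1 - r) ^ j \<le> 1" "1 - (1 - r) ^ j \<le> real j * r"
proof -
 show "0 \<le> (1 - r) ^ j" "(1 - r) ^ j \<le> 1" using d_pos d_le by (auto simp: power_le_one)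
 show "1 - (1 - r) ^ j \<le> real j * r" using Bernoulli_inequality[of "- r" j] d_le by simp
qed

lemma T_pow_bound_0:
 assumes p: "1 \<le> p" and Q: "1 + 4 * moll_bd 0 \<le> Q" and a: "0 \<le> a" "a \<le> 1"
  and b: "0 \<le> b" "Lp_norm p M f \<le> ennreal b"
 shows "Lp_norm p M ((T a ^^ k) f) \<le> ennreal (Q ^ k * b)"
proof (induction k)
 case (Suc k)
 have Q0: "0 \<le> Q" using Q moll_bd(1)[of 0] by simp
 have "Lp_norm p M ((T a ^^ Suc k) f) \<le> ennreal ((1 + 4 * moll_bd 0) * (Q ^ k * b))" using T_bound[OF p a _ Suc] Q0 b by simp
 also have "... \<le> ennreal (Q * (Q ^ k * b))" using Q Q0 b by (intro ennreal_leI mult_right_mono) auto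
 finally show ?case by (simp add: mult.assoc)
qed (use b in simp)

text \<open>One application of \<open>T\<close> gains one factor \<open>r\<close> at the expense of
  one derivative. The derivative of the remaining iterate is an iterate of the same length applied
  to \<open>F 1\<close>, with index \<open>j + 1\<close>, to which the induction hypothesis applies.
  \<open>J\<close> is an upper bound for all indices that occur, so that \<open>Q\<close> stays the
  same throughout the induction.\<close>

lemma T_pow_bound_int:
 assumes p: "1 \<le> p" and Q: "1 + 4 * moll_bd 0 \<le> Q" "real J + 16 * moll_bd 0 * R \<le> Q"
 shows "(\<And>i. i < n ==> has_weak_deriv X 1 (F i) (F (Suc i))) ==> 0 \<le> b ==> (\<And>i. i \<le> n ==> Lp_norm p M (F i) \<le> ennreal b)
  ==> j + n \<le> J ==> n \<le> k ==> Lp_norm p M ((T ((1 - r) ^ j) ^^ k) (F 0)) \<le> ennreal (Q ^ k * (r ^ n * b))"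
proof (induction n arbitrary: F j k)
 case 0
 then show ?case using T_pow_bound_0[OF p Q(1) dilation_power_bounds(1,2)] by simp
next
 case (Suc n)
 obtain l where k: "k = Suc l" "n \<le> l" using Suc.prems(5) by (cases k) auto
 let ?a = "(1 - r) ^ j"
 define G where "G = (T ?a ^^ l) (F 0)"
 define G' where "G' = (T ((1 - r) ^ Suc j) ^^ l) (F 1)"
 have Q0: "0 \<le> Q" using Q moll_bd(1)[of 0] by simp
 have i: "integrable M (F 0)" "integrable M (F 1)" using Suc.prems(3)[of 0] Suc.prems(3)[of 1] by (auto intro: Lp_imp_integrable[OF p])
 have bG: "Lp_norm p M G \<le> ennreal (Q ^ l * (r ^ n * b))" unfolding G_def using Suc.prems k by (intro Suc.IH) auto
 have bG': "Lp_norm p M G' \<le> ennreal (Q ^ l * (r ^ n * b))"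
  unfolding G'_def using Suc.IH[of "\<lambda>i. F (Suc i)" "Suc j" l] Suc.prems k by simp
 have w: "has_weak_deriv X 1 G G'" unfolding G_def G'_def power_Suc2 using Suc.prems(1)[of 0] by (intro T_pow_weak_deriv i) simp
 have nn: "0 \<le> Q ^ l * (r ^ n * b)" using Q0 d_pos Suc.prems(2) by simp
 have iG: "integrable M G" unfolding G_def by (rule T_pow_integrable[OF i(1)])
 have "Lp_norm p M (\<lambda>x. G x - moll G x) \<le> ennreal (16 * moll_bd 0 * H * (Q ^ l * (r ^ n * b)))"
  by (rule moll_error_deriv[OF p iG w nn bG'])
 then have "Lp_norm p M (T ?a G) \<le> ennreal (real J * r * (Q ^ l * (r ^ n * b)) + 16 * moll_bd 0 * H * (Q ^ l * (r ^ n * b)))"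
 proof (rule T_split_bound[OF p dilation_power_bounds(1,2) _ nn bG, rotated 2])
  have "real j * r \<le> real J * r" using Suc.prems(4) d_pos by (intro mult_right_mono) auto
  then show "1 - ?a \<le> real J * r" using dilation_power_bounds(3)[of j] by linarith
  show "0 \<le> 16 * moll_bd 0 * H * (Q ^ l * (r ^ n * b))" using moll_bd(1)[of 0] R_pos d_pos Q0 Suc.prems(2) by simp
 qed
 also have "real J * r * (Q ^ l * (r ^ n * b)) + 16 * moll_bd 0 * H * (Q ^ l * (r ^ n * b))
   = (real J + 16 * moll_bd 0 * R) * (r * (Q ^ l * (r ^ n * b)))" by (simp add: algebra_simps)
 also have "ennreal ... \<le> ennreal (Q * (r * (Q ^ l * (r ^ n * b))))" using Q(2) nn d_pos by (intro ennreal_leI mult_right_mono) auto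
 finally show ?case by (simp add: k G_def mult_ac)
qed

text \<open>The same induction, but it ends with the seminorm of fractional order in place of an
  \<open>L^p\<close> norm. This takes one further application of \<open>T\<close>, hence the strict
  inequality between \<open>n\<close> and \<open>k\<close>.\<close>

lemma T_pow_bound_frac:
 assumes p: "1 \<le> p" and t: "0 \<le> t" "t \<le> 1"
  and Q: "1 + 4 * moll_bd 0 \<le> Q" "real J + 16 * moll_bd 0 * R \<le> Q" "real J + 8 * moll_bd 0 * (2 * R) powr t \<le> Q"
 shows "(\<And>i. i < n ==> has_weak_deriv X 1 (F i) (F (Suc i))) ==> 0 \<le> b ==> (\<And>i. i \<le> n ==> Lp_norm p M (F i) \<le> ennreal b)
  ==> slobodeckij_seminorm X t p (F n) \<le> ennreal b
  ==> j + n \<le> J ==> n < k ==> Lp_norm p M ((T ((1 - r) ^ j) ^^ k) (F 0)) \<le> ennreal (Q ^ k * (r powr (real n + t) * b))"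
proof (induction n arbitrary: F j k)
 case 0
 let ?a = "(1 - r) ^ j"
 obtain l where k: "k = Suc l" using 0 by (cases k) auto
 have Q0: "0 \<le> Q" using Q moll_bd(1)[of 0] by simp
 have i: "integrable M (F 0)" using 0(3)[of 0] by (auto intro: Lp_imp_integrable[OF p])
 have "Lp_norm p M (\<lambda>x. F 0 x - moll (F 0) x) \<le> ennreal (8 * moll_bd 0 * (2 * H) powr t * b)"
  using 0 by (intro moll_error_slobodeckij[OF p i t(1)]) auto
 then have "Lp_norm p M (T ?a (F 0)) \<le> ennreal (real J * r * b + 8 * moll_bd 0 * (2 * H) powr t * b)"
 proof (rule T_split_bound[OF p dilation_power_bounds(1,2), rotated 4])
  have "real j * r \<le> real J * r" using 0(5) d_pos by (intro mult_right_mono) auto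
  then show "1 - ?a \<le> real J * r" using dilation_power_bounds(3)[of j] by linarith
 qed (use 0 moll_bd(1)[of 0] in auto)
 also have "... \<le> ennreal (Q * (r powr t * b))"
 proof (rule ennreal_leI)
  have "r powr 1 \<le> r powr t" using t d_pos d_le by (intro powr_mono') auto
  then have d: "r \<le> r powr t" using d_pos by simp
  have "(2 * H) powr t = (2 * R) powr t * r powr t" using R_pos d_pos by (simp add: powr_mult mult_ac)
  then have "real J * r * b + 8 * moll_bd 0 * (2 * H) powr t * b
   = real J * r * b + 8 * moll_bd 0 * (2 * R) powr t * (r powr t * b)" by (simp add: mult_ac)
  also have "real J * r * b \<le> real J * r powr t * b" using d 0(2) by (intro mult_right_mono mult_left_mono) auto
  finally have "real J * r * b + 8 * moll_bd 0 * (2 * H) powr t * b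
   \<le> (real J + 8 * moll_bd 0 * (2 * R) powr t) * (r powr t * b)" by (simp add: algebra_simps)
  also have "... \<le> Q * (r powr t * b)" using Q(3) 0(2) by (intro mult_right_mono) auto
  finally show "real J * r * b + 8 * moll_bd 0 * (2 * H) powr t * b \<le> Q * (r powr t * b)" .
 qed
 finally have "Lp_norm p M ((T ?a ^^ l) (T ?a (F 0))) \<le> ennreal (Q ^ l * (Q * (r powr t * b)))"
  using Q0 0(2) by (intro T_pow_bound_0[OF p Q(1) dilation_power_bounds(1,2)]) auto
 then show ?case by (simp add: k funpow_swap1 mult_ac)
next
 case (Suc n)
 obtain l where k: "k = Suc l" "n < l" using Suc.prems(6) by (cases k) auto
 let ?a = "(1 - r) ^ j"
 define G where "G = (T ?a ^^ l) (F 0)"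
 define G' where "G' = (T ((1 - r) ^ Suc j) ^^ l) (F 1)"
 have Q0: "0 \<le> Q" using Q moll_bd(1)[of 0] by simp
 have i: "integrable M (F 0)" "integrable M (F 1)" using Suc.prems(3)[of 0] Suc.prems(3)[of 1] by (auto intro: Lp_imp_integrable[OF p])
 \<comment> \<open>The term without derivative may use all \<open>n + 1\<close> derivatives in the
   integer estimate, and \<open>r ^ Suc n\<close> is below \<open>r powr (n + t)\<close>.\<close>
 have "Lp_norm p M G \<le> ennreal (Q ^ l * (r ^ Suc n * b))" unfolding G_def using Suc.prems k by (intro T_pow_bound_int[OF p Q(1,2)]) auto
 also have "... \<le> ennreal (Q ^ l * (r powr (real n + t) * b))"
 proof (intro ennreal_leI mult_left_mono mult_right_mono)
  have "r ^ Suc n = r powr real (Suc n)" by (rule powr_realpow[OF d_pos, symmetric])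
  also have "... \<le> r powr (real n + t)" using t d_pos d_le by (intro powr_mono') auto
  finally show "r ^ Suc n \<le> r powr (real n + t)" .
 qed (use Suc.prems Q0 in auto)
 finally have bG: "Lp_norm p M G \<le> ennreal (Q ^ l * (r powr (real n + t) * b))" .
 have bG': "Lp_norm p M G' \<le> ennreal (Q ^ l * (r powr (real n + t) * b))"
  unfolding G'_def using Suc.IH[of "\<lambda>i. F (Suc i)" "Suc j" l] Suc.prems k by simp
 have w: "has_weak_deriv X 1 G G'" unfolding G_def G'_def power_Suc2 using Suc.prems(1)[of 0] by (intro T_pow_weak_deriv i) simp
 have nn: "0 \<le> Q ^ l * (r powr (real n + t) * b)" using Q0 Suc.prems(2) by simp
 have iG: "integrable M G" unfolding G_def by (rule T_pow_integrable[OF i(1)])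
 have "Lp_norm p M (\<lambda>x. G x - moll G x) \<le> ennreal (16 * moll_bd 0 * H * (Q ^ l * (r powr (real n + t) * b)))"
  by (rule moll_error_deriv[OF p iG w nn bG'])
 then have "Lp_norm p M (T ?a G) \<le> ennreal (real J * r * (Q ^ l * (r powr (real n + t) * b)) + 16 * moll_bd 0 * H * (Q ^ l * (r powr (real n + t) * b)))"
 proof (rule T_split_bound[OF p dilation_power_bounds(1,2) _ nn bG, rotated 2])
  have "real j * r \<le> real J * r" using Suc.prems(5) d_pos by (intro mult_right_mono) auto
  then show "1 - ?a \<le> real J * r" using dilation_power_bounds(3)[of j] by linarith
  show "0 \<le> 16 * moll_bd 0 * H * (Q ^ l * (r powr (real n + t) * b))" using moll_bd(1)[of 0] R_pos d_pos Q0 Suc.prems(2) by simp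
 qed
 also have "real J * r * (Q ^ l * (r powr (real n + t) * b)) + 16 * moll_bd 0 * H * (Q ^ l * (r powr (real n + t) * b))
   = (real J + 16 * moll_bd 0 * R) * (r * (Q ^ l * (r powr (real n + t) * b)))" by (simp add: algebra_simps)
 also have "ennreal ... \<le> ennreal (Q * (r * (Q ^ l * (r powr (real n + t) * b))))" using Q(2) nn d_pos by (intro ennreal_leI mult_right_mono) auto
 also have "Q * (r * (Q ^ l * (r powr (real n + t) * b))) = Q ^ k * (r powr (real (Suc n) + t) * b)"
 proof -
  have "r powr (real (Suc n) + t) = r powr 1 * r powr (real n + t)" by (subst powr_add[symmetric]) (simp add: add_ac)
  then show ?thesis using d_pos by (simp add: k mult_ac)
 qed
 finally show ?case by (simp add: k G_def)
qed

lemma moll_higher_deriv_bound: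
 assumes p: "1 \<le> p" and b: "0 \<le> b" "Lp_norm p M f \<le> ennreal b"
 shows "\<bar>(deriv ^^ q) (moll f) x\<bar> \<le> 2 * moll_bd q * H powr (- real q - enn2real (1 / p)) * b"
proof -
 define ip where "ip = enn2real (1 / p)"
 define e where "e = H"
 have e: "0 < e" using e_pos by (simp add: e_def)
 have ip: "0 \<le> ip" "ip \<le> 1" unfolding ip_def using p by (cases p rule: exponent_cases; simp)+
 have f: "integrable M f" using Lp_imp_integrable[OF p b(2)] .
 have "\<bar>(deriv ^^ q) (moll f) x\<bar> = ((1 - r) / e) ^ q * \<bar>ker q f x\<bar> / e"
  unfolding moll_derivs(2)[OF f] e_def[symmetric] using e d_le by (simp add: abs_mult abs_divide power_abs)
 also have "... \<le> (1 / e) ^ q * (moll_bd q * ((2 * e) powr (1 - ip) * b)) / e"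
  using ker_sup_bound[OF p _ b, of q x] f e d_pos d_le unfolding e_def[symmetric] ip_def[symmetric]
  by (intro divide_right_mono mult_mono power_mono) auto
 also have "... = moll_bd q * (2 powr (1 - ip) * ((1 / e) ^ q * e powr (1 - ip) / e)) * b" using e by (simp add: powr_mult)
 also have "(1 / e) ^ q * e powr (1 - ip) / e = e powr (- real q - ip)"
 proof -
  have "(1 / e) ^ q = e powr (- real q)" using e by (simp add: powr_minus powr_realpow power_one_over divide_inverse power_inverse)
  moreover have "e powr (1 - ip) / e = e powr (- ip)" using e by (simp add: powr_diff powr_minus divide_inverse)
  ultimately show ?thesis using e by (simp add: powr_diff powr_minus divide_inverse)
 qed
 also have "moll_bd q * (2 powr (1 - ip) * e powr (- real q - ip)) * b \<le> moll_bd q * (2 * e powr (- real q - ip)) * b"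
 proof -
  have "2 powr (1 - ip) \<le> 2 powr (1 :: real)" using ip by (intro powr_mono) auto
  then show ?thesis using moll_bd(1)[of q] b by (intro mult_right_mono mult_left_mono) auto
 qed
 finally show ?thesis by (simp add: e_def ip_def mult_ac)
qed

end

context inner_mollification
begin

text \<open>\<open>F\<close> lists the derivatives of the given function up to the integer part
  \<open>n\<close> of its smoothness, and \<open>t\<close> is the fractional part. The derivative of
  order \<open>i\<close> of the error is again an iterate, \<open>E i\<close>, so the
  \<open>n - i\<close> remaining derivatives and the fractional part all yield their powers of
  \<open>r\<close>. The claim about \<open>F n - E n\<close> prepares seminorms of order between
  \<open>n\<close> and \<open>n + 1\<close>: \<open>E n\<close> need not have a derivative, but this
  difference has one, of size \<open>H powr (t - 1)\<close>.\<close>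

lemma jackson_core:
 fixes F :: "nat => real => real" and n :: nat
 defines "E \<equiv> \<lambda>i. (T ((1 - r) ^ i) ^^ Suc n) (F i)"
  and "V \<equiv> \<lambda>x. \<Sum>l<Suc n. moll ((T 1 ^^ l) (F 0)) x"
 assumes p: "1 \<le> p" and t: "0 \<le> t" "t \<le> 1"
  and Q: "1 + 4 * moll_bd 0 \<le> Q" "real n + 16 * moll_bd 0 * R \<le> Q" "real n + 8 * moll_bd 0 * (2 * R) powr t \<le> Q"
  and F: "\<And>i. i < n ==> has_weak_deriv X 1 (F i) (F (Suc i))" "locally_integrable X (F 0)"
  and S: "0 \<le> S" "\<And>i. i \<le> n ==> Lp_norm p M (F i) \<le> ennreal S" "0 < t ==> slobodeckij_seminorm X t p (F n) \<le> ennreal S"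
 shows "smooth V"
  and "\<And>i. i \<le> n ==> has_weak_deriv X i (\<lambda>x. F 0 x - V x) (E i)"
  and "\<And>i. i \<le> n ==> Lp_norm p M (E i) \<le> ennreal (Q ^ Suc n * (r powr (real n + t - real i) * S))"
  and "0 < t ==> \<exists>G. has_weak_deriv X 1 (\<lambda>x. F n x - E n x) G \<and>
   Lp_norm p M G \<le> ennreal (real (Suc n) * Q ^ Suc n * (8 * moll_bd 1 * (2 * H) powr t / H * S))"
  and "\<bar>(deriv ^^ q) V x\<bar> \<le> real (Suc n) * Q ^ Suc n * (2 * moll_bd q * H powr (- real q - enn2real (1 / p)) * S)"
proof -
 have i: "integrable M (F i)" if "i \<le> n" for i using Lp_imp_integrable[OF p S(2)[OF that]] .
 have Q1: "1 \<le> Q" using Q(1) moll_bd(1)[of 0] by simp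
 have sm: "smooth (moll ((T 1 ^^ l) (F 0)))" for l by (intro moll_derivs T_pow_integrable i) simp
 show sV: "smooth V" unfolding V_def by (intro smooth_sum sm)
 have E0: "E 0 = (\<lambda>x. F 0 x - V x)" unfolding E_def V_def by (rule ext) (simp only: T_telescope power_0 mult_1_left)
 show "has_weak_deriv X i (\<lambda>x. F 0 x - V x) (E i)" if "i \<le> n" for i using that
 proof (induction i)
  case 0
  have "locally_integrable X (E 0)" unfolding E_def by (intro integrable_locally_integrable T_pow_integrable i) auto
  then show ?case using has_weak_deriv_0[of X "E 0"] by (simp add: E0)
 next
  case (Suc m)
  have "has_weak_deriv X 1 (E m) (E (Suc m))" unfolding E_def power_Suc2 using Suc.prems by (intro T_pow_weak_deriv i F) auto
  then show ?case using Suc by (intro has_weak_deriv_compose[of _ m _ "E m"]) auto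
 qed
 show "Lp_norm p M (E i) \<le> ennreal (Q ^ Suc n * (r powr (real n + t - real i) * S))" if "i \<le> n" for i
 proof (cases "0 < t")
  case True
  have "Lp_norm p M ((T ((1 - r) ^ i) ^^ Suc n) ((\<lambda>j. F (i + j)) 0)) \<le> ennreal (Q ^ Suc n * (r powr (real (n - i) + t) * S))"
   using that S True F by (intro T_pow_bound_frac[OF p t Q]) auto
  moreover have "real (n - i) + t = real n + t - real i" using that by simp
  ultimately show ?thesis by (simp only: E_def add_0_right)
 next
  case False
  have "Lp_norm p M ((T ((1 - r) ^ i) ^^ Suc n) ((\<lambda>j. F (i + j)) 0)) \<le> ennreal (Q ^ Suc n * (r ^ (n - i) * S))"
   using that S F by (intro T_pow_bound_int[OF p Q(1,2)]) auto
  moreover have "r ^ (n - i) = r powr (real n + t - real i)" using that False t d_pos by (simp add: powr_realpow[symmetric])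
  ultimately show ?thesis by (simp only: E_def add_0_right)
 qed
 have QS: "0 \<le> S * Q ^ l \<and> Q ^ l \<le> Q ^ Suc n" if "l < Suc n" for l
  using that Q1 S(1) power_increasing[of l "Suc n" Q] by (simp del: power_Suc)
 show "\<exists>G. has_weak_deriv X 1 (\<lambda>x. F n x - E n x) G \<and>
   Lp_norm p M G \<le> ennreal (real (Suc n) * Q ^ Suc n * (8 * moll_bd 1 * (2 * H) powr t / H * S))"
  if pos: "0 < t"
 proof -
  define a where "a = (1 - r) ^ n"
  have a: "0 \<le> a" "a \<le> 1" unfolding a_def by (rule dilation_power_bounds)+
  have ac: "0 \<le> a * (1 - r)" "a * (1 - r) \<le> 1" using a d_pos d_le by (auto intro: mult_le_one)
  define D where "D = deriv (moll (F n))"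
  define Z where "Z = 8 * moll_bd 1 * (2 * H) powr t / H * S"
  have Z: "0 \<le> Z" using moll_bd(1)[of 1] R_pos d_pos S(1) by (simp add: Z_def)
  have ms: "smooth (moll (F n))" by (intro moll_derivs i) simp
  have Di: "integrable M D" unfolding D_def by (intro smooth_integrable smooth_deriv ms)
  have Dm: "D \<in> borel_measurable M" using Di by auto
  have DZ: "Lp_norm p M D \<le> ennreal Z" unfolding D_def Z_def by (intro moll_error_slobodeckij(2)[OF p i t(1) S(1,3)]) (use pos in auto)
  have w0: "has_weak_deriv X 1 (moll (F n)) D" unfolding D_def using has_weak_deriv_smooth[OF ms, of "-R" R 1] by simp
  have wl: "has_weak_deriv X 1 ((T a ^^ l) (moll (F n))) ((T (a * (1 - r)) ^^ l) D)" for l by (intro T_pow_weak_deriv moll_integrable i w0 Di) simp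
  define G where "G x = a * (\<Sum>l<Suc n. (T (a * (1 - r)) ^^ l) D x)" for x
  \<comment> \<open>\<open>moll\<close> commutes with \<open>T a\<close> and is moved to the inside,
    so that the iterates act on a smooth function with known derivative \<open>D\<close>.\<close>
  have "F n x - E n x = a * (\<Sum>l<Suc n. (T a ^^ l) (moll (F n)) x)" for x
  proof -
   have "E n x = F n x - a * (\<Sum>l<Suc n. moll ((T a ^^ l) (F n)) x)" unfolding E_def a_def by (rule T_telescope)
   then show ?thesis using moll_T_pow[OF i[of n]] by simp
  qed
  moreover have "has_weak_deriv X 1 (\<lambda>x. a * (\<Sum>l<Suc n. (T a ^^ l) (moll (F n)) x)) G"
   unfolding G_def by (rule has_weak_deriv_cmult[OF has_weak_deriv_sum[OF _ wl]]) simp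
  ultimately have "has_weak_deriv X 1 (\<lambda>x. F n x - E n x) G" by simp
  moreover have "Lp_norm p M G \<le> ennreal (real (Suc n) * Q ^ Suc n * Z)"
  proof -
   have tm: "(T (a * (1 - r)) ^^ l) D \<in> borel_measurable M" for l using T_pow_integrable[OF Di] by auto
   have sm: "(\<lambda>x. \<Sum>l<Suc n. (T (a * (1 - r)) ^^ l) D x) \<in> borel_measurable M" by (intro borel_measurable_sum tm)
   have "Lp_norm p M (\<lambda>x. \<Sum>l<Suc n. (T (a * (1 - r)) ^^ l) D x) \<le> (\<Sum>l<Suc n. Lp_norm p M ((T (a * (1 - r)) ^^ l) D))"
    by (intro Lp_norm_sum[OF p] tm) simp
   also have "... \<le> (\<Sum>l<Suc n. ennreal (Q ^ Suc n * Z))"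
   proof (intro sum_mono)
    fix l assume l: "l \<in> {..<Suc n}"
    have "Lp_norm p M ((T (a * (1 - r)) ^^ l) D) \<le> ennreal (Q ^ l * Z)" by (rule T_pow_bound_0[OF p Q(1) ac Z DZ])
    also have "... \<le> ennreal (Q ^ Suc n * Z)" using QS[of l] l Z by (intro ennreal_leI mult_right_mono) auto
    finally show "Lp_norm p M ((T (a * (1 - r)) ^^ l) D) \<le> ennreal (Q ^ Suc n * Z)" .
   qed
   also have "... = ennreal (real (Suc n) * (Q ^ Suc n * Z))" using Q1 Z by (subst sum_ennreal) auto
   finally have "Lp_norm p M (\<lambda>x. \<Sum>l<Suc n. (T (a * (1 - r)) ^^ l) D x) \<le> ennreal (real (Suc n) * (Q ^ Suc n * Z))" .
   from Lp_norm_cmult_le'[OF p sm _ this, of a 1] show ?thesis using a Q1 Z by (simp add: G_def[abs_def] mult.assoc del: power_Suc)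
  qed
  ultimately show ?thesis unfolding Z_def by blast
 qed
 show "\<bar>(deriv ^^ q) V x\<bar> \<le> real (Suc n) * Q ^ Suc n * (2 * moll_bd q * H powr (- real q - enn2real (1 / p)) * S)"
 proof -
  have "(deriv ^^ q) V = (\<lambda>x. \<Sum>l<Suc n. (deriv ^^ q) (moll ((T 1 ^^ l) (F 0))) x)" unfolding V_def
   by (rule smooth_higher_deriv_unique(2)[of "\<lambda>q x. \<Sum>l<Suc n. (deriv ^^ q) (moll ((T 1 ^^ l) (F 0))) x"])
    (intro DERIV_sum smooth_higher_DERIV sm, simp)
  then have "\<bar>(deriv ^^ q) V x\<bar> \<le> (\<Sum>l<Suc n. \<bar>(deriv ^^ q) (moll ((T 1 ^^ l) (F 0))) x\<bar>)" by (simp only: sum_abs)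
  also have "... \<le> (\<Sum>l<Suc n. Q ^ Suc n * (2 * moll_bd q * H powr (- real q - enn2real (1 / p)) * S))"
  proof (intro sum_mono)
   fix l assume l: "l \<in> {..<Suc n}"
   have b: "Lp_norm p M ((T 1 ^^ l) (F 0)) \<le> ennreal (Q ^ l * S)" by (rule T_pow_bound_0[OF p Q(1) _ _ S(1,2)]) auto
   have "\<bar>(deriv ^^ q) (moll ((T 1 ^^ l) (F 0))) x\<bar> \<le> 2 * moll_bd q * H powr (- real q - enn2real (1 / p)) * (Q ^ l * S)"
    using Q1 S(1) by (intro moll_higher_deriv_bound[OF p _ b]) auto
   also have "... \<le> 2 * moll_bd q * H powr (- real q - enn2real (1 / p)) * (Q ^ Suc n * S)"
    using QS[of l] l S(1) moll_bd(1)[of q] by (intro mult_left_mono mult_right_mono) auto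
   finally show "\<bar>(deriv ^^ q) (moll ((T 1 ^^ l) (F 0))) x\<bar> \<le> Q ^ Suc n * (2 * moll_bd q * H powr (- real q - enn2real (1 / p)) * S)"
    by (simp add: mult_ac)
  qed
  also have "... = real (Suc n) * Q ^ Suc n * (2 * moll_bd q * H powr (- real q - enn2real (1 / p)) * S)" by (simp del: power_Suc)
  finally show ?thesis .
 qed
qed

end

section \<open>Polynomial approximation of a smooth function together with its derivatives\<close>

lemma poly_antiderivative: "\<exists>q :: real poly. pderiv q = p"
proof -
 have "p = (\<Sum>i\<le>degree p. monom (coeff p i) i)" by (simp add: poly_as_sum_of_monoms)
 also have "... = pderiv (\<Sum>i\<le>degree p. monom (coeff p i / real (Suc i)) (Suc i))"
  by (simp add: higher_pderiv_sum[of 1, simplified] pderiv_monom del: of_nat_Suc)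
 finally show ?thesis by metis
qed

lemma weierstrass_poly:
 fixes f :: "real => real"
 assumes "continuous_on {a..b} f" "0 < e"
 obtains q where "\<And>x. x \<in> {a..b} ==> \<bar>f x - poly q x\<bar> \<le> e"
proof -
 obtain g where g: "real_polynomial_function g" "\<And>x. x \<in> {a..b} ==> \<bar>f x - g x\<bar> < e"
  using Stone_Weierstrass_real_polynomial_function[OF compact_Icc assms(1,2)] by blast
 then obtain c n where "g = (\<lambda>x. \<Sum>i\<le>n. c i * x ^ i)" unfolding real_polynomial_function_iff_sum by blast
 then have "g x = poly (\<Sum>i\<le>n. monom (c i) i) x" for x by (simp add: poly_sum poly_monom)
 then show ?thesis using g(2) by (intro that[of "\<Sum>i\<le>n. monom (c i) i"]) (simp add: less_imp_le)
qed

text \<open>Weierstrass' theorem is applied to the highest derivative and the polynomial is then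
  integrated back. An integration from 0 multiplies the error by at most \<open>R\<close>, hence the
  tolerance \<open>min e (e / R)\<close> one level above.\<close>

lemma smooth_poly_approx:
 assumes "0 < R"
 shows "smooth V ==> 0 < e ==> \<exists>q :: real poly. \<forall>i\<le>L. \<forall>x\<in>{-R..R}. \<bar>(deriv ^^ i) V x - poly ((pderiv ^^ i) q) x\<bar> \<le> e"
proof (induction L arbitrary: V e)
 case 0
 obtain q where "\<And>x. x \<in> {-R..R} ==> \<bar>V x - poly q x\<bar> \<le> e"
  using weierstrass_poly[OF smooth_continuous_on[OF 0(1)] 0(2)] by blast
 then have "\<forall>i\<le>0. \<forall>x\<in>{-R..R}. \<bar>(deriv ^^ i) V x - poly ((pderiv ^^ i) q) x\<bar> \<le> e" by simp
 then show ?case by blast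
next
 case (Suc L)
 define e' where "e' = min e (e / R)"
 have e': "0 < e'" "e' \<le> e" "e' * R \<le> e" using Suc.prems assms by (auto simp: e'_def min_def field_simps)
 obtain q where q: "\<And>i x. i \<le> L ==> x \<in> {-R..R} ==> \<bar>(deriv ^^ i) (deriv V) x - poly ((pderiv ^^ i) q) x\<bar> \<le> e'"
  using Suc.IH[OF smooth_deriv[OF Suc.prems(1)] e'(1)] by blast
 obtain q1 where q1: "pderiv q1 = q" using poly_antiderivative by blast
 \<comment> \<open>The constant of integration makes the error vanish at 0.\<close>
 define q2 where "q2 = q1 + [:V 0 - poly q1 0:]"
 have dq2: "pderiv q2 = q" by (simp add: q2_def q1 pderiv_add pderiv_pCons)
 have base: "\<bar>V x - poly q2 x\<bar> \<le> e" if x: "x \<in> {-R..R}" for x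
 proof -
  define g where "g y = V y - poly q2 y" for y
  have "norm (g x - g 0) \<le> e' * norm (x - 0)"
  proof (rule field_differentiable_bound[of "closed_segment 0 x" g])
   fix y assume y: "y \<in> closed_segment 0 x"
   then have y': "y \<in> {-R..R}" using x by (auto simp: closed_segment_eq_real_ivl split: if_splits)
   show "(g has_real_derivative deriv V y - poly q y) (at y within closed_segment 0 x)" unfolding g_def dq2[symmetric]
    by (intro DERIV_diff has_field_derivative_at_within[OF smooth_DERIV[OF Suc.prems(1)]] has_field_derivative_at_within[OF poly_DERIV])
   show "norm (deriv V y - poly q y) \<le> e'" using q[of 0 y] y' by simp
  qed auto
  moreover have "g 0 = 0" by (simp add: g_def q2_def)
  moreover have "e' * \<bar>x\<bar> \<le> e' * R" using x e' by (intro mult_left_mono) auto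
  ultimately have "\<bar>g x\<bar> \<le> e" using e'(3) by simp
  then show ?thesis by (simp add: g_def)
 qed
 show ?case
 proof (intro exI[of _ q2] allI impI ballI)
  fix i x assume i: "i \<le> Suc L" and x: "x \<in> {-R..R}"
  show "\<bar>(deriv ^^ i) V x - poly ((pderiv ^^ i) q2) x\<bar> \<le> e"
  proof (cases i)
   case 0
   then show ?thesis using base[OF x] by simp
  next
   case (Suc m)
   have "\<bar>(deriv ^^ m) (deriv V) x - poly ((pderiv ^^ m) q) x\<bar> \<le> e" using q[of m x] i x Suc e' by simp
   then show ?thesis unfolding Suc funpow_Suc_right o_apply dq2 .
  qed
 qed
qed

lemma smooth_poly: "smooth (poly q)" and poly_higher_deriv: "(deriv ^^ n) (poly q) = poly ((pderiv ^^ n) q)"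
proof -
 have "(poly ((pderiv ^^ n) q) has_real_derivative poly ((pderiv ^^ Suc n) q) x) (at x)" for n x using poly_DERIV[of "(pderiv ^^ n) q" x] by simp
 from smooth_of_derivative_sequence[of "\<lambda>n. poly ((pderiv ^^ n) q)", OF this]
 show "smooth (poly q)" "(deriv ^^ n) (poly q) = poly ((pderiv ^^ n) q)" by auto
qed

lemma sobolev_norm_parts:
 assumes p: "1 \<le> p" and d: "\<And>i. i \<le> nat \<lfloor>s\<rfloor> ==> has_weak_deriv {a<..<b} i f (d i)"
  and S: "sobolev_norm {a<..<b} s p f \<le> ennreal S"
 shows "i \<le> nat \<lfloor>s\<rfloor> ==> Lp_norm p (lebesgue_on {a<..<b}) (d i) \<le> ennreal S"
  and "s - real (nat \<lfloor>s\<rfloor>) > 0 ==> slobodeckij_seminorm {a<..<b} (s - real (nat \<lfloor>s\<rfloor>)) p (d (nat \<lfloor>s\<rfloor>)) \<le> ennreal S"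
proof -
 let ?A = "\<Sum>i\<le>nat \<lfloor>s\<rfloor>. Lp_norm p (lebesgue_on {a<..<b}) (d i)"
 let ?B = "if s - real (nat \<lfloor>s\<rfloor>) > 0 then slobodeckij_seminorm {a<..<b} (s - real (nat \<lfloor>s\<rfloor>)) p (d (nat \<lfloor>s\<rfloor>)) else 0"
 have E: "sobolev_norm {a<..<b} s p f = ?A + ?B" by (rule sobolev_norm_eq[OF p d])
 have A: "?A \<le> ennreal S" and B: "?B \<le> ennreal S" using S unfolding E by (rule order_trans[rotated], simp)+
 show "Lp_norm p (lebesgue_on {a<..<b}) (d i) \<le> ennreal S" if "i \<le> nat \<lfloor>s\<rfloor>"
  using member_le_sum[of i "{..nat \<lfloor>s\<rfloor>}" "\<lambda>i. Lp_norm p (lebesgue_on {a<..<b}) (d i)"] that A by (auto intro: order_trans)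
 show "slobodeckij_seminorm {a<..<b} (s - real (nat \<lfloor>s\<rfloor>)) p (d (nat \<lfloor>s\<rfloor>)) \<le> ennreal S" if "s - real (nat \<lfloor>s\<rfloor>) > 0"
  using B unfolding if_P[OF that] .
qed

text \<open>If the next integer above \<open>v\<close> does not exceed the integer part
  \<open>n\<close> of \<open>s\<close>, the norm is interpolated between integer orders of the
  error. Otherwise \<open>n < v < s < n + 1\<close>, and no derivative of order \<open>n + 1\<close>
  is available for the interpolation. Then the near part of the seminorm of \<open>E n\<close> is
  split: \<open>F n\<close> is controlled by its own seminorm of order \<open>h\<close>, and the
  smooth difference \<open>F n - E n\<close> by its derivative.\<close>

lemma jackson_smooth:
 fixes R s v :: real and p :: ennreal and L :: nat
 assumes R: "0 < R" and p: "1 \<le> p" and v: "0 \<le> v" "v < s"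
 obtains K where "0 < K"
  "\<And>u r S. 0 \<le> S ==> sobolev_norm {-R<..<R} s p u = ennreal S ==> 0 < r ==> r < 1 ==>
   \<exists>V. smooth V \<and> sobolev_norm {-R<..<R} v p (\<lambda>x. u x - V x) \<le> ennreal (K * r powr (s - v) * S) \<and>
    (\<forall>q\<le>L. \<forall>x. \<bar>(deriv ^^ q) V x\<bar> \<le> K * r powr (- real q - enn2real (1 / p)) * S)"
proof -
 define n where "n = nat \<lfloor>s\<rfloor>"
 define h where "h = s - real n"
 define ns where "ns = nat \<lfloor>v\<rfloor>"
 define hs where "hs = v - real ns"
 have n: "real n = of_int \<lfloor>s\<rfloor>" using v by (simp add: n_def)
 have ns: "real ns = of_int \<lfloor>v\<rfloor>" using v by (simp add: ns_def)
 have h: "0 \<le> h" "h \<le> 1" "h < 1" unfolding h_def n by linarith+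
 have hs: "0 \<le> hs" "hs < 1" unfolding hs_def ns by linarith+
 have nsn: "ns \<le> n" using v unfolding n_def ns_def by (intro nat_mono floor_mono) simp
 define Q where "Q = 1 + 4 * moll_bd 0 + real n + 16 * moll_bd 0 * R + 8 * moll_bd 0 * (2 * R) powr h"
 have M0: "0 \<le> moll_bd 0" "0 \<le> moll_bd 0 * R" "0 \<le> moll_bd 0 * (2 * R) powr h" using moll_bd(1)[of 0] R by auto
 have Q: "1 + 4 * moll_bd 0 \<le> Q" "real n + 16 * moll_bd 0 * R \<le> Q" "real n + 8 * moll_bd 0 * (2 * R) powr h \<le> Q"
  using M0 unfolding Q_def by linarith+
 define QQ where "QQ = Q ^ Suc n"
 have Q1: "1 \<le> Q" using Q(1) M0 by linarith
 have QQ: "1 \<le> QQ" unfolding QQ_def using Q1 by (rule one_le_power)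
 define t where "t = (if 0 < hs then hs else 1 / 2)"
 have t: "0 < t" "t < 1" using hs by (auto simp: t_def)
 show ?thesis
 proof (rule sobolev_norm_le_of_derivs[OF p v(1)], rule slobodeckij_seminorm_le_near[OF p t(1)], rule slobodeckij_near_bound[OF p t], goal_cases)
 case (1 K1 K2 K3)
 note K1 = 1(1,2) and K2 = 1(3,4) and K3 = 1(5,6)
 define ip where "ip = enn2real (1 / p)"
 define \<kappa> where "\<kappa> = real (Suc n) * QQ * (8 * moll_bd 1 * (2 * R) powr h / R)"
 have \<kappa>: "0 \<le> \<kappa>" unfolding \<kappa>_def using QQ moll_bd(1)[of 1] R by (intro mult_nonneg_nonneg divide_nonneg_nonneg) auto
 define Kc where "Kc q = real (Suc n) * QQ * (2 * moll_bd q * R powr (- real q - ip))" for q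
 have Kc: "0 \<le> Kc q" for q unfolding Kc_def using QQ moll_bd(1)[of q] by (intro mult_nonneg_nonneg) auto
 define Ka where "Ka = K1 * QQ"
 define Kb where "Kb = real (Suc n) * QQ + (1 + K3 * \<kappa> + K2 * QQ)"
 define K where "K = Ka + Kb + (\<Sum>q\<le>L. Kc q)"
 have Kab: "0 < Ka" "0 < Kb" unfolding Ka_def Kb_def using K1(1) K2(1) K3(1) \<kappa> QQ by (auto intro!: add_nonneg_pos add_pos_nonneg mult_pos_pos)
 have Ks: "0 \<le> (\<Sum>q\<le>L. Kc q)" by (intro sum_nonneg Kc)
 show ?thesis
 proof (rule that[of K], goal_cases)
  case 1
  show ?case unfolding K_def using Kab Ks by linarith
 next
  case (2 u r S)
  note S = 2(1,2) and r = 2(3,4)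
  interpret inner_mollification R r by unfold_locales (use R r in auto)
  have w: "has_weak_deriv X i u (weak_deriv X i u)" if "i \<le> n" for i
   using S that by (intro sobolev_norm_finite_weak_deriv[of _ s p]) (auto simp: n_def)
  define F where "F i = (if i = 0 then u else weak_deriv X i u)" for i
  have lu: "locally_integrable X u" using w[of 0] unfolding has_weak_deriv_def by simp
  have F: "has_weak_deriv X i u (F i)" if "i \<le> n" for i using w[OF that] has_weak_deriv_0[OF lu] by (simp add: F_def)
  have F0: "F 0 = u" by (simp add: F_def)
  have chain: "has_weak_deriv X 1 (F i) (F (Suc i))" if "i < n" for i using F[of i] F[of "Suc i"] that by (intro has_weak_deriv_step[of _ i u]) auto
  have FS: "Lp_norm p M (F i) \<le> ennreal S" if "i \<le> n" for i
   using S that F by (intro sobolev_norm_parts(1)[OF p, where s = s and f = u and d = F]) (auto simp: n_def)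
  have Fs: "slobodeckij_seminorm X h p (F n) \<le> ennreal S" if "0 < h"
   using S that F unfolding h_def n_def by (intro sobolev_norm_parts(2)[OF p, where s = s and f = u and d = F]) simp_all
  have lF: "locally_integrable X (F 0)" using lu by (simp add: F0)
  define E where "E i = (T ((1 - r) ^ i) ^^ Suc n) (F i)" for i
  define V where "V x = (\<Sum>l<Suc n. moll ((T 1 ^^ l) (F 0)) x)" for x
  note core = jackson_core[OF p h(1,2) Q chain lF S(1) FS Fs, folded E_def V_def QQ_def ip_def]
  have sV: "smooth V" by (rule core(1))
  have wE: "has_weak_deriv X i (\<lambda>x. u x - V x) (E i)" if "i \<le> n" for i using core(2)[OF _ _ _ that] by (simp add: F0)
  have LE: "Lp_norm p M (E i) \<le> ennreal (QQ * (r powr (s - real i) * S))" if "i \<le> n" for i using core(3)[OF _ _ _ that] by (simp add: h_def)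
  have sob: "sobolev_norm X v p (\<lambda>x. u x - V x) \<le> ennreal ((Ka + Kb) * r powr (s - v) * S)"
  proof (cases "nat \<lceil>v\<rceil> \<le> n")
   case True
   have "sobolev_norm X v p (\<lambda>x. u x - V x) \<le> ennreal (K1 * (QQ * (r powr s * S)) * r powr (- v))"
   proof (rule K1(2))
    show "has_weak_deriv X i (\<lambda>x. u x - V x) (E i)" if "i \<le> nat \<lceil>v\<rceil>" for i by (rule wE[OF order_trans[OF that True]])
    show "Lp_norm p M (E i) \<le> ennreal (QQ * (r powr s * S) * r powr (- real i))" if "i \<le> nat \<lceil>v\<rceil>" for i
    proof -
     have "r powr (s - real i) = r powr s * r powr (- real i)" by (simp add: powr_add[symmetric])
     then show ?thesis using LE[OF order_trans[OF that True]] by (simp add: mult_ac)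
    qed
   qed (use R r QQ S in auto)
   also have "K1 * (QQ * (r powr s * S)) * r powr (- v) = Ka * r powr (s - v) * S"
   proof -
    have "r powr (s - v) = r powr s * r powr (- v)" by (simp add: powr_add[symmetric])
    then show ?thesis by (simp add: Ka_def mult_ac)
   qed
   also have "ennreal ... \<le> ennreal ((Ka + Kb) * r powr (s - v) * S)" using Kab S by (intro ennreal_leI mult_right_mono) auto
   finally show ?thesis .
  next
   case False
   then have "int n < \<lceil>v\<rceil>" by linarith
   then have nv: "real n < v" by linarith
   have nsn': "ns = n"
   proof -
    have "n \<le> nat \<lfloor>v\<rfloor>" using nv by (simp add: le_nat_floor)
    then show ?thesis using nsn by (simp add: ns_def)
   qed
   have ts: "0 < hs" "hs < h" "h - hs = s - v" using nv v by (auto simp: hs_def h_def nsn')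
   have t0: "0 < h" and tt: "t = hs" using ts by (auto simp: t_def)
   define Z where "Z = r powr (s - v) * S"
   have Z: "0 \<le> Z" using S by (simp add: Z_def)
   have mF: "F n \<in> borel_measurable M" and mE: "E n \<in> borel_measurable M"
    using has_weak_deriv_measurable(1)[OF F[of n]] has_weak_deriv_measurable(1)[OF wE[of n]] by auto
   obtain G where G: "has_weak_deriv X 1 (\<lambda>x. F n x - E n x) G"
    "Lp_norm p M G \<le> ennreal (real (Suc n) * QQ * (8 * moll_bd 1 * (2 * (r * R)) powr h / (r * R) * S))" using core(4)[OF _ _ _ t0] by auto
   have G': "has_weak_deriv X 1 (\<lambda>x. - 1 * (F n x - E n x)) (\<lambda>x. - 1 * G x)" by (rule has_weak_deriv_cmult[OF G(1)])
   have kz: "real (Suc n) * QQ * (8 * moll_bd 1 * (2 * (r * R)) powr h / (r * R) * S) = \<kappa> * (r powr (h - 1) * S)"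
    using R r by (simp add: \<kappa>_def powr_mult powr_diff divide_simps)
   have kz0: "0 \<le> \<kappa> * (r powr (h - 1) * S)" using \<kappa> S by simp
   have LG: "Lp_norm p M (\<lambda>x. - 1 * G x) \<le> ennreal (\<kappa> * (r powr (h - 1) * S))"
    using Lp_norm_cmult_le'[OF p has_weak_deriv_measurable(1)[OF G(1)] kz0 G(2)[unfolded kz], of "-1" 1] by simp
   have iG: "integrable M (\<lambda>x. - 1 * G x)" by (rule Lp_imp_integrable[OF p LG])
   have RR: "- R < R" using R by simp
   have mG: "(\<lambda>x. - 1 * (F n x - E n x)) \<in> borel_measurable M" "(\<lambda>x. - 1 * G x) \<in> borel_measurable M"
    using has_weak_deriv_measurable[OF G'] by auto
   have near1: "slobodeckij_near X hs p r (\<lambda>x. - 1 * (F n x - E n x)) \<le> ennreal (K3 * r powr (1 - hs) * (\<kappa> * (r powr (h - 1) * S)))"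
    using K3(2)[unfolded tt, OF _ mG weak_deriv_increment_pair[OF RR G' iG] kz0 r(1) LG] by simp
   have near2: "slobodeckij_near X hs p r (F n) \<le> ennreal Z"
   proof -
    have "slobodeckij_near X hs p r (F n) \<le> ennreal (r powr (h - hs)) * slobodeckij_seminorm X h p (F n)"
     using ts r by (intro slobodeckij_near_le[OF p mF]) auto
    also have "... \<le> ennreal (r powr (h - hs)) * ennreal S" by (intro mult_left_mono Fs t0) simp
    finally show ?thesis using S ts by (simp add: Z_def ennreal_mult)
   qed
   have Zk: "K3 * r powr (1 - hs) * (\<kappa> * (r powr (h - 1) * S)) = K3 * \<kappa> * Z"
   proof -
    have "r powr (1 - hs) * r powr (h - 1) = r powr (s - v)" using ts by (simp add: powr_add[symmetric])
    then show ?thesis by (simp add: Z_def algebra_simps)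
   qed
   have near: "slobodeckij_near X hs p r (E n) \<le> ennreal (Z + K3 * \<kappa> * Z)"
   proof -
    have "E n = (\<lambda>x. F n x + - 1 * (F n x - E n x))" by auto
    then have "slobodeckij_near X hs p r (E n) \<le> slobodeckij_near X hs p r (F n) + slobodeckij_near X hs p r (\<lambda>x. - 1 * (F n x - E n x))"
     using slobodeckij_near_triangle[OF p mF mG(1), of hs r] by simp
    also have "... \<le> ennreal Z + ennreal (K3 * \<kappa> * Z)" using near2 near1 unfolding Zk by (rule add_mono)
    also have "... = ennreal (Z + K3 * \<kappa> * Z)" using Z K3(1) \<kappa> by (intro ennreal_plus[symmetric]) auto
    finally show ?thesis .
   qed
   have "slobodeckij_seminorm X hs p (E n) \<le> slobodeckij_near X hs p r (E n) + ennreal (K2 * r powr (- hs) * (QQ * (r powr (s - real n) * S)))"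
    using LE[of n] S QQ by (intro K2(2)[unfolded tt, OF _ mE _ r(1)]) auto
   also have "K2 * r powr (- hs) * (QQ * (r powr (s - real n) * S)) = K2 * QQ * Z"
   proof -
    have "r powr (- hs) * r powr (s - real n) = r powr (s - v)" by (simp add: powr_add[symmetric] hs_def nsn')
    then show ?thesis by (simp add: Z_def algebra_simps)
   qed
   also have "slobodeckij_near X hs p r (E n) + ennreal (K2 * QQ * Z) \<le> ennreal (Z + K3 * \<kappa> * Z) + ennreal (K2 * QQ * Z)"
    by (rule add_right_mono[OF near])
   also have "... = ennreal (Z + K3 * \<kappa> * Z + K2 * QQ * Z)" using Z K2(1) K3(1) \<kappa> QQ by (intro ennreal_plus[symmetric]) auto
   finally have semi: "slobodeckij_seminorm X hs p (E n) \<le> ennreal ((1 + K3 * \<kappa> + K2 * QQ) * Z)" by (simp add: algebra_simps)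
   have "(\<Sum>i\<le>n. Lp_norm p M (E i)) \<le> (\<Sum>i\<le>n. ennreal (QQ * Z))"
   proof (intro sum_mono)
    fix i assume i: "i \<in> {..n}"
    have "Lp_norm p M (E i) \<le> ennreal (QQ * (r powr (s - real i) * S))" using LE i by simp
    also have "... \<le> ennreal (QQ * Z)" unfolding Z_def using i nv S QQ r by (intro ennreal_leI mult_left_mono mult_right_mono powr_mono') auto
    finally show "Lp_norm p M (E i) \<le> ennreal (QQ * Z)" .
   qed
   also have "... = ennreal (real (Suc n) * (QQ * Z))" using QQ Z by (subst sum_ennreal) auto
   finally have sumL: "(\<Sum>i\<le>n. Lp_norm p M (E i)) \<le> ennreal (real (Suc n) * (QQ * Z))" .
   have "sobolev_norm X v p (\<lambda>x. u x - V x) = (\<Sum>i\<le>nat \<lfloor>v\<rfloor>. Lp_norm p M (E i)) +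
    (if v - real (nat \<lfloor>v\<rfloor>) > 0 then slobodeckij_seminorm X (v - real (nat \<lfloor>v\<rfloor>)) p (E (nat \<lfloor>v\<rfloor>)) else 0)"
    using wE nsn' by (intro sobolev_norm_eq[OF p]) (simp add: ns_def)
   also have "... = (\<Sum>i\<le>n. Lp_norm p M (E i)) + slobodeckij_seminorm X hs p (E n)"
    using ts(1) unfolding ns_def[symmetric] hs_def nsn' by simp
   also have "... \<le> ennreal (real (Suc n) * (QQ * Z)) + ennreal ((1 + K3 * \<kappa> + K2 * QQ) * Z)" by (rule add_mono[OF sumL semi])
   also have "... = ennreal (real (Suc n) * (QQ * Z) + (1 + K3 * \<kappa> + K2 * QQ) * Z)"
    using Z K2(1) K3(1) \<kappa> QQ by (intro ennreal_plus[symmetric]) auto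
   also have "real (Suc n) * (QQ * Z) + (1 + K3 * \<kappa> + K2 * QQ) * Z = Kb * Z" by (simp add: Kb_def algebra_simps)
   also have "ennreal (Kb * Z) \<le> ennreal ((Ka + Kb) * r powr (s - v) * S)"
    unfolding Z_def mult.assoc using Kab S by (intro ennreal_leI mult_right_mono) auto
   finally show ?thesis .
  qed
  show ?case
  proof (intro exI[of _ V] conjI sV allI impI)
   have "ennreal ((Ka + Kb) * r powr (s - v) * S) \<le> ennreal (K * r powr (s - v) * S)"
    using Ks S unfolding K_def by (intro ennreal_leI mult_right_mono) auto
   with sob show "sobolev_norm X v p (\<lambda>x. u x - V x) \<le> ennreal (K * r powr (s - v) * S)" by (rule order_trans)
   fix q x assume q: "q \<le> L"
   have "\<bar>(deriv ^^ q) V x\<bar> \<le> real (Suc n) * QQ * (2 * moll_bd q * (r * R) powr (- real q - ip) * S)" by (rule core(5))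
   also have "... = Kc q * (r powr (- real q - ip) * S)" using R r by (simp add: Kc_def powr_mult mult_ac)
   also have "... \<le> K * (r powr (- real q - ip) * S)"
   proof (intro mult_right_mono)
    have "Kc q \<le> (\<Sum>q\<le>L. Kc q)" using q Kc by (intro member_le_sum) auto
    then show "Kc q \<le> K" unfolding K_def using Kab by linarith
   qed (use S in simp)
   finally show "\<bar>(deriv ^^ q) V x\<bar> \<le> K * r powr (- real q - enn2real (1 / p)) * S" by (simp add: ip_def mult_ac)
  qed
 qed
 qed
qed

lemma sobolev_norm_smooth_le:
 fixes R s :: real and p :: ennreal
 assumes R: "0 < R" and p: "1 \<le> p" and s: "0 \<le> s"
 obtains K where "0 < K" "\<And>g e. smooth g ==> 0 \<le> e ==> (\<And>i x. i \<le> nat \<lceil>s\<rceil> ==> x \<in> {-R<..<R} ==> \<bar>(deriv ^^ i) g x\<bar> \<le> e) ==>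
  sobolev_norm {-R<..<R} s p g \<le> ennreal (K * e)"
proof (rule sobolev_norm_le_of_derivs[OF p s], goal_cases)
 case (1 K)
 define v where "v = (if p = \<infinity> then 1 else (2 * R) powr enn2real (1 / p))"
 have v: "0 < v" using R by (simp add: v_def)
 show ?case
 proof (rule 1(1)[of "K * v"])
  show "0 < K * v" using 1(2) v by simp
  fix g and e :: real
  assume g: "smooth g" and e: "0 \<le> e" and b: "\<And>i x. i \<le> nat \<lceil>s\<rceil> ==> x \<in> {-R<..<R} ==> \<bar>(deriv ^^ i) g x\<bar> \<le> e"
  have "sobolev_norm {-R<..<R} s p g \<le> ennreal (K * (e * v) * 1 powr (- s))"
  proof (rule 1(3))
   show "has_weak_deriv {-R<..<R} i g ((deriv ^^ i) g)" for i by (rule has_weak_deriv_smooth[OF g])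
   show "Lp_norm p (lebesgue_on {-R<..<R}) ((deriv ^^ i) g) \<le> ennreal (e * v * 1 powr (- real i))" if "i \<le> nat \<lceil>s\<rceil>" for i
   proof -
    have "Lp_norm p (lebesgue_on {-R<..<R}) ((deriv ^^ i) g) \<le> ennreal (e * v)" unfolding v_def
    proof (rule Lp_norm_le_bounded_on[OF p])
     show "(deriv ^^ i) g \<in> borel_measurable (lebesgue_on {-R<..<R})" using smooth_higher_deriv[OF g] by simp
     show "{-R<..<R} \<in> sets (lebesgue_on {-R<..<R})" by (simp add: sets_restrict_space_iff)
     have "emeasure (lebesgue_on {-R<..<R}) ({-R<..<R} \<inter> {-R<..<R}) \<le> emeasure lebesgue {-R<..<R}" by (rule emeasure_lebesgue_on_le) auto
     also have "... = ennreal (2 * R)" using R by simp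
     finally show "emeasure (lebesgue_on {-R<..<R}) {-R<..<R} \<le> ennreal (2 * R)" by simp
     show "AE x in lebesgue_on {-R<..<R}. \<bar>(deriv ^^ i) g x\<bar> \<le> e * indicator {-R<..<R} x" using b[OF that] by (intro AE_I2) simp
    qed (use R e in auto)
    then show ?thesis by simp
   qed
  qed (use R e v in auto)
  then show "sobolev_norm {-R<..<R} s p g \<le> ennreal (K * v * e)" by (simp add: mult_ac)
 qed
qed

text \<open>The polynomial is controlled up to the order \<open>L\<close> only; the local error
  analysis uses the derivatives up to order \<open>2 * N\<close>, so \<open>L\<close> will be
  \<open>2 * N\<close>.\<close>

lemma jackson_poly:
 fixes R s v :: real and p :: ennreal and L :: nat
 assumes R: "0 < R" and p: "1 \<le> p" and v: "0 \<le> v" "v \<le> s"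
 obtains K where "0 < K"
  "\<And>u d S. 0 \<le> S ==> sobolev_norm {-R<..<R} s p u = ennreal S ==> 0 < d ==> d < 1 ==>
   \<exists>P :: real poly. sobolev_norm {-R<..<R} v p (\<lambda>x. u x - poly P x) \<le> ennreal (K * d powr (s - v) * S) \<and>
    (\<forall>q\<le>L. \<forall>x\<in>{-R..R}. \<bar>poly ((pderiv ^^ q) P) x\<bar> \<le> K * d powr (- real q - enn2real (1 / p)) * S)"
proof (cases "v = s")
 case True
 show ?thesis
 proof (rule that[of 1], goal_cases)
  case (2 u d S)
  then have "sobolev_norm {-R<..<R} v p (\<lambda>x. u x - poly 0 x) \<le> ennreal (1 * d powr (s - v) * S)" using True by simp
  moreover have "(pderiv ^^ q) 0 = (0 :: real poly)" for q by (induction q) auto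
  then have "\<forall>q\<le>L. \<forall>x\<in>{-R..R}. \<bar>poly ((pderiv ^^ q) 0) x\<bar> \<le> 1 * d powr (- real q - enn2real (1 / p)) * S" using 2 by simp
  ultimately show ?case by blast
 qed simp
next
 case False
 then have lt: "v < s" using v by simp
 define L' where "L' = max L (nat \<lceil>v\<rceil>)"
 show ?thesis
 proof (rule jackson_smooth[OF R p v(1) lt, of L'], goal_cases)
  case J: (1 K)
  show ?case
  proof (rule sobolev_norm_smooth_le[OF R p v(1)], goal_cases)
   case M: (1 K')
   show ?case
   proof (rule that[of "K + K' + 1"], goal_cases)
    case 1
    show ?case using J(1) M(1) by simp
   next
    case (2 u d S)
    note S = 2(1,2) and d = 2(3,4)
    obtain V where V: "smooth V" "sobolev_norm {-R<..<R} v p (\<lambda>x. u x - V x) \<le> ennreal (K * d powr (s - v) * S)"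
     "\<And>q x. q \<le> L' ==> \<bar>(deriv ^^ q) V x\<bar> \<le> K * d powr (- real q - enn2real (1 / p)) * S" using J(2)[OF S d] by blast
    \<comment> \<open>Since \<open>d < 1\<close>, this accuracy is below
      \<open>d powr (s - v) * S\<close> and also below \<open>d powr (- q - 1 / p) * S\<close>.
      Replacing \<open>V\<close> by a polynomial thus changes nothing but constants.\<close>
    define e where "e = d powr s * S"
    have e: "0 \<le> e" using S by (simp add: e_def)
    have "\<exists>P :: real poly. \<forall>i\<le>L'. \<forall>x\<in>{-R..R}. \<bar>(deriv ^^ i) V x - poly ((pderiv ^^ i) P) x\<bar> \<le> e"
    proof (cases "S = 0")
     \<comment> \<open>The tolerance is 0, but the derivative bounds already force \<open>V\<close>
       and its derivatives to vanish.\<close>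
     case True
     have "\<bar>(deriv ^^ i) V x - poly ((pderiv ^^ i) 0) x\<bar> \<le> e" if "i \<le> L'" for i x
     proof -
      have "(pderiv ^^ i) 0 = (0 :: real poly)" by (induction i) auto
      then show ?thesis using V(3)[OF that, of x] True by (simp add: e_def)
     qed
     then show ?thesis by blast
    next
     case False
     then have "0 < e" using S d by (simp add: e_def)
     then show ?thesis by (rule smooth_poly_approx[OF R V(1)])
    qed
    then obtain P :: "real poly" where P: "\<And>i x. i \<le> L' ==> x \<in> {-R..R} ==> \<bar>(deriv ^^ i) V x - poly ((pderiv ^^ i) P) x\<bar> \<le> e"
     by blast
    have sd: "smooth (\<lambda>x. V x - poly P x)" by (intro smooth_diff V smooth_poly)
    have dd: "(deriv ^^ i) (\<lambda>x. V x - poly P x) = (\<lambda>x. (deriv ^^ i) V x - poly ((pderiv ^^ i) P) x)" for i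
     by (rule smooth_higher_deriv_unique(2)[of "\<lambda>i x. (deriv ^^ i) V x - poly ((pderiv ^^ i) P) x"])
      (auto simp: poly_higher_deriv[symmetric] simp del: funpow.simps intro!: DERIV_diff smooth_higher_DERIV V smooth_poly)
    have "sobolev_norm {-R<..<R} v p (\<lambda>x. V x - poly P x) \<le> ennreal (K' * e)" using P by (intro M(2)[OF sd e]) (simp add: dd L'_def)
    then have "sobolev_norm {-R<..<R} v p (\<lambda>x. (u x - V x) + (V x - poly P x)) \<le> ennreal (K * d powr (s - v) * S) + ennreal (K' * e)"
     using V(2) by (intro order_trans[OF sobolev_norm_triangle[OF p]] add_mono)
    also have "... = ennreal (K * d powr (s - v) * S + K' * e)" using J(1) M(1) S e by (intro ennreal_plus[symmetric]) auto
    also have "... \<le> ennreal ((K + K' + 1) * d powr (s - v) * S)"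
    proof (rule ennreal_leI)
     have "e \<le> d powr (s - v) * S" unfolding e_def using v d S by (intro mult_right_mono powr_mono') auto
     then have "K' * e \<le> K' * (d powr (s - v) * S)" using M(1) by (intro mult_left_mono) auto
     moreover have "0 \<le> d powr (s - v) * S" using S by simp
     ultimately show "K * d powr (s - v) * S + K' * e \<le> (K + K' + 1) * d powr (s - v) * S" by (simp add: algebra_simps)
    qed
    finally have p1: "sobolev_norm {-R<..<R} v p (\<lambda>x. u x - poly P x) \<le> ennreal ((K + K' + 1) * d powr (s - v) * S)" by simp
    have p2: "\<bar>poly ((pderiv ^^ q) P) x\<bar> \<le> (K + K' + 1) * d powr (- real q - enn2real (1 / p)) * S" if q: "q \<le> L" and x: "x \<in> {-R..R}" for q x
    proof -
     have qL: "q \<le> L'" using q by (simp add: L'_def)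
     have "0 \<le> enn2real (1 / p)" by simp
     then have "- real q - enn2real (1 / p) \<le> s" using v by linarith
     then have "e \<le> d powr (- real q - enn2real (1 / p)) * S" unfolding e_def using d S by (intro mult_right_mono powr_mono') auto
     moreover have "0 \<le> K' * (d powr (- real q - enn2real (1 / p)) * S)" using M(1) S by simp
     ultimately show ?thesis using P[OF qL x] V(3)[OF qL, of x] by (simp add: algebra_simps)
    qed
    show ?case using p1 p2 by blast
   qed
  qed
 qed
qed

section \<open>Trigonometric interpolation of Taylor coefficients\<close>

lemma inverse_matrix_eqI:
 assumes A: "A \<in> carrier_mat n n" and B: "B \<in> carrier_mat n n" and BA: "B * A = 1\<^sub>m n"
 shows "inverse_matrix A = B"
proof (cases "mat_inverse A")
 case None
 have AB: "A * B = 1\<^sub>m n" by (rule mat_mult_left_right_inverse[OF B A BA])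
 have "A \<in> Units (ring_mat TYPE(real) n b)" for b :: unit using A B AB BA unfolding Units_def by (auto simp: ring_mat_def)
 then show ?thesis using mat_inverse(1)[OF A None, of "()"] by blast
next
 case (Some C)
 then have C: "A * C = 1\<^sub>m n" "C \<in> carrier_mat n n" using mat_inverse(2)[OF A Some] by auto
 have "B = B * (A * C)" using B C by simp
 also have "... = (B * A) * C" by (rule assoc_mult_mat[OF B A C(2), symmetric])
 also have "... = C" using C BA by simp
 finally show ?thesis using Some by (simp add: inverse_matrix_def)
qed

lemma inverse_matrix_singular:
 assumes A: "A \<in> carrier_mat n n" and "\<And>B. B \<in> carrier_mat n n ==> B * A \<noteq> 1\<^sub>m n"
 shows "inverse_matrix A = 0\<^sub>m n n"
proof (cases "mat_inverse A")
 case None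
 then show ?thesis using A by (simp add: inverse_matrix_def)
next
 case (Some C)
 then show ?thesis using mat_inverse(2)[OF A Some] assms(2) by blast
qed

text \<open>The nodes are \<open>- (k j)\<^sup>2\<close>, the numbers whose powers fill the
  Vandermonde matrix. The coefficients of this polynomial form row \<open>i\<close> of the inverse
  matrix.\<close>

definition lagrange_poly :: "nat => (nat => real) => nat => real poly" where
 "lagrange_poly N k i = Polynomial.smult (\<Prod>j\<in>{..<N} - {i}. 1 / ((k j)\<^sup>2 - (k i)\<^sup>2)) (\<Prod>j\<in>{..<N} - {i}. [:(k j)\<^sup>2, 1:])"

definition distinct_squares :: "nat => (nat => real) => bool" where
 "distinct_squares N k \<longleftrightarrow> (\<forall>i<N. \<forall>j<N. i \<noteq> j --> (k i)\<^sup>2 \<noteq> (k j)\<^sup>2)"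

lemma degree_lagrange_poly: "i < N ==> degree (lagrange_poly N k i) < N"
proof -
 assume i: "i < N"
 have "degree (lagrange_poly N k i) \<le> degree (\<Prod>j\<in>{..<N} - {i}. [:(k j)\<^sup>2, 1:])"
  unfolding lagrange_poly_def by (rule degree_smult_le)
 also have "... \<le> (\<Sum>j\<in>{..<N} - {i}. degree [:(k j)\<^sup>2, 1:])"
  using degree_prod_sum_le[of "{..<N} - {i}" "\<lambda>j. [:(k j)\<^sup>2, 1:]"] by (simp add: o_def)
 also have "... = N - 1" using i by simp
 finally show ?thesis using i by simp
qed

lemma poly_sum_lessThan: "degree p < N ==> poly p x = (\<Sum>l<N. coeff p l * (x :: real) ^ l)"
 unfolding poly_altdef by (intro sum.mono_neutral_left) (auto simp: coeff_eq_0)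

lemma poly_lagrange_poly:
 assumes d: "distinct_squares N k" and "i < N" "j < N"
 shows "poly (lagrange_poly N k i) (- (k j)\<^sup>2) = (if i = j then 1 else 0)"
proof (cases "i = j")
 case True
 have "(\<Prod>l\<in>{..<N} - {i}. 1 / ((k l)\<^sup>2 - (k i)\<^sup>2)) * (\<Prod>l\<in>{..<N} - {i}. (k l)\<^sup>2 - (k i)\<^sup>2) = 1"
  unfolding prod.distrib[symmetric] using d assms by (intro prod.neutral) (auto simp: distinct_squares_def)
 then show ?thesis using True by (simp add: lagrange_poly_def poly_prod)
next
 case False
 then have "(\<Prod>l\<in>{..<N} - {i}. (k l)\<^sup>2 - (k j)\<^sup>2) = 0" using assms by (intro prod_zero) auto
 then show ?thesis using False by (simp add: lagrange_poly_def poly_prod)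
qed

lemma vandermonde_carrier: "vandermonde_mat N k \<in> carrier_mat N N" by (simp add: vandermonde_mat_def)

lemma inverse_vandermonde:
 assumes d: "distinct_squares N k"
 shows "inverse_matrix (vandermonde_mat N k) = Matrix.mat N N (\<lambda>(i, l). coeff (lagrange_poly N k i) l)"
proof (rule inverse_matrix_eqI[OF vandermonde_carrier])
 show "Matrix.mat N N (\<lambda>(i, l). coeff (lagrange_poly N k i) l) * vandermonde_mat N k = 1\<^sub>m N"
 proof (rule eq_matI)
  fix i j assume ij: "i < dim_row (1\<^sub>m N :: real mat)" "j < dim_col (1\<^sub>m N :: real mat)"
  then have "(Matrix.mat N N (\<lambda>(i, l). coeff (lagrange_poly N k i) l) * vandermonde_mat N k) $$ (i, j)
   = (\<Sum>l<N. coeff (lagrange_poly N k i) l * (- (k j)\<^sup>2) ^ l)" by (simp add: vandermonde_mat_def scalar_prod_def lessThan_atLeast0)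
  also have "... = poly (lagrange_poly N k i) (- (k j)\<^sup>2)" using ij by (intro poly_sum_lessThan[symmetric] degree_lagrange_poly) simp
  also have "... = 1\<^sub>m N $$ (i, j)" using poly_lagrange_poly[OF d] ij by simp
  finally show "(Matrix.mat N N (\<lambda>(i, l). coeff (lagrange_poly N k i) l) * vandermonde_mat N k) $$ (i, j) = 1\<^sub>m N $$ (i, j)" .
 qed (simp_all add: vandermonde_mat_def)
qed simp

lemma inverse_vandermonde_singular:
 assumes "\<not> distinct_squares N k"
 shows "inverse_matrix (vandermonde_mat N k) = 0\<^sub>m N N"
proof (rule inverse_matrix_singular[OF vandermonde_carrier])
 fix B :: "real mat" assume B: "B \<in> carrier_mat N N"
 obtain i j where ij: "i < N" "j < N" "i \<noteq> j" "(k i)\<^sup>2 = (k j)\<^sup>2" using assms unfolding distinct_squares_def by blast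
 show "B * vandermonde_mat N k \<noteq> 1\<^sub>m N"
 proof
  assume e: "B * vandermonde_mat N k = 1\<^sub>m N"
  have "(B * vandermonde_mat N k) $$ (i, i) = (B * vandermonde_mat N k) $$ (i, j)" using B ij by (simp add: vandermonde_mat_def scalar_prod_def)
  then show False unfolding e using ij by simp
 qed
qed

text \<open>The value 0 for repeated nodes reproduces the default of \<open>inverse_matrix\<close>
  for singular matrices.\<close>

definition interp_coeff :: "nat => (nat => real) => (nat => real) => nat => real" where
 "interp_coeff N k t i = (if distinct_squares N k then \<Sum>l<N. coeff (lagrange_poly N k i) l * t l else 0)"

lemma inverse_vandermonde_mult:
 assumes i: "i < N"
 shows "vec_index (inverse_matrix (vandermonde_mat N k) *\<^sub>v Matrix.vec N t) i = interp_coeff N k t i"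
proof (cases "distinct_squares N k")
 case True
 then show ?thesis using i by (simp add: inverse_vandermonde interp_coeff_def scalar_prod_def lessThan_atLeast0)
next
 case False
 then show ?thesis using i by (simp add: inverse_vandermonde_singular interp_coeff_def scalar_prod_def)
qed

lemma inverse_mat_diag:
 "inverse_matrix (mat_diag N k) = (if \<forall>i<N. k i \<noteq> 0 then mat_diag N (\<lambda>i. 1 / k i) else 0\<^sub>m N N)" for k :: "nat => real"
proof (cases "\<forall>i<N. k i \<noteq> 0")
 case True
 have "mat_diag N (\<lambda>i. 1 / k i) * mat_diag N k = 1\<^sub>m N" using True by (simp add: mat_diag_diag) (auto simp: mat_diag_def)
 then show ?thesis using True by (simp add: inverse_matrix_eqI[of _ N])
next
 case False
 then obtain i where i: "i < N" "k i = 0" by blast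
 have "inverse_matrix (mat_diag N k) = 0\<^sub>m N N"
 proof (rule inverse_matrix_singular)
  fix B :: "real mat" assume B: "B \<in> carrier_mat N N"
  show "B * mat_diag N k \<noteq> 1\<^sub>m N"
  proof
   assume e: "B * mat_diag N k = 1\<^sub>m N"
   have "(B * mat_diag N k) $$ (i, i) = 0" using B i by (simp add: mat_diag_mult_right)
   then show False unfolding e using i by simp
  qed
 qed simp
 then show ?thesis by (simp only: False if_False)
qed

text \<open>The formula covers every realisation, including the null set of singular matrices; the
  measurability of the error is derived from it on the whole sample space.\<close>

lemma rf_operator_eq:
 "rf_operator varpi N k \<mu> C c v x = (if rf_event varpi N k \<mu> C c then
   \<Sum>i<N. interp_coeff N k (\<lambda>l. (deriv ^^ (2 * l)) v 0) i * cos (k i * x)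
    + (if \<forall>i<N. k i \<noteq> 0 then 1 / k i * interp_coeff N k (\<lambda>l. (deriv ^^ (2 * l + 1)) v 0) i else 0) * sin (k i * x) else 0)"
proof -
 define w where "w = inverse_matrix (vandermonde_mat N k) *\<^sub>v taylor_odd N v"
 have dim: "dim_row (inverse_matrix (vandermonde_mat N k)) = N"
  by (cases "distinct_squares N k") (simp_all add: inverse_vandermonde inverse_vandermonde_singular)
 have w: "w \<in> carrier_vec N" unfolding w_def by (simp add: carrier_vecI dim)
 have Y: "vec_index (inverse_matrix (mat_diag N k) *\<^sub>v w) i
   = (if \<forall>i<N. k i \<noteq> 0 then 1 / k i * interp_coeff N k (\<lambda>l. (deriv ^^ (2 * l + 1)) v 0) i else 0)" if i: "i < N" for i
 proof (cases "\<forall>i<N. k i \<noteq> 0")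
  case True
  have "vec_index (mat_diag N (\<lambda>i. 1 / k i) *\<^sub>v w) i = (\<Sum>j = 0..<N. (if i = j then 1 / k j else 0) * vec_index w j)"
   using i w by (simp add: mat_diag_def scalar_prod_def)
  also have "... = 1 / k i * vec_index w i" using i by (subst sum.remove[of _ i]) auto
  also have "vec_index w i = interp_coeff N k (\<lambda>l. (deriv ^^ (2 * l + 1)) v 0) i"
   unfolding w_def taylor_odd_def by (rule inverse_vandermonde_mult[OF i])
  finally show ?thesis using True by (simp add: inverse_mat_diag)
 next
  case False
  then have "inverse_matrix (mat_diag N k) = 0\<^sub>m N N" by (simp only: inverse_mat_diag if_False)
  moreover have "vec_index (0\<^sub>m N N *\<^sub>v w) i = 0" using i w by (simp add: scalar_prod_def)
  ultimately show ?thesis using False by (simp only: if_False)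
 qed
 show ?thesis unfolding rf_operator_def Let_def w_def[symmetric] taylor_even_def
  by (intro if_cong sum.cong refl arg_cong2[where f = "(+)"] arg_cong2[where f = "(*)"] inverse_vandermonde_mult Y) auto
qed

text \<open>\<open>q\<close> counts derivatives: each one multiplies by \<open>k i\<close> and
  shifts the phase by \<open>pi / 2\<close>.\<close>

definition trig_sum :: "nat => (nat => real) => (nat => real) => (nat => real) => nat => real => real" where
 "trig_sum N k X Y q x = (\<Sum>i<N. X i * (k i ^ q * cos (k i * x + real q * (pi / 2))) + Y i * (k i ^ q * sin (k i * x + real q * (pi / 2))))"

lemma trig_sum_DERIV: "(trig_sum N k X Y q has_real_derivative trig_sum N k X Y (Suc q) x) (at x)"
proof -
 have c: "cos (a + real (Suc q) * (pi / 2)) = - sin (a + real q * (pi / 2))"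
  and s: "sin (a + real (Suc q) * (pi / 2)) = cos (a + real q * (pi / 2))" for a
 proof -
  have e: "a + real (Suc q) * (pi / 2) = (a + real q * (pi / 2)) + pi / 2" by (simp add: algebra_simps)
  show "cos (a + real (Suc q) * (pi / 2)) = - sin (a + real q * (pi / 2))"
   "sin (a + real (Suc q) * (pi / 2)) = cos (a + real q * (pi / 2))" unfolding e by (simp_all add: cos_add sin_add)
 qed
 show ?thesis unfolding trig_sum_def c s by (auto intro!: derivative_eq_intros sum.cong simp: algebra_simps)
qed

lemma smooth_trig_sum: "smooth (trig_sum N k X Y 0)"
 and trig_sum_higher_deriv: "(deriv ^^ q) (trig_sum N k X Y 0) = trig_sum N k X Y q"
 using smooth_of_derivative_sequence[of "trig_sum N k X Y", OF trig_sum_DERIV] by auto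

text \<open>Even derivatives at 0 see only the cosine coefficients and odd ones only the sine
  coefficients. Both give Vandermonde systems with the nodes \<open>- (k i)\<^sup>2\<close>, the
  second one in the unknowns \<open>Y i * k i\<close>.\<close>

lemma trig_sum_at_0:
 "trig_sum N k X Y (2 * l) 0 = (\<Sum>i<N. X i * (- (k i)\<^sup>2) ^ l)"
 "trig_sum N k X Y (2 * l + 1) 0 = (\<Sum>i<N. Y i * k i * (- (k i)\<^sup>2) ^ l)"
proof -
 have "real (2 * l) * (pi / 2) = real l * pi" by simp
 then have e: "cos (real (2 * l) * (pi / 2)) = (-1) ^ l" "sin (real (2 * l) * (pi / 2)) = 0" by (simp_all only: cos_npi sin_npi)
 have "real (2 * l + 1) * (pi / 2) = real l * pi + pi / 2" by (simp add: algebra_simps)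
 then have o: "cos (real (2 * l + 1) * (pi / 2)) = 0" "sin (real (2 * l + 1) * (pi / 2)) = (-1) ^ l"
  by (simp_all only: cos_add sin_add cos_npi sin_npi cos_pi_half sin_pi_half)
 have p: "(- (k i)\<^sup>2) ^ l = (-1) ^ l * k i ^ (2 * l)" for i by (subst power_minus) (simp add: power_mult)
 show "trig_sum N k X Y (2 * l) 0 = (\<Sum>i<N. X i * (- (k i)\<^sup>2) ^ l)" unfolding trig_sum_def mult_zero_right add_0 e p by (simp add: mult_ac)
 show "trig_sum N k X Y (2 * l + 1) 0 = (\<Sum>i<N. Y i * k i * (- (k i)\<^sup>2) ^ l)"
  unfolding trig_sum_def mult_zero_right add_0 o p by (simp add: mult_ac)
qed

lemma interp_coeff_interpolates:
 assumes d: "distinct_squares N k" and l: "l < N"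
 shows "(\<Sum>i<N. interp_coeff N k t i * (- (k i)\<^sup>2) ^ l) = t l"
proof -
 let ?B = "inverse_matrix (vandermonde_mat N k)" and ?V = "vandermonde_mat N k"
 have B: "?B \<in> carrier_mat N N" by (simp add: inverse_vandermonde[OF d])
 have V: "?V \<in> carrier_mat N N" by (rule vandermonde_carrier)
 have BV: "?B * ?V = 1\<^sub>m N"
 proof (cases "mat_inverse ?V")
  \<comment> \<open>The default would be the zero matrix, but its rows are the coefficients of
    polynomials that take the value 1 at a node.\<close>
  case None
  then have "?B = 0\<^sub>m N N" by (simp add: inverse_matrix_def vandermonde_mat_def)
  then have "coeff (lagrange_poly N k l) m = 0" if "m < N" for m
   using arg_cong[of _ _ "\<lambda>M. M $$ (l, m)", OF inverse_vandermonde[OF d]] that l by simp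
  then have "poly (lagrange_poly N k l) (- (k l)\<^sup>2) = 0" using poly_sum_lessThan[OF degree_lagrange_poly[OF l]] by simp
  then show ?thesis using poly_lagrange_poly[OF d l l] by simp
 next
  case (Some C)
  then show ?thesis using mat_inverse(2)[OF V Some] by (simp add: inverse_matrix_def)
 qed
 have VB: "?V * ?B = 1\<^sub>m N" by (rule mat_mult_left_right_inverse[OF B V BV])
 have tv: "Matrix.vec N t \<in> carrier_vec N" by simp
 have "?V *\<^sub>v (?B *\<^sub>v Matrix.vec N t) = Matrix.vec N t" using assoc_mult_mat_vec[OF V B tv] VB tv by simp
 then have "t l = vec_index (?V *\<^sub>v (?B *\<^sub>v Matrix.vec N t)) l" using l by simp
 also have "... = (\<Sum>i<N. (- (k i)\<^sup>2) ^ l * vec_index (?B *\<^sub>v Matrix.vec N t) i)"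
  using l B by (subst index_mult_mat_vec) (simp_all add: scalar_prod_def lessThan_atLeast0 vandermonde_mat_def[of N k])
 also have "... = (\<Sum>i<N. interp_coeff N k t i * (- (k i)\<^sup>2) ^ l)" by (intro sum.cong) (auto simp: inverse_vandermonde_mult mult.commute)
 finally show ?thesis by simp
qed

lemma coeff_prod_linear_nonneg:
 "finite J ==> (\<And>j. j \<in> J ==> 0 \<le> a j) ==> 0 \<le> coeff (\<Prod>j\<in>J. [:a j, 1:]) l" for a :: "nat => real"
proof (induction J arbitrary: l rule: finite_induct)
 case (insert j J)
 then show ?case by (cases l) (auto simp: coeff_pCons intro!: add_nonneg_nonneg mult_nonneg_nonneg)
qed (auto simp: coeff_1 split: if_splits)

text \<open>The product that \<open>rf_event\<close> bounds. It is also the Lagrange polynomial of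
  node \<open>i\<close>, with coefficients replaced by their absolute values, evaluated at
  \<open>C^2\<close>.\<close>

definition node_ratio :: "nat => (nat => real) => real => nat => real" where
 "node_ratio N k C i = (\<Prod>j\<in>{..<N} - {i}. (C^2 + (k j)\<^sup>2) / \<bar>(k i)\<^sup>2 - (k j)\<^sup>2\<bar>)"

lemma node_ratio_nonneg: "0 \<le> node_ratio N k C i" unfolding node_ratio_def by (intro prod_nonneg) auto

text \<open>The numerator of the Lagrange polynomial has nonnegative coefficients. Data that grow
  like powers of \<open>C^2\<close> therefore sum up exactly to its value at
  \<open>C^2\<close>.\<close>

lemma interp_coeff_bound:
 assumes i: "i < N" and B: "0 \<le> B" and t: "\<And>l. l < N ==> \<bar>t l\<bar> \<le> B * (C^2) ^ l"
 shows "\<bar>interp_coeff N k t i\<bar> \<le> B * node_ratio N k C i"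
proof (cases "distinct_squares N k")
 case True
 let ?c = "\<Prod>j\<in>{..<N} - {i}. 1 / ((k j)\<^sup>2 - (k i)\<^sup>2)" and ?p = "\<Prod>j\<in>{..<N} - {i}. [:(k j)\<^sup>2, 1:]"
 have nn: "0 \<le> coeff ?p l" for l by (rule coeff_prod_linear_nonneg) auto
 have co: "coeff (lagrange_poly N k i) l = ?c * coeff ?p l" for l by (simp add: lagrange_poly_def)
 have dp: "degree ?p < N"
 proof -
  have "degree ?p \<le> (\<Sum>j\<in>{..<N} - {i}. degree [:(k j)\<^sup>2, 1:])"
   using degree_prod_sum_le[of "{..<N} - {i}" "\<lambda>j. [:(k j)\<^sup>2, 1:]"] by (simp add: o_def)
  also have "... = N - 1" using i by simp
  finally show ?thesis using i by simp
 qed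
 have "\<bar>interp_coeff N k t i\<bar> \<le> (\<Sum>l<N. \<bar>coeff (lagrange_poly N k i) l * t l\<bar>)" using True by (simp add: interp_coeff_def)
 also have "... \<le> (\<Sum>l<N. \<bar>?c\<bar> * B * (coeff ?p l * (C^2) ^ l))"
 proof (intro sum_mono)
  fix l assume l: "l \<in> {..<N}"
  have "\<bar>coeff (lagrange_poly N k i) l * t l\<bar> = \<bar>?c\<bar> * (coeff ?p l * \<bar>t l\<bar>)"
   unfolding co using nn[of l] by (simp add: abs_mult)
  also have "... \<le> \<bar>?c\<bar> * (coeff ?p l * (B * (C^2) ^ l))" using t[of l] l nn[of l] by (intro mult_left_mono) auto
  finally show "\<bar>coeff (lagrange_poly N k i) l * t l\<bar> \<le> \<bar>?c\<bar> * B * (coeff ?p l * (C^2) ^ l)" by (simp add: mult_ac)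
 qed
 also have "... = \<bar>?c\<bar> * B * poly ?p (C^2)" unfolding poly_sum_lessThan[OF dp] by (simp add: sum_distrib_left)
 also have "\<bar>?c\<bar> * B * poly ?p (C^2) = B * node_ratio N k C i"
 proof -
  have "\<bar>?c\<bar> * poly ?p (C^2) = (\<Prod>j\<in>{..<N} - {i}. \<bar>1 / ((k j)\<^sup>2 - (k i)\<^sup>2)\<bar>) * (\<Prod>j\<in>{..<N} - {i}. (k j)\<^sup>2 + C^2)"
   by (simp add: poly_prod abs_prod)
  also have "... = node_ratio N k C i" unfolding node_ratio_def prod.distrib[symmetric]
   by (intro prod.cong) (auto simp: abs_divide abs_minus_commute add.commute)
  finally show ?thesis by (simp add: mult_ac)
 qed
 finally show ?thesis .
next
 case False
 then show ?thesis using B node_ratio_nonneg by (simp add: interp_coeff_def)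
qed

lemma taylor_remainder_bound:
 assumes g: "smooth g" and z: "\<And>q. q < m ==> (deriv ^^ q) g 0 = 0"
  and G: "\<And>x. \<bar>x\<bar> \<le> \<rho> ==> \<bar>(deriv ^^ m) g x\<bar> \<le> G" and \<rho>: "0 \<le> \<rho>"
 shows "q \<le> m ==> \<bar>x\<bar> \<le> \<rho> ==> \<bar>(deriv ^^ q) g x\<bar> \<le> G * \<rho> ^ (m - q)"
proof (induction "m - q" arbitrary: q x)
 case 0
 then show ?case using G by simp
next
 case (Suc d)
 then have q: "q < m" "d = m - Suc q" by auto
 have G0: "0 \<le> G" using G[of 0] \<rho> by (auto intro: order_trans[OF abs_ge_zero])
 have "norm ((deriv ^^ q) g x - (deriv ^^ q) g 0) \<le> (G * \<rho> ^ (m - Suc q)) * norm (x - 0)"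
 proof (rule field_differentiable_bound[of "closed_segment 0 x" "(deriv ^^ q) g"])
  fix y assume y: "y \<in> closed_segment 0 x"
  then have y': "\<bar>y\<bar> \<le> \<rho>" using Suc.prems(2) by (auto simp: closed_segment_eq_real_ivl split: if_splits)
  show "((deriv ^^ q) g has_real_derivative (deriv ^^ Suc q) g y) (at y within closed_segment 0 x)"
   by (rule has_field_derivative_at_within[OF smooth_higher_DERIV[OF g]])
  show "norm ((deriv ^^ Suc q) g y) \<le> G * \<rho> ^ (m - Suc q)" using Suc.hyps(1)[of "Suc q" y] q y' unfolding real_norm_def by (metis Suc_leI)
 qed auto
 also have "... \<le> (G * \<rho> ^ (m - Suc q)) * \<rho>" using Suc.prems(2) G0 \<rho> by (intro mult_left_mono) auto
 also have "... = G * \<rho> ^ (m - q)"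
 proof -
  have "m - q = Suc (m - Suc q)" using q by simp
  then show ?thesis by simp
 qed
 finally show ?case using z[OF q(1)] by simp
qed

text \<open>The difference vanishes to order \<open>2 * N\<close> at 0, so everything reduces to its
  derivative of order \<open>2 * N\<close>. For \<open>v\<close> this is a hypothesis; for the
  trigonometric sum it follows from the bounds on the interpolation coefficients. The function
  \<open>w\<close> is smooth on the line and equals the operator, which makes the difference
  accessible to Taylor's theorem.\<close>

lemma rf_local_error:
 assumes d: "distinct_squares N k" and nz: "\<And>i. i < N ==> k i \<noteq> 0" and v: "smooth v"
  and B: "0 \<le> B" and C: "0 \<le> C" and \<rho>: "0 \<le> \<rho>" and vb: "\<And>q x. q \<le> 2 * N ==> \<bar>x\<bar> \<le> \<rho> ==> \<bar>(deriv ^^ q) v x\<bar> \<le> B * C ^ q"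
  and ev: "rf_event varpi N k \<mu> C c"
 obtains w where "smooth w" "\<And>x. rf_operator varpi N k \<mu> C c v x = w x"
  "\<And>q x. q \<le> 2 * N ==> \<bar>x\<bar> \<le> \<rho> ==> \<bar>(deriv ^^ q) (\<lambda>x. v x - w x) x\<bar>
   \<le> B * (C ^ (2 * N) + (\<Sum>i<N. node_ratio N k C i * (\<bar>k i\<bar> ^ (2 * N) + C * \<bar>k i\<bar> ^ (2 * N - 1)))) * \<rho> ^ (2 * N - q)"
proof -
 define X where "X = interp_coeff N k (\<lambda>l. (deriv ^^ (2 * l)) v 0)"
 define Z where "Z = interp_coeff N k (\<lambda>l. (deriv ^^ (2 * l + 1)) v 0)"
 define Y where "Y i = 1 / k i * Z i" for i
 define w where "w = trig_sum N k X Y 0"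
 have nz': "\<forall>i<N. k i \<noteq> 0" using nz by blast
 have eq: "rf_operator varpi N k \<mu> C c v x = w x" for x
  unfolding rf_operator_eq if_P[OF ev] if_P[OF nz'] by (simp add: w_def trig_sum_def X_def Y_def Z_def)
 have Xb: "\<bar>X i\<bar> \<le> B * node_ratio N k C i" if i: "i < N" for i unfolding X_def
 proof (rule interp_coeff_bound[OF i B])
  fix l assume "l < N"
  then show "\<bar>(deriv ^^ (2 * l)) v 0\<bar> \<le> B * (C^2) ^ l" using vb[of "2 * l" 0] \<rho> by (simp add: power_mult)
 qed
 have Zb: "\<bar>Z i\<bar> \<le> (B * C) * node_ratio N k C i" if i: "i < N" for i unfolding Z_def
 proof (rule interp_coeff_bound[OF i])
  fix l assume "l < N"
  then show "\<bar>(deriv ^^ (2 * l + 1)) v 0\<bar> \<le> (B * C) * (C^2) ^ l" using vb[of "2 * l + 1" 0] \<rho> by (simp add: power_mult[symmetric] mult_ac)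
 qed (use B C in simp)
 define g where "g x = v x - w x" for x
 have sw: "smooth w" unfolding w_def by (rule smooth_trig_sum)
 have sg: "smooth g" unfolding g_def by (intro smooth_diff v sw)
 have dg: "(deriv ^^ q) g = (\<lambda>x. (deriv ^^ q) v x - trig_sum N k X Y q x)" for q
  by (rule smooth_higher_deriv_unique(2)[of "\<lambda>q x. (deriv ^^ q) v x - trig_sum N k X Y q x"])
   (auto simp: g_def w_def simp del: funpow.simps intro!: DERIV_diff smooth_higher_DERIV[OF v] trig_sum_DERIV)
 have zero: "(deriv ^^ q) g 0 = 0" if q: "q < 2 * N" for q
 proof (cases "even q")
  case True
  then obtain l where l: "q = 2 * l" by blast
  then show ?thesis using interp_coeff_interpolates[OF d, of l "\<lambda>l. (deriv ^^ (2 * l)) v 0"] q unfolding dg l trig_sum_at_0 X_def by simp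
 next
  case False
  then obtain l where l: "q = 2 * l + 1" by (elim oddE)
  have "(\<Sum>i<N. Y i * k i * (- (k i)\<^sup>2) ^ l) = (\<Sum>i<N. Z i * (- (k i)\<^sup>2) ^ l)" using nz by (intro sum.cong) (auto simp: Y_def)
  also have "... = (deriv ^^ (2 * l + 1)) v 0"
   unfolding Z_def using interp_coeff_interpolates[OF d, of l "\<lambda>l. (deriv ^^ (2 * l + 1)) v 0"] q l by simp
  finally show ?thesis unfolding dg l trig_sum_at_0 by (simp only: diff_self)
 qed
 define G where "G = B * (C ^ (2 * N) + (\<Sum>i<N. node_ratio N k C i * (\<bar>k i\<bar> ^ (2 * N) + C * \<bar>k i\<bar> ^ (2 * N - 1))))"
 have top: "\<bar>(deriv ^^ (2 * N)) g x\<bar> \<le> G" if x: "\<bar>x\<bar> \<le> \<rho>" for x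
 proof -
  have "\<bar>trig_sum N k X Y (2 * N) x\<bar> \<le> (\<Sum>i<N. B * (node_ratio N k C i * (\<bar>k i\<bar> ^ (2 * N) + C * \<bar>k i\<bar> ^ (2 * N - 1))))"
   unfolding trig_sum_def
  proof (rule order_trans[OF sum_abs], intro sum_mono)
   fix i assume i: "i \<in> {..<N}"
   let ?a = "k i * x + real (2 * N) * (pi / 2)"
   have "\<bar>X i * (k i ^ (2 * N) * cos ?a)\<bar> \<le> \<bar>X i\<bar> * \<bar>k i\<bar> ^ (2 * N)"
    unfolding abs_mult power_abs by (intro mult_left_mono mult_left_le) auto
   also have "... \<le> (B * node_ratio N k C i) * \<bar>k i\<bar> ^ (2 * N)" using Xb i by (intro mult_right_mono) auto
   finally have 1: "\<bar>X i * (k i ^ (2 * N) * cos ?a)\<bar> \<le> (B * node_ratio N k C i) * \<bar>k i\<bar> ^ (2 * N)" .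
   \<comment> \<open>The sine coefficient contains a division by \<open>k i\<close>, which takes
     away one power of \<open>k i\<close>; in return the odd data carry one more factor
     \<open>C\<close>.\<close>
   have Ykk: "\<bar>Y i\<bar> * \<bar>k i\<bar> ^ (2 * N) = \<bar>Z i\<bar> * \<bar>k i\<bar> ^ (2 * N - 1)"
   proof -
    have "2 * N = Suc (2 * N - 1)" using i by auto
    then have "\<bar>k i\<bar> ^ (2 * N) = \<bar>k i\<bar> * \<bar>k i\<bar> ^ (2 * N - 1)" by (metis power_Suc)
    then show ?thesis using nz[of i] i by (simp add: Y_def abs_mult)
   qed
   have "\<bar>Y i * (k i ^ (2 * N) * sin ?a)\<bar> \<le> \<bar>Y i\<bar> * \<bar>k i\<bar> ^ (2 * N)"
    unfolding abs_mult power_abs by (intro mult_left_mono mult_left_le) auto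
   also have "... \<le> ((B * C) * node_ratio N k C i) * \<bar>k i\<bar> ^ (2 * N - 1)" unfolding Ykk using Zb i by (intro mult_right_mono) auto
   finally have 2: "\<bar>Y i * (k i ^ (2 * N) * sin ?a)\<bar> \<le> ((B * C) * node_ratio N k C i) * \<bar>k i\<bar> ^ (2 * N - 1)" .
   show "\<bar>X i * (k i ^ (2 * N) * cos ?a) + Y i * (k i ^ (2 * N) * sin ?a)\<bar> \<le> B * (node_ratio N k C i * (\<bar>k i\<bar> ^ (2 * N) + C * \<bar>k i\<bar> ^ (2 * N - 1)))"
    using abs_triangle_ineq[of "X i * (k i ^ (2 * N) * cos ?a)" "Y i * (k i ^ (2 * N) * sin ?a)"] 1 2 by (simp add: algebra_simps)
  qed
  moreover have "\<bar>(deriv ^^ (2 * N)) v x\<bar> \<le> B * C ^ (2 * N)" using vb[of "2 * N" x] x by simp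
  ultimately show ?thesis unfolding dg G_def by (simp add: distrib_left sum_distrib_left)
 qed
 show ?thesis
 proof (rule that[OF sw eq])
  fix q x assume "q \<le> 2 * N" "\<bar>x\<bar> \<le> \<rho>"
  from taylor_remainder_bound[OF sg zero top \<rho> this]
  show "\<bar>(deriv ^^ q) (\<lambda>x. v x - w x) x\<bar> \<le> B * (C ^ (2 * N) + (\<Sum>i<N. node_ratio N k C i * (\<bar>k i\<bar> ^ (2 * N) + C * \<bar>k i\<bar> ^ (2 * N - 1)))) * \<rho> ^ (2 * N - q)"
   by (simp add: g_def[abs_def] G_def)
 qed
qed

section \<open>The probability of an ill-conditioned sample\<close>

lemma Q_scale: "\<Q> varpi c k w = varpi powr (c / (c - 1)) * \<Q> 1 c k w" by (simp add: \<Q>_def Let_def)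

lemma Q_lower_large: "4 / 3 < k ==> (1 + w^2) / k^2 \<le> \<Q> 1 c k w"
proof -
 assume k: "4 / 3 < k"
 have "(1 + w^2) / k^2 \<le> 28 * (1 + w^2) / (23 * k^2)" using k by (simp add: divide_simps)
 then show ?thesis using k by (simp add: \<Q>_def Let_def)
qed

lemma Q_lower_small: "k \<le> 4 / 3 ==> 0 \<le> k ==> (1 + w^2) / (k + 1) \<le> \<Q> 1 c k w"
proof -
 assume k: "k \<le> 4 / 3" "0 \<le> k"
 have "0 \<le> (w^2 + 1) / (k + 1)" using k by simp
 then have "(w^2 + 1) / (k + 1) \<le> 2 * ((w^2 + 1) / (k + 1))" by linarith
 also have "... \<le> \<Q> 1 c k w"
 proof -
  have "2 * z \<le> 2 * max x (max y z)" for x y z :: real by simp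
  then show ?thesis using k by (simp add: \<Q>_def Let_def del: times_divide_eq_right mult_le_cancel_left_pos)
 qed
 finally show ?thesis by (simp add: add.commute)
qed

text \<open>As a function of \<open>x\<close> the difference of the two sides is convex, so the end points suffice.\<close>

lemma Q_lower_near:
 assumes k: "0 < k" "k \<le> 4 / 3" and x: "max (k - 1 / 2) 0 \<le> x" "x \<le> max (k - 1 / 2) 0 + 1"
 shows "w^2 + x^2 \<le> \<Q> 1 c k w * (k + x)"
proof -
 define a where "a = max (k - 1 / 2) 0"
 define m where "m = max ((w^2 + a^2) / (k + a)) ((w^2 + (a + 1)\<^sup>2) / (k + (a + 1)))"
 have a: "0 \<le> a" by (simp add: a_def)
 have m: "w^2 + a^2 \<le> m * (k + a)" "w^2 + (a + 1)\<^sup>2 \<le> m * (k + (a + 1))" using k a by (simp_all add: m_def pos_divide_le_eq[symmetric])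
 have m0: "0 \<le> m" using k a by (auto simp: m_def le_max_iff_disj)
 have x': "0 \<le> x - a" "0 \<le> a + 1 - x" using x by (auto simp: a_def)
 have "(a + 1 - x) * (w^2 + a^2) + (x - a) * (w^2 + (a + 1)\<^sup>2) \<le> (a + 1 - x) * (m * (k + a)) + (x - a) * (m * (k + (a + 1)))"
  using m x' by (intro add_mono mult_left_mono) auto
 also have "... = m * (k + x)" by (simp add: algebra_simps)
 finally have "(a + 1 - x) * (w^2 + a^2) + (x - a) * (w^2 + (a + 1)\<^sup>2) \<le> m * (k + x)" .
 moreover have "(a + 1 - x) * (w^2 + a^2) + (x - a) * (w^2 + (a + 1)\<^sup>2) = w^2 + x^2 + (x - a) * (a + 1 - x)" by (simp add: power2_eq_square algebra_simps)
 moreover have "0 \<le> (x - a) * (a + 1 - x)" using x' by simp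
 ultimately have "w^2 + x^2 \<le> m * (k + x)" by linarith
 also have "m * (k + x) \<le> \<Q> 1 c k w * (k + x)"
 proof (rule mult_right_mono)
  have "m \<le> 2 * m" using m0 by simp
  also have "... \<le> \<Q> 1 c k w" using k by (simp add: \<Q>_def Let_def m_def a_def[symmetric])
  finally show "m \<le> \<Q> 1 c k w" .
 qed (use k a x' in linarith)
 finally show ?thesis .
qed

lemma Q_1_pos: "0 \<le> k ==> 0 < \<Q> 1 c k w"
proof (cases "4 / 3 < k")
 case True
 have "0 < (1 + w^2) / k^2" using True by (intro divide_pos_pos) (auto simp: add_pos_nonneg)
 then show ?thesis using Q_lower_large[OF True] by (rule less_le_trans)
next
 case False
 assume "0 \<le> k"
 then have "0 < (1 + w^2) / (k + 1)" by (intro divide_pos_pos) (auto simp: add_pos_nonneg)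
 then show ?thesis using Q_lower_small[of k w c] False \<open>0 \<le> k\<close> by (auto intro: less_le_trans)
qed

lemma Q_pos: "0 \<le> k ==> 1 \<le> varpi ==> 0 < \<Q> varpi c k w" by (subst Q_scale) (auto intro!: mult_pos_pos Q_1_pos)

text \<open>\<open>\<Q>\<close> decays like the inverse square of \<open>k\<close>, which
  compensates for the powers of the features in the derivative of order \<open>2 * N\<close>. The
  exponent \<open>c / (c - 1)\<close> is at most 2 because \<open>c > 2\<close>. For
  \<open>k <= 4 / 3\<close> the constant 10 comes from \<open>a + 1 <= 11 / 6\<close> and
  \<open>k^2 / (k + x) <= 4 / 3\<close>.\<close>

lemma Q_upper:
 assumes k: "0 < k" and c: "2 < c" and \<pi>: "1 \<le> varpi"
 shows "\<Q> varpi c k w * k^2 \<le> 10 * varpi^2 * (1 + w^2)"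
proof -
 have "\<Q> 1 c k w * k^2 \<le> 10 * (1 + w^2)"
 proof (cases "4 / 3 < k")
  case True
  have k2: "16 / 9 < k^2" using power_strict_mono[of "4/3" k 2] True by (simp add: power2_eq_square)
  have "((1 + w^2) / (2 * (k^2 - 1)) + w^2 / (2 * k^2)) * k^2 = (1 + w^2) * (k^2 / (2 * (k^2 - 1))) + w^2 / 2"
  proof -
   have "k^2 - 1 \<noteq> 0" using k2 by linarith
   then show ?thesis using k by (simp add: distrib_right)
  qed
  also have "... \<le> (1 + w^2) * 2 + w^2 / 2" using k2 by (intro add_mono mult_left_mono) (auto simp: divide_simps)
  also have "... \<le> 10 * (1 + w^2)" by simp
  finally have 1: "((1 + w^2) / (2 * (k^2 - 1)) + w^2 / (2 * k^2)) * k^2 \<le> 10 * (1 + w^2)" .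
  have 2: "28 * (1 + w^2) / (23 * k^2) * k^2 \<le> 10 * (1 + w^2)" using k by simp
  have "\<Q> 1 c k w = ((1 + w^2) / (2 * (k^2 - 1)) + w^2 / (2 * k^2)) \<or> \<Q> 1 c k w = 28 * (1 + w^2) / (23 * k^2)"
   using True by (auto simp: \<Q>_def Let_def max_def)
  then show ?thesis using 1 2 by fastforce
 next
  case False
  define a where "a = max (k - 1 / 2) 0"
  have "k - 1 / 2 \<le> 5 / 6" using False by simp
  then have "a \<le> 5 / 6" unfolding a_def by (rule max.boundedI) simp
  moreover have "0 \<le> a" by (simp add: a_def)
  ultimately have a: "0 \<le> a" "a \<le> 5 / 6" by auto
  have g: "2 * ((w^2 + x^2) / (k + x)) * k^2 \<le> 10 * (1 + w^2)" if x: "0 \<le> x" "x \<le> 11 / 6" for x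
  proof -
   have "k^2 / (k + x) \<le> 4 / 3"
   proof -
    have "k^2 \<le> 4 / 3 * k" using False k by (simp add: power2_eq_square)
    also have "... \<le> 4 / 3 * (k + x)" using x by simp
    finally show ?thesis using k x by (simp add: pos_divide_le_eq)
   qed
   moreover have "x^2 \<le> 121 / 36" using power_mono[OF x(2,1), of 2] by (simp add: power2_eq_square)
   ultimately have "(w^2 + x^2) * (k^2 / (k + x)) \<le> (w^2 + 121 / 36) * (4 / 3)" using k x by (intro mult_mono) auto
   also have "... \<le> 5 * (1 + w^2)" by (simp add: field_simps)
   finally have "(w^2 + x^2) * (k^2 / (k + x)) \<le> 5 * (1 + w^2)" .
   moreover have "2 * ((w^2 + x^2) / (k + x)) * k^2 = 2 * ((w^2 + x^2) * (k^2 / (k + x)))" by simp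
   ultimately show ?thesis by linarith
  qed
  let ?h = "\<lambda>x. (w^2 + x^2) / (k + x)"
  have "\<Q> 1 c k w = 2 * max (?h a) (max (?h (a + 1)) (?h 1))" using False by (simp add: \<Q>_def Let_def a_def)
  then have "\<Q> 1 c k w = 2 * ?h a \<or> \<Q> 1 c k w = 2 * ?h (a + 1) \<or> \<Q> 1 c k w = 2 * ?h 1" by (auto simp: max_def)
  moreover have "2 * ?h a * k^2 \<le> 10 * (1 + w^2)" by (rule g) (use a in auto)
  moreover have "2 * ?h (a + 1) * k^2 \<le> 10 * (1 + w^2)" by (rule g) (use a in auto)
  moreover have "2 * ?h 1 * k^2 \<le> 10 * (1 + w^2)" by (rule g) auto
  ultimately show ?thesis by (elim disjE) (simp_all only:)
 qed
 moreover have "varpi powr (c / (c - 1)) \<le> varpi powr 2" using c \<pi> by (intro powr_mono) (auto simp: divide_simps)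
 moreover have "0 \<le> \<Q> 1 c k w * k^2" using Q_1_pos[of k c w] k by simp
 ultimately have "varpi powr (c / (c - 1)) * (\<Q> 1 c k w * k^2) \<le> varpi powr 2 * (10 * (1 + w^2))"
  by (intro mult_mono[of "varpi powr (c / (c - 1))" "varpi powr 2" "\<Q> 1 c k w * k^2"] powr_ge_zero)
 then show ?thesis unfolding Q_scale[of varpi] using \<pi> by (simp add: mult_ac algebra_simps)
qed

lemma powr_le_scaled:
 assumes "x \<le> q * y" "0 \<le> x" "0 \<le> q" "1 \<le> y" "0 \<le> a" "a \<le> 1"
 shows "x powr a \<le> q powr a * (y :: real)"
proof -
 have "x powr a \<le> (q * y) powr a" using assms by (intro powr_mono2) auto
 also have "... = q powr a * y powr a" using assms by (simp add: powr_mult)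
 also have "... \<le> q powr a * y powr 1" using assms by (intro mult_left_mono powr_mono) auto
 finally show ?thesis using assms by simp
qed

text \<open>The ratio is singular at \<open>x = k\<close> only, and an exponent \<open>l < 1\<close>
  makes the singularity integrable. Within distance \<open>h\<close> of \<open>k\<close> the bound
  carries the weight \<open>max 1 (x ^ 3)\<close>, which is what the sampling assumption controls
  against the density; farther away it grows like \<open>1 + x^2\<close>, which has a finite mean.
  The factor \<open>h powr (l - 1)\<close> cancels when the singular part is integrated, so that the
  size of \<open>h\<close> has no influence on the moment.\<close>

lemma sampling_ratio_bound:
 fixes k w l :: real
 assumes k: "0 < k" and l: "0 < l" "l < 1"
 obtains h where "0 < h" "\<And>x. 0 < x ==> ((w^2 + x^2) / \<bar>k^2 - x^2\<bar>) powr l \<le> \<Q> 1 c k w powr l *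
  (4 / 3 * h powr (l - 1) * (indicator {..h} \<bar>k - x\<bar> * \<bar>k - x\<bar> powr (-l)) * max 1 (x ^ 3) + 20 * (1 + x^2))"
proof -
 let ?q = "\<Q> 1 c k w" and ?r = "\<lambda>x. (w^2 + x^2) / \<bar>k^2 - x^2\<bar>"
 have q: "0 < ?q" by (rule Q_1_pos) (use k in simp)
 have fac: "\<bar>k^2 - x^2\<bar> = \<bar>k - x\<bar> * (k + x)" if "0 < x" for x
  using that k by (simp add: power2_eq_square square_diff_square_factored abs_mult mult.commute)
 have ww: "w^2 + x^2 \<le> (1 + w^2) * (1 + x^2)" for x by (simp add: algebra_simps)
 have far: "?r x powr l \<le> ?q powr l * (n + 20 * (1 + x^2))" if "?r x \<le> ?q * (20 * (1 + x^2))" "0 \<le> n" for x n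
 proof -
  have "?r x powr l \<le> ?q powr l * (20 * (1 + x^2))"
  proof (rule powr_le_scaled[OF that(1)])
   have "0 \<le> x^2" by simp
   then show "1 \<le> 20 * (1 + x^2)" by argo
  qed (use q l in auto)
  also have "... \<le> ?q powr l * (n + 20 * (1 + x^2))" using that by (intro mult_left_mono) auto
  finally show ?thesis .
 qed
 have near: "?r x powr l \<le> ?q powr l * (n + 20 * (1 + x^2))"
  if "?r x \<le> ?q * (m / \<bar>k - x\<bar>)" "m powr l * \<bar>k - x\<bar> powr (-l) \<le> n" "0 \<le> m" for x m n
 proof -
  have "?r x powr l \<le> (?q * (m / \<bar>k - x\<bar>)) powr l" using that l by (intro powr_mono2) auto
  also have "... = ?q powr l * (m powr l * \<bar>k - x\<bar> powr (-l))" using q that by (simp add: powr_mult powr_divide powr_minus_divide)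
  also have "... \<le> ?q powr l * (n + 20 * (1 + x^2))"
   using that zero_le_power2[of x] by (intro mult_left_mono) (auto intro: order_trans[OF that(2)])
  finally show ?thesis .
 qed
 show thesis
 proof (cases "4 / 3 < k")
  case True
  show thesis
  proof (rule that[of "k / 4"])
   fix x :: real assume x: "0 < x"
   show "?r x powr l \<le> ?q powr l *
    (4 / 3 * (k / 4) powr (l - 1) * (indicator {..k / 4} \<bar>k - x\<bar> * \<bar>k - x\<bar> powr (-l)) * max 1 (x ^ 3) + 20 * (1 + x^2))"
   proof (cases "\<bar>k - x\<bar> \<le> k / 4")
    case near': True
    then have x1: "1 \<le> x" "3 / 4 * k \<le> x" using True by linarith+
    show ?thesis
    proof (rule near[of _ "k * x^2"])
     have "w^2 + x^2 \<le> (1 + w^2) * x^2" using x1 mult_left_mono[of 1 "x^2" "w^2"] by (simp add: algebra_simps)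
     then have "?r x \<le> ((1 + w^2) * x^2) / (\<bar>k - x\<bar> * k)"
      unfolding fac[OF x] using k x by (cases "x = k") (auto intro!: frac_le mult_left_mono)
     also have "... = (1 + w^2) / k^2 * (k * x^2 / \<bar>k - x\<bar>)" using k by (simp add: power2_eq_square)
     also have "... \<le> ?q * (k * x^2 / \<bar>k - x\<bar>)" using Q_lower_large[OF True] k by (intro mult_right_mono) auto
     finally show "?r x \<le> ?q * (k * x^2 / \<bar>k - x\<bar>)" .
     \<comment> \<open>In this range \<open>k <= 4 / 3 * x\<close>, so the remaining factor
       \<open>k\<close> becomes the third power of \<open>x\<close>. Replacing \<open>k\<close> by
       \<open>k / 4\<close> enlarges the power because its exponent \<open>l - 1\<close> is
       negative.\<close>
     have "(k * x^2) powr l = k * k powr (l - 1) * (x^2) powr l" using k by (simp add: powr_mult powr_diff)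
     also have "... \<le> (4 / 3 * x) * (k / 4) powr (l - 1) * (x^2) powr 1" using k x1 l by (intro mult_mono powr_mono powr_mono2') auto
     also have "... = 4 / 3 * (k / 4) powr (l - 1) * x ^ 3" using x by (simp add: power3_eq_cube power2_eq_square)
     also have "... \<le> 4 / 3 * (k / 4) powr (l - 1) * max 1 (x ^ 3)" by (intro mult_left_mono) auto
     finally have "(k * x^2) powr l * \<bar>k - x\<bar> powr (-l) \<le> 4 / 3 * (k / 4) powr (l - 1) * max 1 (x ^ 3) * \<bar>k - x\<bar> powr (-l)"
      by (rule mult_right_mono) simp
     then show "(k * x^2) powr l * \<bar>k - x\<bar> powr (-l) \<le> 4 / 3 * (k / 4) powr (l - 1) * (indicator {..k / 4} \<bar>k - x\<bar> * \<bar>k - x\<bar> powr (-l)) * max 1 (x ^ 3)"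
      using near' by (simp add: mult_ac)
    qed (use k in simp)
   next
    case far': False
    show ?thesis
    proof (rule far)
     have "k / 4 * k \<le> \<bar>k - x\<bar> * (k + x)" using far' k x by (intro mult_mono) auto
     then have "?r x \<le> ((1 + w^2) * (1 + x^2)) / (k / 4 * k)" unfolding fac[OF x] using k ww by (intro frac_le) auto
     also have "... = (1 + w^2) / k^2 * (4 * (1 + x^2))" using k by (simp add: power2_eq_square)
     also have "... \<le> ?q * (20 * (1 + x^2))" using Q_lower_large[OF True] q by (intro mult_mono) auto
     finally show "?r x \<le> ?q * (20 * (1 + x^2))" .
    qed simp
   qed
  qed (use k in simp)
 next
  case False
  then have k43: "k \<le> 4 / 3" by simp
  \<comment> \<open>Points of \<open>{a..a + 1}\<close> have distance at most 1 from
    \<open>k\<close>, and positive points outside have distance at least \<open>1 / 2\<close>, also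
    when the window is cut off at 0.\<close>
  define a where "a = max (k - 1 / 2) 0"
  show thesis
  proof (rule that[of 1])
   fix x :: real assume x: "0 < x"
   show "?r x powr l \<le> ?q powr l *
    (4 / 3 * 1 powr (l - 1) * (indicator {..1} \<bar>k - x\<bar> * \<bar>k - x\<bar> powr (-l)) * max 1 (x ^ 3) + 20 * (1 + x^2))"
   proof (cases "a \<le> x \<and> x \<le> a + 1")
    case near': True
    show ?thesis
    proof (rule near[of _ 1])
     have "?r x \<le> (?q * (k + x)) / (\<bar>k - x\<bar> * (k + x))"
      unfolding fac[OF x] using Q_lower_near[OF k k43, of x w c] near' k x by (intro divide_right_mono) (auto simp: a_def)
     also have "... = ?q * (1 / \<bar>k - x\<bar>)" using k x by simp
     finally show "?r x \<le> ?q * (1 / \<bar>k - x\<bar>)" .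
     have "\<bar>k - x\<bar> \<le> 1" using near' k by (auto simp: a_def abs_le_iff)
     moreover have "1 * \<bar>k - x\<bar> powr (-l) \<le> (4 / 3 * max 1 (x ^ 3)) * \<bar>k - x\<bar> powr (-l)" by (intro mult_right_mono) auto
     ultimately show "1 powr l * \<bar>k - x\<bar> powr (-l) \<le> 4 / 3 * 1 powr (l - 1) * (indicator {..1} \<bar>k - x\<bar> * \<bar>k - x\<bar> powr (-l)) * max 1 (x ^ 3)"
      by (simp add: mult_ac)
    qed simp
   next
    case far': False
    show ?thesis
    proof (rule far)
     have d: "1 / 2 \<le> \<bar>k - x\<bar>" "(k + 1) / 5 \<le> k + x" using far' k k43 x by (auto simp: a_def max_def split: if_splits)
     then have "1 / 2 * ((k + 1) / 5) \<le> \<bar>k - x\<bar> * (k + x)" using k by (intro mult_mono) auto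
     then have "?r x \<le> ((1 + w^2) * (1 + x^2)) / (1 / 2 * ((k + 1) / 5))" unfolding fac[OF x] using k ww by (intro frac_le) auto
     also have "... = (1 + w^2) / (k + 1) * (10 * (1 + x^2))" using k by simp
     also have "... \<le> ?q * (20 * (1 + x^2))" using Q_lower_small[OF k43, of w c] q k by (intro mult_mono) auto
     finally show "?r x \<le> ?q * (20 * (1 + x^2))" .
    qed simp
   qed
  qed simp
 qed
qed

text \<open>Features vanish with probability 0 by absolute continuity, so integrals over the law
  become integrals over the positive half-line. The value 2 is the total mass plus the second
  moment, which is 1 after division by \<open>\<mu>\<close>.\<close>

lemma sampling_law_density:
 assumes L: "sampling_law L \<mu> varpi" and \<mu>: "0 < \<mu>"
 obtains \<pi> where "\<And>x. 0 \<le> \<pi> x" "\<And>x. 0 < x ==> max 1 (x ^ 3) * \<pi> x \<le> varpi"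
  "\<pi> \<in> borel_measurable borel"
  "\<And>g. g \<in> borel_measurable borel ==> (\<integral>\<^sup>+k. g (\<bar>k\<bar> / \<mu>) \<partial>L) = (\<integral>\<^sup>+x. ennreal (\<pi> x) * g x * indicator {0<..} x \<partial>lborel)"
  "(\<integral>\<^sup>+x. ennreal (\<pi> x) * ennreal (1 + x^2) * indicator {0<..} x \<partial>lborel) = 2"
proof -
 interpret real_distribution L using L by (simp add: sampling_law_def)
 obtain \<pi> where \<pi>: "\<And>x. 0 \<le> \<pi> x" "distributed L lborel (\<lambda>k. \<bar>k\<bar> / \<mu>) (\<lambda>x. ennreal (\<pi> x))"
  "bdd_above ((\<lambda>x. max 1 (x ^ 3) * \<pi> x) ` {0<..})" "varpi = max 1 (SUP x\<in>{0<..}. max 1 (x ^ 3) * \<pi> x)"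
  using L unfolding sampling_law_def by blast
 have ac: "absolutely_continuous lborel L" and int: "integrable L (\<lambda>k. k\<^sup>2)" and m2: "\<mu> = sqrt (\<integral>k. k\<^sup>2 \<partial>L)"
  using L by (auto simp: sampling_law_def)
 have 0: "AE k in L. k \<noteq> 0"
 proof (rule AE_I)
  show "{k \<in> space L. \<not> k \<noteq> 0} \<subseteq> {0}" by auto
  have "{0::real} \<in> null_sets lborel" by (simp add: null_sets_def)
  then have "{0} \<in> null_sets L" using ac by (auto simp: absolutely_continuous_def)
  then show "emeasure L {0} = 0" "{0} \<in> sets L" by auto
 qed
 have [measurable]: "(\<lambda>x. ennreal (\<pi> x)) \<in> borel_measurable borel" using \<pi>(2) by (auto simp: distributed_def)
 have m: "\<pi> \<in> borel_measurable borel"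
 proof -
  have "(\<lambda>x. enn2real (ennreal (\<pi> x))) \<in> borel_measurable borel" by measurable
  then show ?thesis using \<pi>(1) by simp
 qed
 have g: "(\<integral>\<^sup>+k. g (\<bar>k\<bar> / \<mu>) \<partial>L) = (\<integral>\<^sup>+x. ennreal (\<pi> x) * g x * indicator {0<..} x \<partial>lborel)" if [measurable]: "g \<in> borel_measurable borel" for g
 proof -
  have "(\<integral>\<^sup>+k. g (\<bar>k\<bar> / \<mu>) \<partial>L) = (\<integral>\<^sup>+k. g (\<bar>k\<bar> / \<mu>) * indicator {0<..} (\<bar>k\<bar> / \<mu>) \<partial>L)"
   using 0 \<mu> by (intro nn_integral_cong_AE) (auto elim!: eventually_mono)
  also have "... = (\<integral>\<^sup>+x. ennreal (\<pi> x) * (g x * indicator {0<..} x) \<partial>lborel)"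
   by (rule distributed_nn_integral[OF \<pi>(2), symmetric]) (use that in simp)
  finally show ?thesis by (simp add: mult_ac)
 qed
 show thesis
 proof (rule that[OF \<pi>(1) _ m g])
  fix x :: real assume "0 < x"
  then show "max 1 (x ^ 3) * \<pi> x \<le> varpi" unfolding \<pi>(4) by (intro max.coboundedI2 cSUP_upper \<pi>(3)) simp
 next
  have "(\<integral>k. k\<^sup>2 \<partial>L) = \<mu>^2" unfolding m2 by simp
  have "(\<integral>\<^sup>+x. ennreal (\<pi> x) * ennreal (1 + x^2) * indicator {0<..} x \<partial>lborel) = (\<integral>\<^sup>+k. ennreal (1 + (\<bar>k\<bar> / \<mu>)\<^sup>2) \<partial>L)"
   by (rule g[symmetric]) measurable
  also have "... = ennreal (\<integral>k. 1 + (\<bar>k\<bar> / \<mu>)\<^sup>2 \<partial>L)"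
   by (intro nn_integral_eq_integral) (auto simp: power_divide intro!: Bochner_Integration.integrable_add integrable_divide int)
  also have "(\<integral>k. 1 + (\<bar>k\<bar> / \<mu>)\<^sup>2 \<partial>L) = 1 + (\<integral>k. k\<^sup>2 \<partial>L) / \<mu>^2"
   using prob_space by (simp add: power_divide int)
  also have "... = 2" unfolding \<open>(\<integral>k. k\<^sup>2 \<partial>L) = \<mu>\<^sup>2\<close> using \<mu> by simp
  finally show "(\<integral>\<^sup>+x. ennreal (\<pi> x) * ennreal (1 + x^2) * indicator {0<..} x \<partial>lborel) = 2" by simp
 qed
qed

lemma sampling_law_ge_1: "sampling_law L \<mu> varpi ==> 1 \<le> varpi" by (auto simp: sampling_law_def)

lemma ennreal_combine:
 "0 \<le> b ==> 0 \<le> n ==> 0 \<le> a ==> 0 \<le> y ==> 0 \<le> z ==>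
  ennreal (b * n + a * (y * z)) = ennreal b * ennreal n + ennreal a * (ennreal y * ennreal z)" by (simp add: ennreal_mult)

text \<open>The singular part contributes \<open>1 / (1 - a) = c\<close>. This factor
  \<open>c\<close> reappears in the failure probability, and its power \<open>N - 1\<close> is the
  eventual power of the logarithm.\<close>

lemma sampling_ratio_moment:
 assumes L: "sampling_law L \<mu> varpi" and \<mu>: "0 < \<mu>" and k: "0 < k" and c: "2 < c"
 shows "(\<integral>\<^sup>+x. ennreal (((w^2 + (\<bar>x\<bar> / \<mu>)\<^sup>2) / \<bar>k^2 - (\<bar>x\<bar> / \<mu>)\<^sup>2\<bar>) powr (1 - 1 / c)) \<partial>L) \<le> ennreal (23 * c * \<Q> varpi c k w powr (1 - 1 / c))"
proof -
 define a where "a = 1 - 1 / c"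
 have a: "0 < a" "a < 1" "1 / (1 - a) = c" using c by (auto simp: a_def)
 define A where "A = \<Q> 1 c k w powr a"
 have A: "0 \<le> A" by (simp add: A_def)
 have \<pi>1: "1 \<le> varpi" by (rule sampling_law_ge_1[OF L])
 have QA: "\<Q> varpi c k w powr a = varpi * A"
 proof -
  \<comment> \<open>The exponent in \<open>\<Q>\<close> is the reciprocal of \<open>a\<close>, so
    that \<open>varpi\<close> enters the moment linearly, as it does in the bound for the
    density.\<close>
  have "(varpi powr (c / (c - 1))) powr a = varpi powr 1" unfolding powr_powr a_def using c by (simp add: field_simps)
  then show ?thesis unfolding Q_scale[of varpi] A_def using Q_1_pos[of k c w] k \<pi>1 by (simp add: powr_mult)
 qed
 show ?thesis
 proof (rule sampling_law_density[OF L \<mu>], goal_cases)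
  case (1 \<pi>)
  note \<pi>[measurable] = 1(3)
  show ?case
  proof (rule sampling_ratio_bound[OF k a(1,2), of w c], goal_cases)
   case (1 h)
   let ?n = "\<lambda>x. indicator {..h} \<bar>k - x\<bar> * \<bar>k - x\<bar> powr (-a)"
   let ?b = "A * (4 / 3 * h powr (a - 1) * varpi)"
   have b: "0 \<le> ?b" using A \<pi>1 by simp
   have "(\<integral>\<^sup>+x. ennreal (((w^2 + (\<bar>x\<bar> / \<mu>)\<^sup>2) / \<bar>k^2 - (\<bar>x\<bar> / \<mu>)\<^sup>2\<bar>) powr a) \<partial>L)
     = (\<integral>\<^sup>+x. ennreal (\<pi> x) * ennreal (((w^2 + x^2) / \<bar>k^2 - x^2\<bar>) powr a) * indicator {0<..} x \<partial>lborel)"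
    by (rule \<open>\<And>g. g \<in> borel_measurable borel ==> _ g\<close>) measurable
   also have "... \<le> (\<integral>\<^sup>+x. ennreal ?b * ennreal (?n x) + ennreal (20 * A) * (ennreal (\<pi> x) * ennreal (1 + x^2) * indicator {0<..} x) \<partial>lborel)"
   proof (intro nn_integral_mono)
    fix x :: real
    show "ennreal (\<pi> x) * ennreal (((w^2 + x^2) / \<bar>k^2 - x^2\<bar>) powr a) * indicator {0<..} x
      \<le> ennreal ?b * ennreal (?n x) + ennreal (20 * A) * (ennreal (\<pi> x) * ennreal (1 + x^2) * indicator {0<..} x)"
    proof (cases "0 < x")
     case True
     have "\<pi> x * ((w^2 + x^2) / \<bar>k^2 - x^2\<bar>) powr a \<le> \<pi> x * (A * (4 / 3 * h powr (a - 1) * ?n x * max 1 (x ^ 3) + 20 * (1 + x^2)))"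
      unfolding A_def by (intro mult_left_mono 1 True \<open>\<And>x. 0 \<le> \<pi> x\<close>)
     also have "... = A * (4 / 3 * h powr (a - 1) * (max 1 (x ^ 3) * \<pi> x)) * ?n x + 20 * A * (\<pi> x * (1 + x^2))" by (simp add: algebra_simps)
     also have "... \<le> ?b * ?n x + 20 * A * (\<pi> x * (1 + x^2))"
      using A True by (intro add_right_mono mult_right_mono mult_left_mono \<open>\<And>x. 0 < x ==> max 1 (x ^ 3) * \<pi> x \<le> varpi\<close>) auto
     finally have "\<pi> x * ((w^2 + x^2) / \<bar>k^2 - x^2\<bar>) powr a \<le> ?b * ?n x + 20 * A * (\<pi> x * (1 + x^2))" .
     then have "ennreal (\<pi> x * ((w^2 + x^2) / \<bar>k^2 - x^2\<bar>) powr a) \<le> ennreal (?b * ?n x + 20 * A * (\<pi> x * (1 + x^2)))"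
      by (rule ennreal_leI)
     also have "... = ennreal ?b * ennreal (?n x) + ennreal (20 * A) * (ennreal (\<pi> x) * ennreal (1 + x^2))"
      by (rule ennreal_combine) (use b A \<open>\<And>x. 0 \<le> \<pi> x\<close> in auto)
     finally show ?thesis using True \<open>\<And>x. 0 \<le> \<pi> x\<close>[of x] by (simp only: ennreal_mult'' powr_ge_zero indicator_simps greaterThan_iff mult_1_right)
    qed simp
   qed
   also have "... = ennreal ?b * (\<integral>\<^sup>+x. ennreal (?n x) \<partial>lborel) + ennreal (20 * A) * 2"
    using \<open>(\<integral>\<^sup>+x. ennreal (\<pi> x) * ennreal (1 + x^2) * indicator {0<..} x \<partial>lborel) = 2\<close>
    by (subst nn_integral_add; (subst nn_integral_cmult)?) (simp_all add: nn_integral_cmult)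
   also have "(\<integral>\<^sup>+x. ennreal (?n x) \<partial>lborel) = (\<integral>\<^sup>+x. ennreal (?n x) \<partial>lebesgue_on UNIV)"
    by (simp add: nn_integral_completion lebesgue_on_UNIV_eq)
   also have "... \<le> ennreal (2 * (h powr (-a + 1) / (-a + 1)))" by (rule nn_integral_powr_near) (use 1(1) a in auto)
   also have "2 * (h powr (-a + 1) / (-a + 1)) = 2 * c * h powr (1 - a)" using a(3) by (simp add: divide_inverse mult_ac)
   also have "ennreal ?b * ennreal (2 * c * h powr (1 - a)) + ennreal (20 * A) * 2 = ennreal (?b * (2 * c * h powr (1 - a)) + 20 * A * 2)"
   proof -
    have "ennreal (?b * (2 * c * h powr (1 - a)) + 20 * A * (1 * 2)) = ennreal ?b * ennreal (2 * c * h powr (1 - a)) + ennreal (20 * A) * (ennreal 1 * ennreal 2)"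
     by (rule ennreal_combine) (use b A c in auto)
    then show ?thesis by (simp only: mult_1_left ennreal_1 ennreal_numeral)
   qed
   also have "?b * (2 * c * h powr (1 - a)) + 20 * A * 2 \<le> 23 * c * (varpi * A)"
   proof -
    have "h powr (a - 1) * h powr (1 - a) = 1" using 1(1) by (simp add: powr_add[symmetric])
    moreover have "?b * (2 * c * h powr (1 - a)) = 8 / 3 * c * (varpi * A) * (h powr (a - 1) * h powr (1 - a))" by (simp only: mult_ac)
    ultimately have e: "?b * (2 * c * h powr (1 - a)) = 8 / 3 * c * (varpi * A)" by simp
    define y where "y = c * (varpi * A)"
    \<comment> \<open>The contribution \<open>40 * A\<close> of the far part is at most
      \<open>20 * y\<close> because \<open>c > 2\<close>, and \<open>8 / 3 + 20\<close> is below
      23.\<close>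
    have "2 * (1 * A) \<le> y" unfolding y_def using c \<pi>1 A by (intro mult_mono) auto
    moreover have "0 \<le> y" unfolding y_def using c \<pi>1 A by simp
    moreover have "8 / 3 * c * (varpi * A) = 8 / 3 * y" "23 * c * (varpi * A) = 23 * y" by (simp_all add: y_def)
    ultimately show ?thesis unfolding e by linarith
   qed
   finally show ?case unfolding QA[unfolded a_def] a_def by (simp add: add_right_mono mult_left_mono ennreal_leI)
  qed
 qed
qed

text \<open>On the event every one of the \<open>N - 1\<close> factors \<open>exp c * \<Q>\<close>
  meets a factor \<open>(k i)\<^sup>2\<close>, and \<open>Q_upper\<close> bounds the product by a
  quantity free of the features. Only two powers of \<open>k i\<close> are left over, and their
  expectation is finite.\<close>

lemma rf_event_bound:
 assumes ev: "rf_event varpi N k \<mu> C c" and i: "i < N" and k: "k i \<noteq> 0" and \<mu>: "0 < \<mu>" and C: "0 \<le> C" and c: "2 < c" and \<pi>: "1 \<le> varpi"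
 shows "node_ratio N k C i * (\<bar>k i\<bar> ^ (2 * N) + C * \<bar>k i\<bar> ^ (2 * N - 1)) \<le> (exp c * (10 * varpi^2 * (\<mu>^2 + C^2))) ^ (N - 1) * (2 * (k i)\<^sup>2 + C^2)"
proof -
 define \<kappa> where "\<kappa> = \<bar>k i\<bar> / \<mu>"
 have \<kappa>: "0 < \<kappa>" using k \<mu> by (simp add: \<kappa>_def)
 let ?q = "\<Q> varpi c \<kappa> (C / \<mu>)"
 have q: "0 < ?q" by (rule Q_pos) (use \<kappa> \<pi> in auto)
 have "\<bar>k i\<bar> ^ (2 * (N - 1) + l) = ((k i)\<^sup>2) ^ (N - 1) * \<bar>k i\<bar> ^ l" for l by (simp only: power_add power_mult power2_abs)
 moreover have "2 * N = 2 * (N - 1) + 2" "2 * N - 1 = 2 * (N - 1) + 1" using i by auto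
 ultimately have N: "\<bar>k i\<bar> ^ (2 * N) = ((k i)\<^sup>2) ^ (N - 1) * (k i)\<^sup>2" "\<bar>k i\<bar> ^ (2 * N - 1) = ((k i)\<^sup>2) ^ (N - 1) * \<bar>k i\<bar>"
  by (metis power2_abs, metis power_one_right)
 have p: "\<bar>k i\<bar> ^ (2 * N) + C * \<bar>k i\<bar> ^ (2 * N - 1) = ((k i)\<^sup>2) ^ (N - 1) * ((k i)\<^sup>2 + C * \<bar>k i\<bar>)"
  unfolding N by (simp add: algebra_simps)
 have "node_ratio N k C i \<le> (exp c * ?q) ^ (N - 1)"
 proof (cases "N = 1")
  case True
  then have "{..<N} - {i} = {}" using i by auto
  then show ?thesis unfolding node_ratio_def by (simp only: prod.empty True diff_self_eq_0 power_0)
 next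
  case False
  then show ?thesis using ev i by (auto simp: rf_event_def node_ratio_def \<kappa>_def)
 qed
 then have "node_ratio N k C i * ((k i)\<^sup>2) ^ (N - 1) \<le> (exp c * ?q) ^ (N - 1) * ((k i)\<^sup>2) ^ (N - 1)" by (rule mult_right_mono) simp
 also have "... = (exp c * (?q * (k i)\<^sup>2)) ^ (N - 1)" by (simp add: power_mult_distrib)
 also have "... \<le> (exp c * (10 * varpi^2 * (\<mu>^2 + C^2))) ^ (N - 1)"
 proof (intro power_mono mult_left_mono)
  have "?q * (k i)\<^sup>2 = (?q * \<kappa>^2) * \<mu>^2" using \<mu> by (simp add: \<kappa>_def power_divide)
  also have "... \<le> (10 * varpi^2 * (1 + (C / \<mu>)\<^sup>2)) * \<mu>^2" by (intro mult_right_mono Q_upper \<kappa> c \<pi>) simp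
  also have "... = 10 * varpi^2 * (\<mu>^2 + C^2)" using \<mu> by (simp add: power_divide field_simps)
  finally show "?q * (k i)\<^sup>2 \<le> 10 * varpi^2 * (\<mu>^2 + C^2)" .
 qed (use q in auto)
 finally have 1: "node_ratio N k C i * ((k i)\<^sup>2) ^ (N - 1) \<le> (exp c * (10 * varpi^2 * (\<mu>^2 + C^2))) ^ (N - 1)" .
 have "2 * (C * \<bar>k i\<bar>) \<le> (k i)\<^sup>2 + C^2" using zero_le_power2[of "C - \<bar>k i\<bar>"] by (simp add: power2_diff)
 moreover have "0 \<le> C^2" "0 \<le> (k i)\<^sup>2" by simp_all
 ultimately have "(k i)\<^sup>2 + C * \<bar>k i\<bar> \<le> 2 * (k i)\<^sup>2 + C^2" by linarith
 then have "(node_ratio N k C i * ((k i)\<^sup>2) ^ (N - 1)) * ((k i)\<^sup>2 + C * \<bar>k i\<bar>) \<le> (exp c * (10 * varpi^2 * (\<mu>^2 + C^2))) ^ (N - 1) * (2 * (k i)\<^sup>2 + C^2)"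
  using 1 C node_ratio_nonneg by (intro mult_mono) auto
 then show ?thesis unfolding p by (simp only: mult.assoc)
qed

lemma Q_measurable [measurable (raw)]:
 assumes [measurable]: "f \<in> borel_measurable M"
 shows "(\<lambda>x. \<Q> varpi c (f x) w) \<in> borel_measurable M"
 unfolding \<Q>_def Let_def by measurable

section \<open>Independent features and the probability that the event fails\<close>

locale feature_sample = prob_space P for P :: "'w measure" +
 fixes N :: nat and k :: "nat => 'w => real" and L \<mu> varpi
 assumes iid: "iid_with_law P N k L" and law: "sampling_law L \<mu> varpi" and \<mu>: "0 < \<mu>"
begin

lemma k_measurable: "q < N ==> k q \<in> borel_measurable P" using iid by (auto simp: iid_with_law_def indep_vars_def)

sublocale L: real_distribution L using law by (simp add: sampling_law_def)

lemma measurable_law: "f \<in> borel_measurable borel ==> f \<in> borel_measurable L" by (simp add: measurable_cong_sets[OF L.events_eq_borel refl])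

sublocale LL: product_sigma_finite "\<lambda>_::nat. L" by standard

lemma distr_k: "q < N ==> distr P borel (k q) = L" using iid by (simp add: iid_with_law_def)

text \<open>Independence enters through this identity alone: the joint law of the features in
  \<open>I\<close> is the product of copies of \<open>L\<close>.\<close>

lemma nn_integral_joint:
 assumes I: "I \<subseteq> {..<N}" "I \<noteq> {}" and f: "f \<in> borel_measurable (Pi\<^sub>M I (\<lambda>_. borel))"
 shows "(\<integral>\<^sup>+w. f (\<lambda>q\<in>I. k q w) \<partial>P) = (\<integral>\<^sup>+z. f z \<partial>Pi\<^sub>M I (\<lambda>_. L))"
proof -
 have iv: "indep_vars (\<lambda>_. borel) k I" using iid I(1) by (auto simp: iid_with_law_def intro: indep_vars_subset)
 have d: "distr P (Pi\<^sub>M I (\<lambda>_. borel)) (\<lambda>w. \<lambda>q\<in>I. k q w) = Pi\<^sub>M I (\<lambda>q. distr P borel (k q))"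
  using iv by (subst (asm) indep_vars_iff_distr_eq_PiM'[OF I(2)]) (use I k_measurable in auto)
 have e: "Pi\<^sub>M I (\<lambda>q. distr P borel (k q)) = Pi\<^sub>M I (\<lambda>_. L)" using I(1) distr_k by (intro PiM_cong) auto
 have m: "(\<lambda>w. \<lambda>q\<in>I. k q w) \<in> P \<rightarrow>\<^sub>M Pi\<^sub>M I (\<lambda>_. borel)" using I(1) k_measurable by (intro measurable_restrict) auto
 show ?thesis unfolding e[symmetric] d[symmetric] by (rule nn_integral_distr[OF m, symmetric]) (use f in simp)
qed

lemma AE_law_notin_finite:
 assumes "finite S" shows "AE x in L. x \<notin> S"
proof (rule AE_I)
 have "S \<in> null_sets lborel" using assms by (rule finite_imp_null_set_lborel)
 then have "S \<in> null_sets L" using law by (auto simp: sampling_law_def absolutely_continuous_def)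
 then show "emeasure L S = 0" "S \<in> sets L" by auto
qed auto

lemma AE_nonzero: "q < N ==> AE w in P. k q w \<noteq> 0"
proof -
 assume q: "q < N"
 have "AE x in distr P borel (k q). x \<noteq> 0" using AE_law_notin_finite[of "{0}"] by (subst distr_k[OF q]) simp
 then show ?thesis by (subst (asm) AE_distr_iff) (use k_measurable[OF q] in auto)
qed

text \<open>For a fixed value \<open>x\<close> of one feature, the squares coincide only if the
  other feature lies in \<open>{x, - x}\<close>, which is a null set for an absolutely continuous
  law.\<close>

lemma AE_distinct_pair:
 assumes "i < N" "j < N" "i \<noteq> j"
 shows "AE w in P. (k i w)\<^sup>2 \<noteq> (k j w)\<^sup>2"
proof -
 note [measurable] = k_measurable
 have I: "insert i {j} \<subseteq> {..<N}" "insert i {j} \<noteq> {}" using assms by auto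
 let ?g = "\<lambda>x y :: real. if x\<^sup>2 = y^2 then 1 else 0 :: ennreal"
 have m: "(\<lambda>z. ?g (z i) (z j)) \<in> borel_measurable (Pi\<^sub>M (insert i {j}) (\<lambda>_. borel))" by measurable
 have m': "(\<lambda>z. ?g (z i) (z j)) \<in> borel_measurable (Pi\<^sub>M (insert i {j}) (\<lambda>_. L))"
  using m by (subst measurable_cong_sets[OF sets_PiM_cong refl]) auto
 have m2: "case_prod ?g \<in> borel_measurable (L \<Otimes>\<^sub>M L)"
 proof -
  have "(\<lambda>z. ?g (fst z) (snd z)) \<in> borel_measurable (borel \<Otimes>\<^sub>M borel)" by measurable
  then show ?thesis by (subst measurable_cong_sets[OF sets_pair_measure_cong refl]) (auto simp: case_prod_beta')
 qed
 have "(\<integral>\<^sup>+w. ?g (k i w) (k j w) \<partial>P) = (\<integral>\<^sup>+z. ?g (z i) (z j) \<partial>Pi\<^sub>M (insert i {j}) (\<lambda>_. L))"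
  by (subst nn_integral_joint[OF I m, symmetric]) simp
 also have "... = (\<integral>\<^sup>+x. (\<integral>\<^sup>+z. ?g ((z(i := x)) i) ((z(i := x)) j) \<partial>Pi\<^sub>M {j} (\<lambda>_. L)) \<partial>L)"
  by (rule LL.product_nn_integral_insert_rev) (use assms m' in auto)
 also have "... = (\<integral>\<^sup>+x. 0 \<partial>L)"
 proof (rule nn_integral_cong)
  fix x assume "x \<in> space L"
  have mx: "?g x \<in> borel_measurable L" by (rule measurable_law) measurable
  have "(\<integral>\<^sup>+z. ?g x (z j) \<partial>Pi\<^sub>M {j} (\<lambda>_. L)) = (\<integral>\<^sup>+y. ?g x y \<partial>L)"
   by (rule LL.product_nn_integral_singleton[OF mx])
  also have "... = (\<integral>\<^sup>+y. 0 \<partial>L)"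
  proof (rule nn_integral_cong_AE)
   have "finite {x, - x}" by simp
   from AE_law_notin_finite[OF this] show "AE y in L. ?g x y = 0" by (elim eventually_mono) (auto simp: power2_eq_iff)
  qed
  finally show "(\<integral>\<^sup>+z. ?g ((z(i := x)) i) ((z(i := x)) j) \<partial>Pi\<^sub>M {j} (\<lambda>_. L)) = 0" using assms by simp
 qed
 finally have 0: "(\<integral>\<^sup>+w. ?g (k i w) (k j w) \<partial>P) = 0" by simp
 have "AE w in P. ?g (k i w) (k j w) = 0" using assms by (subst nn_integral_0_iff_AE[symmetric]) (auto simp: 0)
 then show ?thesis by eventually_elim (auto split: if_splits)
qed

lemma AE_regular: "AE w in P. distinct_squares N (\<lambda>q. k q w) \<and> (\<forall>q<N. k q w \<noteq> 0)"
proof -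
 have "AE w in P. \<forall>i\<in>{..<N}. \<forall>j\<in>{..<N} - {i}. (k i w)\<^sup>2 \<noteq> (k j w)\<^sup>2"
  by (intro AE_finite_allI AE_distinct_pair) auto
 moreover have "AE w in P. \<forall>q\<in>{..<N}. k q w \<noteq> 0" by (intro AE_finite_allI AE_nonzero) auto
 ultimately show ?thesis by eventually_elim (auto simp: distinct_squares_def)
qed

lemma second_moment: "q < N ==> (\<integral>\<^sup>+w. ennreal ((k q w)\<^sup>2) \<partial>P) = ennreal (\<mu>^2)"
proof -
 assume q: "q < N"
 have L: "integrable L (\<lambda>k. k\<^sup>2)" "\<mu> = sqrt (\<integral>k. k\<^sup>2 \<partial>L)" using law by (auto simp: sampling_law_def)
 have "(\<integral>\<^sup>+w. ennreal ((k q w)\<^sup>2) \<partial>P) = (\<integral>\<^sup>+x. ennreal (x^2) \<partial>distr P borel (k q))"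
  using k_measurable[OF q] by (subst nn_integral_distr) auto
 also have "... = ennreal (\<integral>x. x\<^sup>2 \<partial>L)" unfolding distr_k[OF q] by (rule nn_integral_eq_integral[OF L(1)]) simp
 also have "(\<integral>x. x\<^sup>2 \<partial>L) = \<mu>^2" unfolding L(2) by simp
 finally show ?thesis .
qed

lemma node_ratio_measurable: "i < N ==> (\<lambda>w. node_ratio N (\<lambda>q. k q w) C i) \<in> borel_measurable P" unfolding node_ratio_def
proof (intro borel_measurable_prod)
 fix j assume "i < N" "j \<in> {..<N} - {i}"
 then have [measurable]: "k i \<in> borel_measurable P" "k j \<in> borel_measurable P" by (auto intro: k_measurable)
 show "(\<lambda>w. (C^2 + (k j w)\<^sup>2) / \<bar>(k i w)\<^sup>2 - (k j w)\<^sup>2\<bar>) \<in> borel_measurable P" by measurable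
qed

lemma rf_event_measurable: "{w \<in> space P. rf_event varpi N (\<lambda>q. k q w) \<mu> C c} \<in> sets P"
proof (cases "N = 1")
 case False
 have "{w \<in> space P. rf_event varpi N (\<lambda>q. k q w) \<mu> C c}
  = {w \<in> space P. \<forall>i\<in>{..<N}. node_ratio N (\<lambda>q. k q w) C i < (exp c * \<Q> varpi c (\<bar>k i w\<bar> / \<mu>) (C / \<mu>)) ^ (N - 1)}"
  using False by (auto simp: rf_event_def node_ratio_def)
 also have "... \<in> sets P"
 proof (intro sets.sets_Collect_finite_All)
  fix i assume i: "i \<in> {..<N}"
  then have [measurable]: "(\<lambda>w. node_ratio N (\<lambda>q. k q w) C i) \<in> borel_measurable P" "k i \<in> borel_measurable P"
   by (auto intro: node_ratio_measurable k_measurable)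
  show "{w \<in> space P. node_ratio N (\<lambda>q. k q w) C i < (exp c * \<Q> varpi c (\<bar>k i w\<bar> / \<mu>) (C / \<mu>)) ^ (N - 1)} \<in> sets P"
   by measurable
 qed simp
 finally show ?thesis .
qed (simp add: rf_event_def)

text \<open>Markov's inequality for the power \<open>a = 1 - 1 / c\<close> of the node ratio. For a
  fixed value of \<open>k i\<close> the factors are independent, so their moment is the power
  \<open>N - 1\<close> of a single moment, at most \<open>23 * c * \<Q> powr a\<close>. Dividing by
  the threshold to the power \<open>a\<close> cancels \<open>\<Q>\<close> and leaves
  \<open>23 * c * exp (- c * a)\<close>.\<close>

lemma ill_conditioned_node:
 assumes i: "i < N" and c: "2 < c"
 shows "emeasure P {w \<in> space P. \<not> node_ratio N (\<lambda>q. k q w) C i < (exp c * \<Q> varpi c (\<bar>k i w\<bar> / \<mu>) (C / \<mu>)) ^ (N - 1)}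
  \<le> ennreal ((69 * c * exp (-c)) ^ (N - 1))"
proof -
 define a where "a = 1 - 1 / c"
 have a: "0 < a" "a < 1" using c by (auto simp: a_def)
 have \<pi>: "1 \<le> varpi" by (rule sampling_law_ge_1[OF law])
 define X where "X x = exp c * \<Q> varpi c (\<bar>x\<bar> / \<mu>) (C / \<mu>)" for x
 have X: "0 < X x" for x unfolding X_def using \<mu> \<pi> by (intro mult_pos_pos Q_pos) auto
 have [measurable]: "X \<in> borel_measurable borel" unfolding X_def[abs_def] by measurable
 define G where "G x y = ((C^2 + y^2) / \<bar>x^2 - y^2\<bar>) powr a / X x powr a" for x y
 have G0: "0 \<le> G x y" for x y by (simp add: G_def)
 have [measurable]: "case_prod G \<in> borel_measurable (borel \<Otimes>\<^sub>M borel)" unfolding G_def[abs_def] by measurable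
 let ?I = "{..<N} - {i}"
 have I: "insert i ?I \<subseteq> {..<N}" "insert i ?I \<noteq> {}" using i by auto
 let ?f = "\<lambda>z. \<Prod>j\<in>?I. ennreal (G (z i) (z j))"
 have m: "?f \<in> borel_measurable (Pi\<^sub>M (insert i ?I) (\<lambda>_. borel))"
 proof (intro borel_measurable_prod_ennreal)
  fix j assume j: "j \<in> ?I"
  have "(\<lambda>z. (z i, z j)) \<in> Pi\<^sub>M (insert i ?I) (\<lambda>_. borel) \<rightarrow>\<^sub>M (borel \<Otimes>\<^sub>M borel :: (real \<times> real) measure)"
   using j by (intro measurable_Pair measurable_component_singleton) auto
  then have "(\<lambda>z. case_prod G (z i, z j)) \<in> borel_measurable (Pi\<^sub>M (insert i ?I) (\<lambda>_. borel))" by (rule measurable_compose) measurable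
  then show "(\<lambda>z. ennreal (G (z i) (z j))) \<in> borel_measurable (Pi\<^sub>M (insert i ?I) (\<lambda>_. borel))" by simp
 qed
 have m': "?f \<in> borel_measurable (Pi\<^sub>M (insert i ?I) (\<lambda>_. L))" using m by (subst measurable_cong_sets[OF sets_PiM_cong refl]) auto
 have moment: "(\<integral>\<^sup>+y. ennreal (G x y) \<partial>L) \<le> ennreal (69 * c * exp (-c))" if x: "x \<noteq> 0" for x
 proof -
  have r: "(C^2 + y^2) / \<bar>x^2 - y^2\<bar> = ((C / \<mu>)\<^sup>2 + (\<bar>y\<bar> / \<mu>)\<^sup>2) / \<bar>(\<bar>x\<bar> / \<mu>)\<^sup>2 - (\<bar>y\<bar> / \<mu>)\<^sup>2\<bar>" for y
  proof -
   have "((C / \<mu>)\<^sup>2 + (\<bar>y\<bar> / \<mu>)\<^sup>2) = (C^2 + y^2) / \<mu>^2" "\<bar>(\<bar>x\<bar> / \<mu>)\<^sup>2 - (\<bar>y\<bar> / \<mu>)\<^sup>2\<bar> = \<bar>x^2 - y^2\<bar> / \<mu>^2"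
    by (simp_all add: power_divide add_divide_distrib diff_divide_distrib[symmetric])
   then show ?thesis using \<mu> by simp
  qed
  have "(\<integral>\<^sup>+y. ennreal (G x y) \<partial>L) = (\<integral>\<^sup>+y. ennreal (1 / X x powr a) * ennreal (((C^2 + y^2) / \<bar>x^2 - y^2\<bar>) powr a) \<partial>L)"
   by (intro nn_integral_cong) (simp add: G_def ennreal_mult''[symmetric])
  also have "... = ennreal (1 / X x powr a) * (\<integral>\<^sup>+y. ennreal (((C^2 + y^2) / \<bar>x^2 - y^2\<bar>) powr a) \<partial>L)"
   by (rule nn_integral_cmult, rule measurable_law) measurable
  also have "... \<le> ennreal (1 / X x powr a) * ennreal (23 * c * \<Q> varpi c (\<bar>x\<bar> / \<mu>) (C / \<mu>) powr a)"
   unfolding r a_def by (intro mult_left_mono sampling_ratio_moment[OF law \<mu>] c) (use x \<mu> in auto)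
  also have "... = ennreal (23 * c * exp (- (c * a)))"
  proof -
   have q: "0 < \<Q> varpi c (\<bar>x\<bar> / \<mu>) (C / \<mu>)" using \<mu> \<pi> by (intro Q_pos) auto
   have "X x powr a = exp (c * a) * \<Q> varpi c (\<bar>x\<bar> / \<mu>) (C / \<mu>) powr a" using q by (simp add: X_def powr_mult exp_powr_real)
   then have "1 / X x powr a * (23 * c * \<Q> varpi c (\<bar>x\<bar> / \<mu>) (C / \<mu>) powr a) = 23 * c * exp (- (c * a))"
    using q by (simp add: exp_minus field_simps)
   then show ?thesis using c by (subst ennreal_mult[symmetric]) simp_all
  qed
  also have "... \<le> ennreal (69 * c * exp (-c))"
  proof (intro ennreal_leI)
   \<comment> \<open>Using the power \<open>a\<close> in place of the first moment costs only a
     factor \<open>exp 1 <= 3\<close>, whence 69.\<close>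
   have e: "- (c * a) = 1 + - c" using c by (simp add: a_def field_simps)
   have "c * exp (- c) * exp 1 \<le> c * exp (- c) * 3" using c exp_le by (intro mult_left_mono) auto
   then show "23 * c * exp (- (c * a)) \<le> 69 * c * exp (- c)" unfolding e exp_add by (simp add: mult_ac)
  qed
  finally show ?thesis .
 qed
 have "emeasure P {w \<in> space P. \<not> node_ratio N (\<lambda>q. k q w) C i < X (k i w) ^ (N - 1)}
   = (\<integral>\<^sup>+w. indicator {w \<in> space P. \<not> node_ratio N (\<lambda>q. k q w) C i < X (k i w) ^ (N - 1)} w \<partial>P)"
 proof -
  note [measurable] = node_ratio_measurable[OF i] k_measurable[OF i]
  show ?thesis by (rule nn_integral_indicator[symmetric]) measurable
 qed
 also have "... \<le> (\<integral>\<^sup>+w. ?f (\<lambda>q\<in>insert i ?I. k q w) \<partial>P)"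
 proof (rule nn_integral_mono)
  fix w assume "w \<in> space P"
  show "indicator {w \<in> space P. \<not> node_ratio N (\<lambda>q. k q w) C i < X (k i w) ^ (N - 1)} w \<le> ?f (\<lambda>q\<in>insert i ?I. k q w)"
  proof (cases "node_ratio N (\<lambda>q. k q w) C i < X (k i w) ^ (N - 1)")
   case False
   have f: "?f (\<lambda>q\<in>insert i ?I. k q w) = ennreal (\<Prod>j\<in>?I. G (k i w) (k j w))" using G0 by (simp add: prod_ennreal)
   have "(\<Prod>j\<in>?I. G (k i w) (k j w)) = node_ratio N (\<lambda>q. k q w) C i powr a / (X (k i w) powr a) ^ (N - 1)"
   proof -
    have "node_ratio N (\<lambda>q. k q w) C i powr a = (\<Prod>j\<in>?I. ((C^2 + (k j w)\<^sup>2) / \<bar>(k i w)\<^sup>2 - (k j w)\<^sup>2\<bar>) powr a)"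
     unfolding node_ratio_def by (rule prod_powr_distrib)
    moreover have "(\<Prod>j\<in>?I. X (k i w) powr a) = (X (k i w) powr a) ^ (N - 1)" using i by simp
    ultimately show ?thesis by (simp only: G_def prod_dividef)
   qed
   moreover have "(X (k i w) powr a) ^ (N - 1) \<le> node_ratio N (\<lambda>q. k q w) C i powr a"
   proof -
    have "(X (k i w) powr a) ^ (N - 1) = (X (k i w) ^ (N - 1)) powr a"
    proof -
     have "X (k i w) ^ (N - 1) = X (k i w) powr real (N - 1)" using powr_realpow[OF X] by simp
     moreover have "(X (k i w) powr a) ^ (N - 1) = (X (k i w) powr a) powr real (N - 1)"
      using powr_realpow[of "X (k i w) powr a"] X[of "k i w"] by simp
     ultimately show ?thesis by (simp only: powr_powr mult.commute)
    qed
    also have "... \<le> node_ratio N (\<lambda>q. k q w) C i powr a" using X[of "k i w"] False a by (intro powr_mono2) auto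
    finally show ?thesis .
   qed
   moreover have "0 < (X (k i w) powr a) ^ (N - 1)" using X[of "k i w"] by simp
   ultimately have "1 \<le> (\<Prod>j\<in>?I. G (k i w) (k j w))" by (simp only: le_divide_eq_1_pos)
   then have "ennreal 1 \<le> ennreal (\<Prod>j\<in>?I. G (k i w) (k j w))" by (rule ennreal_leI)
   then show ?thesis unfolding f by (auto simp: indicator_def)
  qed simp
 qed
 also have "... = (\<integral>\<^sup>+z. ?f z \<partial>Pi\<^sub>M (insert i ?I) (\<lambda>_. L))" by (rule nn_integral_joint[OF I m])
 also have "... = (\<integral>\<^sup>+x. (\<integral>\<^sup>+z. ?f (z(i := x)) \<partial>Pi\<^sub>M ?I (\<lambda>_. L)) \<partial>L)"
  by (rule LL.product_nn_integral_insert_rev) (use m' in auto)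
 also have "... = (\<integral>\<^sup>+x. (\<integral>\<^sup>+y. ennreal (G x y) \<partial>L) ^ (N - 1) \<partial>L)"
 proof (rule nn_integral_cong)
  fix x
  have "(\<integral>\<^sup>+z. ?f (z(i := x)) \<partial>Pi\<^sub>M ?I (\<lambda>_. L)) = (\<integral>\<^sup>+z. (\<Prod>j\<in>?I. ennreal (G x (z j))) \<partial>Pi\<^sub>M ?I (\<lambda>_. L))"
   by (intro nn_integral_cong prod.cong) auto
  also have "... = (\<Prod>j\<in>?I. \<integral>\<^sup>+y. ennreal (G x y) \<partial>L)" by (rule LL.product_nn_integral_prod) (auto simp: G_def)
  also have "... = (\<integral>\<^sup>+y. ennreal (G x y) \<partial>L) ^ (N - 1)" using i by simp
  finally show "(\<integral>\<^sup>+z. ?f (z(i := x)) \<partial>Pi\<^sub>M ?I (\<lambda>_. L)) = (\<integral>\<^sup>+y. ennreal (G x y) \<partial>L) ^ (N - 1)" .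
 qed
 also have "... \<le> (\<integral>\<^sup>+x. ennreal ((69 * c * exp (-c)) ^ (N - 1)) \<partial>L)"
 proof (rule nn_integral_mono_AE)
  show "AE x in L. (\<integral>\<^sup>+y. ennreal (G x y) \<partial>L) ^ (N - 1) \<le> ennreal ((69 * c * exp (-c)) ^ (N - 1))"
   using AE_law_notin_finite[of "{0}", OF finite.insertI[OF finite.emptyI]]
  proof (elim eventually_mono)
   fix x :: real assume "x \<notin> {0}"
   then have "(\<integral>\<^sup>+y. ennreal (G x y) \<partial>L) ^ (N - 1) \<le> ennreal (69 * c * exp (-c)) ^ (N - 1)" by (intro power_mono moment) auto
   then show "(\<integral>\<^sup>+y. ennreal (G x y) \<partial>L) ^ (N - 1) \<le> ennreal ((69 * c * exp (-c)) ^ (N - 1))" using c by (simp add: ennreal_power)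
  qed
 qed
 also have "... = ennreal ((69 * c * exp (-c)) ^ (N - 1))" using L.emeasure_space_1 by simp
 finally show ?thesis by (simp add: X_def)
qed

lemma ill_conditioned_sample:
 assumes c: "2 < c"
 shows "emeasure P {w \<in> space P. \<not> rf_event varpi N (\<lambda>q. k q w) \<mu> C c} \<le> (if N = 1 then 0 else ennreal (real N * (69 * c * exp (-c)) ^ (N - 1)))"
proof (cases "N = 1")
 case False
 let ?B = "\<lambda>i. {w \<in> space P. \<not> node_ratio N (\<lambda>q. k q w) C i < (exp c * \<Q> varpi c (\<bar>k i w\<bar> / \<mu>) (C / \<mu>)) ^ (N - 1)}"
 have eq: "{w \<in> space P. \<not> rf_event varpi N (\<lambda>q. k q w) \<mu> C c} = (\<Union>i\<in>{..<N}. ?B i)"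
  using False by (auto simp: rf_event_def node_ratio_def)
 have "emeasure P (\<Union>i\<in>{..<N}. ?B i) \<le> (\<Sum>i<N. emeasure P (?B i))"
 proof (rule emeasure_subadditive_finite)
  show "?B ` {..<N} \<subseteq> sets P"
  proof (intro image_subsetI)
   fix i assume "i \<in> {..<N}"
   then have [measurable]: "(\<lambda>w. node_ratio N (\<lambda>q. k q w) C i) \<in> borel_measurable P" "k i \<in> borel_measurable P"
    by (auto intro: node_ratio_measurable k_measurable)
   show "?B i \<in> sets P" by measurable
  qed
 qed simp
 also have "... \<le> (\<Sum>i<N. ennreal ((69 * c * exp (-c)) ^ (N - 1)))" by (rule sum_mono, rule ill_conditioned_node[OF _ c]) simp
 also have "... = ennreal (real N * (69 * c * exp (-c)) ^ (N - 1))"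
 proof -
  have "0 \<le> (69 * c * exp (-c)) ^ (N - 1)" using c by simp
  then show ?thesis by (simp only: sum_constant card_lessThan ennreal_of_nat_eq_real_of_nat ennreal_mult'')
 qed
 finally show ?thesis unfolding eq using False by simp
qed (simp add: rf_event_def)

end

section \<open>Localisation by the partition of unity\<close>

lemma has_weak_deriv_compose1:
 assumes "has_weak_deriv X 1 u w" "has_weak_deriv X n w z"
 shows "has_weak_deriv X (Suc n) u z"
 unfolding has_weak_deriv_def
proof (intro conjI allI impI)
 show "locally_integrable X u" "locally_integrable X z" using assms unfolding has_weak_deriv_def by auto
 fix f assume t: "test_function X f"
 have "(\<integral>x. u x * (deriv ^^ 1) ((deriv ^^ n) f) x \<partial>lebesgue_on X) = (-1) ^ 1 * (\<integral>x. w x * (deriv ^^ n) f x \<partial>lebesgue_on X)"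
  using assms(1) test_function_higher_deriv[OF t] unfolding has_weak_deriv_def by blast
 also have "(\<integral>x. w x * (deriv ^^ n) f x \<partial>lebesgue_on X) = (-1) ^ n * (\<integral>x. z x * f x \<partial>lebesgue_on X)"
  using assms(2) t unfolding has_weak_deriv_def by blast
 finally show "(\<integral>x. u x * (deriv ^^ Suc n) f x \<partial>lebesgue_on X) = (-1) ^ Suc n * (\<integral>x. z x * f x \<partial>lebesgue_on X)" by simp
qed

lemma has_weak_deriv_vanishes:
 assumes f: "has_weak_deriv {a<..<b} n f d" and sub: "{c<..<h} \<subseteq> {a<..<b}"
  and z: "AE x in lebesgue_on {a<..<b}. x \<in> {c<..<h} --> f x = 0"
 shows "AE x in lebesgue_on {c<..<h}. d x = 0"
proof (rule fundamental_lemma)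
 show "locally_integrable {c<..<h} d" using f sub unfolding has_weak_deriv_def locally_integrable_def by (meson order_trans)
 fix g assume t: "test_function {c<..<h} g"
 then have t': "test_function {a<..<b} g" using sub by (rule test_function_subset)
 have "(\<integral>x. d x * g x \<partial>lebesgue_on {c<..<h}) = (\<integral>x. d x * g x \<partial>lebesgue_on {a<..<b})"
  using test_function_zero_outside[OF t] sub
 proof (subst (1 2) integral_lebesgue_on)
  have "indicator {c<..<h} x * (d x * g x) = indicator {a<..<b} x * (d x * g x)" for x
  proof (cases "x \<in> {c<..<h}")
   case True
   then have "x \<in> {a<..<b}" using sub by blast
   then show ?thesis using True by simp
  qed (simp add: test_function_zero_outside[OF t])
  then show "(\<integral>x. indicator {c<..<h} x * (d x * g x) \<partial>lebesgue) = (\<integral>x. indicator {a<..<b} x * (d x * g x) \<partial>lebesgue)" by (simp only:)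
 qed simp_all
 also have "... = 0"
 proof -
  have "(\<integral>x. f x * (deriv ^^ n) g x \<partial>lebesgue_on {a<..<b}) = 0"
  proof (rule integral_eq_zero_AE)
   show "AE x in lebesgue_on {a<..<b}. f x * (deriv ^^ n) g x = 0"
    using z by eventually_elim (use test_function_zero_outside[OF test_function_higher_deriv[OF t]] in auto)
  qed
  moreover have "(\<integral>x. f x * (deriv ^^ n) g x \<partial>lebesgue_on {a<..<b}) = (-1) ^ n * (\<integral>x. d x * g x \<partial>lebesgue_on {a<..<b})"
   using f t' unfolding has_weak_deriv_def by blast
  ultimately show ?thesis by simp
 qed
 finally show "(\<integral>x. d x * g x \<partial>lebesgue_on {c<..<h}) = 0" .
qed

text \<open>The Leibniz formula as a recursion, without binomial coefficients: \<open>i\<close> and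
  \<open>l\<close> count the derivatives that have already fallen on the two factors. The expansion
  has \<open>2 ^ q\<close> terms, which is the constant in \<open>leibniz_bound\<close>.\<close>

fun leibniz :: "(nat => real => real) => (nat => real => real) => nat => nat => nat => real => real" where
 "leibniz d h 0 i l x = d i x * h l x"
| "leibniz d h (Suc q) i l x = leibniz d h q (Suc i) l x + leibniz d h q i (Suc l) x"

lemma has_weak_deriv_leibniz:
 assumes d: "\<And>i. i < m ==> has_weak_deriv {a<..<b} 1 (d i) (d (Suc i))" "locally_integrable {a<..<b} (d 0)" and g: "smooth g"
 shows "i + q \<le> m ==> has_weak_deriv {a<..<b} q (\<lambda>x. d i x * (deriv ^^ l) g x) (leibniz d (\<lambda>l. (deriv ^^ l) g) q i l)"
proof (induction q arbitrary: i l)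
 case 0
 have li: "locally_integrable {a<..<b} (d i)" using d(1)[of "i - 1"] d(2) 0 by (cases i) (auto simp: has_weak_deriv_def)
 have "locally_integrable {a<..<b} (\<lambda>x. d i x * (deriv ^^ l) g x)"
  by (rule locally_integrable_continuous_mult) (use li g in \<open>auto intro!: smooth_continuous_on smooth_higher_deriv\<close>)
 moreover have "leibniz d (\<lambda>l. (deriv ^^ l) g) 0 i l = (\<lambda>x. d i x * (deriv ^^ l) g x)" by auto
 ultimately show ?case using has_weak_deriv_0 by simp
next
 case (Suc q)
 have "has_weak_deriv {a<..<b} 1 (\<lambda>x. d i x * (deriv ^^ l) g x) (\<lambda>x. d (Suc i) x * (deriv ^^ l) g x + d i x * (deriv ^^ Suc l) g x)"
  using has_weak_deriv_mult_smooth[OF _ d(1)[of i] smooth_higher_deriv[OF g, of l]] Suc.prems by simp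
 moreover have "leibniz d (\<lambda>l. (deriv ^^ l) g) (Suc q) i l
   = (\<lambda>x. leibniz d (\<lambda>l. (deriv ^^ l) g) q (Suc i) l x + leibniz d (\<lambda>l. (deriv ^^ l) g) q i (Suc l) x)" by auto
 ultimately show ?case
  using has_weak_deriv_compose1 has_weak_deriv_add[OF interval_lebesgue_sets Suc.IH[of "Suc i" l] Suc.IH[of i "Suc l"]] Suc.prems by simp
qed

lemma leibniz_bound:
 fixes A H b :: real
 assumes A: "\<And>i. i \<le> m ==> AE x in M. \<bar>d i x\<bar> \<le> A * b ^ i * indicator S x"
  and H: "\<And>i x. i \<le> m ==> x \<in> S ==> \<bar>h i x\<bar> \<le> H * b ^ i" and pos: "0 \<le> A" "0 \<le> H" "0 \<le> b"
 shows "i + q \<le> m ==> l + q \<le> m ==> AE x in M. \<bar>leibniz d h q i l x\<bar> \<le> 2 ^ q * (A * H * b ^ (i + l + q)) * indicator S x"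
proof (induction q arbitrary: i l)
 case 0
 show ?case using A[OF 0(1)[unfolded add_0_right]]
 proof eventually_elim
  case x: (elim x)
  show ?case
  proof (cases "x \<in> S")
   case True
   have "\<bar>d i x\<bar> * \<bar>h l x\<bar> \<le> (A * b ^ i) * (H * b ^ l)" using x H[of l x] True 0 pos by (intro mult_mono) auto
   then show ?thesis using True by (simp add: abs_mult power_add mult_ac)
  qed (use x in simp)
 qed
next
 case (Suc q)
 have "AE x in M. \<bar>leibniz d h q (Suc i) l x\<bar> \<le> 2 ^ q * (A * H * b ^ (Suc i + l + q)) * indicator S x"
  "AE x in M. \<bar>leibniz d h q i (Suc l) x\<bar> \<le> 2 ^ q * (A * H * b ^ (i + Suc l + q)) * indicator S x"
  using Suc.IH[of "Suc i" l] Suc.IH[of i "Suc l"] Suc.prems by auto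
 then show ?case by eventually_elim (simp add: algebra_simps)
qed

lemma partition_patch:
 assumes pu: "partition_of_unity X m M C\<phi> J \<phi>" and j: "j \<in> {1..J}"
 obtains a b where "a < b" "patch X (\<phi> j) = {a<..<b}" "{a<..<b} \<subseteq> X" "patch_radius X (\<phi> j) = (b - a) / 2"
  "patch_center X (\<phi> j) = (a + b) / 2" "closure (patch X (\<phi> j)) = {a..b}"
proof -
 obtain a b where "a < b" "patch X (\<phi> j) = {a<..<b}" "{a<..<b} \<subseteq> X" using pu j unfolding partition_of_unity_def by blast
 then show thesis by (intro that[of a b]) (auto simp: patch_radius_def patch_center_def diameter_open_interval)
qed

text \<open>The assumption bounds the derivatives on the patch. To the left and to the right of it
  the function vanishes on an interval, hence so does every weak derivative, and the two end points
  are negligible. Quasi-uniformity replaces the radius of the patch by \<open>r\<close>; the maxima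
  give the constants a definite sign.\<close>

lemma partition_weak_deriv_bound:
 assumes pu: "partition_of_unity {h<..<n} m M C\<phi> J \<phi>" and j: "j \<in> {1..J}" and i: "i \<le> m"
  and r: "0 < r" "r \<le> \<kappa> * patch_radius {h<..<n} (\<phi> j)"
 shows "has_weak_deriv {h<..<n} i (\<phi> j) (weak_deriv {h<..<n} i (\<phi> j))"
  "AE x in lebesgue_on {h<..<n}. \<bar>weak_deriv {h<..<n} i (\<phi> j) x\<bar> \<le> max C\<phi> 0 * (max \<kappa> 1 / r) ^ i * indicator (patch {h<..<n} (\<phi> j)) x"
proof -
 obtain a b where ab: "a < b" "patch {h<..<n} (\<phi> j) = {a<..<b}" "{a<..<b} \<subseteq> {h<..<n}" "patch_radius {h<..<n} (\<phi> j) = (b - a) / 2"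
  by (rule partition_patch[OF pu j]; rule that; assumption)
 let ?d = "weak_deriv {h<..<n} i (\<phi> j)" and ?\<rho> = "patch_radius {h<..<n} (\<phi> j)"
 have \<rho>: "0 < ?\<rho>" using ab by simp
 have "\<phi> j \<in> sobolev_space {h<..<n} (real m) \<infinity>" using pu j unfolding partition_of_unity_def by blast
 then show hw: "has_weak_deriv {h<..<n} i (\<phi> j) ?d"
  using sobolev_norm_finite_weak_deriv[of "{h<..<n}" "real m" \<infinity> "\<phi> j" i] i by (simp add: sobolev_space_def)
 have le: "Lp_norm \<infinity> (lebesgue_on {a<..<b}) ?d \<le> ennreal (max C\<phi> 0 * (max \<kappa> 1 / r) ^ i)"
 proof -
  have "Lp_norm \<infinity> (lebesgue_on {a<..<b}) ?d \<le> ennreal (C\<phi> / ?\<rho> ^ i)"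
   using pu j i unfolding partition_of_unity_def ab(2)[symmetric] by blast
  also have "C\<phi> / ?\<rho> ^ i \<le> max C\<phi> 0 * (1 / ?\<rho>) ^ i" using \<rho> by (simp add: power_one_over divide_right_mono)
  also have "... \<le> max C\<phi> 0 * (max \<kappa> 1 / r) ^ i"
  proof (intro mult_left_mono power_mono)
   have "r \<le> max \<kappa> 1 * ?\<rho>" using r(2) \<rho> by (meson max.cobounded1 mult_right_mono order_trans less_imp_le)
   then show "1 / ?\<rho> \<le> max \<kappa> 1 / r" using r(1) \<rho> by (simp add: divide_simps mult.commute)
  qed (use \<rho> in auto)
  finally show ?thesis by (simp add: ennreal_leI)
 qed
 have m: "?d \<in> borel_measurable (lebesgue_on {a<..<b})" using has_weak_deriv_measurable(1)[OF hw] ab(3) by (rule measurable_restrict_mono)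
 have in_patch: "AE x in lebesgue. x \<in> {a<..<b} --> \<bar>?d x\<bar> \<le> max C\<phi> 0 * (max \<kappa> 1 / r) ^ i"
  using le r by (subst (asm) Lp_norm_le_iff_inf[OF m]) (auto simp: AE_lebesgue_on_iff)
 have z: "AE x in lebesgue_on {h<..<n}. x \<notin> {a<..<b} --> \<phi> j x = 0" using pu j unfolding partition_of_unity_def ab(2)[symmetric] by blast
 have ab': "h \<le> a" "b \<le> n" using ab(1,3) by (simp_all add: greaterThanLessThan_subseteq_greaterThanLessThan)
 have "AE x in lebesgue_on {h<..<a}. ?d x = 0"
  by (rule has_weak_deriv_vanishes[OF hw]) (use z ab' ab(1) in \<open>auto elim!: eventually_mono\<close>)
 then have l: "AE x in lebesgue. x \<in> {h<..<a} --> ?d x = 0" by (subst (asm) AE_lebesgue_on_iff) auto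
 have "AE x in lebesgue_on {b<..<n}. ?d x = 0"
  by (rule has_weak_deriv_vanishes[OF hw]) (use z ab' ab(1) in \<open>auto elim!: eventually_mono\<close>)
 then have u: "AE x in lebesgue. x \<in> {b<..<n} --> ?d x = 0" by (subst (asm) AE_lebesgue_on_iff) auto
 have "AE x in lebesgue. x \<notin> {a, b}" by (rule AE_not_in, rule null_sets_completionI, rule finite_imp_null_set_lborel) simp
 then have "AE x in lebesgue. x \<in> {h<..<n} --> \<bar>?d x\<bar> \<le> max C\<phi> 0 * (max \<kappa> 1 / r) ^ i * indicator {a<..<b} x"
  using in_patch l u
 proof eventually_elim
  case (elim x)
  then show ?case by (cases "x \<in> {a<..<b}") auto
 qed
 then show "AE x in lebesgue_on {h<..<n}. \<bar>?d x\<bar> \<le> max C\<phi> 0 * (max \<kappa> 1 / r) ^ i * indicator (patch {h<..<n} (\<phi> j)) x"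
  unfolding ab(2) by (subst AE_lebesgue_on_iff) auto
qed

text \<open>A pure scaling argument. Every derivative costs a factor \<open>1 / r\<close> on both
  factors of the product, and a patch of length at most \<open>2 * r\<close> contributes
  \<open>r powr (1 / p)\<close> to an \<open>L^p\<close> norm.
  \<open>sobolev_norm_le_of_derivs\<close> at the scale \<open>r\<close> then also covers fractional
  orders.\<close>

lemma partition_product_estimate:
 fixes s :: real and p :: ennreal
 assumes p: "1 \<le> p" and s: "0 \<le> s"
 obtains K where "0 < K" "\<And>h u M J \<phi> j g H r. h < u ==> partition_of_unity {h<..<u} (nat \<lceil>s\<rceil>) M C\<phi> J \<phi> ==> j \<in> {1..J} ==>
  0 < r ==> r \<le> 1 ==> patch_radius {h<..<u} (\<phi> j) \<le> r ==> r \<le> \<kappa> * patch_radius {h<..<u} (\<phi> j) ==> smooth g ==> 0 \<le> H ==>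
  (\<And>q x. q \<le> nat \<lceil>s\<rceil> ==> x \<in> patch {h<..<u} (\<phi> j) ==> \<bar>(deriv ^^ q) g x\<bar> \<le> H * (1 / r) ^ q) ==>
  sobolev_norm {h<..<u} s p (\<lambda>x. \<phi> j x * g x) \<le> ennreal (K * H * r powr (enn2real (1 / p) - s))"
proof -
 define m where "m = nat \<lceil>s\<rceil>"
 define A where "A = max C\<phi> 0 + 1"
 define k where "k = max \<kappa> 1"
 define ip where "ip = enn2real (1 / p)"
 have Ak: "0 < A" "1 \<le> k" by (auto simp: A_def k_def)
 show thesis
 proof (rule sobolev_norm_le_of_derivs[OF p s], goal_cases)
  case (1 K)
  note K = 1
  show thesis
  \<comment> \<open>The factors stem from the terms of the Leibniz expansion, from the bounds on the
    partition, and from \<open>2 powr (1 / p) <= 2\<close>.\<close>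
  proof (rule that[of "K * (2 ^ m * (A * k ^ m) * 2)"], goal_cases)
   case 1
   show ?case using K(1) Ak by simp
  next
   case (2 h u M J \<phi> j g H r)
   note ab = 2(1) and pu = 2(2) and j = 2(3) and r = 2(4-7) and g = 2(8) and H = 2(9) and gH = 2(10)
   let ?S = "patch {h<..<u} (\<phi> j)" and ?d = "\<lambda>i. weak_deriv {h<..<u} i (\<phi> j)"
   obtain a b where S: "a < b" "?S = {a<..<b}" "{a<..<b} \<subseteq> {h<..<u}" "patch_radius {h<..<u} (\<phi> j) = (b - a) / 2"
    by (rule partition_patch[OF pu j]; rule that; assumption)
   note wd = partition_weak_deriv_bound[OF pu j _ r(1,4)]
   define D where "D q = leibniz ?d (\<lambda>l. (deriv ^^ l) g) q 0 0" for q
   have D1: "has_weak_deriv {h<..<u} q (\<lambda>x. ?d 0 x * g x) (D q)" if q: "q \<le> m" for q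
   proof -
    have "has_weak_deriv {h<..<u} q (\<lambda>x. ?d 0 x * (deriv ^^ 0) g x) (leibniz ?d (\<lambda>l. (deriv ^^ l) g) q 0 0)"
    proof (rule has_weak_deriv_leibniz[where m = m])
     show "has_weak_deriv {h<..<u} 1 (?d i) (?d (Suc i))" if "i < m" for i using has_weak_deriv_step[OF wd(1) wd(1), of i] that by (simp add: m_def)
     show "locally_integrable {h<..<u} (?d 0)" using wd(1)[of 0] by (simp add: has_weak_deriv_def)
    qed (use q g in auto)
    then show ?thesis by (simp add: D_def)
   qed
   have D2: "AE x in lebesgue_on {h<..<u}. \<bar>D q x\<bar> \<le> 2 ^ q * (A * H * (k / r) ^ (0 + 0 + q)) * indicator ?S x" if q: "q \<le> m" for q
    unfolding D_def
   proof (rule leibniz_bound[where m = m])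
    show "AE x in lebesgue_on {h<..<u}. \<bar>?d i x\<bar> \<le> A * (k / r) ^ i * indicator ?S x" if i: "i \<le> m" for i
     using wd(2)[OF i[unfolded m_def]]
    proof eventually_elim
     case (elim x)
     have "max C\<phi> 0 * (max \<kappa> 1 / r) ^ i * indicator ?S x \<le> A * (k / r) ^ i * indicator ?S x"
      using r(1) by (intro mult_right_mono) (auto simp: A_def k_def)
     with elim show ?case by (rule order_trans)
    qed
    show "\<bar>(deriv ^^ i) g x\<bar> \<le> H * (k / r) ^ i" if "i \<le> m" "x \<in> ?S" for i x
    proof -
     have "\<bar>(deriv ^^ i) g x\<bar> \<le> H * (1 / r) ^ i" using gH that by (simp add: m_def)
     also have "... \<le> H * (k / r) ^ i" using H r(1) Ak by (intro mult_left_mono power_mono divide_right_mono) auto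
     finally show ?thesis .
    qed
   qed (use q H Ak r in auto)
   have ae0: "AE x in lebesgue_on {h<..<u}. ?d 0 x = \<phi> j x"
    by (rule has_weak_deriv_unique[OF wd(1)[of 0]]) (use wd(1)[of 0] in \<open>auto simp: has_weak_deriv_def intro: has_weak_deriv_0\<close>)
   have mg: "(\<lambda>x. \<phi> j x * g x) \<in> borel_measurable (lebesgue_on {h<..<u})"
    by (intro borel_measurable_times has_weak_deriv_measurable(2)[OF wd(1)[of 0]] smooth_measurable_lebesgue_on g) simp
   have "sobolev_norm {h<..<u} s p (\<lambda>x. \<phi> j x * g x) \<le> ennreal (K * ((2 ^ m * (A * k ^ m) * 2) * H * r powr ip) * r powr (-s))"
   proof (rule K(2)[where d = D])
    fix q assume q: "q \<le> nat \<lceil>s\<rceil>"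
    have mq: "D q \<in> borel_measurable (lebesgue_on {h<..<u})" using has_weak_deriv_measurable(1)[OF D1] q by (simp add: m_def)
    show "has_weak_deriv {h<..<u} q (\<lambda>x. \<phi> j x * g x) (D q)"
     by (rule has_weak_deriv_cong_AE[OF D1 mg mq]) (use q ae0 in \<open>auto simp: m_def elim!: eventually_mono\<close>)
    let ?a = "2 ^ q * (A * H * (k / r) ^ q)"
    have "Lp_norm p (lebesgue_on {h<..<u}) (D q) \<le> ennreal (?a * (if p = \<infinity> then 1 else (2 * r) powr enn2real (1 / p)))"
    proof (rule Lp_norm_le_bounded_on[OF p mq])
     show "?S \<in> sets (lebesgue_on {h<..<u})" unfolding S(2) using S(3) by (auto simp: sets_restrict_space_iff)
     have "emeasure (lebesgue_on {h<..<u}) ?S = emeasure lebesgue {a<..<b}" unfolding S(2) using S(3) by (intro emeasure_restrict_space) auto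
     also have "... = ennreal (b - a)" using S(1) by simp
     also have "... \<le> ennreal (2 * r)" using r(3) S(4) by (intro ennreal_leI) simp
     finally show "emeasure (lebesgue_on {h<..<u}) ?S \<le> ennreal (2 * r)" .
     show "AE x in lebesgue_on {h<..<u}. \<bar>D q x\<bar> \<le> ?a * indicator ?S x" using D2[of q] q by (simp add: m_def)
    qed (use r H Ak in auto)
    also have "?a * (if p = \<infinity> then 1 else (2 * r) powr enn2real (1 / p)) \<le> ((2 ^ m * (A * k ^ m) * 2) * H * r powr ip) * r powr (- real q)"
    proof -
     have e: "(if p = \<infinity> then 1 else (2 * r) powr enn2real (1 / p)) \<le> 2 * r powr ip"
     proof (cases rule: exponent_cases[OF p])
      case 1
      then show ?thesis using r(1) by (simp add: ip_def)
     next
      case (2 P)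
      have "(2 * r) powr (1 / P) = 2 powr (1 / P) * r powr (1 / P)" using r(1) by (simp add: powr_mult)
      also have "... \<le> 2 powr 1 * r powr (1 / P)" using 2(1) by (intro mult_right_mono powr_mono) auto
      finally show ?thesis using 2 by (simp add: ip_def)
     qed
     have "?a = (2 ^ q * (A * k ^ q)) * H * r powr (- real q)" using r(1) by (simp add: power_divide powr_minus_divide powr_realpow mult_ac)
     also have "... \<le> (2 ^ m * (A * k ^ m)) * H * r powr (- real q)"
      using q H Ak by (intro mult_right_mono mult_mono power_increasing) (auto simp: m_def)
     finally have "?a * (if p = \<infinity> then 1 else (2 * r) powr enn2real (1 / p)) \<le> ((2 ^ m * (A * k ^ m)) * H * r powr (- real q)) * (2 * r powr ip)"
      using e H Ak r(1) by (intro mult_mono[of ?a _ "if p = \<infinity> then 1 else (2 * r) powr enn2real (1 / p)"]) auto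
     then show ?thesis by (simp add: mult_ac)
    qed
    finally show "Lp_norm p (lebesgue_on {h<..<u}) (D q) \<le> ennreal (((2 ^ m * (A * k ^ m) * 2) * H * r powr ip) * r powr (- real q))"
     by (simp add: ennreal_leI)
   qed (use ab r H Ak in auto)
   also have "K * ((2 ^ m * (A * k ^ m) * 2) * H * r powr ip) * r powr (-s) = K * (2 ^ m * (A * k ^ m) * 2) * H * r powr (ip - s)"
    by (simp add: powr_diff powr_minus divide_inverse)
   finally show ?case by (simp add: ip_def)
  qed
 qed
qed

lemma partition_nonempty:
 assumes pu: "partition_of_unity {a<..<b} m M C\<phi> J \<phi>" and ab: "a < b"
 shows "1 \<le> J"
proof (rule ccontr)
 assume "\<not> 1 \<le> J"
 then have "AE x in lebesgue_on {a<..<b}. False" using pu unfolding partition_of_unity_def by auto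
 then have "emeasure (lebesgue_on {a<..<b}) (space (lebesgue_on {a<..<b})) = 0" by (simp only: ae_filter_eq_bot_iff[symmetric] trivial_limit_def)
 then have "emeasure (lebesgue_on {a<..<b}) {a<..<b} = 0" by simp
 moreover have "emeasure (lebesgue_on {a<..<b}) {a<..<b} = ennreal (b - a)" using ab by (subst emeasure_restrict_space) auto
 ultimately show False using ab by simp
qed

text \<open>Counting lengths twice: every patch is at least \<open>r / \<kappa>\<close> long, and by
  the overlap condition all patches together are at most \<open>M\<close> times as long as the
  interval.\<close>

lemma partition_count:
 assumes pu: "partition_of_unity {a<..<b} m M C\<phi> J \<phi>" and ab: "a < b" and r: "0 < r"
  and q: "\<And>j. j \<in> {1..J} ==> r \<le> \<kappa> * patch_radius {a<..<b} (\<phi> j)"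
 shows "real J * r \<le> \<kappa> * (real M * (b - a))"
proof -
 let ?S = "\<lambda>j. patch {a<..<b} (\<phi> j)"
 have J: "1 \<le> J" by (rule partition_nonempty[OF pu ab])
 have s: "?S j \<in> sets lborel \<and> emeasure lborel (?S j) = ennreal (2 * patch_radius {a<..<b} (\<phi> j)) \<and> 0 < patch_radius {a<..<b} (\<phi> j) \<and> ?S j \<subseteq> {a<..<b}"
  if "j \<in> {1..J}" for j by (rule partition_patch[OF pu that]) auto
 have "0 < \<kappa> * patch_radius {a<..<b} (\<phi> 1)" using q[of 1] J r by auto
 then have \<kappa>: "0 < \<kappa>" using s[of 1] J by (auto simp: zero_less_mult_iff)
 have lo: "r / \<kappa> \<le> 2 * patch_radius {a<..<b} (\<phi> j)" if "j \<in> {1..J}" for j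
 proof -
  have "r \<le> patch_radius {a<..<b} (\<phi> j) * \<kappa>" using q[OF that] by (simp add: mult.commute)
  then have "r / \<kappa> \<le> patch_radius {a<..<b} (\<phi> j)" using \<kappa> by (simp add: divide_le_eq)
  then show ?thesis using s[OF that] by linarith
 qed
 have "ennreal (real J * (r / \<kappa>)) = (\<Sum>j\<in>{1..J}. ennreal (r / \<kappa>))"
  using r \<kappa> by (simp add: ennreal_of_nat_eq_real_of_nat ennreal_mult[symmetric])
 also have "... \<le> (\<Sum>j\<in>{1..J}. emeasure lborel (?S j))" using s lo by (intro sum_mono) (auto intro!: ennreal_leI)
 also have "... = (\<Sum>j\<in>{1..J}. \<integral>\<^sup>+x. indicator (?S j) x \<partial>lborel)" using s by (intro sum.cong) auto
 also have "... = (\<integral>\<^sup>+x. (\<Sum>j\<in>{1..J}. indicator (?S j) x) \<partial>lborel)" using s by (intro nn_integral_sum[symmetric] borel_measurable_indicator) auto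
 also have "... \<le> (\<integral>\<^sup>+x. of_nat M * indicator {a<..<b} x \<partial>lborel)"
 proof (rule nn_integral_mono)
  fix x
  have e: "(\<Sum>j\<in>{1..J}. indicator (?S j) x) = (of_nat (card {j \<in> {1..J}. x \<in> ?S j}) :: ennreal)"
   by (simp add: indicator_def sum.If_cases Int_def)
  show "(\<Sum>j\<in>{1..J}. indicator (?S j) x) \<le> (of_nat M * indicator {a<..<b} x :: ennreal)"
  proof (cases "x \<in> {a<..<b}")
   case True
   then have "card {j \<in> {1..J}. x \<in> ?S j} \<le> M" using pu unfolding partition_of_unity_def by blast
   then show ?thesis unfolding e using True by simp
  next
   case False
   then have "(\<Sum>j\<in>{1..J}. indicator (?S j) x) = (0 :: ennreal)" proof (intro sum.neutral ballI)
    fix j assume "j \<in> {1..J}"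
    then have "x \<notin> ?S j" using s[of j] False by blast
    then show "indicator (?S j) x = (0 :: ennreal)" by simp
   qed
   then show ?thesis by simp
  qed
 qed
 also have "... = ennreal (real M * (b - a))" using ab by (simp add: nn_integral_cmult ennreal_mult ennreal_of_nat_eq_real_of_nat)
 finally have "real J * (r / \<kappa>) \<le> real M * (b - a)" using ab by (subst (asm) ennreal_le_iff) auto
 then show ?thesis using \<kappa> by (simp add: divide_le_eq mult.commute)
qed

section \<open>Measurability of the error\<close>

text \<open>For \<open>p = \<infinity>\<close> a sublevel set of the essential supremum is the set
  of parameters for which the integral of an indicator vanishes, and such integrals depend
  measurably on the parameter.\<close>

lemma Lp_norm_measurable:
 assumes p: "1 \<le> p" and sf: "sigma_finite_measure M" and f: "case_prod f \<in> borel_measurable (P \<Otimes>\<^sub>M M)"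
 shows "(\<lambda>w. Lp_norm p M (f w)) \<in> borel_measurable P"
proof -
 interpret sigma_finite_measure M by (rule sf)
 have fm: "f w \<in> borel_measurable M" if "w \<in> space P" for w using measurable_Pair2[OF f that] by simp
 show ?thesis
 proof (cases "p = \<infinity>")
  case True
  have "(\<lambda>w. esssup M (\<lambda>x. ennreal \<bar>f w x\<bar>)) \<in> borel_measurable P"
  proof (rule borel_measurableI_le)
   fix y :: ennreal
   let ?g = "\<lambda>w x. if y < ennreal \<bar>f w x\<bar> then 1 else 0 :: ennreal"
   have [measurable]: "(\<lambda>z. f (fst z) (snd z)) \<in> borel_measurable (P \<Otimes>\<^sub>M M)" using f by (simp add: case_prod_beta')
   have "case_prod ?g \<in> borel_measurable (P \<Otimes>\<^sub>M M)" unfolding case_prod_beta' by measurable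
   then have m: "(\<lambda>w. \<integral>\<^sup>+x. ?g w x \<partial>M) \<in> borel_measurable P" by (rule borel_measurable_nn_integral)
   have "esssup M (\<lambda>x. ennreal \<bar>f w x\<bar>) \<le> y \<longleftrightarrow> (\<integral>\<^sup>+x. ?g w x \<partial>M) = 0" if w: "w \<in> space P" for w
   proof -
    note [measurable] = fm[OF w]
    have "esssup M (\<lambda>x. ennreal \<bar>f w x\<bar>) \<le> y \<longleftrightarrow> (AE x in M. ennreal \<bar>f w x\<bar> \<le> y)"
     using esssup_AE[of "\<lambda>x. ennreal \<bar>f w x\<bar>" M] by (auto intro!: esssup_I elim!: eventually_mono order_trans)
    also have "... \<longleftrightarrow> (AE x in M. ?g w x = 0)" by (intro AE_cong) auto
    also have "... \<longleftrightarrow> (\<integral>\<^sup>+x. ?g w x \<partial>M) = 0" by (rule nn_integral_0_iff_AE[symmetric]) measurable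
    finally show ?thesis .
   qed
   then have "{w \<in> space P. esssup M (\<lambda>x. ennreal \<bar>f w x\<bar>) \<le> y} = {w \<in> space P. (\<integral>\<^sup>+x. ?g w x \<partial>M) = 0}" by blast
   also have "... \<in> sets P" using m by measurable
   finally show "{w \<in> space P. esssup M (\<lambda>x. ennreal \<bar>f w x\<bar>) \<le> y} \<in> sets P" .
  qed
  then show ?thesis by (rule measurable_cong[THEN iffD1, rotated]) (simp add: Lp_norm_def fm True[unfolded infinity_ennreal_def])
 next
  case False
  have "case_prod (\<lambda>w x. ennreal (\<bar>f w x\<bar> powr enn2real p)) \<in> borel_measurable (P \<Otimes>\<^sub>M M)"
   using f unfolding case_prod_beta' by measurable
  then have [measurable]: "(\<lambda>w. \<integral>\<^sup>+x. ennreal (\<bar>f w x\<bar> powr enn2real p) \<partial>M) \<in> borel_measurable P" by (rule borel_measurable_nn_integral)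
  have "(\<lambda>w. let I = (\<integral>\<^sup>+x. ennreal (\<bar>f w x\<bar> powr enn2real p) \<partial>M) in if I = \<infinity> then \<infinity> else ennreal (enn2real I powr enn2real (1 / p))) \<in> borel_measurable P"
   unfolding Let_def by measurable
  then show ?thesis by (rule measurable_cong[THEN iffD1, rotated]) (use False in \<open>simp add: Lp_norm_def fm\<close>)
 qed
qed

lemma slobodeckij_seminorm_measurable:
 assumes p: "1 \<le> p" and f: "case_prod f \<in> borel_measurable (P \<Otimes>\<^sub>M lebesgue_on {a<..<b})"
 shows "(\<lambda>w. slobodeckij_seminorm {a<..<b} t p (f w)) \<in> borel_measurable P"
 unfolding slobodeckij_seminorm_def
proof (rule Lp_norm_measurable[OF p])
 let ?M = "lebesgue_on {a<..<b}"
 interpret sigma_finite_measure ?M by (rule sigma_finite_lebesgue_on) simp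
 interpret pair_sigma_finite ?M ?M ..
 show "sigma_finite_measure (?M \<Otimes>\<^sub>M ?M)" ..
 have "(\<lambda>z. f (fst z) (fst (snd z))) \<in> borel_measurable (P \<Otimes>\<^sub>M (?M \<Otimes>\<^sub>M ?M))"
  "(\<lambda>z. f (fst z) (snd (snd z))) \<in> borel_measurable (P \<Otimes>\<^sub>M (?M \<Otimes>\<^sub>M ?M))"
  using measurable_compose[OF _ f, of "\<lambda>z. (fst z, fst (snd z))" "P \<Otimes>\<^sub>M (?M \<Otimes>\<^sub>M ?M)"]
   measurable_compose[OF _ f, of "\<lambda>z. (fst z, snd (snd z))" "P \<Otimes>\<^sub>M (?M \<Otimes>\<^sub>M ?M)"] by simp_all
 moreover have "(\<lambda>z. fst (snd z)) \<in> borel_measurable (P \<Otimes>\<^sub>M (?M \<Otimes>\<^sub>M ?M))" "(\<lambda>z. snd (snd z)) \<in> borel_measurable (P \<Otimes>\<^sub>M (?M \<Otimes>\<^sub>M ?M))"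
  by (intro measurable_compose[OF measurable_snd] measurable_fst_lebesgue_on measurable_snd_lebesgue_on)+
 ultimately show "case_prod (\<lambda>w (x, y). \<bar>f w x - f w y\<bar> / \<bar>x - y\<bar> powr (t + enn2real (1 / p))) \<in> borel_measurable (P \<Otimes>\<^sub>M (?M \<Otimes>\<^sub>M ?M))"
  unfolding case_prod_beta' by (intro borel_measurable_divide borel_measurable_abs borel_measurable_diff powr_real_measurable borel_measurable_const)
qed

lemma leibniz_measurable:
 assumes "\<And>i. i \<le> m ==> d i \<in> borel_measurable M" "\<And>l. l \<le> m ==> (\<lambda>z. h (fst z) l (snd z)) \<in> borel_measurable (P \<Otimes>\<^sub>M M)"
 shows "i + q \<le> m ==> l + q \<le> m ==> (\<lambda>z. leibniz d (h (fst z)) q i l (snd z)) \<in> borel_measurable (P \<Otimes>\<^sub>M M)"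
proof (induction q arbitrary: i l)
 case 0
 have "(\<lambda>z. d i (snd z)) \<in> borel_measurable (P \<Otimes>\<^sub>M M)" by (rule measurable_compose[OF measurable_snd]) (use assms(1) 0 in simp)
 then show ?case using assms(2)[of l] 0 by (simp add: borel_measurable_times)
next
 case (Suc q)
 then show ?case using Suc.IH[of "Suc i" l] Suc.IH[of i "Suc l"] by (simp add: borel_measurable_add)
qed

text \<open>\<open>weak_deriv\<close> is chosen separately for every sample point, so the definition
  of the norm reveals nothing about measurability. Rewriting it with the Leibniz expansion yields
  derivatives that are jointly measurable in the sample and in \<open>x\<close>.\<close>

lemma sobolev_norm_measurable:
 fixes U :: "nat => real => real" and d :: "'j => nat => real => real"
 assumes p: "1 \<le> p" and n: "n = nat \<lfloor>s\<rfloor>"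
  and U: "\<And>i. i \<le> n ==> has_weak_deriv {a<..<b} i u (U i)"
  and d: "\<And>j i. j \<in> I ==> i \<le> n ==> has_weak_deriv {a<..<b} i (d j 0) (d j i)"
  and W: "\<And>j v. j \<in> I ==> v \<in> space P ==> smooth (W j v)"
   "\<And>j l. j \<in> I ==> (\<lambda>z. (deriv ^^ l) (W j (fst z)) (snd z)) \<in> borel_measurable (P \<Otimes>\<^sub>M lebesgue_on {a<..<b})"
 shows "(\<lambda>v. sobolev_norm {a<..<b} s p (\<lambda>x. u x - (\<Sum>j\<in>I. d j 0 x * W j v x))) \<in> borel_measurable P"
proof -
 let ?M = "lebesgue_on {a<..<b}"
 define E where "E i v x = U i x - (\<Sum>j\<in>I. leibniz (d j) (\<lambda>l. (deriv ^^ l) (W j v)) i 0 0 x)" for i v x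
 have w: "has_weak_deriv {a<..<b} i (\<lambda>x. u x - (\<Sum>j\<in>I. d j 0 x * W j v x)) (E i v)" if i: "i \<le> n" and v: "v \<in> space P" for i v
 proof -
  have "has_weak_deriv {a<..<b} i (\<lambda>x. d j 0 x * W j v x) (leibniz (d j) (\<lambda>l. (deriv ^^ l) (W j v)) i 0 0)" if j: "j \<in> I" for j
  proof -
   have "has_weak_deriv {a<..<b} i (\<lambda>x. d j 0 x * (deriv ^^ 0) (W j v) x) (leibniz (d j) (\<lambda>l. (deriv ^^ l) (W j v)) i 0 0)"
   proof (rule has_weak_deriv_leibniz[where m = n])
    show "has_weak_deriv {a<..<b} 1 (d j q) (d j (Suc q))" if "q < n" for q using has_weak_deriv_step[OF d[OF j] d[OF j], of q] that by simp
    show "locally_integrable {a<..<b} (d j 0)" using d[OF j, of 0] by (simp add: has_weak_deriv_def)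
   qed (use W(1)[OF j v] i in auto)
   then show ?thesis by simp
  qed
  then show ?thesis unfolding E_def by (intro has_weak_deriv_diff has_weak_deriv_sum U i) auto
 qed
 have m: "case_prod (E i) \<in> borel_measurable (P \<Otimes>\<^sub>M ?M)" if i: "i \<le> n" for i
 proof -
  have "(\<lambda>z. U i (snd z)) \<in> borel_measurable (P \<Otimes>\<^sub>M ?M)"
   by (rule measurable_compose[OF measurable_snd has_weak_deriv_measurable(1)[OF U[OF i]]])
  moreover have "(\<lambda>z. leibniz (d j) (\<lambda>l. (deriv ^^ l) (W j (fst z))) i 0 0 (snd z)) \<in> borel_measurable (P \<Otimes>\<^sub>M ?M)" if j: "j \<in> I" for j
   by (rule leibniz_measurable[where h = "\<lambda>v l. (deriv ^^ l) (W j v)" and m = n])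
    (use has_weak_deriv_measurable(1)[OF d[OF j]] W(2)[OF j] i in auto)
  ultimately show ?thesis unfolding E_def case_prod_beta' by (intro borel_measurable_diff borel_measurable_sum)
 qed
 have "(\<lambda>v. (\<Sum>i\<le>n. Lp_norm p ?M (E i v)) + (if s - real n > 0 then slobodeckij_seminorm {a<..<b} (s - real n) p (E n v) else 0)) \<in> borel_measurable P"
  using slobodeckij_seminorm_measurable[OF p m]
  by (intro borel_measurable_add borel_measurable_sum Lp_norm_measurable[OF p sigma_finite_lebesgue_on] m) simp_all
 moreover have "sobolev_norm {a<..<b} s p (\<lambda>x. u x - (\<Sum>j\<in>I. d j 0 x * W j v x))
   = (\<Sum>i\<le>n. Lp_norm p ?M (E i v)) + (if s - real n > 0 then slobodeckij_seminorm {a<..<b} (s - real n) p (E n v) else 0)"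
  if "v \<in> space P" for v unfolding n by (rule sobolev_norm_eq[OF p]) (rule w, simp_all add: n that)
 ultimately show ?thesis by (subst measurable_cong)
qed

lemma sobolev_norm_cong_AE:
 assumes p: "1 \<le> p" and m: "f \<in> borel_measurable (lebesgue_on {a<..<b})" "g \<in> borel_measurable (lebesgue_on {a<..<b})"
  and ae: "AE x in lebesgue_on {a<..<b}. f x = g x"
 shows "sobolev_norm {a<..<b} s p f = sobolev_norm {a<..<b} s p g"
proof -
 have "has_weak_deriv {a<..<b} i f w \<longleftrightarrow> has_weak_deriv {a<..<b} i g w" for i w
  using has_weak_deriv_cong_AE[OF _ m(2) has_weak_deriv_measurable(1) ae] has_weak_deriv_cong_AE[OF _ m(1) has_weak_deriv_measurable(1), of _ g w] ae
  by (auto simp: eq_commute)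
 then have iff: "has_weak_deriv {a<..<b} i f = has_weak_deriv {a<..<b} i g" for i by blast
 then have "weak_deriv {a<..<b} i f = weak_deriv {a<..<b} i g" for i by (simp only: weak_deriv_def)
 then show ?thesis by (simp only: sobolev_norm_def iff)
qed

section \<open>Measurability of the interpolation coefficients and of the random operator\<close>

lemma coeff_prod_linear_measurable:
 assumes "finite J" "\<And>j. j \<in> J ==> a j \<in> borel_measurable P"
 shows "(\<lambda>w. coeff (\<Prod>j\<in>J. [:a j w :: real, 1:]) l) \<in> borel_measurable P"
 using assms
proof (induction J arbitrary: l rule: finite_induct)
 case (insert j J)
 have "coeff (\<Prod>j\<in>insert j J. [:a j w, 1:]) l = a j w * coeff (\<Prod>j\<in>J. [:a j w, 1:]) l + (case l of 0 => 0 | Suc l => coeff (\<Prod>j\<in>J. [:a j w, 1:]) l)" for w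
  using insert.hyps by (simp add: coeff_pCons)
 moreover have "(\<lambda>w. case l of 0 => 0 | Suc l => coeff (\<Prod>j\<in>J. [:a j w, 1:]) l) \<in> borel_measurable P"
  using insert by (cases l) auto
 ultimately show ?case using insert by (simp del: prod.insert)
qed auto

lemma rf_operator_trig:
 "rf_operator varpi N k \<mu> C c v = (\<lambda>x. if rf_event varpi N k \<mu> C c then trig_sum N k (interp_coeff N k (\<lambda>l. (deriv ^^ (2 * l)) v 0))
   (\<lambda>i. if \<forall>i<N. k i \<noteq> 0 then 1 / k i * interp_coeff N k (\<lambda>l. (deriv ^^ (2 * l + 1)) v 0) i else 0) 0 x else 0)"
 by (rule ext) (simp add: rf_operator_eq trig_sum_def)

lemma smooth_rf_operator: "smooth (\<lambda>x. rf_operator varpi N k \<mu> C c v (x - a))"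
 and rf_operator_higher_deriv: "(deriv ^^ q) (\<lambda>x. rf_operator varpi N k \<mu> C c v (x - a)) = (\<lambda>x. if rf_event varpi N k \<mu> C c then
  trig_sum N k (interp_coeff N k (\<lambda>l. (deriv ^^ (2 * l)) v 0))
   (\<lambda>i. if \<forall>i<N. k i \<noteq> 0 then 1 / k i * interp_coeff N k (\<lambda>l. (deriv ^^ (2 * l + 1)) v 0) i else 0) q (x - a) else 0)"
proof -
 let ?X = "interp_coeff N k (\<lambda>l. (deriv ^^ (2 * l)) v 0)"
  and ?Y = "\<lambda>i. if \<forall>i<N. k i \<noteq> 0 then 1 / k i * interp_coeff N k (\<lambda>l. (deriv ^^ (2 * l + 1)) v 0) i else 0"
 define D where "D q x = (if rf_event varpi N k \<mu> C c then trig_sum N k ?X ?Y q (x - a) else 0)" for q x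
 have "(D q has_real_derivative D (Suc q) x) (at x)" for q x
 proof (cases "rf_event varpi N k \<mu> C c")
  case True
  have "((\<lambda>x. trig_sum N k ?X ?Y q (x - a)) has_real_derivative trig_sum N k ?X ?Y (Suc q) (x - a) * 1) (at x)"
   by (rule DERIV_chain2[OF trig_sum_DERIV]) (auto intro!: derivative_eq_intros)
  then show ?thesis using True by (simp add: D_def[abs_def])
 next
  case False
  then show ?thesis by (simp add: D_def[abs_def])
 qed
 moreover have "D 0 = (\<lambda>x. rf_operator varpi N k \<mu> C c v (x - a))" unfolding D_def[abs_def] rf_operator_trig ..
 ultimately show "smooth (\<lambda>x. rf_operator varpi N k \<mu> C c v (x - a))"
  "(deriv ^^ q) (\<lambda>x. rf_operator varpi N k \<mu> C c v (x - a)) = (\<lambda>x. if rf_event varpi N k \<mu> C c then trig_sum N k ?X ?Y q (x - a) else 0)"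
  using smooth_higher_deriv_unique[of D] by (auto simp: D_def[abs_def])
qed

lemma trig_term_measurable:
 fixes f g w x :: "'a => real"
 assumes [measurable]: "f \<in> borel_measurable M" "g \<in> borel_measurable M" "w \<in> borel_measurable M" "x \<in> borel_measurable M"
 shows "(\<lambda>z. f z * (w z ^ l * cos (w z * (x z - a) + b)) + g z * (w z ^ l * sin (w z * (x z - a) + b))) \<in> borel_measurable M"
 by measurable

context feature_sample
begin

lemma distinct_squares_measurable: "{w \<in> space P. distinct_squares N (\<lambda>q. k q w)} \<in> sets P"
proof -
 have "{w \<in> space P. distinct_squares N (\<lambda>q. k q w)} = {w \<in> space P. \<forall>i\<in>{..<N}. \<forall>j\<in>{..<N}. i \<noteq> j --> (k i w)\<^sup>2 \<noteq> (k j w)\<^sup>2}"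
  by (auto simp: distinct_squares_def)
 also have "... \<in> sets P"
 proof (intro sets.sets_Collect_finite_All)
  fix i j assume "i \<in> {..<N}" "j \<in> {..<N}"
  then have [measurable]: "k i \<in> borel_measurable P" "k j \<in> borel_measurable P" by (auto intro: k_measurable)
  show "{w \<in> space P. i \<noteq> j --> (k i w)\<^sup>2 \<noteq> (k j w)\<^sup>2} \<in> sets P" by measurable
 qed auto
 finally show ?thesis .
qed

lemma interp_coeff_measurable: "i < N ==> (\<lambda>w. interp_coeff N (\<lambda>q. k q w) t i) \<in> borel_measurable P"
proof -
 assume i: "i < N"
 have c: "(\<lambda>w. \<Prod>j\<in>{..<N} - {i}. 1 / ((k j w)\<^sup>2 - (k i w)\<^sup>2)) \<in> borel_measurable P"
 proof (intro borel_measurable_prod)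
  fix j assume "j \<in> {..<N} - {i}"
  then have [measurable]: "k i \<in> borel_measurable P" "k j \<in> borel_measurable P" using i by (auto intro: k_measurable)
  show "(\<lambda>w. 1 / ((k j w)\<^sup>2 - (k i w)\<^sup>2)) \<in> borel_measurable P" by measurable
 qed
 have "(\<lambda>w. coeff (\<Prod>j\<in>{..<N} - {i}. [:(k j w)\<^sup>2, 1:]) l) \<in> borel_measurable P" for l
  by (rule coeff_prod_linear_measurable) (auto intro!: borel_measurable_power k_measurable)
 then have "(\<lambda>w. \<Sum>l<N. coeff (lagrange_poly N (\<lambda>q. k q w) i) l * t l) \<in> borel_measurable P"
  unfolding lagrange_poly_def coeff_smult using c by (intro borel_measurable_sum borel_measurable_times) auto
 then show ?thesis unfolding interp_coeff_def by (rule measurable_If) (simp_all add: distinct_squares_measurable)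
qed

lemma rf_operator_measurable:
 "(\<lambda>z. (deriv ^^ l) (\<lambda>x. rf_operator varpi N (\<lambda>q. k q (fst z)) \<mu> C c v (x - a)) (snd z)) \<in> borel_measurable (P \<Otimes>\<^sub>M lebesgue_on {h<..<b})"
 unfolding rf_operator_higher_deriv trig_sum_def
proof (rule measurable_If)
 let ?M = "P \<Otimes>\<^sub>M lebesgue_on {h<..<b}"
 show "{z \<in> space ?M. rf_event varpi N (\<lambda>q. k q (fst z)) \<mu> C c} \<in> sets ?M"
 proof -
  have "{z \<in> space ?M. rf_event varpi N (\<lambda>q. k q (fst z)) \<mu> C c} = fst -` {w \<in> space P. rf_event varpi N (\<lambda>q. k q w) \<mu> C c} \<inter> space ?M"
   by (auto simp: space_pair_measure)
  also have "... \<in> sets ?M" by (rule measurable_sets[OF measurable_fst rf_event_measurable])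
  finally show ?thesis .
 qed
 have km: "(\<lambda>z. k i (fst z)) \<in> borel_measurable ?M" if "i < N" for i by (rule measurable_compose[OF measurable_fst k_measurable[OF that]])
 have im: "(\<lambda>z. interp_coeff N (\<lambda>q. k q (fst z)) t i) \<in> borel_measurable ?M" if "i < N" for i t
  by (rule measurable_compose[OF measurable_fst interp_coeff_measurable[OF that]])
 have nz: "{z \<in> space ?M. \<forall>i<N. k i (fst z) \<noteq> 0} \<in> sets ?M"
 proof -
  have "{z \<in> space ?M. \<forall>i\<in>{..<N}. k i (fst z) \<noteq> 0} \<in> sets ?M"
  proof (intro sets.sets_Collect_finite_All)
   fix i assume "i \<in> {..<N}"
   then show "{z \<in> space ?M. k i (fst z) \<noteq> 0} \<in> sets ?M" using km[of i] by (intro borel_measurable_neq) auto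
  qed simp
  then show ?thesis by (simp only: Ball_def lessThan_iff)
 qed
 have x: "(\<lambda>z. snd z) \<in> borel_measurable ?M" by (rule measurable_snd_lebesgue_on)
 show "(\<lambda>z. \<Sum>i<N. interp_coeff N (\<lambda>q. k q (fst z)) (\<lambda>l. (deriv ^^ (2 * l)) v 0) i * (k i (fst z) ^ l * cos (k i (fst z) * (snd z - a) + real l * (pi / 2))) +
   (if \<forall>i<N. k i (fst z) \<noteq> 0 then 1 / k i (fst z) * interp_coeff N (\<lambda>q. k q (fst z)) (\<lambda>l. (deriv ^^ (2 * l + 1)) v 0) i else 0) *
   (k i (fst z) ^ l * sin (k i (fst z) * (snd z - a) + real l * (pi / 2)))) \<in> borel_measurable ?M"
 proof (intro borel_measurable_sum)
  fix i assume "i \<in> {..<N}"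
  then have i: "i < N" by simp
  note [measurable] = km[OF i] im[OF i] x
  have Y: "(\<lambda>z. if \<forall>i<N. k i (fst z) \<noteq> 0 then 1 / k i (fst z) * interp_coeff N (\<lambda>q. k q (fst z)) (\<lambda>l. (deriv ^^ (2 * l + 1)) v 0) i else 0) \<in> borel_measurable ?M"
  proof (rule measurable_If[OF _ _ nz])
   show "(\<lambda>z. 1 / k i (fst z) * interp_coeff N (\<lambda>q. k q (fst z)) (\<lambda>l. (deriv ^^ (2 * l + 1)) v 0) i) \<in> borel_measurable ?M" by measurable
  qed simp
  show "(\<lambda>z. interp_coeff N (\<lambda>q. k q (fst z)) (\<lambda>l. (deriv ^^ (2 * l)) v 0) i * (k i (fst z) ^ l * cos (k i (fst z) * (snd z - a) + real l * (pi / 2))) +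
   (if \<forall>i<N. k i (fst z) \<noteq> 0 then 1 / k i (fst z) * interp_coeff N (\<lambda>q. k q (fst z)) (\<lambda>l. (deriv ^^ (2 * l + 1)) v 0) i else 0) *
   (k i (fst z) ^ l * sin (k i (fst z) * (snd z - a) + real l * (pi / 2)))) \<in> borel_measurable ?M"
   by (rule trig_term_measurable[OF im[OF i] Y km[OF i] x])
 qed
qed simp

end

section \<open>Convergence rate\<close>

lemma degree_pderiv_funpow: "degree ((pderiv ^^ n) (p :: real poly)) = degree p - n" by (induction n) (auto simp: degree_pderiv)

lemma pderiv_funpow_eq_0: "degree p < n ==> (pderiv ^^ n) (p :: real poly) = 0"
proof (induction n)
 case (Suc n)
 have "degree ((pderiv ^^ n) p) = 0" using Suc.prems by (simp add: degree_pderiv_funpow)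
 then show ?case by (simp add: pderiv_eq_0_iff)
qed simp

text \<open>Only finitely many derivatives differ from 0, so the prefactor can absorb their ratios
  to the powers of \<open>C\<close>.\<close>

lemma has_gevrey_constant_poly:
 assumes C: "0 < C" shows "has_gevrey_constant {a..b} (poly q) C"
proof -
 have "\<exists>B\<ge>0. \<forall>x\<in>{a..b}. \<bar>poly ((pderiv ^^ n) q) x\<bar> \<le> B" for n
 proof -
  have "compact ((\<lambda>x. poly ((pderiv ^^ n) q) x) ` {a..b})" by (intro compact_continuous_image continuous_intros compact_Icc)
  then obtain B where "\<forall>y\<in>(\<lambda>x. poly ((pderiv ^^ n) q) x) ` {a..b}. norm y \<le> B" using compact_imp_bounded bounded_iff by metis
  then show ?thesis by (intro exI[of _ "max B 0"]) auto
 qed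
 then obtain B where B: "\<And>n. 0 \<le> B n" "\<And>n x. x \<in> {a..b} ==> \<bar>poly ((pderiv ^^ n) q) x\<bar> \<le> B n" by metis
 define A where "A = 1 + (\<Sum>n\<le>degree q. B n / C ^ n)"
 have A: "0 < A" unfolding A_def using B(1) C by (intro add_pos_nonneg sum_nonneg) auto
 have "\<bar>poly ((pderiv ^^ n) q) x\<bar> \<le> A * C ^ n" if x: "x \<in> {a..b}" for n x
 proof (cases "n \<le> degree q")
  case True
  have "B n / C ^ n \<le> (\<Sum>n\<le>degree q. B n / C ^ n)" using True B(1) C by (intro member_le_sum) auto
  then have "B n / C ^ n \<le> A" by (simp add: A_def)
  then have "B n \<le> A * C ^ n" using C by (simp add: divide_le_eq)
  then show ?thesis using B(2)[OF x, of n] by linarith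
 qed (use A C in \<open>simp add: pderiv_funpow_eq_0\<close>)
 moreover have "(poly ((pderiv ^^ n) q) has_real_derivative poly ((pderiv ^^ Suc n) q) x) (at x within {a..b})" for n x
  by (simp add: has_field_derivative_at_within poly_DERIV)
 ultimately show ?thesis unfolding has_gevrey_constant_def using A C by (intro conjI exI[of _ "\<lambda>n. poly ((pderiv ^^ n) q)"] exI[of _ A]) auto
qed

lemma smooth_shift: "smooth h ==> smooth (\<lambda>x. h (x - a))"
 and higher_deriv_shift: "smooth h ==> (deriv ^^ q) (\<lambda>x. h (x - a)) x = (deriv ^^ q) h (x - a)"
proof -
 assume h: "smooth h"
 have "((\<lambda>x. (deriv ^^ n) h (x - a)) has_real_derivative (deriv ^^ Suc n) h (x - a)) (at x)" for n x
 proof -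
  have "((\<lambda>x. (deriv ^^ n) h (x - a)) has_real_derivative (deriv ^^ Suc n) h (x - a) * 1) (at x)"
   by (rule DERIV_chain2[OF smooth_higher_DERIV[OF h]]) (auto intro!: derivative_eq_intros)
  then show ?thesis by simp
 qed
 note D = smooth_higher_deriv_unique[of "\<lambda>n x. (deriv ^^ n) h (x - a)", OF this]
 show "smooth (\<lambda>x. h (x - a))" "(deriv ^^ q) (\<lambda>x. h (x - a)) x = (deriv ^^ q) h (x - a)" using D by auto
qed

text \<open>The bound has the form of a constant times \<open>(1 / r) ^ q\<close>, as
  \<open>partition_product_estimate\<close> expects. On the event the constant comes from the Taylor
  remainder. Off the event the operator is 0 and \<open>V\<close> itself is the error;
  \<open>r * C <= 2\<close> converts \<open>C ^ q\<close> into \<open>(2 / r) ^ q\<close>.\<close>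

lemma patch_error_derivatives:
 fixes k :: "nat => real"
 assumes reg: "distinct_squares N k" "\<And>i. i < N ==> k i \<noteq> 0" and V: "smooth V"
  and pos: "0 \<le> B" "0 < C" "0 < r" "0 < \<mu>" and \<rho>: "0 \<le> \<rho>" "\<rho> \<le> r" and rC: "r * C \<le> 2" and m: "m \<le> 2 * N" and c: "2 < c" and \<pi>: "1 \<le> varpi"
  and Vb: "\<And>q x. q \<le> 2 * N ==> \<bar>x - z\<bar> \<le> \<rho> ==> \<bar>(deriv ^^ q) V x\<bar> \<le> B * C ^ q"
  and q: "q \<le> m" and x: "\<bar>x - z\<bar> \<le> \<rho>"
 shows "\<bar>(deriv ^^ q) (\<lambda>x. V x - rf_operator varpi N k \<mu> C c (\<lambda>y. V (y + z)) (x - z)) x\<bar> \<le>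
  (if rf_event varpi N k \<mu> C c then B * r ^ (2 * N) * (C ^ (2 * N) + (exp c * (10 * varpi^2 * (\<mu>^2 + C^2))) ^ (N - 1) * (\<Sum>i<N. 2 * (k i)\<^sup>2 + C^2))
   else 2 ^ m * B) * (1 / r) ^ q"
proof (cases "rf_event varpi N k \<mu> C c")
 case True
 let ?E = "(exp c * (10 * varpi^2 * (\<mu>^2 + C^2))) ^ (N - 1)"
 let ?v = "\<lambda>y. V (y + z)"
 have v: "smooth ?v" using smooth_shift[OF V, of "-z"] by simp
 have dv: "(deriv ^^ q) ?v y = (deriv ^^ q) V (y + z)" for q y using higher_deriv_shift[OF V, of q "-z" y] by simp
 have vb: "\<bar>(deriv ^^ q) ?v y\<bar> \<le> B * C ^ q" if "q \<le> 2 * N" "\<bar>y\<bar> \<le> \<rho>" for q y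
  unfolding dv using Vb[of q "y + z"] that by simp
 show ?thesis
 proof (rule rf_local_error[where B = B and C = C and \<rho> = \<rho>, OF reg v pos(1) less_imp_le[OF pos(2)] \<rho>(1) vb True], goal_cases)
  case (4 w)
  note w = 4
  have dg: "(deriv ^^ q) (\<lambda>x. V x - rf_operator varpi N k \<mu> C c ?v (x - z)) x = (deriv ^^ q) (\<lambda>y. ?v y - w y) (x - z)"
   using higher_deriv_shift[OF smooth_diff[OF v w(1)], of q z x] by (simp add: w(2))
  have "\<bar>(deriv ^^ q) (\<lambda>y. ?v y - w y) (x - z)\<bar>
   \<le> B * (C ^ (2 * N) + (\<Sum>i<N. node_ratio N k C i * (\<bar>k i\<bar> ^ (2 * N) + C * \<bar>k i\<bar> ^ (2 * N - 1)))) * \<rho> ^ (2 * N - q)"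
   by (rule w(3)) (use q m x in auto)
  also have "... \<le> B * (C ^ (2 * N) + ?E * (\<Sum>i<N. 2 * (k i)\<^sup>2 + C^2)) * r ^ (2 * N - q)"
  proof (intro mult_mono mult_left_mono add_left_mono power_mono)
   show "(\<Sum>i<N. node_ratio N k C i * (\<bar>k i\<bar> ^ (2 * N) + C * \<bar>k i\<bar> ^ (2 * N - 1))) \<le> ?E * (\<Sum>i<N. 2 * (k i)\<^sup>2 + C^2)"
    unfolding sum_distrib_left using True reg pos c \<pi> by (intro sum_mono rf_event_bound) auto
   show "0 \<le> B * (C ^ (2 * N) + ?E * (\<Sum>i<N. 2 * (k i)\<^sup>2 + C^2))"
    using pos by (intro mult_nonneg_nonneg add_nonneg_nonneg sum_nonneg) auto
   show "0 \<le> C ^ (2 * N) + (\<Sum>i<N. node_ratio N k C i * (\<bar>k i\<bar> ^ (2 * N) + C * \<bar>k i\<bar> ^ (2 * N - 1)))"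
    using pos by (intro mult_nonneg_nonneg add_nonneg_nonneg sum_nonneg node_ratio_nonneg) auto
  qed (use pos \<rho> in auto)
  also have "r ^ (2 * N - q) = r ^ (2 * N) * (1 / r) ^ q" using pos q m by (simp add: power_diff power_one_over)
  finally show ?case unfolding dg using True by (simp add: mult_ac)
 qed auto
next
 case False
 have "(\<lambda>x. V x - rf_operator varpi N k \<mu> C c (\<lambda>y. V (y + z)) (x - z)) = V" using False by (simp add: rf_operator_eq)
 then have "\<bar>(deriv ^^ q) (\<lambda>x. V x - rf_operator varpi N k \<mu> C c (\<lambda>y. V (y + z)) (x - z)) x\<bar> \<le> B * C ^ q"
  using Vb[of q x] q m x by simp
 also have "... \<le> B * (2 / r) ^ q" using pos rC by (intro mult_left_mono power_mono) (auto simp: pos_le_divide_eq mult.commute)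
 also have "... = 2 ^ q * B * (1 / r) ^ q" by (simp add: power_divide)
 also have "... \<le> 2 ^ m * B * (1 / r) ^ q" using q pos by (intro mult_right_mono power_increasing) auto
 finally show ?thesis using False by simp
qed

text \<open>On the event the bound is affine in the squares of the features, so their second moments
  suffice. Off the event it is a constant, which gets multiplied by the failure probability.\<close>

lemma (in feature_sample) patch_error_moment:
 assumes pos: "0 \<le> A" "0 \<le> B" "0 \<le> E" and c: "2 < c"
 shows "(\<integral>\<^sup>+w. ennreal (if rf_event varpi N (\<lambda>q. k q w) \<mu> C c then B * (A + E * (\<Sum>i<N. 2 * (k i w)\<^sup>2 + C^2)) else F) \<partial>P)
  \<le> ennreal (B * (A + E * (real N * (2 * \<mu>^2 + C^2)))) + ennreal F * (if N = 1 then 0 else ennreal (real N * (69 * c * exp (-c)) ^ (N - 1)))"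
proof -
 let ?bad = "{w \<in> space P. \<not> rf_event varpi N (\<lambda>q. k q w) \<mu> C c}"
 have bad: "?bad \<in> sets P"
 proof -
  have "?bad = space P - {w \<in> space P. rf_event varpi N (\<lambda>q. k q w) \<mu> C c}" by blast
  then show ?thesis using rf_event_measurable by simp
 qed
 have km: "k i \<in> borel_measurable P" if "i \<in> {..<N}" for i using that k_measurable by simp
 have "(\<integral>\<^sup>+w. ennreal (if rf_event varpi N (\<lambda>q. k q w) \<mu> C c then B * (A + E * (\<Sum>i<N. 2 * (k i w)\<^sup>2 + C^2)) else F) \<partial>P)
  \<le> (\<integral>\<^sup>+w. (ennreal (B * (A + E * (real N * C^2))) + ennreal (B * E * 2) * (\<Sum>i<N. ennreal ((k i w)\<^sup>2))) + ennreal F * indicator ?bad w \<partial>P)"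
 proof (rule nn_integral_mono)
  fix w assume w: "w \<in> space P"
  show "ennreal (if rf_event varpi N (\<lambda>q. k q w) \<mu> C c then B * (A + E * (\<Sum>i<N. 2 * (k i w)\<^sup>2 + C^2)) else F)
   \<le> (ennreal (B * (A + E * (real N * C^2))) + ennreal (B * E * 2) * (\<Sum>i<N. ennreal ((k i w)\<^sup>2))) + ennreal F * indicator ?bad w"
  proof (cases "rf_event varpi N (\<lambda>q. k q w) \<mu> C c")
   case True
   have "B * (A + E * (\<Sum>i<N. 2 * (k i w)\<^sup>2 + C^2)) = B * (A + E * (real N * C^2)) + B * E * 2 * (\<Sum>i<N. (k i w)\<^sup>2)"
    by (simp add: sum.distrib sum_distrib_left[symmetric] algebra_simps)
   also have "ennreal ... = ennreal (B * (A + E * (real N * C^2))) + ennreal (B * E * 2) * (\<Sum>i<N. ennreal ((k i w)\<^sup>2))"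
   proof -
    have "0 \<le> B * (A + E * (real N * C^2))" "0 \<le> B * E * 2" "0 \<le> (\<Sum>i<N. (k i w)\<^sup>2)" using pos by (auto intro!: sum_nonneg)
    then show ?thesis by (simp add: ennreal_plus ennreal_mult sum_ennreal del: ennreal_plus[symmetric])
   qed
   finally show ?thesis using True by simp
  next
   case False
   then show ?thesis using w by simp
  qed
 qed
 also have "... = (ennreal (B * (A + E * (real N * C^2))) + ennreal (B * E * 2) * (\<Sum>i<N. \<integral>\<^sup>+w. ennreal ((k i w)\<^sup>2) \<partial>P)) + ennreal F * emeasure P ?bad"
 proof -
  have m: "(\<lambda>w. ennreal ((k i w)\<^sup>2)) \<in> borel_measurable P" if "i \<in> {..<N}" for i using km[OF that] by measurable
  have ms: "(\<lambda>w. \<Sum>i<N. ennreal ((k i w)\<^sup>2)) \<in> borel_measurable P" by (intro borel_measurable_sum m)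
  have "(\<lambda>w. ennreal F * indicator ?bad w) \<in> borel_measurable P" using bad by measurable
  moreover have "(\<integral>\<^sup>+w. (\<Sum>i<N. ennreal ((k i w)\<^sup>2)) \<partial>P) = (\<Sum>i<N. \<integral>\<^sup>+w. ennreal ((k i w)\<^sup>2) \<partial>P)"
   by (rule nn_integral_sum[OF m])
  ultimately show ?thesis using ms bad by (simp add: nn_integral_add nn_integral_cmult emeasure_space_1 del: sum_ennreal)
 qed
 also have "(\<Sum>i<N. \<integral>\<^sup>+w. ennreal ((k i w)\<^sup>2) \<partial>P) = ennreal (real N * \<mu>^2)"
  by (simp add: second_moment ennreal_mult ennreal_of_nat_eq_real_of_nat)
 also have "ennreal (B * (A + E * (real N * C^2))) + ennreal (B * E * 2) * ennreal (real N * \<mu>^2) = ennreal (B * (A + E * (real N * (2 * \<mu>^2 + C^2))))"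
 proof -
  have "ennreal (B * (A + E * (real N * C^2))) + ennreal (B * E * 2) * ennreal (real N * \<mu>^2) = ennreal (B * (A + E * (real N * C^2)) + B * E * 2 * (real N * \<mu>^2))"
   using pos by (subst ennreal_mult[symmetric]) (auto simp: ennreal_plus)
  also have "B * (A + E * (real N * C^2)) + B * E * 2 * (real N * \<mu>^2) = B * (A + E * (real N * (2 * \<mu>^2 + C^2)))" by (simp add: algebra_simps)
  finally show ?thesis .
 qed
 finally show ?thesis by (rule order_trans) (intro add_left_mono mult_left_mono ill_conditioned_sample c, simp)
qed

text \<open>The condition on \<open>t\<close> says \<open>- l <= t\<close>, because
  \<open>1 - l = (s + 1) / D\<close>. So \<open>\<mu>\<close> is at most a constant multiple of
  \<open>C\<close>, and the conditioning bound is governed by \<open>C\<close> alone.\<close>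

lemma rate_parameters:
 fixes N m :: nat and s v g \<nu> t varpi :: real
 assumes N: "1 \<le> N" and v: "0 \<le> v" "v \<le> s" "v \<le> real N - 1" and g: "0 \<le> g" and \<nu>: "0 < \<nu>"
 defines "D \<equiv> real N + s - v + g"
 defines "l \<equiv> (real N - 1 - v + g) / D"
 defines "b \<equiv> real N * (1 - l)"
 assumes t: "(s + 1) / D - 1 \<le> t"
 obtains K r0 where "0 < K" "0 < r0" "r0 \<le> 1" "0 \<le> l" "0 < D"
  "\<And>r. 0 < r ==> r < r0 ==> \<exists>c. 2 < c \<and> 1 \<le> \<bar>ln r\<bar> \<and> r * (2 * r powr (-l)) \<le> 2 \<and>
   (\<forall>B\<ge>0. B * r ^ (2 * N) * ((2 * r powr (-l)) ^ (2 * N) + (exp c * (10 * varpi^2 * ((\<nu> * r powr t)\<^sup>2 + (2 * r powr (-l))\<^sup>2))) ^ (N - 1) * (real N * (2 * (\<nu> * r powr t)\<^sup>2 + (2 * r powr (-l))\<^sup>2)))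
    + 2 ^ m * B * (if N = 1 then 0 else real N * (69 * c * exp (-c)) ^ (N - 1)) \<le> K * B * r powr b * \<bar>ln r\<bar> ^ (N - 1))"
proof -
 have D: "0 < D" using N v g by (simp add: D_def)
 have l: "0 \<le> l" using v g D by (simp add: l_def)
 have l1: "1 - l = (s + 1) / D" using D by (simp add: l_def D_def field_simps)
 then have t1': "0 < 1 - l" using v D by simp
 have b: "0 < b" unfolding b_def using t1' N by simp
 define c0 where "c0 = 1 + \<nu>^2"
 define K1 where "K1 = real N * (2 * c0) * (10 * varpi^2 * c0) ^ (N - 1)"
 define K where "K = 2 ^ (2 * N) * (1 + K1) + 2 ^ m * (real N * (69 * b) ^ (N - 1))"
 have c0: "1 \<le> c0" by (simp add: c0_def)
 have K1: "0 \<le> K1" using c0 by (simp add: K1_def)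
 have K: "0 < K" unfolding K_def using K1 b by (intro add_pos_nonneg) auto
 \<comment> \<open>\<open>r < r0\<close> means that \<open>\<bar>ln r\<bar>\<close> exceeds
   \<open>2 * N / b + 1\<close>. The first summand ensures \<open>c > 2\<close>, the second one that
   the logarithm is at least 1.\<close>
 define r0 where "r0 = exp (- (2 * real N / b + 1))"
 have Nb: "0 \<le> 2 * real N / b" using b by simp
 then have r0: "0 < r0" "r0 \<le> 1" by (simp_all add: r0_def)
 show thesis
 proof (rule that[OF K r0 l D], goal_cases)
  case r: (1 r)
  have r1: "r \<le> 1" using r r0 by simp
  have "ln r < - (2 * real N / b + 1)" using r by (metis ln_exp ln_less_cancel_iff r0(1) r0_def)
  then have lnr: "2 * real N / b + 1 < - ln r" by simp
  define L where "L = \<bar>ln r\<bar>"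
  have L: "L = - ln r" "2 * real N / b + 1 < L" using lnr Nb unfolding L_def by linarith+
  have L1: "1 \<le> L" using L(2) Nb by linarith
  \<comment> \<open>For \<open>N > 1\<close> this gives
    \<open>exp c ^ (N - 1) = r powr (- b)\<close>. For \<open>N = 1\<close> the event is sure and
    the value 3 is an arbitrary one above 2.\<close>
  define c where "c = (if N = 1 then 3 else b * L / real (N - 1))"
  define C where "C = 2 * r powr (-l)"
  define \<mu> where "\<mu> = \<nu> * r powr t"
  have c2: "2 < c"
  proof (cases "N = 1")
   case False
   have "2 * real N / b < L" using L by simp
   then have "2 * real N < b * L" using b by (simp add: divide_less_eq mult.commute)
   moreover have "2 * real (N - 1) \<le> 2 * real N" by simp
   ultimately have "2 * real (N - 1) < b * L" by linarith
   then show ?thesis using False N by (simp add: c_def less_divide_eq)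
  qed (simp add: c_def)
  have cN: "N \<noteq> 1 ==> c * real (N - 1) = b * L" using N by (simp add: c_def)
  define X where "X = exp c ^ (N - 1)"
  have X1: "1 \<le> X" unfolding X_def using c2 by (intro one_le_power) simp
  have Xr: "X \<le> r powr (-b)"
  proof (cases "N = 1")
   case True
   then show ?thesis using powr_mono'[of "-b" 0 r] r r1 b by (simp add: X_def)
  next
   case False
   have "X = exp (c * real (N - 1))" by (simp only: X_def exp_of_nat_mult[symmetric] mult.commute)
   also have "... = r powr (-b)" using cN[OF False] L(1) r by (simp add: powr_def)
   finally show ?thesis by simp
  qed
  have C: "0 < C" using r by (simp add: C_def)
  have rC: "r * C = 2 * r powr (1 - l)" using r by (simp add: C_def powr_diff powr_minus_divide)
  have rC2: "r * C \<le> 2" unfolding rC using powr_mono'[of 0 "1 - l" r] r r1 t1' by simp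
  have \<mu>: "\<mu>^2 \<le> \<nu>^2 * C^2"
  proof -
   have "r powr t \<le> r powr (-l)" using t l1 r r1 by (intro powr_mono') auto
   also have "... \<le> C" by (simp add: C_def)
   finally have "\<mu> \<le> \<nu> * C" using \<nu> by (simp add: \<mu>_def)
   moreover have "0 \<le> \<mu>" using \<nu> by (simp add: \<mu>_def)
   ultimately have "\<mu>^2 \<le> (\<nu> * C)\<^sup>2" by (intro power_mono)
   then show ?thesis by (simp add: power_mult_distrib)
  qed
  have m1: "\<mu>^2 + C^2 \<le> c0 * C^2" "2 * \<mu>^2 + C^2 \<le> 2 * c0 * C^2"
  proof -
   have "c0 * C^2 = C^2 + \<nu>^2 * C^2" "2 * c0 * C^2 = 2 * C^2 + 2 * (\<nu>^2 * C^2)" by (simp_all add: c0_def algebra_simps)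
   moreover have "0 \<le> C^2" by simp
   ultimately show "\<mu>^2 + C^2 \<le> c0 * C^2" "2 * \<mu>^2 + C^2 \<le> 2 * c0 * C^2" using \<mu> by linarith+
  qed
  let ?E = "(exp c * (10 * varpi^2 * (\<mu>^2 + C^2))) ^ (N - 1)"
  have "?E * (real N * (2 * \<mu>^2 + C^2)) \<le> (X * (10 * varpi^2 * (c0 * C^2)) ^ (N - 1)) * (real N * (2 * c0 * C^2))"
   unfolding X_def power_mult_distrib[symmetric] using m1 c0 by (intro mult_mono power_mono mult_left_mono) auto
  also have "... = X * K1 * ((C^2) ^ (N - 1) * C^2)" by (simp add: K1_def power_mult_distrib)
  also have "(C^2) ^ (N - 1) * C^2 = C ^ (2 * N)"
  proof -
   have "(C^2) ^ (N - 1) * C^2 = (C^2) ^ Suc (N - 1)" by simp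
   then show ?thesis using N by (simp add: power_mult[symmetric])
  qed
  finally have "?E * (real N * (2 * \<mu>^2 + C^2)) \<le> X * K1 * C ^ (2 * N)" .
  moreover have "1 * C ^ (2 * N) \<le> X * C ^ (2 * N)" using X1 C by (intro mult_right_mono) auto
  ultimately have "C ^ (2 * N) + ?E * (real N * (2 * \<mu>^2 + C^2)) \<le> X * C ^ (2 * N) + X * K1 * C ^ (2 * N)" by linarith
  also have "... = (1 + K1) * (X * C ^ (2 * N))" by (simp add: algebra_simps)
  finally have t1: "r ^ (2 * N) * (C ^ (2 * N) + ?E * (real N * (2 * \<mu>^2 + C^2))) \<le> r ^ (2 * N) * ((1 + K1) * (X * C ^ (2 * N)))"
   using r by (intro mult_left_mono) auto
  also have "... = (1 + K1) * ((r * C) ^ (2 * N) * X)" by (simp add: power_mult_distrib)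
  also have "... \<le> (1 + K1) * ((r * C) ^ (2 * N) * r powr (-b))" using Xr K1 r C by (intro mult_left_mono) auto
  also have "(r * C) ^ (2 * N) = 2 ^ (2 * N) * (r powr b * r powr b)"
  proof -
   have "(r powr (1 - l)) ^ (2 * N) = r powr (b + b)" using r by (simp add: powr_power b_def algebra_simps)
   then show ?thesis by (simp only: rC power_mult_distrib powr_add)
  qed
  also have "(1 + K1) * (2 ^ (2 * N) * (r powr b * r powr b) * r powr (-b)) = 2 ^ (2 * N) * (1 + K1) * r powr b" using r by (simp add: powr_minus)
  \<comment> \<open>The contribution of the event carries no logarithm; the power of
    \<open>L\<close>, which is at least 1, is inserted to match the other contribution.\<close>
  also have "... \<le> 2 ^ (2 * N) * (1 + K1) * r powr b * L ^ (N - 1)"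
   using L1 K1 mult_left_mono[of 1 "L ^ (N - 1)" "2 ^ (2 * N) * (1 + K1) * r powr b"] by simp
  finally have T1: "r ^ (2 * N) * (C ^ (2 * N) + ?E * (real N * (2 * \<mu>^2 + C^2))) \<le> 2 ^ (2 * N) * (1 + K1) * r powr b * L ^ (N - 1)" .
  have T2: "(if N = 1 then 0 else real N * (69 * c * exp (-c)) ^ (N - 1)) \<le> real N * (69 * b) ^ (N - 1) * r powr b * L ^ (N - 1)"
  proof (cases "N = 1")
   case False
   have "exp (-c) ^ (N - 1) = exp (- (c * real (N - 1)))" by (simp add: exp_of_nat_mult[symmetric] mult.commute)
   also have "... = r powr b" using cN[OF False] L(1) r by (simp add: powr_def)
   finally have e: "exp (-c) ^ (N - 1) = r powr b" .
   \<comment> \<open>This estimate of \<open>c\<close> by \<open>b * L\<close> is the point at which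
     the failure probability acquires its power of the logarithm.\<close>
   have "c * 1 \<le> c * real (N - 1)" using c2 False N by (intro mult_left_mono) auto
   then have "c \<le> b * L" using cN[OF False] by simp
   then have "(69 * c) ^ (N - 1) \<le> (69 * b * L) ^ (N - 1)" using c2 by (intro power_mono) auto
   then have "real N * ((69 * c) ^ (N - 1) * r powr b) \<le> real N * ((69 * b * L) ^ (N - 1) * r powr b)" by (intro mult_left_mono mult_right_mono) auto
   then show ?thesis by (simp only: False if_False power_mult_distrib e mult_ac)
  next
   case True
   then show ?thesis using L1 b by simp
  qed
  show ?case unfolding C_def[symmetric] \<mu>_def[symmetric] L_def[symmetric]
  proof (intro exI[of _ c] conjI allI impI c2 L1 rC2)
   fix B :: real assume B: "0 \<le> B"
   have "B * r ^ (2 * N) * (C ^ (2 * N) + ?E * (real N * (2 * \<mu>^2 + C^2))) \<le> B * (2 ^ (2 * N) * (1 + K1) * r powr b * L ^ (N - 1))"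
    using mult_left_mono[OF T1 B] by (simp only: mult.assoc)
   moreover have "2 ^ m * B * (if N = 1 then 0 else real N * (69 * c * exp (-c)) ^ (N - 1)) \<le> 2 ^ m * B * (real N * (69 * b) ^ (N - 1) * r powr b * L ^ (N - 1))"
    using B by (intro mult_left_mono T2) auto
   moreover have "B * (2 ^ (2 * N) * (1 + K1) * r powr b * L ^ (N - 1)) + 2 ^ m * B * (real N * (69 * b) ^ (N - 1) * r powr b * L ^ (N - 1)) = K * B * r powr b * L ^ (N - 1)"
    by (simp add: K_def algebra_simps)
   ultimately show "B * r ^ (2 * N) * (C ^ (2 * N) + ?E * (real N * (2 * \<mu>^2 + C^2)))
    + 2 ^ m * B * (if N = 1 then 0 else real N * (69 * c * exp (-c)) ^ (N - 1)) \<le> K * B * r powr b * L ^ (N - 1)" by linarith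
  qed
 qed
qed

lemma patch_radius_bounds:
 assumes pu: "partition_of_unity {a<..<b} m M C\<phi> J \<phi>" and ab: "a < b" and j: "j \<in> {1..J}"
 shows "0 < patch_radius {a<..<b} (\<phi> j)" "patch_radius {a<..<b} (\<phi> j) \<le> mesh_radius {a<..<b} J \<phi>" "0 < mesh_radius {a<..<b} J \<phi>"
proof -
 show 1: "0 < patch_radius {a<..<b} (\<phi> j)" by (rule partition_patch[OF pu j]) simp
 show 2: "patch_radius {a<..<b} (\<phi> j) \<le> mesh_radius {a<..<b} J \<phi>" unfolding mesh_radius_def using j by (intro Max_ge) auto
 show "0 < mesh_radius {a<..<b} J \<phi>" using 1 2 by linarith
qed

text \<open>Uniformity is automatic in this argument: \<open>u\<close> enters through its norm
  \<open>S\<close> only, the partition through \<open>M\<close>, \<open>C\<phi>\<close>,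
  \<open>\<kappa>\<close> and \<open>r\<close>, and the laws through their scale and
  \<open>varpi\<close>. Hence \<open>K\<close> and the threshold for \<open>r\<close> can be fixed
  in advance.\<close>

theorem corollary2p11:
  fixes R s \<sigma> \<nu> t varpi C\<phi> \<kappa> :: real and p :: ennreal and N M :: nat
    and \<Omega> :: "real set"
  assumes "0 < R" and "\<Omega> = {-R<..<R}"
    and "0 \<le> s" and "1 \<le> p" and "1 \<le> N"
    and "0 \<le> \<sigma>" and "\<sigma> \<le> min s (real N - 1)"
    and "0 < \<nu>"
    and "(s + 1) / (real N + s - \<sigma> + enn2real (1 / p)) - 1 \<le> t"
  shows "\<exists>K r\<^sub>0. 0 < K \<and> 0 < r\<^sub>0 \<and>
    (\<forall>u J \<phi> (P :: 'w measure) L k r.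
      u \<in> sobolev_space \<Omega> s p \<and>
      partition_of_unity \<Omega> (nat \<lceil>\<sigma>\<rceil>) M C\<phi> J \<phi> \<and>
      r = mesh_radius \<Omega> J \<phi> \<and>
      (\<forall>j\<in>{1..J}. r \<le> \<kappa> * patch_radius \<Omega> (\<phi> j)) \<and>
      prob_space P \<and>
      (\<forall>j\<in>{1..J}. iid_with_law P N (k j) (L j) \<and> sampling_law (L j) (\<nu> * r powr t) varpi) \<and>
      r < r\<^sub>0
      \<longrightarrow>
      (\<exists>u\<epsilon> C c.
        u\<epsilon> \<in> gevrey0 (closure \<Omega>) \<and>
        (\<forall>j\<in>{1..J}. has_gevrey_constant (closure (patch \<Omega> (\<phi> j))) u\<epsilon> (C j) \<and> 2 < c j) \<and>
        (let err = (\<lambda>\<omega>. sobolev_norm \<Omega> \<sigma> p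
               (\<lambda>x. u x - rf_approximation \<Omega> J \<phi> varpi N (\<lambda>j q. k j q \<omega>) (\<lambda>_. \<nu> * r powr t) C c u\<epsilon> x))
         in err \<in> borel_measurable P \<and>
            (\<integral>\<^sup>+\<omega>. err \<omega> \<partial>P) \<le>
              ennreal (K * r powr ((real N - \<sigma> - 1 + enn2real (1 / p)) * (s - \<sigma>)
                                     / (real N + s - \<sigma> + enn2real (1 / p)))
                         * \<bar>ln r\<bar> ^ (N - 1))
              * sobolev_norm \<Omega> s p u)))"
proof -
 note R = assms(1) and \<Omega> = assms(2) and p = assms(4) and N = assms(5) and s0 = assms(6)
 have \<sigma>: "\<sigma> \<le> s" "\<sigma> \<le> real N - 1" using assms(7) by auto
 define g where "g = enn2real (1 / p)"
 have g: "0 \<le> g" "g \<le> 1"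
 proof -
  show "0 \<le> g" by (simp add: g_def)
  show "g \<le> 1" by (cases rule: exponent_cases[OF p]) (auto simp: g_def)
 qed
 define D where "D = real N + s - \<sigma> + g"
 define v where "v = (real N - 1 - \<sigma> + g) / D"
 define n where "n = real N * (1 - v)"
 define m where "m = nat \<lceil>\<sigma>\<rceil>"
 have m: "m \<le> 2 * N" using \<sigma>(2) by (simp add: m_def nat_le_iff ceiling_le_iff)
 show ?thesis
 proof (rule jackson_poly[OF R p s0 \<sigma>(1), where L = "2 * N"], goal_cases)
 case (1 K1)
 note K1 = 1
 show ?thesis
 proof (rule partition_product_estimate[OF p s0, where C\<phi> = C\<phi> and \<kappa> = \<kappa>], goal_cases)
 case (1 K2)
 note K2 = 1
 have t: "(s + 1) / (real N + s - \<sigma> + g) - 1 \<le> t" using assms(9) by (simp add: g_def)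
 show ?thesis
 proof (rule rate_parameters[OF N s0 \<sigma> g(1) assms(8) t, where varpi = varpi and m = m], goal_cases)
 case (1 K3 r0)
 note K3 = 1[folded D_def, folded v_def, folded n_def]
 \<comment> \<open>An upper bound for \<open>J * r\<close> by \<open>partition_count\<close>. The
   absolute value is taken because no partition, which would force \<open>\<kappa>\<close> to be
   positive, is given yet.\<close>
 define Q where "Q = \<bar>\<kappa>\<bar> * (real M * (R - - R))"
 \<comment> \<open>The first summand accounts for the smoothing error and the second for the
   patches; the 2 bounds the power of 2 that comes from the definition of \<open>dd\<close>.\<close>
 define K where "K = K1 + Q * (K2 * (K3 * (K1 * 2)))"
 have Q: "0 \<le> Q" using R by (simp add: Q_def)
 have K: "0 < K" unfolding K_def using K1(1) K2(1) K3(1) Q by (intro add_pos_nonneg mult_nonneg_nonneg) auto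
 define e where "e = (real N - \<sigma> - 1 + g) * (s - \<sigma>) / (real N + s - \<sigma> + g)"
 have e: "e = v * (s - \<sigma>)" by (simp add: e_def v_def D_def algebra_simps)
 \<comment> \<open>The contributions are -1 from the number of patches, \<open>g - \<sigma>\<close>
   from the product with the partition functions, \<open>- v * g\<close> from the pointwise bound
   \<open>B\<close>, and \<open>n\<close> from the local error. The choice of \<open>v\<close> makes
   their sum equal to the rate \<open>v * (s - \<sigma>)\<close> of the smoothing error.\<close>
 have exponent: "-1 + (g - \<sigma>) - v * g + n = e"
 proof -
  have "v * D = real N - 1 - \<sigma> + g" using K3(5) by (simp add: v_def)
  then show ?thesis unfolding e n_def D_def by (simp add: algebra_simps)
 qed
 show ?thesis
  unfolding g_def[symmetric] e_def[symmetric] \<Omega>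
 proof (rule exI[of _ K], rule exI[of _ r0], intro conjI K K3(2) allI impI, elim conjE, goal_cases)
  case (1 u J \<phi> P L k r)
  note u = 1(1) and pu = 1(2) and r_def = 1(3) and qu = 1(4) and P = 1(5) and law = 1(6) and rr0 = 1(7)
  let ?\<Omega> = "{-R<..<R}" and ?\<mu> = "\<nu> * r powr t"
  interpret P: prob_space P by (rule P)
  have RR: "- R < R" using R by simp
  have J: "1 \<le> J" by (rule partition_nonempty[OF pu RR])
  have pr: "0 < patch_radius ?\<Omega> (\<phi> j)" "patch_radius ?\<Omega> (\<phi> j) \<le> r" if "j \<in> {1..J}" for j
   using patch_radius_bounds[OF pu RR that] by (auto simp: r_def)
  have r: "0 < r" "r \<le> 1" using pr[of 1] J rr0 K3(3) by auto
  have \<mu>: "0 < ?\<mu>" using assms(8) r by simp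
  obtain c where c: "2 < c" "1 \<le> \<bar>ln r\<bar>" "r * (2 * r powr (-v)) \<le> 2" and rate:
   "\<And>B. 0 \<le> B ==> B * r ^ (2 * N) * ((2 * r powr (-v)) ^ (2 * N) + (exp c * (10 * varpi^2 * (?\<mu>\<^sup>2 + (2 * r powr (-v))\<^sup>2))) ^ (N - 1) * (real N * (2 * ?\<mu>\<^sup>2 + (2 * r powr (-v))\<^sup>2)))
    + 2 ^ m * B * (if N = 1 then 0 else real N * (69 * c * exp (-c)) ^ (N - 1)) \<le> K3 * B * r powr n * \<bar>ln r\<bar> ^ (N - 1)"
   using K3(6)[OF r(1) rr0] by (elim exE conjE) (rule that; (assumption | blast))
  \<comment> \<open>The factor \<open>1 / 2\<close> keeps the smoothing parameter below 1 also for
    \<open>v = 0\<close>, where \<open>r powr v\<close> equals 1. It reappears as the 2 in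
    \<open>C\<close>.\<close>
  define dd where "dd = r powr v / 2"
  define C where "C = 2 * r powr (-v)"
  have Cd: "C = 1 / dd" "0 < C" using r by (simp_all add: C_def dd_def powr_minus_divide)
  have dd: "0 < dd" "dd < 1"
  proof -
   show "0 < dd" using r by (simp add: dd_def)
   have "r powr v \<le> 1" using powr_mono'[of 0 v r] r K3(4) by simp
   then show "dd < 1" by (simp add: dd_def)
  qed
  define S where "S = enn2real (sobolev_norm ?\<Omega> s p u)"
  have S: "0 \<le> S" "sobolev_norm ?\<Omega> s p u = ennreal S" using u by (auto simp: S_def sobolev_space_def)
  obtain q where q: "sobolev_norm ?\<Omega> \<sigma> p (\<lambda>x. u x - poly q x) \<le> ennreal (K1 * dd powr (s - \<sigma>) * S)"
   "\<forall>l\<le>2 * N. \<forall>x\<in>{-R..R}. \<bar>poly ((pderiv ^^ l) q) x\<bar> \<le> K1 * dd powr (- real l - g) * S"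
   using K1(2)[OF S dd, folded g_def] by (elim exE conjE) (rule that)
  \<comment> \<open>Splitting off \<open>dd powr (- l) = C ^ l\<close> turns the Jackson bounds into
    bounds of Gevrey type up to the order \<open>2 * N\<close>. \<open>C\<close> is a Gevrey
    constant of the polynomial in any case; what counts here is that these low orders hold with the
    controlled prefactor \<open>B\<close>.\<close>
  define B where "B = K1 * dd powr (- g) * S"
  have B: "0 \<le> B" using K1(1) S by (simp add: B_def)
  have Vb: "\<bar>(deriv ^^ l) (poly q) x\<bar> \<le> B * C ^ l" if "l \<le> 2 * N" "x \<in> {-R..R}" for l x
  proof -
   have "dd powr (- real l - g) = dd powr (- g) * C ^ l"
    using dd by (simp add: Cd powr_diff powr_minus_divide powr_realpow power_one_over)
   then show ?thesis using q(2)[rule_format, OF that] by (simp add: poly_higher_deriv B_def mult_ac)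
  qed
  define E where "E = (exp c * (10 * varpi^2 * (?\<mu>\<^sup>2 + C^2))) ^ (N - 1)"
  have E: "0 \<le> E" by (simp add: E_def)
  define z where "z j = patch_center ?\<Omega> (\<phi> j)" for j
  define W where "W j \<omega> x = rf_operator varpi N (\<lambda>q. k j q \<omega>) ?\<mu> C c (\<lambda>y. poly q (y + z j)) (x - z j)" for j \<omega> x
  have sW: "smooth (W j \<omega>)" for j \<omega> unfolding W_def[abs_def] by (rule smooth_rf_operator)
  define H where "H j \<omega> = (if rf_event varpi N (\<lambda>q. k j q \<omega>) ?\<mu> C c
   then B * r ^ (2 * N) * (C ^ (2 * N) + E * (\<Sum>i<N. 2 * (k j i \<omega>)\<^sup>2 + C^2)) else 2 ^ m * B)" for j \<omega>
  have H: "0 \<le> H j \<omega>" for j \<omega>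
   unfolding H_def using B E Cd(2) r by (auto intro!: mult_nonneg_nonneg add_nonneg_nonneg sum_nonneg)
  have fs: "feature_sample P N (k j) (L j) ?\<mu> varpi" if "j \<in> {1..J}" for j
   using law that \<mu> P by (auto simp: feature_sample_def feature_sample_axioms_def)
  define err where "err \<omega> = sobolev_norm ?\<Omega> \<sigma> p (\<lambda>x. u x - (\<Sum>j\<in>{1..J}. \<phi> j x * W j \<omega> x))" for \<omega>
  have uw: "has_weak_deriv ?\<Omega> i u (weak_deriv ?\<Omega> i u)" if "i \<le> nat \<lfloor>\<sigma>\<rfloor>" for i
  proof (rule sobolev_norm_finite_weak_deriv)
   show "sobolev_norm ?\<Omega> s p u < \<infinity>" using u by (simp add: sobolev_space_def)
   show "i \<le> nat \<lfloor>s\<rfloor>" using that \<sigma>(1) by (meson floor_mono nat_mono order_trans)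
  qed
  note \<phi>w = partition_weak_deriv_bound(1)[OF pu _ _ r(1) bspec[OF qu]]
  have err_m: "err \<in> borel_measurable P"
  proof -
   \<comment> \<open>At order 0 the function \<open>\<phi> j\<close> itself is taken and not a
     version of it, so that the sum is literally the one in \<open>err\<close>.\<close>
   define d where "d j i = (if i = 0 then \<phi> j else weak_deriv ?\<Omega> i (\<phi> j))" for j i
   have "(\<lambda>\<omega>. sobolev_norm ?\<Omega> \<sigma> p (\<lambda>x. u x - (\<Sum>j\<in>{1..J}. d j 0 x * W j \<omega> x))) \<in> borel_measurable P"
   proof (rule sobolev_norm_measurable[OF p refl uw])
    fix j i assume j: "j \<in> {1..J}" and i: "i \<le> nat \<lfloor>\<sigma>\<rfloor>"
    have "i \<le> nat \<lceil>\<sigma>\<rceil>" using i by (meson floor_le_ceiling nat_mono order_trans)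
    then show "has_weak_deriv ?\<Omega> i (d j 0) (d j i)"
     using \<phi>w[OF j _ j, of i] \<phi>w[OF j _ j, of 0] by (auto simp: d_def has_weak_deriv_def intro: has_weak_deriv_0)
   next
    fix j l assume j: "j \<in> {1..J}"
    interpret feature_sample P N "k j" "L j" ?\<mu> varpi by (rule fs[OF j])
    show "(\<lambda>z. (deriv ^^ l) (W j (fst z)) (snd z)) \<in> borel_measurable (P \<Otimes>\<^sub>M lebesgue_on ?\<Omega>)"
     unfolding W_def[abs_def] by (rule rf_operator_measurable)
   qed (simp_all add: sW)
   then show ?thesis by (simp add: err_def[abs_def] d_def)
  qed
  have patch_err: "AE \<omega> in P. sobolev_norm ?\<Omega> \<sigma> p (\<lambda>x. \<phi> j x * (poly q x - W j \<omega> x)) \<le> ennreal (K2 * r powr (g - \<sigma>)) * ennreal (H j \<omega>)"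
   if j: "j \<in> {1..J}" for j
  proof -
   interpret feature_sample P N "k j" "L j" ?\<mu> varpi by (rule fs[OF j])
   obtain a b where ab: "a < b" "patch ?\<Omega> (\<phi> j) = {a<..<b}" "{a<..<b} \<subseteq> ?\<Omega>" "patch_radius ?\<Omega> (\<phi> j) = (b - a) / 2" "patch_center ?\<Omega> (\<phi> j) = (a + b) / 2"
    by (rule partition_patch[OF pu j]; rule that; assumption)
   have ab': "- R \<le> a" "b \<le> R" using ab(1,3) by (simp_all add: greaterThanLessThan_subseteq_greaterThanLessThan)
   show ?thesis
    using AE_regular
   proof eventually_elim
    case (elim \<omega>)
    have "sobolev_norm ?\<Omega> \<sigma> p (\<lambda>x. \<phi> j x * (poly q x - W j \<omega> x)) \<le> ennreal (K2 * H j \<omega> * r powr (enn2real (1 / p) - \<sigma>))"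
    proof (rule K2(2)[OF RR pu j r pr(2)[OF j] bspec[OF qu j] _ H])
     show "smooth (\<lambda>x. poly q x - W j \<omega> x)" by (intro smooth_diff smooth_poly sW)
     fix l x assume l: "l \<le> nat \<lceil>\<sigma>\<rceil>" and x: "x \<in> patch ?\<Omega> (\<phi> j)"
     show "\<bar>(deriv ^^ l) (\<lambda>x. poly q x - W j \<omega> x) x\<bar> \<le> H j \<omega> * (1 / r) ^ l"
      unfolding W_def[abs_def] H_def E_def
     proof (rule patch_error_derivatives[where \<rho> = "(b - a) / 2"])
      show "\<bar>(deriv ^^ i) (poly q) y\<bar> \<le> B * C ^ i" if "i \<le> 2 * N" "\<bar>y - z j\<bar> \<le> (b - a) / 2" for i y
       using that ab' unfolding z_def ab(5) by (intro Vb) (auto simp: abs_le_iff field_simps)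
      show "\<bar>x - z j\<bar> \<le> (b - a) / 2" using x unfolding z_def ab(2,5) by (auto simp: abs_le_iff field_simps)
      show "1 \<le> varpi" using law j sampling_law_ge_1 by blast
      show "(b - a) / 2 \<le> r" using pr(2)[OF j] ab(4) by simp
     qed (use elim B Cd(2) r \<mu> ab(1) c m l smooth_poly in \<open>auto simp: m_def C_def\<close>)
    qed
    also have "... = ennreal (K2 * r powr (g - \<sigma>)) * ennreal (H j \<omega>)"
     using K2(1) H by (subst ennreal_mult[symmetric]) (auto simp: g_def mult_ac)
    finally show ?case .
   qed
  qed
  have path: "AE \<omega> in P. err \<omega> \<le> ennreal (K1 * dd powr (s - \<sigma>) * S) + (\<Sum>j\<in>{1..J}. ennreal (K2 * r powr (g - \<sigma>)) * ennreal (H j \<omega>))"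
  proof -
   have "AE \<omega> in P. \<forall>j\<in>{1..J}. sobolev_norm ?\<Omega> \<sigma> p (\<lambda>x. \<phi> j x * (poly q x - W j \<omega> x)) \<le> ennreal (K2 * r powr (g - \<sigma>)) * ennreal (H j \<omega>)"
    using patch_err by (intro AE_finite_allI) auto
   then show ?thesis
   proof eventually_elim
    case (elim \<omega>)
    have mu: "u \<in> borel_measurable (lebesgue_on ?\<Omega>)" by (rule has_weak_deriv_measurable(2)[OF uw[of 0]]) simp
    have m\<phi>: "\<phi> j \<in> borel_measurable (lebesgue_on ?\<Omega>)" if "j \<in> {1..J}" for j
     by (rule has_weak_deriv_measurable(2)[OF \<phi>w[OF that _ that, of 0]]) simp
    \<comment> \<open>The partition of unity distributes the polynomial over the patches. As it sums
      to 1 only almost everywhere, the norms are compared by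
      \<open>sobolev_norm_cong_AE\<close>.\<close>
    have 1: "err \<omega> = sobolev_norm ?\<Omega> \<sigma> p (\<lambda>x. (u x - poly q x) + (\<Sum>j\<in>{1..J}. \<phi> j x * (poly q x - W j \<omega> x)))"
     unfolding err_def
    proof (rule sobolev_norm_cong_AE[OF p])
     show "(\<lambda>x. u x - (\<Sum>j\<in>{1..J}. \<phi> j x * W j \<omega> x)) \<in> borel_measurable (lebesgue_on ?\<Omega>)"
      by (intro borel_measurable_diff borel_measurable_sum borel_measurable_times mu m\<phi> smooth_measurable_lebesgue_on sW)
     show "(\<lambda>x. (u x - poly q x) + (\<Sum>j\<in>{1..J}. \<phi> j x * (poly q x - W j \<omega> x))) \<in> borel_measurable (lebesgue_on ?\<Omega>)"
      by (intro borel_measurable_add borel_measurable_diff borel_measurable_sum borel_measurable_times mu m\<phi> smooth_measurable_lebesgue_on sW smooth_poly)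
     have "AE x in lebesgue_on ?\<Omega>. (\<Sum>j=1..J. \<phi> j x) = 1" using pu unfolding partition_of_unity_def by blast
     then show "AE x in lebesgue_on ?\<Omega>. u x - (\<Sum>j\<in>{1..J}. \<phi> j x * W j \<omega> x) = (u x - poly q x) + (\<Sum>j\<in>{1..J}. \<phi> j x * (poly q x - W j \<omega> x))"
     proof eventually_elim
      case (elim x)
      have "(\<Sum>j\<in>{1..J}. \<phi> j x * (poly q x - W j \<omega> x)) = (\<Sum>j=1..J. \<phi> j x) * poly q x - (\<Sum>j\<in>{1..J}. \<phi> j x * W j \<omega> x)"
       by (simp only: right_diff_distrib sum_subtractf sum_distrib_right)
      then show ?case using elim by simp
     qed
    qed
    have 2: "sobolev_norm ?\<Omega> \<sigma> p (\<lambda>x. u x - poly q x) + sobolev_norm ?\<Omega> \<sigma> p (\<lambda>x. \<Sum>j\<in>{1..J}. \<phi> j x * (poly q x - W j \<omega> x)) \<le> ennreal (K1 * dd powr (s - \<sigma>) * S) + (\<Sum>j\<in>{1..J}. ennreal (K2 * r powr (g - \<sigma>)) * ennreal (H j \<omega>))"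
    proof (rule add_mono[OF q(1)], rule order_trans[OF sobolev_norm_sum[OF p]], rule sum_mono)
     fix j assume "j \<in> {1..J}"
     with elim show "sobolev_norm ?\<Omega> \<sigma> p (\<lambda>x. \<phi> j x * (poly q x - W j \<omega> x)) \<le> ennreal (K2 * r powr (g - \<sigma>)) * ennreal (H j \<omega>)" by (rule bspec)
    qed
    show ?case unfolding 1 by (rule order_trans[OF sobolev_norm_triangle[OF p] 2])
   qed
  qed
  define Lr where "Lr = \<bar>ln r\<bar> ^ (N - 1)"
  have Lr: "1 \<le> Lr" unfolding Lr_def using c(2) by (rule one_le_power)
  have moment: "(\<integral>\<^sup>+\<omega>. ennreal (H j \<omega>) \<partial>P) \<le> ennreal (K3 * B * r powr n * Lr)" if j: "j \<in> {1..J}" for j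
  proof -
   interpret feature_sample P N "k j" "L j" ?\<mu> varpi by (rule fs[OF j])
   let ?A = "B * r ^ (2 * N) * (C ^ (2 * N) + E * (real N * (2 * ?\<mu>\<^sup>2 + C^2)))" and ?b = "if N = 1 then 0 else real N * (69 * c * exp (-c)) ^ (N - 1)"
   have "(\<integral>\<^sup>+\<omega>. ennreal (H j \<omega>) \<partial>P) \<le> ennreal ?A + ennreal (2 ^ m * B) * (if N = 1 then 0 else ennreal (real N * (69 * c * exp (-c)) ^ (N - 1)))"
    unfolding H_def using B Cd(2) r E by (intro patch_error_moment c(1)) auto
   also have "... = ennreal (?A + 2 ^ m * B * ?b)"
   proof -
    have "0 \<le> ?A" using B Cd(2) r E by (intro mult_nonneg_nonneg add_nonneg_nonneg) auto
    moreover have "0 \<le> ?b" "0 \<le> 2 ^ m * B" using c(1) B by auto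
    ultimately have "ennreal (?A + 2 ^ m * B * ?b) = ennreal ?A + ennreal (2 ^ m * B) * ennreal ?b" by (simp only: ennreal_plus ennreal_mult mult_nonneg_nonneg)
    moreover have "ennreal ?b = (if N = 1 then 0 else ennreal (real N * (69 * c * exp (-c)) ^ (N - 1)))" by simp
    ultimately show ?thesis by (simp only:)
   qed
   also have "... \<le> ennreal (K3 * B * r powr n * Lr)"
    using rate[OF B] unfolding Lr_def E_def C_def by (rule ennreal_leI)
   finally show ?thesis .
  qed
  have Hm: "(\<lambda>\<omega>. ennreal (H j \<omega>)) \<in> borel_measurable P" if j: "j \<in> {1..J}" for j
  proof -
   interpret feature_sample P N "k j" "L j" ?\<mu> varpi by (rule fs[OF j])
   have "(\<lambda>\<omega>. \<Sum>i<N. 2 * (k j i \<omega>)\<^sup>2 + C^2) \<in> borel_measurable P"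
    by (intro borel_measurable_sum borel_measurable_add borel_measurable_times borel_measurable_power borel_measurable_const k_measurable) auto
   then have "(\<lambda>\<omega>. B * r ^ (2 * N) * (C ^ (2 * N) + E * (\<Sum>i<N. 2 * (k j i \<omega>)\<^sup>2 + C^2))) \<in> borel_measurable P"
    by (intro borel_measurable_times borel_measurable_add borel_measurable_const)
   then show ?thesis unfolding H_def by (intro measurable_compose[OF _ measurable_ennreal] measurable_If borel_measurable_const rf_event_measurable)
  qed
  have expectation: "(\<integral>\<^sup>+\<omega>. err \<omega> \<partial>P) \<le> ennreal (K * r powr e * Lr * S)"
  proof -
   have "(\<integral>\<^sup>+\<omega>. err \<omega> \<partial>P) \<le> (\<integral>\<^sup>+\<omega>. ennreal (K1 * dd powr (s - \<sigma>) * S) + (\<Sum>j\<in>{1..J}. ennreal (K2 * r powr (g - \<sigma>)) * ennreal (H j \<omega>)) \<partial>P)"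
    by (rule nn_integral_mono_AE[OF path])
   also have "... = ennreal (K1 * dd powr (s - \<sigma>) * S) + (\<Sum>j\<in>{1..J}. ennreal (K2 * r powr (g - \<sigma>)) * (\<integral>\<^sup>+\<omega>. ennreal (H j \<omega>) \<partial>P))"
   proof -
    let ?h = "\<lambda>j \<omega>. ennreal (K2 * r powr (g - \<sigma>)) * ennreal (H j \<omega>)"
    have hm: "?h j \<in> borel_measurable P" if "j \<in> {1..J}" for j
     by (rule borel_measurable_times_ennreal[OF borel_measurable_const Hm[OF that]])
    then have "(\<lambda>\<omega>. \<Sum>j\<in>{1..J}. ?h j \<omega>) \<in> borel_measurable P" by (rule borel_measurable_sum)
    then have "(\<integral>\<^sup>+\<omega>. ennreal (K1 * dd powr (s - \<sigma>) * S) + (\<Sum>j\<in>{1..J}. ?h j \<omega>) \<partial>P)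
     = (\<integral>\<^sup>+\<omega>. ennreal (K1 * dd powr (s - \<sigma>) * S) \<partial>P) + (\<integral>\<^sup>+\<omega>. (\<Sum>j\<in>{1..J}. ?h j \<omega>) \<partial>P)"
     by (rule nn_integral_add[OF borel_measurable_const])
    moreover have "(\<integral>\<^sup>+\<omega>. ennreal (K1 * dd powr (s - \<sigma>) * S) \<partial>P) = ennreal (K1 * dd powr (s - \<sigma>) * S)"
     by (simp add: P.emeasure_space_1)
    moreover have "(\<integral>\<^sup>+\<omega>. (\<Sum>j\<in>{1..J}. ?h j \<omega>) \<partial>P) = (\<Sum>j\<in>{1..J}. \<integral>\<^sup>+\<omega>. ?h j \<omega> \<partial>P)" by (rule nn_integral_sum[OF hm])
    moreover have "(\<Sum>j\<in>{1..J}. \<integral>\<^sup>+\<omega>. ?h j \<omega> \<partial>P) = (\<Sum>j\<in>{1..J}. ennreal (K2 * r powr (g - \<sigma>)) * (\<integral>\<^sup>+\<omega>. ennreal (H j \<omega>) \<partial>P))"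
     by (rule sum.cong[OF refl], rule nn_integral_cmult[OF Hm])
    ultimately show ?thesis by (simp only:)
   qed
   also have "... \<le> ennreal (K1 * dd powr (s - \<sigma>) * S) + (\<Sum>j\<in>{1..J}. ennreal (K2 * r powr (g - \<sigma>)) * ennreal (K3 * B * r powr n * Lr))"
    by (intro add_left_mono sum_mono mult_left_mono moment) auto
   also have "... = ennreal (K1 * dd powr (s - \<sigma>) * S + real J * (K2 * r powr (g - \<sigma>) * (K3 * B * r powr n * Lr)))"
   proof -
    have "0 \<le> K1 * dd powr (s - \<sigma>) * S" "0 \<le> K2 * r powr (g - \<sigma>)" "0 \<le> K3 * B * r powr n * Lr"
     using K1(1) K2(1) K3(1) S B Lr by auto
    then show ?thesis by (simp only: sum_constant card_atLeastAtMost diff_Suc_1 ennreal_of_nat_eq_real_of_nat ennreal_plus ennreal_mult mult_nonneg_nonneg of_nat_0_le_iff add_diff_cancel_right')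
   qed
   also have "... \<le> ennreal (K * r powr e * Lr * S)"
   proof (intro ennreal_leI)
    have d1: "dd powr (s - \<sigma>) \<le> r powr e * Lr"
    proof -
     have "dd powr (s - \<sigma>) \<le> (r powr v) powr (s - \<sigma>)" using dd \<sigma>(1) r by (intro powr_mono2) (auto simp: dd_def)
     also have "... = r powr e" by (simp add: e powr_powr)
     also have "... \<le> r powr e * Lr" using Lr mult_left_mono[of 1 Lr "r powr e"] by simp
     finally show ?thesis .
    qed
    have d2: "dd powr (-g) \<le> 2 * r powr (- (v * g))"
    proof -
     have "dd powr (-g) = 2 powr g * r powr (- (v * g))"
      using r by (simp add: dd_def powr_divide powr_powr powr_minus_divide)
     also have "... \<le> 2 powr 1 * r powr (- (v * g))" using g by (intro mult_right_mono powr_mono) auto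
     finally show ?thesis by simp
    qed
    have d3: "real J \<le> Q * r powr (-1)"
    proof -
     have "real J * r \<le> \<kappa> * (real M * (R - - R))" by (rule partition_count[OF pu RR r(1)]) (use qu in blast)
     also have "... \<le> Q" unfolding Q_def using R by (intro mult_right_mono) auto
     finally show ?thesis using r by (simp add: powr_minus_divide pos_le_divide_eq)
    qed
    have "real J * (K2 * r powr (g - \<sigma>) * (K3 * B * r powr n * Lr)) \<le> (Q * r powr (-1)) * (K2 * r powr (g - \<sigma>) * (K3 * (K1 * (2 * r powr (- (v * g))) * S) * r powr n * Lr))"
     unfolding B_def using d2 d3 K1(1) K2(1) K3(1) S Lr Q by (intro mult_mono mult_left_mono mult_right_mono) auto
    also have "... = Q * (K2 * (K3 * (K1 * 2))) * (r powr (-1) * r powr (g - \<sigma>) * r powr (- (v * g)) * r powr n) * Lr * S" by (simp only: mult_ac)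
    also have "r powr (-1) * r powr (g - \<sigma>) * r powr (- (v * g)) * r powr n = r powr e"
     unfolding exponent[symmetric] powr_add[symmetric] by simp
    finally have "real J * (K2 * r powr (g - \<sigma>) * (K3 * B * r powr n * Lr)) \<le> Q * (K2 * (K3 * (K1 * 2))) * r powr e * Lr * S" .
    moreover have "K1 * dd powr (s - \<sigma>) * S \<le> K1 * (r powr e * Lr) * S"
     using d1 K1(1) S by (intro mult_right_mono mult_left_mono) auto
    ultimately show "K1 * dd powr (s - \<sigma>) * S + real J * (K2 * r powr (g - \<sigma>) * (K3 * B * r powr n * Lr)) \<le> K * r powr e * Lr * S"
     by (simp add: K_def algebra_simps)
   qed
   finally show ?thesis .
  qed
  have clR: "closure ?\<Omega> = {-R..R}" using R by simp
  show ?case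
  proof (rule exI[of _ "poly q"], rule exI[of _ "\<lambda>_. C"], rule exI[of _ "\<lambda>_. c"], intro conjI ballI, goal_cases)
   case 1
   show ?case unfolding clR gevrey0_def using has_gevrey_constant_poly[OF Cd(2)] by blast
  next
   case (2 j)
   show ?case by (rule partition_patch[OF pu 2]) (simp add: has_gevrey_constant_poly Cd(2))
  next
   case 3
   show ?case by (rule c(1))
  next
   case 4
   have err: "(\<lambda>\<omega>. sobolev_norm ?\<Omega> \<sigma> p (\<lambda>x. u x - rf_approximation ?\<Omega> J \<phi> varpi N (\<lambda>j q. k j q \<omega>) (\<lambda>_. ?\<mu>) (\<lambda>_. C) (\<lambda>_. c) (poly q) x)) = err"
    by (simp add: err_def[abs_def] rf_approximation_def W_def z_def)
   have "ennreal (K * r powr e * Lr * S) = ennreal (K * r powr e * \<bar>ln r\<bar> ^ (N - 1)) * sobolev_norm ?\<Omega> s p u"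
    unfolding S(2) Lr_def[symmetric] using K S Lr by (intro ennreal_mult) auto
   then show ?case
    unfolding err Let_def using err_m expectation by simp
  qed
 qed
 qed
 qed
 qed
qed

end
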